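(* Let $I=[0,1]$ and $f:I\to I$. Let $\{(p_i,p_{i+1})\}_{i=1}^N$ be a partition of a full-measure subset of $[0,1]$ such that for any $1\le i\le N$, $f([p_i,p_{i+1}])=[0,1]$, $f\in\mathcal C^3([p_i,p_{i+1}],[0,1])$, and $f'(p_i^+)=f'(p_i^-)$ for $i\in\{2,\dots,N\}$, and assume $f$ is expanding, $f'>\lambda>1$. Also assume that $D_f:=\left(\frac1{f'}\right)'$ satisfies $D_f\not\equiv0$ and $D_f\ge0$. Then, for $\mathcal L_1:W^{2,1}([0,1])\to W^{2,1}([0,1])$, $$\sigma(\mathcal L_1)\subset\left\{z\in\mathbb C:|z|\le\min\left\{1,\tfrac2{f'(1)}-\tfrac1{f'(0)}\right\}\right\}\cup\{1\},$$ $$\sigma_{\mathrm{ess}}(\mathcal L_1)\subset\left\{z\in\mathbb C:|z|\le\tfrac1{f'(1)^2}\right\}.$$ Moreover, $1$ is a simple eigenvalue of $\mathcal L_1$. In addition, there exists $\mu_2<\frac1{f'(1)}$ such that, setting $\Delta=\frac1{f'(1)}-\frac1{f'(0)}$, $\mu_*=\frac1{f'(1)}$, $\Gamma=1-\sum_{i=1}^N\frac1{f'(p_i)}$ and $$A_0=\{a\in\mathbb R:\mu_2<a<1\},$$ $$A_1=\left\{a+ib\in\mathbb C: a>\mu_*,\ b^2<\frac{(a-\mu_* )\Delta}{2(1+a^{-1}\Gamma)}\left[\sqrt{1+4\frac{(1+a^{-1}\Gamma)^2(a-\mu_* )^2}{\Delta^2}}-1\right]\right\},$$ $$A_2=\left\{a+ib\in\mathbb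 C:a<-\mu_*,\ b^2<\frac{(|a|-\mu_* )^2(a^2-\mu_*^2-\Delta|a|)}{a^2-\mu_*^2+\Delta|a|}\right\},$$ $$A_3=\left\{a+ib\in\mathbb C:a\ge0,\ |a+ib-\mu_*|^2>\mu_*^2+\mu_*\frac{\Delta+\sqrt{4\mu_*^2+\Delta^2}}2\right\},$$ $$A_4=\left\{a+ib\in\mathbb C:a<0,\ b^2>\mu_*\Delta+\mu_*^2+2|a|\mu_*-a^2\right\}$$ ($a,b\in\mathbb R$), we have $$\left(\bigcup_{i=0}^4A_i\right)\cap\big[\sigma(\mathcal L_1)\setminus\{1\}\big]=\emptyset.$$
   Context: $g(p^+)$ and $g(p^-)$ denote the right and left limits of $g$ at $p$. The points satisfy $0=p_1<p_2<\dots<p_{N+1}=1$; $f$ is $\mathcal C^3$ on each closed interval $[p_i,p_{i+1}]$ in the sense that $f|_{(p_i,p_{i+1})}$ extends to a $\mathcal C^3$ map onto $[0,1]$; $f'(0),f'(1)$ and $f'(p_i)$ denote the corresponding one-sided limits (which agree at $p_2,\dots,p_N$). Derivatives of $f$ are taken branch by branch, at the smoothness points. The transfer operator is $\mathcal L_1h(x)=\sum_{y\in f^{-1}(x)}\frac{h(y)}{f'(y)}$, the sum being over the $N$ inverse branches. *)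

theory Defs
  imports "HOL-Analysis.Analysis"
begin

section \<open>Piecewise smooth maps of the interval\<close>

definition right_lim :: "(real \<Rightarrow> real) \<Rightarrow> real \<Rightarrow> real" where
  "right_lim g p = Lim (at_right p) g"

definition left_lim :: "(real \<Rightarrow> real) \<Rightarrow> real \<Rightarrow> real" where
  "left_lim g p = Lim (at_left p) g"

text \<open>At a boundary point of \<open>S\<close> lying in \<open>S\<close>, the derivatives are one-sided.\<close>

definition Ck_on :: "nat \<Rightarrow> real set \<Rightarrow> (real \<Rightarrow> real) \<Rightarrow> bool" where
  "Ck_on k S g \<longleftrightarrow> (\<exists>D :: nat \<Rightarrow> real \<Rightarrow> real.
     (\<forall>x\<in>S. D 0 x = g x) \<and>
     (\<forall>j<k. \<forall>x\<in>S. (D j has_real_derivative D (Suc j) x) (at x within S)) \<and>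
     continuous_on S (D k))"

text \<open>The continuous extension to \<open>[a,b]\<close> of the restriction of \<open>g\<close> to \<open>(a,b)\<close>. It is used
  both for a map and for its derivative, so the values of the map at the partition points
  play no role.\<close>

definition ext :: "real \<Rightarrow> real \<Rightarrow> (real \<Rightarrow> real) \<Rightarrow> real \<Rightarrow> real" where
  "ext a b g x = Lim (at x within {a<..<b}) g"

definition inv_branch :: "(nat \<Rightarrow> real) \<Rightarrow> (real \<Rightarrow> real) \<Rightarrow> nat \<Rightarrow> real \<Rightarrow> real" where
  "inv_branch p f i = inv_into {p i..p (Suc i)} (ext (p i) (p (Suc i)) f)"

definition smooth_points :: "nat \<Rightarrow> (nat \<Rightarrow> real) \<Rightarrow> real set" where
  "smooth_points N p = (\<Union>i\<in>{1..N}. {p i<..<p (Suc i)})"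

definition D_inv :: "(real \<Rightarrow> real) \<Rightarrow> real \<Rightarrow> real" where
  "D_inv f = deriv (\<lambda>y. 1 / deriv f y)"

definition transfer ::
    "nat \<Rightarrow> (nat \<Rightarrow> real) \<Rightarrow> (real \<Rightarrow> real) \<Rightarrow> (real \<Rightarrow> complex) \<Rightarrow> real \<Rightarrow> complex" where
  "transfer N p f h x =
     (if x \<in> {0..1}
      then \<Sum>i=1..N. h (inv_branch p f i x) /
             complex_of_real (ext (p i) (p (Suc i)) (deriv f) (inv_branch p f i x))
      else 0)"

section \<open>The Sobolev space\<close>

definition test_fun :: "(real \<Rightarrow> real) \<Rightarrow> bool" where
  "test_fun \<phi> \<longleftrightarrow>
     (\<forall>n x. (deriv ^^ n) \<phi> field_differentiable at x) \<and>
     closure {x. \<phi> x \<noteq> 0} \<subseteq> {0<..<1}"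

definition weak_deriv :: "nat \<Rightarrow> (real \<Rightarrow> complex) \<Rightarrow> (real \<Rightarrow> complex) \<Rightarrow> bool" where
  "weak_deriv k u v \<longleftrightarrow>
     set_integrable lborel {0..1} v \<and>
     (\<forall>\<phi>. test_fun \<phi> \<longrightarrow>
        (LINT x:{0..1}|lborel. u x * complex_of_real ((deriv ^^ k) \<phi> x)) =
        (-1) ^ k * (LINT x:{0..1}|lborel. v x * complex_of_real (\<phi> x)))"

text \<open>Every class in \<open>W\<^sup>2\<^sup>,\<^sup>1([0,1])\<close> contains exactly one function that is continuous on \<open>[0,1]\<close>
  (and set to \<open>0\<close> elsewhere); the space is represented by these functions, so that equality of
  elements is equality of functions and the transfer operator may be evaluated pointwise.\<close>

definition W21 :: "(real \<Rightarrow> complex) set" where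
  "W21 = {h. continuous_on {0..1} h \<and> (\<forall>x. x \<notin> {0..1} \<longrightarrow> h x = 0) \<and>
             (\<forall>k\<le>2. \<exists>v. weak_deriv k h v)}"

text \<open>The choice is immaterial, as weak derivatives are unique almost everywhere.\<close>

definition norm_W21 :: "(real \<Rightarrow> complex) \<Rightarrow> real" where
  "norm_W21 h = (\<Sum>k\<le>2. LINT x:{0..1}|lborel. cmod ((SOME v. weak_deriv k h v) x))"

section \<open>Spectral notions\<close>

text \<open>Here \<open>V\<close> is a complex linear space of functions with norm \<open>nrm\<close>.\<close>

definition bounded_op ::
    "('a \<Rightarrow> complex) set \<Rightarrow> (('a \<Rightarrow> complex) \<Rightarrow> real) \<Rightarrow>
     (('a \<Rightarrow> complex) \<Rightarrow> ('a \<Rightarrow> complex)) \<Rightarrow> bool" where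
  "bounded_op V nrm T \<longleftrightarrow>
     (\<forall>h\<in>V. T h \<in> V) \<and>
     (\<forall>g\<in>V. \<forall>h\<in>V. T (\<lambda>x. g x + h x) = (\<lambda>x. T g x + T h x)) \<and>
     (\<forall>c. \<forall>h\<in>V. T (\<lambda>x. c * h x) = (\<lambda>x. c * T h x)) \<and>
     (\<exists>C. \<forall>h\<in>V. nrm (T h) \<le> C * nrm h)"

definition shift ::
    "(('a \<Rightarrow> complex) \<Rightarrow> ('a \<Rightarrow> complex)) \<Rightarrow> complex \<Rightarrow>
     ('a \<Rightarrow> complex) \<Rightarrow> ('a \<Rightarrow> complex)" where
  "shift T z h = (\<lambda>x. z * h x - T h x)"

definition spectrum ::
    "('a \<Rightarrow> complex) set \<Rightarrow> (('a \<Rightarrow> complex) \<Rightarrow> real) \<Rightarrow>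
     (('a \<Rightarrow> complex) \<Rightarrow> ('a \<Rightarrow> complex)) \<Rightarrow> complex set" where
  "spectrum V nrm T =
     {z. \<not> (\<exists>R. bounded_op V nrm R \<and>
                (\<forall>h\<in>V. R (shift T z h) = h \<and> shift T z (R h) = h))}"

definition gen_eigenspace ::
    "('a \<Rightarrow> complex) set \<Rightarrow> (('a \<Rightarrow> complex) \<Rightarrow> ('a \<Rightarrow> complex)) \<Rightarrow> complex \<Rightarrow>
     ('a \<Rightarrow> complex) set" where
  "gen_eigenspace V T z = {h\<in>V. \<exists>n. (shift T z ^^ n) h = (\<lambda>_. 0)}"

definition finite_dim :: "('a \<Rightarrow> complex) set \<Rightarrow> bool" where
  "finite_dim E \<longleftrightarrow>
     (\<exists>B. finite B \<and> (\<forall>h\<in>E. \<exists>c. h = (\<lambda>x. \<Sum>b\<in>B. c b * b x)))"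

definition closed_in_norm ::
    "('a \<Rightarrow> complex) set \<Rightarrow> (('a \<Rightarrow> complex) \<Rightarrow> real) \<Rightarrow> ('a \<Rightarrow> complex) set \<Rightarrow> bool" where
  "closed_in_norm V nrm E \<longleftrightarrow>
     (\<forall>u h. (\<forall>n::nat. u n \<in> E) \<and> h \<in> V \<and> (\<lambda>n. nrm (\<lambda>x. u n x - h x)) \<longlonglongrightarrow> 0 \<longrightarrow> h \<in> E)"

text \<open>The essential spectrum in the sense of Browder: its complement in the spectrum consists of
  the isolated eigenvalues of finite algebraic multiplicity. It contains the essential spectra
  defined through Fredholm properties.\<close>

definition ess_spectrum ::
    "('a \<Rightarrow> complex) set \<Rightarrow> (('a \<Rightarrow> complex) \<Rightarrow> real) \<Rightarrow>
     (('a \<Rightarrow> complex) \<Rightarrow> ('a \<Rightarrow> complex)) \<Rightarrow> complex set" where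
  "ess_spectrum V nrm T =
     {z \<in> spectrum V nrm T.
        \<not> closed_in_norm V nrm (shift T z ` V) \<or>
        \<not> finite_dim (gen_eigenspace V T z) \<or>
        z islimpt spectrum V nrm T}"

text \<open>Simplicity is algebraic: the generalized eigenspace, not just the eigenspace, is a line.\<close>

definition simple_eigenvalue ::
    "('a \<Rightarrow> complex) set \<Rightarrow> (('a \<Rightarrow> complex) \<Rightarrow> ('a \<Rightarrow> complex)) \<Rightarrow> complex \<Rightarrow> bool" where
  "simple_eigenvalue V T z \<longleftrightarrow>
     (\<exists>e\<in>V. e \<noteq> (\<lambda>_. 0) \<and> T e = (\<lambda>x. z * e x) \<and>
        gen_eigenspace V T z = {\<lambda>x. c * e x | c. True})"

section \<open>The spectrum-free regions\<close>

definition A0 :: "real \<Rightarrow> complex set" where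
  "A0 \<mu>2 = {complex_of_real a | a. \<mu>2 < a \<and> a < 1}"

definition A1 :: "real \<Rightarrow> real \<Rightarrow> real \<Rightarrow> complex set" where
  "A1 \<mu> \<Delta> \<Gamma> = {Complex a b | a b. a > \<mu> \<and>
     b\<^sup>2 < (a - \<mu>) * \<Delta> / (2 * (1 + inverse a * \<Gamma>)) *
       (sqrt (1 + 4 * ((1 + inverse a * \<Gamma>)\<^sup>2 * (a - \<mu>)\<^sup>2 / \<Delta>\<^sup>2)) - 1)}"

definition A2 :: "real \<Rightarrow> real \<Rightarrow> complex set" where
  "A2 \<mu> \<Delta> = {Complex a b | a b. a < - \<mu> \<and>
     b\<^sup>2 < (\<bar>a\<bar> - \<mu>)\<^sup>2 * (a\<^sup>2 - \<mu>\<^sup>2 - \<Delta> * \<bar>a\<bar>) / (a\<^sup>2 - \<mu>\<^sup>2 + \<Delta> * \<bar>a\<bar>)}"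

definition A3 :: "real \<Rightarrow> real \<Rightarrow> complex set" where
  "A3 \<mu> \<Delta> = {Complex a b | a b. a \<ge> 0 \<and>
     (cmod (Complex a b - complex_of_real \<mu>))\<^sup>2 >
       \<mu>\<^sup>2 + \<mu> * ((\<Delta> + sqrt (4 * \<mu>\<^sup>2 + \<Delta>\<^sup>2)) / 2)}"

definition A4 :: "real \<Rightarrow> real \<Rightarrow> complex set" where
  "A4 \<mu> \<Delta> = {Complex a b | a b. a < 0 \<and>
     b\<^sup>2 > \<mu> * \<Delta> + \<mu>\<^sup>2 + 2 * \<bar>a\<bar> * \<mu> - a\<^sup>2}"

end

theory Submission
  imports Defs "HOL-Computational_Algebra.Polynomial"
begin

text \<open>
  Let \<open>Y\<^sub>i : [0,1] \<rightarrow> [p\<^sub>i, p\<^sub>i\<^sub>+\<^sub>1]\<close> be the inverse branches of the map, so that the transfer operator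
  is \<open>L h = (\<Sum>i. Y\<^sub>i' \<cdot> h \<circ> Y\<^sub>i)\<close>. Monotonicity of \<open>1 / f'\<close> and the matching of the one-sided
  derivatives say that \<open>Y\<^sub>i'' \<ge> 0\<close> and that \<open>Y\<^sub>i'\<close> continues to increase from each branch to the next,
  so \<open>Y\<^sub>i' \<le> \<mu> = 1 / f'(1) < 1\<close>.

  Essential spectrum. In \<open>(L h)''\<close> the second derivative of \<open>h\<close> enters only through
  \<open>\<Sum>i. (Y\<^sub>i')\<^sup>3 \<cdot> h'' \<circ> Y\<^sub>i\<close>, whose \<open>L\<^sup>1\<close> norm is at most \<open>\<mu>\<^sup>2\<close> times that of \<open>h''\<close>, because the
  substitutions \<open>Y\<^sub>i\<close> tile the interval. The other terms contain only \<open>h\<close> and \<open>h'\<close>, which may be replaced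
  by step functions at a small cost in \<open>L\<^sup>1\<close>. So \<open>L\<close> is within \<open>\<mu>\<^sup>2 + \<epsilon>\<close> of an operator of finite rank
  (\<open>finite_rank_approximation\<close>). Consequently, outside the disc of radius \<open>\<mu>\<^sup>2\<close> the Fredholm alternative
  holds (\<open>fredholm_shift\<close>), and the spectrum there consists of isolated eigenvalues of finite algebraic
  multiplicity (\<open>eigenvalues_isolated\<close>, \<open>finite_ascent\<close>, \<open>kernel_power_finite_dim\<close>).

  The eigenvalue equation. Since \<open>L\<close> preserves integrals, an eigenfunction \<open>h\<close> with eigenvalue
  \<open>z \<noteq> 1\<close> has mean zero, hence it is recovered from \<open>g = h'\<close>: it is \<open>h(0) + \<integral>\<^sub>0\<^sup>x g\<close> with
  \<open>h(0) = - \<integral> (1 - x) g\<close>. Differentiating \<open>L h = z h\<close> gives \<open>z g = P g + h(0) D\<close>, where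
  \<open>P u = \<Sum>i. (Y\<^sub>i')\<^sup>2 \<cdot> u \<circ> Y\<^sub>i + Y\<^sub>i'' \<cdot> (\<integral>\<^sub>0 u) \<circ> Y\<^sub>i\<close> and \<open>D = \<Sum>i. Y\<^sub>i'' \<ge> 0\<close>. The operator \<open>P\<close> is
  positive, and since \<open>P u\<close> is the derivative of \<open>\<Sum>i. Y\<^sub>i' \<cdot> (\<integral>\<^sub>0 u) \<circ> Y\<^sub>i\<close>, a telescoping sum shows that
  it multiplies integrals by exactly \<open>\<mu>\<close>; in the same way \<open>\<integral> D = \<Delta>\<close> and \<open>\<integral> (1 - x) D = \<Gamma>\<close>.

  Integrating \<open>|z g| \<le> P |g| + |h(0)| D\<close> yields \<open>|z| \<le> \<mu> + \<Delta>\<close>, and \<open>h(0) \<noteq> 0\<close> once \<open>|z| > \<mu>\<close>; so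
  \<open>h(0) = 1\<close> may be assumed. Splitting \<open>g\<close> into real and imaginary, positive and negative parts and
  integrating turns the equation into linear inequalities between a few nonnegative numbers. In each
  of the regions these are inconsistent (\<open>region_1\<close> to \<open>region_4\<close>, \<open>no_real_eigenvalue_above_mu\<close>).

  The borderline values \<open>1\<close> and \<open>\<mu>\<close>. For real \<open>u\<close> with \<open>L u = u\<close> or \<open>P u = \<mu> u\<close>, equality of the
  integrals forces the positive part of \<open>u\<close> to satisfy the same equation. Its zero set is then mapped
  into itself by all branches, and the only nonempty closed set with this property is \<open>[0,1]\<close>
  (\<open>invariant_closed_set\<close>). So \<open>u\<close> has constant sign, and a vanishing mean makes it zero. This gives the
  simplicity of the eigenvalue \<open>1\<close> and excludes \<open>\<mu>\<close> as an eigenvalue; as \<open>\<mu>\<close> is not a limit point of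
  the spectrum either, the gap around \<open>\<mu>\<close> follows (\<open>gap\<close>).
\<close>

section \<open>Finite rank perturbations and the Fredholm alternative\<close>

text \<open>The type class of normed spaces provides real scalars, so the multiplication by complex ones is a
  parameter here. Completeness is required in the form in which the Neumann series uses it.\<close>

locale complex_scaling =
  fixes cs :: "complex \<Rightarrow> 'v::real_normed_vector \<Rightarrow> 'v"  (infixr "\<odot>" 75)
  assumes cs_add_right: "c \<odot> (x + y) = c \<odot> x + c \<odot> y"
    and cs_add_left: "(c + d) \<odot> x = c \<odot> x + d \<odot> x"
    and cs_cs: "c \<odot> d \<odot> x = (c * d) \<odot> x"
    and cs_of_real: "complex_of_real r \<odot> x = r *\<^sub>R x"
    and norm_cs: "norm (c \<odot> x) = cmod c * norm x"
    and abs_summable: "summable (\<lambda>n. norm (X n :: 'v)) \<Longrightarrow> summable X"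
begin

definition clinear :: "('v \<Rightarrow> 'v) \<Rightarrow> bool" where
  "clinear T \<longleftrightarrow> bounded_linear T \<and> (\<forall>c x. T (c \<odot> x) = c \<odot> T x)"

definition cfunctional :: "('v \<Rightarrow> complex) \<Rightarrow> bool" where
  "cfunctional l \<longleftrightarrow> bounded_linear l \<and> (\<forall>c x. l (c \<odot> x) = c * l x)"

lemma bounded_linear_cs: "bounded_linear (\<lambda>x. c \<odot> x)"
proof
  show "c \<odot> (x + y) = c \<odot> x + c \<odot> y" for x y by (rule cs_add_right)
  show "c \<odot> (r *\<^sub>R x) = r *\<^sub>R (c \<odot> x)" for r x
    by (metis cs_cs cs_of_real mult.commute)
  show "\<exists>K. \<forall>x. norm (c \<odot> x) \<le> norm x * K"
    by (rule exI[of _ "cmod c"]) (simp add: norm_cs)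
qed

lemma bounded_linear_cs_left: "bounded_linear (\<lambda>c. c \<odot> x)"
proof
  show "(c + d) \<odot> x = c \<odot> x + d \<odot> x" for c d by (rule cs_add_left)
  show "(r *\<^sub>R c) \<odot> x = r *\<^sub>R (c \<odot> x)" for r c
    by (metis cs_cs cs_of_real scaleR_conv_of_real)
  show "\<exists>K. \<forall>c. norm (c \<odot> x) \<le> norm c * K"
    by (rule exI[of _ "norm x"]) (simp add: norm_cs)
qed

lemma cs_one [simp]: "1 \<odot> x = x"
  using cs_of_real[of 1 x] by simp

lemma cs_zero_left [simp]: "0 \<odot> x = 0"
  using linear_0[OF bounded_linear.linear[OF bounded_linear_cs_left]] by blast

lemma cs_zero_right [simp]: "c \<odot> 0 = 0"
  using linear_0[OF bounded_linear.linear[OF bounded_linear_cs]] by blast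

lemma cs_diff_right: "c \<odot> (x - y) = c \<odot> x - c \<odot> y"
  using linear_diff[OF bounded_linear.linear[OF bounded_linear_cs]] by blast

lemma cs_diff_left: "(c - d) \<odot> x = c \<odot> x - d \<odot> x"
  using linear_diff[OF bounded_linear.linear[OF bounded_linear_cs_left]] by blast

lemma cs_sum_right: "c \<odot> (\<Sum>j\<in>J. g j) = (\<Sum>j\<in>J. c \<odot> g j)"
  using linear_sum[OF bounded_linear.linear[OF bounded_linear_cs]] by blast

lemma cs_eq_0: "c \<odot> x = 0 \<longleftrightarrow> c = 0 \<or> x = 0"
  by (metis cs_zero_left cs_zero_right mult_eq_0_iff norm_cs norm_eq_zero)

lemma clinear_bl: "clinear T \<Longrightarrow> bounded_linear T"
  by (simp add: clinear_def)

lemma clinear_cs: "clinear T \<Longrightarrow> T (c \<odot> x) = c \<odot> T x"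
  by (simp add: clinear_def)

lemma clinear_add: "clinear T \<Longrightarrow> T (x + y) = T x + T y"
  by (simp add: clinear_def linear_simps)

lemma clinear_diff: "clinear T \<Longrightarrow> T (x - y) = T x - T y"
  by (simp add: clinear_def linear_simps)

lemma clinear_zero: "clinear T \<Longrightarrow> T 0 = 0"
  by (simp add: clinear_def linear_simps)

lemma clinear_sum: "clinear T \<Longrightarrow> T (\<Sum>j\<in>J. g j) = (\<Sum>j\<in>J. T (g j))"
  using linear_sum[OF bounded_linear.linear[OF clinear_bl]] by blast

lemma cfunctional_bl: "cfunctional l \<Longrightarrow> bounded_linear l"
  by (simp add: cfunctional_def)

lemma cfunctional_cs: "cfunctional l \<Longrightarrow> l (c \<odot> x) = c * l x"
  by (simp add: cfunctional_def)

lemma cfunctional_add: "cfunctional l \<Longrightarrow> l (x + y) = l x + l y"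
  by (simp add: cfunctional_def linear_simps)

lemma cfunctional_diff: "cfunctional l \<Longrightarrow> l (x - y) = l x - l y"
  by (simp add: cfunctional_def linear_simps)

lemma clinear_ident: "clinear (\<lambda>x. x)"
  by (simp add: clinear_def bounded_linear_ident)

lemma clinear_scale: "clinear T \<Longrightarrow> clinear (\<lambda>x. c \<odot> T x)"
  unfolding clinear_def
  using bounded_linear_compose[OF bounded_linear_cs, of T] by (auto simp: cs_cs mult.commute)

lemma clinear_sub: "clinear S \<Longrightarrow> clinear T \<Longrightarrow> clinear (\<lambda>x. S x - T x)"
  unfolding clinear_def by (auto intro: bounded_linear_sub simp: cs_diff_right)

lemma clinear_comp: "clinear S \<Longrightarrow> clinear T \<Longrightarrow> clinear (\<lambda>x. S (T x))"
  unfolding clinear_def by (auto intro: bounded_linear_compose)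

lemma clinear_shift: "clinear T \<Longrightarrow> clinear (\<lambda>x. z \<odot> x - T x)"
  using clinear_sub[OF clinear_scale[OF clinear_ident]] by blast

lemma clinear_rank_one: "cfunctional l \<Longrightarrow> clinear (\<lambda>x. l x \<odot> e)"
  unfolding clinear_def cfunctional_def
  using bounded_linear_compose[OF bounded_linear_cs_left, of l e] by (auto simp: cs_cs)

lemma clinear_finite_rank:
  fixes d :: nat
  shows "(\<And>j. j < d \<Longrightarrow> cfunctional (l j)) \<Longrightarrow> clinear (\<lambda>x. \<Sum>j<d. l j x \<odot> e j)"
  unfolding clinear_def
  using clinear_rank_one
  by (auto intro!: bounded_linear_sum simp: cs_sum_right cfunctional_cs cs_cs dest: clinear_bl)

lemma cfunctional_plus: "cfunctional l \<Longrightarrow> cfunctional k \<Longrightarrow> cfunctional (\<lambda>x. l x + k x)"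
  unfolding cfunctional_def by (auto intro: bounded_linear_add simp: distrib_left)

lemma cfunctional_comp: "cfunctional l \<Longrightarrow> clinear T \<Longrightarrow> cfunctional (\<lambda>x. l (T x))"
  unfolding cfunctional_def clinear_def by (auto intro: bounded_linear_compose)

text \<open>Every value has a preimage of comparable norm. For injective operators this says that the inverse is
  bounded, so carrying it along replaces an appeal to the open mapping theorem.\<close>

definition lifts :: "('v \<Rightarrow> 'v) \<Rightarrow> bool" where
  "lifts G \<longleftrightarrow> (\<exists>C. \<forall>x. \<exists>y. G y = G x \<and> norm y \<le> C * norm (G x))"

text \<open>The part of the Fredholm property that is stable under the rank one steps below and that is enough to
  produce resolvents: injectivity implies surjectivity.\<close>

definition fredholm :: "('v \<Rightarrow> 'v) \<Rightarrow> bool" where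
  "fredholm G \<longleftrightarrow> clinear G \<and> lifts G \<and> closed (range G) \<and> (inj G \<longrightarrow> surj G)"

definition invertible_op :: "('v \<Rightarrow> 'v) \<Rightarrow> bool" where
  "invertible_op S \<longleftrightarrow> clinear S \<and> surj S \<and> (\<exists>C. \<forall>x. norm x \<le> C * norm (S x))"

lemma invertible_op_imp_fredholm: "invertible_op S \<Longrightarrow> fredholm S"
  unfolding invertible_op_def fredholm_def lifts_def by (auto, blast)

lemma cfunctional_bound:
  assumes "cfunctional l" obtains K where "K > 0" "\<And>x. cmod (l x) \<le> K * norm x"
  using bounded_linear.pos_bounded[OF cfunctional_bl[OF assms]] by (metis mult.commute)

text \<open>Modulo \<open>S\<close> the operator acts as the identity minus a rank one operator: it multiplies \<open>u\<close> by
  \<open>1 - l u\<close>, so it is inverted by solving one scalar equation.\<close>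

lemma invertible_op_rank_one:
  assumes S: "invertible_op S" and l: "cfunctional l" and u: "S u = e" and lu: "l u \<noteq> 1"
  shows "invertible_op (\<lambda>x. S x - l x \<odot> e)"
proof -
  obtain C where C: "\<And>x. norm x \<le> C * norm (S x)" and cS: "clinear S" and sS: "surj S"
    using S unfolding invertible_op_def by auto
  obtain K where K: "K > 0" "\<And>x. cmod (l x) \<le> K * norm x" using cfunctional_bound[OF l] by blast
  define \<delta> where "\<delta> = 1 - l u"
  have \<delta>: "\<delta> \<noteq> 0" using lu by (simp add: \<delta>_def)
  have surj: "surj (\<lambda>x. S x - l x \<odot> e)"
  proof (rule surjI)
    fix k
    define x0 where "x0 = inv S k"
    define t where "t = l x0 / \<delta>"
    have Sx0: "S x0 = k" using sS by (simp add: x0_def surj_f_inv_f)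
    have "t - t * l u = t * \<delta>" by (simp add: \<delta>_def algebra_simps)
    then have t: "t - t * l u = l x0" using \<delta> by (simp add: t_def)
    have "S (x0 + t \<odot> u) - l (x0 + t \<odot> u) \<odot> e = k + (t - t * l u - l x0) \<odot> e"
      by (simp add: clinear_add[OF cS] clinear_cs[OF cS] cfunctional_add[OF l] cfunctional_cs[OF l] Sx0 u
          cs_add_left cs_diff_left)
    also have "\<dots> = k" using t by simp
    finally show "S ((\<lambda>k. inv S k + (l (inv S k) / \<delta>) \<odot> u) k)
        - l ((\<lambda>k. inv S k + (l (inv S k) / \<delta>) \<odot> u) k) \<odot> e = k"
      by (simp add: x0_def t_def)
  qed
  define M where "M = 1 + K / cmod \<delta> * norm u"
  have M0: "M \<ge> 0" using K by (simp add: M_def)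
  have "norm x \<le> M * C * norm (S x - l x \<odot> e)" for x
  proof -
    define x0 where "x0 = x - l x \<odot> u"
    have Sx0: "S x0 = S x - l x \<odot> e"
      by (simp add: x0_def clinear_diff[OF cS] clinear_cs[OF cS] u)
    have "l x0 = l x * \<delta>"
      by (simp add: x0_def cfunctional_diff[OF l] cfunctional_cs[OF l] \<delta>_def algebra_simps)
    then have "x = x0 + (l x0 / \<delta>) \<odot> u" using \<delta> by (simp add: x0_def)
    then have "norm x \<le> norm x0 + cmod (l x0) / cmod \<delta> * norm u"
      by (metis norm_triangle_ineq norm_cs norm_divide)
    also have "\<dots> \<le> norm x0 + K * norm x0 / cmod \<delta> * norm u"
      using K(2)[of x0] by (intro add_left_mono mult_right_mono divide_right_mono) auto
    also have "\<dots> = M * norm x0" by (simp add: M_def algebra_simps)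
    also have "\<dots> \<le> M * (C * norm (S x0))" using M0 C by (intro mult_left_mono) auto
    finally show ?thesis by (simp add: Sx0)
  qed
  then show ?thesis
    unfolding invertible_op_def using surj clinear_sub[OF cS clinear_rank_one[OF l]] by blast
qed

text \<open>The perturbation creates the kernel vector \<open>u\<close>, so injectivity fails and only the range and the lifting
  need care. Subtracting a multiple of \<open>u\<close> shows that the new range is the image under \<open>G\<close> of the
  kernel of \<open>l\<close>. This is all of the old range if some kernel vector of \<open>G\<close> is not killed by \<open>l\<close>;
  otherwise \<open>l\<close> factors through \<open>G\<close>, boundedly because of the lifting property, and the image is closed.\<close>

lemma fredholm_rank_one_singular:
  assumes G: "fredholm G" and l: "cfunctional l" and u: "G u = e" and lu: "l u = 1"
  shows "fredholm (\<lambda>x. G x - l x \<odot> e)"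
proof -
  define H where "H = (\<lambda>x. G x - l x \<odot> e)"
  have cG: "clinear G" and clG: "closed (range G)" and "lifts G" using G by (auto simp: fredholm_def)
  then obtain C where C: "\<And>x. \<exists>y. G y = G x \<and> norm y \<le> C * norm (G x)"
    by (auto simp: lifts_def)
  obtain K where K: "K > 0" "\<And>x. cmod (l x) \<le> K * norm x" using cfunctional_bound[OF l] by blast
  have cH: "clinear H" unfolding H_def by (rule clinear_sub[OF cG clinear_rank_one[OF l]])
  have red: "\<exists>y. l y = 0 \<and> G y = H x" for x
    by (rule exI[of _ "x - l x \<odot> u"])
       (simp add: H_def cfunctional_diff[OF l] cfunctional_cs[OF l] lu clinear_diff[OF cG] clinear_cs[OF cG] u)
  have HG: "H y = G y" if "l y = 0" for y using that by (simp add: H_def)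
  have "H u = 0" by (simp add: H_def u lu)
  moreover have "u \<noteq> 0" using lu linear_0[OF bounded_linear.linear[OF cfunctional_bl[OF l]]] by auto
  ultimately have notinj: "\<not> inj H" using clinear_zero[OF cH] by (metis injD)
  have "lifts H \<and> closed (range H)"
  proof (cases "\<exists>v. G v = 0 \<and> l v \<noteq> 0")
    case True
    then obtain w where w: "G w = 0" "l w \<noteq> 0" by auto
    define v where "v = (1 / l w) \<odot> w"
    have v: "G v = 0" "l v = 1"
      using w by (simp_all add: v_def clinear_cs[OF cG] cfunctional_cs[OF l])
    define adj where "adj = (\<lambda>x. x - l x \<odot> v)"
    have adj: "H (adj x) = G x" for x
      by (simp add: H_def adj_def cfunctional_diff[OF l] cfunctional_cs[OF l] v clinear_diff[OF cG] clinear_cs[OF cG])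
    have adj_norm: "norm (adj x) \<le> (1 + K * norm v) * norm x" for x
    proof -
      have "norm (adj x) \<le> norm x + cmod (l x) * norm v"
        unfolding adj_def by (metis norm_cs norm_triangle_ineq4)
      also have "\<dots> \<le> norm x + (K * norm x) * norm v"
        using K(2) by (intro add_left_mono mult_right_mono) auto
      finally show ?thesis by (simp add: algebra_simps)
    qed
    have "\<exists>y. H y = H x \<and> norm y \<le> (1 + K * norm v) * C * norm (H x)" for x
    proof -
      obtain y where y: "G y = H x" using red by blast
      obtain y' where y': "G y' = G y" "norm y' \<le> C * norm (G y)" using C by blast
      have "norm (adj y') \<le> (1 + K * norm v) * (C * norm (G y))"
        using adj_norm[of y'] y'(2) K(1)
        by (intro order_trans[OF adj_norm[of y']] mult_left_mono) auto
      then have "norm (adj y') \<le> (1 + K * norm v) * C * norm (H x)"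
        by (simp add: y mult.assoc)
      moreover have "H (adj y') = H x" using adj[of y'] y y'(1) by simp
      ultimately show ?thesis by blast
    qed
    moreover have "range H = range G"
    proof (intro equalityI subsetI)
      fix k assume "k \<in> range H"
      then obtain x where "k = H x" by auto
      then show "k \<in> range G" using red[of x] by (metis rangeI)
    next
      fix k assume "k \<in> range G"
      then obtain x where "k = G x" by auto
      then show "k \<in> range H" using adj[of x] by (metis rangeI)
    qed
    ultimately show ?thesis using clG unfolding lifts_def by auto
  next
    case False
    then have ker: "G v = 0 \<Longrightarrow> l v = 0" for v by blast
    have same: "l x = l y" if "G x = G y" for x y
      using ker[of "x - y"] that by (simp add: clinear_diff[OF cG] cfunctional_diff[OF l])
    have "\<exists>y. H y = H x \<and> norm y \<le> C * norm (H x)" for x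
    proof -
      obtain y where y: "l y = 0" "G y = H x" using red by blast
      obtain y' where y': "G y' = G y" "norm y' \<le> C * norm (G y)" using C by blast
      have "l y' = 0" using same[OF y'(1)] y(1) by simp
      then have "H y' = H x" using HG y'(1) y(2) by simp
      then show ?thesis using y'(2) y(2) by auto
    qed
    moreover have "closed (range H)"
      unfolding closed_sequential_limits
    proof (intro allI impI, elim conjE)
      fix k0 k assume k0: "\<forall>n. k0 n \<in> range H" and lim: "k0 \<longlonglongrightarrow> k"
      have "\<exists>y. l y = 0 \<and> G y = k0 n" for n using k0 red by (metis rangeE)
      then have "\<forall>n. \<exists>y. l y = 0 \<and> G y = k0 n" by blast
      then obtain y where y: "\<And>n. l (y n) = 0" "\<And>n. G (y n) = k0 n" by metis
      have "k0 n \<in> range G" for n using y(2)[of n] by (metis rangeI)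
      then have "k \<in> range G"
        by (intro closed_sequentially[OF clG _ lim]) blast
      then obtain x where x: "k = G x" by auto
      have "\<forall>n. \<exists>v. G v = G (y n - x) \<and> norm v \<le> C * norm (G (y n - x))" using C by blast
      then obtain v where v: "\<And>n. G (v n) = G (y n - x)" "\<And>n. norm (v n) \<le> C * norm (G (y n - x))"
        by metis
      have "(\<lambda>n. C * norm (k0 n - k)) \<longlonglongrightarrow> C * norm (k - k)"
        by (intro tendsto_intros lim)
      then have "v \<longlonglongrightarrow> 0"
        using v(2) by (intro Lim_null_comparison[of v]) (auto simp: clinear_diff[OF cG] y x)
      then have "(\<lambda>n. l (v n)) \<longlonglongrightarrow> l 0"
        using bounded_linear.tendsto[OF cfunctional_bl[OF l]] by blast
      moreover have "l (v n) = - l x" for n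
        using same[OF v(1)[of n]] by (simp add: cfunctional_diff[OF l] y)
      ultimately have "l x = 0"
        using linear_0[OF bounded_linear.linear[OF cfunctional_bl[OF l]]] by (simp add: LIMSEQ_const_iff)
      then show "k \<in> range H" using HG x by (metis rangeI)
    qed
    ultimately show ?thesis unfolding lifts_def by auto
  qed
  then show ?thesis using cH notinj unfolding fredholm_def H_def by blast
qed

text \<open>The rank one terms are absorbed one at a time. As long as one of the functionals can be made regular
  against \<open>u\<close>, the perturbed operator stays invertible and the induction hypothesis applies to it. If the
  last functional is singular and all others vanish on \<open>u\<close>, then \<open>u\<close> still solves \<open>G u = e d\<close> for the
  operator \<open>G\<close> with the other terms, and the singular rank one step finishes.\<close>

lemma fredholm_finite_rank:
  fixes d :: nat
  assumes "invertible_op S" "\<And>j. j < d \<Longrightarrow> cfunctional (l j)"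
  shows "fredholm (\<lambda>x. S x - (\<Sum>j<d. l j x \<odot> e j))"
  using assms
proof (induction d arbitrary: S l e)
  case 0
  then show ?case by (simp add: invertible_op_imp_fredholm)
next
  case (Suc d)
  obtain u where u: "S u = e d" using Suc.prems(1) unfolding invertible_op_def by (metis surjD)
  have regular: "fredholm (\<lambda>x. S x - (\<Sum>j<Suc d. l' j x \<odot> e' j))"
    if l': "\<And>j. j < Suc d \<Longrightarrow> cfunctional (l' j)" and "e' d = e d" "l' d u \<noteq> 1" for l' e'
  proof -
    have "invertible_op (\<lambda>x. S x - l' d x \<odot> e' d)"
      using that u by (intro invertible_op_rank_one[OF Suc.prems(1), of _ u]) auto
    from Suc.IH[OF this, of l' e'] l' show ?thesis
      by (simp add: algebra_simps)
  qed
  consider "l d u \<noteq> 1" | j where "l d u = 1" "j < d" "l j u \<noteq> 0"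
    | "l d u = 1" "\<And>j. j < d \<Longrightarrow> l j u = 0" by blast
  then show ?case
  proof cases
    case 1
    then show ?thesis using regular[of l e] Suc.prems(2) by blast
  next
    case 2
    \<comment> \<open>Adding the \<open>j\<close>-th functional to the last one and subtracting the last vector from the \<open>j\<close>-th
      leaves the sum unchanged, but moves the last functional away from the value \<open>1\<close> at \<open>u\<close>.\<close>
    define l' where "l' = l(d := (\<lambda>x. l d x + l j x))"
    define e' where "e' = e(j := e j - e d)"
    have "fredholm (\<lambda>x. S x - (\<Sum>i<Suc d. l' i x \<odot> e' i))"
      using 2 Suc.prems(2) by (intro regular) (auto simp: l'_def e'_def intro: cfunctional_plus)
    moreover have "(\<Sum>i<Suc d. l' i x \<odot> e' i) = (\<Sum>i<Suc d. l i x \<odot> e i)" for x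
    proof -
      have "(\<Sum>i<d. l' i x \<odot> e' i) = (\<Sum>i<d. l i x \<odot> e i - (if i = j then l j x \<odot> e d else 0))"
        by (rule sum.cong) (auto simp: l'_def e'_def cs_diff_right)
      also have "\<dots> = (\<Sum>i<d. l i x \<odot> e i) - l j x \<odot> e d"
        using 2(2) by (simp add: sum_subtractf sum.delta')
      finally show ?thesis using 2(2) by (simp add: l'_def e'_def cs_add_left)
    qed
    ultimately show ?thesis by simp
  next
    case 3
    define G where "G = (\<lambda>x. S x - (\<Sum>j<d. l j x \<odot> e j))"
    have "fredholm G" unfolding G_def using Suc by auto
    moreover have "G u = e d" using 3(2) u by (simp add: G_def)
    ultimately have "fredholm (\<lambda>x. G x - l d x \<odot> e d)"
      using 3(1) Suc.prems(2) by (intro fredholm_rank_one_singular[of _ _ u]) auto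
    then show ?thesis by (simp add: G_def algebra_simps)
  qed
qed

text \<open>The preimage is the sum of the Neumann series.\<close>

lemma neumann:
  assumes B: "clinear B" and Bn: "\<And>x. norm (B x) \<le> \<rho> * norm x" and \<rho>: "0 \<le> \<rho>" "\<rho> < cmod z"
  shows "invertible_op (\<lambda>x. z \<odot> x - B x)"
proof -
  have z: "z \<noteq> 0" using \<rho> by auto
  have "\<exists>x. z \<odot> x - B x = k" for k
  proof -
    define X where "X = rec_nat ((1 / z) \<odot> k) (\<lambda>_ y. (1 / z) \<odot> B y)"
    have X0: "X 0 = (1 / z) \<odot> k" and XS: "X (Suc n) = (1 / z) \<odot> B (X n)" for n
      by (simp_all add: X_def)
    have Xn: "norm (X n) \<le> (\<rho> / cmod z) ^ n * norm (X 0)" for n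
    proof (induction n)
      case (Suc n)
      have "norm (X (Suc n)) \<le> 1 / cmod z * (\<rho> * norm (X n))"
        unfolding XS norm_cs using Bn[of "X n"] by (simp add: norm_divide divide_right_mono)
      also have "\<dots> \<le> 1 / cmod z * (\<rho> * ((\<rho> / cmod z) ^ n * norm (X 0)))"
        using Suc \<rho> by (intro mult_left_mono) auto
      finally show ?case by simp
    qed simp
    have geom: "summable (\<lambda>n. (\<rho> / cmod z) ^ n * norm (X 0))"
      using \<rho> by (intro summable_mult2 summable_geometric) (simp add: divide_simps)
    have "summable (\<lambda>n. norm (X n))"
    proof (rule summable_comparison_test'[OF geom])
      show "norm (norm (X n)) \<le> (\<rho> / cmod z) ^ n * norm (X 0)" if "0 \<le> n" for n
        using Xn[of n] by simp
    qed
    then have sX: "summable X" by (rule abs_summable)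
    have "(\<lambda>n. z \<odot> X (Suc n) - B (X (Suc n))) = (\<lambda>n. B (X n) - B (X (Suc n)))"
      using z by (simp add: XS cs_cs)
    have bl: "bounded_linear (\<lambda>x. z \<odot> x - B x)" using clinear_bl[OF clinear_shift[OF B]] .
    have part: "(\<Sum>i<n. z \<odot> X i - B (X i)) = k - z \<odot> X n" for n
      using z by (induction n) (simp_all add: X0 XS cs_cs)
    have "(\<lambda>n. z \<odot> X n) \<longlonglongrightarrow> z \<odot> 0"
      by (intro bounded_linear.tendsto[OF bounded_linear_cs] summable_LIMSEQ_zero sX)
    then have "(\<lambda>n. z \<odot> X n - B (X n)) sums k"
      unfolding sums_def part using tendsto_diff[OF tendsto_const[of k]] by fastforce
    moreover have "(\<lambda>n. z \<odot> X n - B (X n)) sums (z \<odot> suminf X - B (suminf X))"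
      using bounded_linear.sums[OF bl summable_sums[OF sX]] .
    ultimately show ?thesis using sums_unique2 by blast
  qed
  then have "surj (\<lambda>x. z \<odot> x - B x)" by (auto simp: surj_def eq_commute)
  moreover have "norm x \<le> 1 / (cmod z - \<rho>) * norm (z \<odot> x - B x)" for x
  proof -
    have "cmod z * norm x \<le> norm (z \<odot> x - B x) + norm (B x)"
      by (metis norm_cs norm_triangle_sub add.commute)
    then have "(cmod z - \<rho>) * norm x \<le> norm (z \<odot> x - B x)" using Bn[of x] by (simp add: algebra_simps)
    then show ?thesis using \<rho> by (simp add: field_simps)
  qed
  ultimately show ?thesis unfolding invertible_op_def using clinear_shift[OF B] by blast
qed

section \<open>Quasi-compact operators\<close>

text \<open>The lemma of F. Riesz: after normalization, \<open>x\<close> minus a nearly closest kernel element \<open>m\<close> stays away from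
  the kernel.\<close>

lemma almost_orthogonal_to_kernel:
  assumes Q: "clinear Q" and x: "Q x \<noteq> 0"
  obtains a m where "Q m = 0" "norm (a *\<^sub>R (x - m)) = 1"
    "\<And>w. Q w = 0 \<Longrightarrow> norm (a *\<^sub>R (x - m) - w) \<ge> 1/2"
proof -
  define K where "K = {w. Q w = 0}"
  have sc: "Q (r *\<^sub>R y) = r *\<^sub>R Q y" for r y
    using linear_scale[OF bounded_linear.linear[OF clinear_bl[OF Q]]] .
  have clK: "closed K" unfolding K_def
    by (intro closed_Collect_eq bounded_linear.continuous_on[OF clinear_bl[OF Q]] continuous_intros)
  have "0 \<in> K" by (simp add: K_def clinear_zero[OF Q])
  then have ne: "K \<noteq> {}" by auto
  define \<delta> where "\<delta> = infdist x K"
  have "x \<notin> K" using x by (simp add: K_def)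
  then have \<delta>: "\<delta> > 0"
    using in_closed_iff_infdist_zero[OF clK ne, of x] infdist_nonneg[of x K] by (simp add: \<delta>_def)
  have "\<exists>m\<in>K. dist x m < 2 * \<delta>"
  proof (rule ccontr)
    assume "\<not> ?thesis"
    then have "2 * \<delta> \<le> infdist x K"
      using ne unfolding infdist_notempty[OF ne] by (intro cINF_greatest) auto
    then show False using \<delta> by (simp add: \<delta>_def)
  qed
  then obtain m where m: "Q m = 0" "norm (x - m) < 2 * \<delta>" by (auto simp: K_def dist_norm)
  have lower: "\<delta> \<le> norm (x - w)" if "Q w = 0" for w
    using infdist_le[of w K x] that by (simp add: \<delta>_def K_def dist_norm)
  define a where "a = 1 / norm (x - m)"
  have pos: "norm (x - m) > 0" using lower[OF m(1)] \<delta> by linarith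
  have a: "a > 0" using pos by (simp add: a_def)
  have "norm (a *\<^sub>R (x - m)) = 1" using pos by (simp add: a_def)
  moreover have "norm (a *\<^sub>R (x - m) - w) \<ge> 1/2" if w: "Q w = 0" for w
  proof -
    have "Q (m + (1 / a) *\<^sub>R w) = 0" by (simp add: clinear_add[OF Q] sc m(1) w)
    then have "\<delta> \<le> norm (x - (m + (1 / a) *\<^sub>R w))" by (rule lower)
    moreover have "a *\<^sub>R (x - m) - w = a *\<^sub>R (x - (m + (1 / a) *\<^sub>R w))"
      using a by (simp add: algebra_simps)
    ultimately have "a * \<delta> \<le> norm (a *\<^sub>R (x - m) - w)" using a by simp
    moreover have "1/2 \<le> a * \<delta>" using m(2) pos by (simp add: a_def field_simps)
    ultimately show ?thesis by linarith
  qed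
  ultimately show ?thesis using that m(1) by blast
qed

text \<open>The powers of \<open>T\<close> and \<open>B\<close> differ by an operator of finite rank. Only the functionals through which it
  factors matter later: where they are small, the powers of \<open>T\<close> are as small as those of \<open>B\<close>.\<close>

lemma power_minus_power_finite_rank:
  fixes d :: nat
  assumes T: "clinear T" and B: "clinear B" and TB: "\<And>x. T x = B x + (\<Sum>j<d. l j x \<odot> e j)"
  shows "\<exists>C\<ge>0. \<forall>y. norm ((T ^^ k) y - (B ^^ k) y) \<le> C * (\<Sum>j<k. \<Sum>i<d. cmod (l i ((B ^^ j) y)))"
proof (induction k)
  case 0
  show ?case by (rule exI[of _ 0]) simp
next
  case (Suc k)
  then obtain C where C0: "C \<ge> 0" and C1:
    "\<forall>y. norm ((T ^^ k) y - (B ^^ k) y) \<le> C * (\<Sum>j<k. \<Sum>i<d. cmod (l i ((B ^^ j) y)))"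
    by (elim exE conjE)
  note C = C0 C1[rule_format]
  obtain K where K: "K > 0" "\<And>x. norm (T x) \<le> K * norm x"
    using bounded_linear.pos_bounded[OF clinear_bl[OF T]] by (metis mult.commute)
  define E where "E = (\<Sum>i<d. norm (e i))"
  have E: "E \<ge> 0" by (simp add: E_def sum_nonneg)
  have "norm ((T ^^ Suc k) y - (B ^^ Suc k) y)
      \<le> (K * C + E) * (\<Sum>j<Suc k. \<Sum>i<d. cmod (l i ((B ^^ j) y)))" for y
  proof -
    define S where "S = (\<Sum>j<k. \<Sum>i<d. cmod (l i ((B ^^ j) y)))"
    define S' where "S' = (\<Sum>i<d. cmod (l i ((B ^^ k) y)))"
    have S: "S \<ge> 0" "S' \<ge> 0" by (auto simp: S_def S'_def intro!: sum_nonneg)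
    have "(T ^^ Suc k) y - (B ^^ Suc k) y
        = T ((T ^^ k) y - (B ^^ k) y) + (\<Sum>i<d. l i ((B ^^ k) y) \<odot> e i)"
      using TB[of "(B ^^ k) y"] by (simp add: clinear_diff[OF T])
    also have "norm \<dots> \<le> K * norm ((T ^^ k) y - (B ^^ k) y) + (\<Sum>i<d. norm (l i ((B ^^ k) y) \<odot> e i))"
      by (intro norm_triangle_le add_mono K(2) norm_sum)
    also have "\<dots> \<le> K * (C * S) + (\<Sum>i<d. cmod (l i ((B ^^ k) y)) * E)"
    proof (intro add_mono mult_left_mono sum_mono)
      show "norm ((T ^^ k) y - (B ^^ k) y) \<le> C * S" using C(2) by (simp add: S_def)
      show "norm (l i ((B ^^ k) y) \<odot> e i) \<le> cmod (l i ((B ^^ k) y)) * E" if "i \<in> {..<d}" for i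
        unfolding norm_cs E_def using that by (intro mult_left_mono member_le_sum) auto
    qed (use K in auto)
    also have "\<dots> = K * C * S + E * S'" by (simp add: S'_def flip: sum_distrib_right)
    also have "\<dots> \<le> (K * C + E) * (S + S')" using S E C(1) K(1) by (simp add: algebra_simps)
    finally show ?thesis by (simp add: S_def S'_def)
  qed
  moreover have "K * C + E \<ge> 0" using K C E by simp
  ultimately show ?case by (intro exI[of _ "K * C + E"] conjI allI)
qed

lemma common_convergent_subsequence:
  fixes a :: "'j \<Rightarrow> nat \<Rightarrow> complex"
  assumes "finite J" "\<And>j. j \<in> J \<Longrightarrow> bounded (range (a j))"
  shows "\<exists>s. strict_mono s \<and> (\<forall>j\<in>J. convergent (\<lambda>n. a j (s n)))"
  using assms
proof (induction J rule: finite_induct)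
  case empty
  then show ?case using strict_mono_id by blast
next
  case (insert j J)
  then obtain s where s: "strict_mono s" "\<And>i. i \<in> J \<Longrightarrow> convergent (\<lambda>n. a i (s n))" by blast
  have "bounded (range (\<lambda>n. a j (s n)))"
    using insert.prems[of j] by (rule_tac bounded_subset[of "range (a j)"]) auto
  then obtain l t where t: "strict_mono t" "((\<lambda>n. a j (s n)) \<circ> t) \<longlonglongrightarrow> l"
    using bounded_imp_convergent_subsequence by metis
  have "convergent (\<lambda>n. a i ((s \<circ> t) n))" if "i \<in> insert j J" for i
  proof (cases "i = j")
    case True
    then show ?thesis using t(2) by (auto simp: convergent_def o_def)
  next
    case False
    then have "convergent (\<lambda>n. a i (s n))" using that s by blast
    then obtain L where "(\<lambda>n. a i (s n)) \<longlonglongrightarrow> L" by (auto simp: convergent_def)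
    from LIMSEQ_subseq_LIMSEQ[OF this t(1)] show ?thesis by (auto simp: convergent_def o_def)
  qed
  then show ?case using strict_mono_o[OF s(1) t(1)] by blast
qed

text \<open>The product of the operators \<open>\<zeta> j - T\<close> for \<open>j < n\<close>. Varying the parameters treats generalized eigenvectors
  (constant \<open>\<zeta>\<close>) and sequences of distinct eigenvalues at the same time.\<close>

primrec shifts :: "('v \<Rightarrow> 'v) \<Rightarrow> (nat \<Rightarrow> complex) \<Rightarrow> nat \<Rightarrow> 'v \<Rightarrow> 'v" where
  "shifts T \<zeta> 0 x = x"
| "shifts T \<zeta> (Suc n) x = \<zeta> n \<odot> shifts T \<zeta> n x - T (shifts T \<zeta> n x)"

lemma clinear_shifts: "clinear T \<Longrightarrow> clinear (shifts T \<zeta> n)"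
proof (induction n)
  case 0
  have "shifts T \<zeta> 0 = (\<lambda>x. x)" by (simp add: fun_eq_iff)
  then show ?case by (simp add: clinear_ident)
next
  case (Suc n)
  have "shifts T \<zeta> (Suc n) = (\<lambda>x. \<zeta> n \<odot> shifts T \<zeta> n x - T (shifts T \<zeta> n x))"
    by (simp add: fun_eq_iff)
  then show ?case using clinear_comp[OF clinear_shift[of T "\<zeta> n"], of "shifts T \<zeta> n"] Suc by simp
qed

lemma shifts_commute: "clinear T \<Longrightarrow> shifts T \<zeta> n (T x) = T (shifts T \<zeta> n x)"
  by (induction n) (simp_all add: clinear_diff clinear_cs)

text \<open>Riesz' argument. If all kernels were distinct, there would be unit vectors \<open>y n\<close> in the kernels of
  \<open>shifts T \<zeta> (Suc n)\<close> at distance at least \<open>1/2\<close> from the previous kernels. Modulo the previous kernel,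
  \<open>T\<close> acts on \<open>y n\<close> as multiplication by \<open>\<zeta> n\<close>, so \<open>T ^^ k\<close> would separate any two of these vectors by at
  least \<open>\<rho>' ^ k / 2\<close>. But along a subsequence the finitely many functionals converge, so \<open>T ^^ k\<close> moves
  two successive members apart hardly more than \<open>B ^^ k\<close> does, that is by at most about
  \<open>2 * \<rho> ^ k\<close>, which is smaller when \<open>k\<close> is large.\<close>

lemma shift_kernels_stabilize:
  fixes d :: nat
  assumes T: "clinear T" and B: "clinear B" and TB: "\<And>x. T x = B x + (\<Sum>j<d. l j x \<odot> e j)"
    and l: "\<And>j. j < d \<Longrightarrow> cfunctional (l j)"
    and Bn: "\<And>x. norm (B x) \<le> \<rho> * norm x" and \<rho>: "0 \<le> \<rho>" "\<rho> < \<rho>'"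
    and lam: "\<And>n. \<rho>' \<le> cmod (\<zeta> n)"
  shows "\<exists>n. \<forall>x. shifts T \<zeta> (Suc n) x = 0 \<longrightarrow> shifts T \<zeta> n x = 0"
proof (rule ccontr)
  assume "\<not> ?thesis"
  then have ex: "\<exists>x. shifts T \<zeta> (Suc n) x = 0 \<and> shifts T \<zeta> n x \<noteq> 0" for n by blast
  define M where "M n = {x. shifts T \<zeta> n x = 0}" for n
  have cP: "clinear (shifts T \<zeta> n)" for n by (rule clinear_shifts[OF T])
  have M_sub: "M n \<subseteq> M m" if "n \<le> m" for n m
    by (rule lift_Suc_mono_le[OF _ that]) (auto simp: M_def clinear_zero[OF T])
  have M_add: "x + y \<in> M n" if "x \<in> M n" "y \<in> M n" for x y n
    using that by (simp add: M_def clinear_add[OF cP])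
  have M_cs: "c \<odot> x \<in> M n" if "x \<in> M n" for c x n
    using that by (simp add: M_def clinear_cs[OF cP])
  have M_diff: "x - y \<in> M n" if "x \<in> M n" "y \<in> M n" for x y n
    using that by (simp add: M_def clinear_diff[OF cP])
  have M_T: "T x \<in> M n" if "x \<in> M n" for x n
    using that by (simp add: M_def shifts_commute[OF T] clinear_zero[OF T])
  have M_Tk: "(T ^^ k) x \<in> M n" if "x \<in> M n" for x n k
    using that by (induction k) (auto intro: M_T)
  have M_step: "T x - \<zeta> n \<odot> x \<in> M n" if "x \<in> M (Suc n)" for x n
    using that by (simp add: M_def clinear_diff[OF cP] clinear_cs[OF cP] shifts_commute[OF T])
  have M_stepk: "(T ^^ k) x - (\<zeta> n ^ k) \<odot> x \<in> M n" if "x \<in> M (Suc n)" for x n k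
  proof (induction k)
    case 0
    then show ?case by (simp add: M_def clinear_zero[OF cP])
  next
    case (Suc k)
    have "(T ^^ Suc k) x - (\<zeta> n ^ Suc k) \<odot> x
        = T ((T ^^ k) x - (\<zeta> n ^ k) \<odot> x) + (\<zeta> n ^ k) \<odot> (T x - \<zeta> n \<odot> x)"
      by (simp add: clinear_diff[OF T] clinear_cs[OF T] cs_diff_right cs_cs mult.commute)
    then show ?case using M_T[OF Suc] M_cs[OF M_step[OF that]] M_add by metis
  qed
  have "\<exists>y. y \<in> M (Suc n) \<and> norm y = 1 \<and> (\<forall>w\<in>M n. norm (y - w) \<ge> 1/2)" for n
  proof -
    obtain x where x: "x \<in> M (Suc n)" "shifts T \<zeta> n x \<noteq> 0" using ex[of n] by (auto simp: M_def)
    obtain a m where am: "shifts T \<zeta> n m = 0" "norm (a *\<^sub>R (x - m)) = 1"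
      "\<And>w. shifts T \<zeta> n w = 0 \<Longrightarrow> norm (a *\<^sub>R (x - m) - w) \<ge> 1/2"
      by (rule almost_orthogonal_to_kernel[OF cP x(2)]) (rule that)
    have "m \<in> M (Suc n)" using am(1) M_sub[of n "Suc n"] by (auto simp: M_def)
    then have "a *\<^sub>R (x - m) \<in> M (Suc n)"
      using M_cs[OF M_diff[OF x(1)], of m "complex_of_real a"] by (simp add: cs_of_real)
    then show ?thesis using am by (auto simp: M_def)
  qed
  then obtain y where y: "\<And>n. y n \<in> M (Suc n)" "\<And>n. norm (y n) = 1"
    "\<And>n w. w \<in> M n \<Longrightarrow> norm (y n - w) \<ge> 1/2" by metis
  have \<rho>': "\<rho>' > 0" using \<rho> by simp
  obtain k where k: "(\<rho> / \<rho>') ^ k < 1/8"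
    using real_arch_pow_inv[of "1/8" "\<rho> / \<rho>'"] \<rho> by (auto simp: field_simps)
  then have k': "2 * \<rho> ^ k < \<rho>' ^ k / 4" using \<rho>' by (simp add: power_divide field_simps)
  have Bk: "norm ((B ^^ j) x) \<le> \<rho> ^ j * norm x" for j x
  proof (induction j)
    case (Suc j)
    have "norm ((B ^^ Suc j) x) \<le> \<rho> * norm ((B ^^ j) x)" using Bn by simp
    also have "\<dots> \<le> \<rho> * (\<rho> ^ j * norm x)" using Suc \<rho> by (intro mult_left_mono) auto
    finally show ?case by simp
  qed simp
  have cBj: "clinear (B ^^ j)" for j
  proof (induction j)
    case (Suc j)
    then show ?case using clinear_comp[OF B Suc] by (simp add: o_def)
  qed (simp add: clinear_ident id_def)
  have cTk: "clinear (T ^^ j)" for j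
  proof (induction j)
    case (Suc j)
    then show ?case using clinear_comp[OF T Suc] by (simp add: o_def)
  qed (simp add: clinear_ident id_def)
  obtain C where C0: "C \<ge> 0" and C1:
    "\<forall>y. norm ((T ^^ k) y - (B ^^ k) y) \<le> C * (\<Sum>j<k. \<Sum>i<d. cmod (l i ((B ^^ j) y)))"
    using power_minus_power_finite_rank[OF T B TB, of k] by (elim exE conjE)
  note C = C0 C1[rule_format]
  define a where "a p n = l (snd p) ((B ^^ fst p) (y n))" for p :: "nat \<times> nat" and n
  have a_fun: "cfunctional (\<lambda>x. l (snd p) ((B ^^ fst p) x))" if "p \<in> {..<k} \<times> {..<d}" for p
    using cfunctional_comp[OF l cBj] that by auto
  have "bounded (range (a p))" if p: "p \<in> {..<k} \<times> {..<d}" for p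
  proof -
    obtain K where "\<And>x. cmod (l (snd p) ((B ^^ fst p) x)) \<le> K * norm x"
      using cfunctional_bound[OF a_fun[OF p]] by blast
    then have "cmod (a p n) \<le> K" for n using y(2)[of n] by (metis a_def mult.right_neutral)
    then show ?thesis by (auto intro: boundedI)
  qed
  then obtain s where s: "strict_mono s" "\<And>p. p \<in> {..<k} \<times> {..<d} \<Longrightarrow> convergent (\<lambda>n. a p (s n))"
    using common_convergent_subsequence[of "{..<k} \<times> {..<d}" a] by auto
  have "(\<lambda>n. a p (s (Suc n)) - a p (s n)) \<longlonglongrightarrow> 0" if p: "p \<in> {..<k} \<times> {..<d}" for p
  proof -
    obtain L where L: "(\<lambda>n. a p (s n)) \<longlonglongrightarrow> L" using s(2)[OF p] by (auto simp: convergent_def)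
    from tendsto_diff[OF LIMSEQ_Suc[OF L] L] show ?thesis by simp
  qed
  then have "(\<lambda>n. C * (\<Sum>j<k. \<Sum>i<d. cmod (a (j, i) (s (Suc n)) - a (j, i) (s n)))) \<longlonglongrightarrow>
      C * (\<Sum>j<k. \<Sum>i<d. 0)"
    by (intro tendsto_intros tendsto_norm_zero) auto
  then have "\<forall>\<^sub>F n in sequentially.
      C * (\<Sum>j<k. \<Sum>i<d. cmod (a (j, i) (s (Suc n)) - a (j, i) (s n))) < \<rho>' ^ k / 4"
    using \<rho>' by (intro order_tendstoD(2)) auto
  then obtain i0 where i0:
    "C * (\<Sum>j<k. \<Sum>i<d. cmod (a (j, i) (s (Suc i0)) - a (j, i) (s i0))) < \<rho>' ^ k / 4"
    by (auto simp: eventually_sequentially)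
  define n where "n = s (Suc i0)"
  define m where "m = s i0"
  have mn: "m < n" using s(1) by (simp add: n_def m_def strict_mono_Suc_iff)
  define v where "v = y n - y m"
  have "C * (\<Sum>j<k. \<Sum>i<d. cmod (l i ((B ^^ j) v))) < \<rho>' ^ k / 4"
  proof -
    have "l i ((B ^^ j) v) = a (j, i) n - a (j, i) m" if "j < k" "i < d" for i j
      using cfunctional_diff[OF a_fun[of "(j,i)"], of "y n" "y m"] that by (simp add: v_def a_def)
    then have "(\<Sum>j<k. \<Sum>i<d. cmod (l i ((B ^^ j) v)))
        = (\<Sum>j<k. \<Sum>i<d. cmod (a (j, i) n - a (j, i) m))"
      by (intro sum.cong) auto
    then show ?thesis using i0 by (simp add: n_def m_def)
  qed
  then have "norm ((T ^^ k) v - (B ^^ k) v) < \<rho>' ^ k / 4" using C(2)[of v] by linarith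
  moreover have "norm ((B ^^ k) v) \<le> \<rho> ^ k * 2"
  proof -
    have "norm v \<le> 2" using norm_triangle_ineq4[of "y n" "y m"] y(2) by (simp add: v_def)
    then have "\<rho> ^ k * norm v \<le> \<rho> ^ k * 2" using \<rho> by (intro mult_left_mono) auto
    then show ?thesis using Bk[of k v] by linarith
  qed
  moreover have "norm ((T ^^ k) v) \<le> norm ((T ^^ k) v - (B ^^ k) v) + norm ((B ^^ k) v)"
    by (metis diff_add_cancel norm_triangle_ineq)
  ultimately have upper: "norm ((T ^^ k) v) < \<rho>' ^ k / 2" using k' by linarith
  have lam0: "\<zeta> n ^ k \<noteq> 0" using lam[of n] \<rho>' by auto
  define w where "w = (1 / \<zeta> n ^ k) \<odot> ((T ^^ k) (y m) - ((T ^^ k) (y n) - (\<zeta> n ^ k) \<odot> y n))"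
  have "y m \<in> M n" using y(1)[of m] M_sub[of "Suc m" n] mn by auto
  then have "w \<in> M n" unfolding w_def by (intro M_cs M_diff M_Tk M_stepk y(1))
  moreover have "(T ^^ k) v = (\<zeta> n ^ k) \<odot> (y n - w)"
  proof -
    have "\<zeta> n ^ k * (1 / \<zeta> n ^ k) = 1" using lam0 by (simp add: divide_self)
    then have "(\<zeta> n ^ k) \<odot> w = (T ^^ k) (y m) - ((T ^^ k) (y n) - (\<zeta> n ^ k) \<odot> y n)"
      by (simp only: w_def cs_cs cs_one)
    then show ?thesis by (simp add: v_def clinear_diff[OF cTk] cs_diff_right)
  qed
  ultimately have "cmod (\<zeta> n ^ k) * (1/2) \<le> norm ((T ^^ k) v)"
    using mult_left_mono[OF y(3)[of w n] norm_ge_zero[of "\<zeta> n ^ k"]] by (simp add: norm_cs)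
  moreover have "\<rho>' ^ k \<le> cmod (\<zeta> n ^ k)" using lam \<rho>' by (simp add: norm_power power_mono)
  ultimately show False using upper by linarith
qed

end

text \<open>The essential norm of \<open>T\<close> is at most \<open>r\<close>, in the strong form that finite rank operators approximate.\<close>

locale quasi_compact = complex_scaling cs
  for cs :: "complex \<Rightarrow> 'v::real_normed_vector \<Rightarrow> 'v" (infixr "\<odot>" 75) +
  fixes T :: "'v \<Rightarrow> 'v" and r :: real
  assumes T: "clinear T" and r: "0 \<le> r"
    and approx: "\<epsilon> > 0 \<Longrightarrow> \<exists>(d::nat) l e. (\<forall>j<d. cfunctional (l j)) \<and>
        (\<forall>x. norm (T x - (\<Sum>j<d. l j x \<odot> e j)) \<le> (r + \<epsilon>) * norm x)"
begin

lemma split: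
  assumes "r < \<rho>"
  obtains d :: nat and l e B where "\<And>j. j < d \<Longrightarrow> cfunctional (l j)" "clinear B"
    "\<And>x. norm (B x) \<le> \<rho> * norm x" "\<And>x. T x = B x + (\<Sum>j<d. l j x \<odot> e j)"
proof -
  obtain d :: nat and l e where le: "\<And>j. j < d \<Longrightarrow> cfunctional (l j)"
    "\<And>x. norm (T x - (\<Sum>j<d. l j x \<odot> e j)) \<le> \<rho> * norm x"
    using approx[of "\<rho> - r"] assms by auto
  show ?thesis
    by (rule that[of d l "\<lambda>x. T x - (\<Sum>j<d. l j x \<odot> e j)" e])
       (use le clinear_sub[OF T clinear_finite_rank[OF le(1)]] in auto)
qed

lemma split_at:
  assumes "r < cmod z"
  obtains d :: nat and l e B where "\<And>j. j < d \<Longrightarrow> cfunctional (l j)"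
    "invertible_op (\<lambda>x. z \<odot> x - B x)" "\<And>x. T x = B x + (\<Sum>j<d. l j x \<odot> e j)"
proof -
  define \<rho> where "\<rho> = (r + cmod z) / 2"
  have \<rho>: "r < \<rho>" "0 \<le> \<rho>" "\<rho> < cmod z" using assms r by (auto simp: \<rho>_def)
  obtain d :: nat and l e B where dec: "\<And>j. j < d \<Longrightarrow> cfunctional (l j)" "clinear B"
    "\<And>x. norm (B x) \<le> \<rho> * norm x" "\<And>x. T x = B x + (\<Sum>j<d. l j x \<odot> e j)"
    by (rule split[OF \<rho>(1)]) (rule that)
  from neumann[OF dec(2,3) \<rho>(2,3)] have "invertible_op (\<lambda>x. z \<odot> x - B x)" .
  from that[OF dec(1) this dec(4)] show ?thesis .
qed

lemma fredholm_shift: "r < cmod z \<Longrightarrow> fredholm (\<lambda>x. z \<odot> x - T x)"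
proof -
  assume "r < cmod z"
  then obtain d :: nat and l e B where "\<And>j. j < d \<Longrightarrow> cfunctional (l j)"
    "invertible_op (\<lambda>x. z \<odot> x - B x)" "\<And>x. T x = B x + (\<Sum>j<d. l j x \<odot> e j)"
    by (rule split_at) (rule that)
  then show ?thesis
    using fredholm_finite_rank[of "\<lambda>x. z \<odot> x - B x" d l e] by (simp add: algebra_simps)
qed

text \<open>Where \<open>z \<odot> x - T x\<close> is a combination of the \<open>b i\<close>, the vector \<open>z \<odot> x - B x\<close> is a combination
  of the \<open>b i\<close> and the \<open>e j\<close>; invert.\<close>

lemma kernel_power_finite_dim:
  assumes z: "r < cmod z"
  shows "\<exists>(m::nat) b. \<forall>x. ((\<lambda>x. z \<odot> x - T x) ^^ n) x = 0 \<longrightarrow> (\<exists>c. x = (\<Sum>i<m. c i \<odot> b i))"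
proof (induction n)
  case 0
  then show ?case by (intro exI[of _ "0::nat"]) auto
next
  case (Suc n)
  then obtain m :: nat and b where mb:
    "\<And>x. ((\<lambda>x. z \<odot> x - T x) ^^ n) x = 0 \<Longrightarrow> \<exists>c. x = (\<Sum>i<m. c i \<odot> b i)" by blast
  obtain d :: nat and l e B where le: "\<And>j. j < d \<Longrightarrow> cfunctional (l j)"
    and S: "invertible_op (\<lambda>x. z \<odot> x - B x)" and TB: "\<And>x. T x = B x + (\<Sum>j<d. l j x \<odot> e j)"
    by (rule split_at[OF z]) (rule that)
  define S' where "S' = (\<lambda>x. z \<odot> x - B x)"
  have cS: "clinear S'" and sS: "surj S'" and "\<exists>C. \<forall>x. norm x \<le> C * norm (S' x)"
    using S by (auto simp: invertible_op_def S'_def)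
  then obtain C where C: "\<And>x. norm x \<le> C * norm (S' x)" by blast
  have inj: "x = y" if "S' x = S' y" for x y
    using C[of "x - y"] that by (simp add: clinear_diff[OF cS])
  define b' where "b' i = inv S' (if i < m then b i else e (i - m))" for i
  have Sb': "S' (b' i) = (if i < m then b i else e (i - m))" for i
    by (simp add: b'_def surj_f_inv_f[OF sS])
  have sum_split: "(\<Sum>i<m + j. g i :: 'v) = (\<Sum>i<m. g i) + (\<Sum>i<j. g (m + i))" for j and g :: "nat \<Rightarrow> 'v"
    by (induction j) (auto simp: algebra_simps)
  have "\<exists>c. x = (\<Sum>i<m + d. c i \<odot> b' i)" if x: "((\<lambda>x. z \<odot> x - T x) ^^ Suc n) x = 0" for x
  proof -
    have "((\<lambda>x. z \<odot> x - T x) ^^ n) (z \<odot> x - T x) = 0" using x by (simp only: funpow_Suc_right o_def)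
    then obtain c where c: "z \<odot> x - T x = (\<Sum>i<m. c i \<odot> b i)" using mb by blast
    define c' where "c' i = (if i < m then c i else l (i - m) x)" for i
    have "S' (\<Sum>i<m + d. c' i \<odot> b' i) = (\<Sum>i<m. c i \<odot> b i) + (\<Sum>j<d. l j x \<odot> e j)"
      by (simp add: clinear_add[OF cS] clinear_sum[OF cS] clinear_cs[OF cS] Sb' sum_split c'_def)
    also have "\<dots> = S' x" using c[symmetric] by (simp add: S'_def TB)
    finally show ?thesis using inj by metis
  qed
  then show ?case by blast
qed

lemma finite_ascent:
  assumes z: "r < cmod z"
  shows "\<exists>n. \<forall>m x. ((\<lambda>x. z \<odot> x - T x) ^^ m) x = 0 \<longrightarrow> ((\<lambda>x. z \<odot> x - T x) ^^ n) x = 0"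
proof -
  define S where "S = (\<lambda>x. z \<odot> x - T x)"
  define \<rho> where "\<rho> = (r + cmod z) / 2"
  have \<rho>: "r < \<rho>" "0 \<le> \<rho>" "\<rho> < cmod z" using z r by (auto simp: \<rho>_def)
  obtain d :: nat and l e B where "\<And>j. j < d \<Longrightarrow> cfunctional (l j)" "clinear B"
    "\<And>x. norm (B x) \<le> \<rho> * norm x" "\<And>x. T x = B x + (\<Sum>j<d. l j x \<odot> e j)"
    by (rule split[OF \<rho>(1)]) (rule that)
  then obtain n where n: "\<And>x. shifts T (\<lambda>_. z) (Suc n) x = 0 \<Longrightarrow> shifts T (\<lambda>_. z) n x = 0"
    using shift_kernels_stabilize[OF T, of B l e d \<rho> "cmod z" "\<lambda>_. z"] \<rho> by auto
  have eq: "shifts T (\<lambda>_. z) m x = (S ^^ m) x" for m x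
    by (induction m) (auto simp: S_def)
  have cS: "clinear S" unfolding S_def by (rule clinear_shift[OF T])
  have zero: "(S ^^ k) 0 = 0" for k by (induction k) (auto simp: clinear_zero[OF cS])
  have "(S ^^ n) x = 0" if "(S ^^ (n + k)) x = 0" for k x
    using that
  proof (induction k arbitrary: x)
    case (Suc k)
    have "(S ^^ (n + k)) (S x) = 0" using Suc.prems by (simp add: funpow_swap1)
    then have "(S ^^ n) (S x) = 0" by (rule Suc.IH)
    then have "(S ^^ Suc n) x = 0" by (simp only: funpow_Suc_right o_def)
    then show ?case using n[of x] by (simp only: eq)
  qed simp
  moreover have "(S ^^ (n + m)) x = 0" if "(S ^^ m) x = 0" for m x
    using that zero by (simp add: funpow_add)
  ultimately show ?thesis unfolding S_def[symmetric] by blast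
qed

text \<open>For distinct eigenvalues \<open>\<zeta> n\<close>, an eigenvector of \<open>\<zeta> n\<close> lies in the kernel of \<open>shifts T \<zeta> (Suc n)\<close> but not
  in that of \<open>shifts T \<zeta> n\<close>.\<close>

lemma eigenvalues_isolated:
  assumes z: "r < cmod z"
  shows "\<not> z islimpt {w. \<exists>x. x \<noteq> 0 \<and> T x = w \<odot> x}"
proof
  assume lim: "z islimpt {w. \<exists>x. x \<noteq> 0 \<and> T x = w \<odot> x}"
  define \<rho>' where "\<rho>' = (r + cmod z) / 2"
  define \<rho> where "\<rho> = (r + \<rho>') / 2"
  have \<rho>': "r < \<rho>'" "\<rho>' < cmod z" using z r by (auto simp: \<rho>'_def)
  have \<rho>: "r < \<rho>" "0 \<le> \<rho>" "\<rho> < \<rho>'" using \<rho>' r by (auto simp: \<rho>_def)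
  have "infinite ({w. \<exists>x. x \<noteq> 0 \<and> T x = w \<odot> x} \<inter> ball z (cmod z - \<rho>'))"
    using lim \<rho>' unfolding islimpt_eq_infinite_ball by simp
  then obtain \<zeta> :: "nat \<Rightarrow> complex" where \<zeta>: "inj \<zeta>"
    "range \<zeta> \<subseteq> {w. \<exists>x. x \<noteq> 0 \<and> T x = w \<odot> x} \<inter> ball z (cmod z - \<rho>')"
    using infinite_countable_subset by meson
  have eig: "\<exists>x. x \<noteq> 0 \<and> T x = \<zeta> n \<odot> x" for n using \<zeta>(2) by auto
  have large: "\<rho>' \<le> cmod (\<zeta> n)" for n
  proof -
    have "dist z (\<zeta> n) < cmod z - \<rho>'" using \<zeta>(2) by (auto simp: subset_iff)
    moreover have "cmod z \<le> cmod (\<zeta> n) + dist z (\<zeta> n)"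
      unfolding dist_norm by (metis norm_triangle_sub)
    ultimately show ?thesis by simp
  qed
  have inj: "\<zeta> i \<noteq> \<zeta> j" if "i \<noteq> j" for i j using \<zeta>(1) that by (auto simp: inj_def)
  obtain d :: nat and l e B where "\<And>j. j < d \<Longrightarrow> cfunctional (l j)" "clinear B"
    "\<And>x. norm (B x) \<le> \<rho> * norm x" "\<And>x. T x = B x + (\<Sum>j<d. l j x \<odot> e j)"
    by (rule split[OF \<rho>(1)]) (rule that)
  then obtain n where n: "\<And>x. shifts T \<zeta> (Suc n) x = 0 \<Longrightarrow> shifts T \<zeta> n x = 0"
    using shift_kernels_stabilize[OF T, of B l e d \<rho> \<rho>' \<zeta>] \<rho> large
    by auto
  obtain x where x: "x \<noteq> 0" "T x = \<zeta> n \<odot> x" using eig by blast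
  \<comment> \<open>The factor of \<open>x\<close> is the product of the differences \<open>\<zeta> j - \<zeta> n\<close> for \<open>j < m\<close>.\<close>
  have sh: "\<exists>c. c \<noteq> 0 \<and> shifts T \<zeta> m x = c \<odot> x" if "m \<le> n" for m
    using that
  proof (induction m)
    case 0
    then show ?case by (intro exI[of _ 1]) simp
  next
    case (Suc m)
    then obtain c where c: "c \<noteq> 0" "shifts T \<zeta> m x = c \<odot> x" by auto
    have "shifts T \<zeta> (Suc m) x = ((\<zeta> m - \<zeta> n) * c) \<odot> x"
      by (simp add: c clinear_cs[OF T] x cs_cs cs_diff_left algebra_simps)
    then show ?case using c inj[of m n] Suc.prems by (intro exI[of _ "(\<zeta> m - \<zeta> n) * c"]) auto
  qed
  then obtain c where c: "c \<noteq> 0" "shifts T \<zeta> n x = c \<odot> x" by blast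
  have "shifts T \<zeta> (Suc n) x = 0"
    by (simp add: c clinear_cs[OF T] x cs_cs mult.commute)
  then have "c \<odot> x = 0" using n c(2) by metis
  then show False using c x by (simp add: cs_eq_0)
qed

end

section \<open>Smooth functions with compact support\<close>

text \<open>The sequence of all derivatives is the witness, which is easier to supply than the iterates of \<open>deriv\<close>.\<close>

definition smooth :: "(real \<Rightarrow> real) \<Rightarrow> bool" where
  "smooth f \<longleftrightarrow> (\<exists>R. R 0 = f \<and> (\<forall>n x. (R n has_real_derivative R (Suc n) x) (at x)))"

lemma smooth_deriv_iter:
  assumes "R 0 = f" "\<And>n x. (R n has_real_derivative R (Suc n) x) (at x)"
  shows "(deriv ^^ n) f = R n"
proof (induction n)
  case (Suc n)
  have "deriv (R n) = R (Suc n)" using DERIV_imp_deriv assms(2) by blast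
  then show ?case using Suc by simp
qed (simp add: assms)

lemma smooth_iff: "smooth f \<longleftrightarrow> (\<forall>n x. (deriv ^^ n) f field_differentiable at x)"
proof
  assume "smooth f"
  then obtain R where R: "R 0 = f" "\<And>n x. (R n has_real_derivative R (Suc n) x) (at x)"
    unfolding smooth_def by blast
  show "\<forall>n x. (deriv ^^ n) f field_differentiable at x"
    unfolding smooth_deriv_iter[of R, OF R] using R(2) field_differentiable_def by blast
next
  assume *: "\<forall>n x. (deriv ^^ n) f field_differentiable at x"
  show "smooth f" unfolding smooth_def
    by (rule exI[of _ "\<lambda>n. (deriv ^^ n) f"]) (use * DERIV_deriv_iff_field_differentiable in auto)
qed

lemma smooth_antideriv:
  assumes "smooth f" "\<And>x. (F has_real_derivative f x) (at x)"
  shows "smooth F"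
proof -
  obtain R where R: "R 0 = f" "\<And>n x. (R n has_real_derivative R (Suc n) x) (at x)"
    using assms(1) unfolding smooth_def by blast
  show ?thesis unfolding smooth_def
    by (rule exI[of _ "case_nat F R"]) (auto simp: R assms(2) split: nat.split)
qed

lemma smooth_affine:
  assumes "smooth f"
  shows "smooth (\<lambda>x. f ((x - a) / e))"
proof -
  obtain R where R: "R 0 = f" "\<And>n x. (R n has_real_derivative R (Suc n) x) (at x)"
    using assms(1) unfolding smooth_def by blast
  have "((\<lambda>x. (1 / e) ^ n * R n ((x - a) / e)) has_real_derivative
      (1 / e) ^ Suc n * R (Suc n) ((x - a) / e)) (at x)" for n x
  proof -
    have "((\<lambda>x. (x - a) / e) has_real_derivative 1 / e) (at x)"
      by (rule DERIV_cdivide) (auto intro!: derivative_eq_intros)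
    from DERIV_cmult[OF DERIV_chain2[OF R(2) this], of "(1 / e) ^ n" n] show ?thesis
      by (simp add: mult_ac)
  qed
  then show ?thesis unfolding smooth_def
    by (intro exI[of _ "\<lambda>n x. (1 / e) ^ n * R n ((x - a) / e)"]) (auto simp: R)
qed

lemma smooth_cmult:
  assumes "smooth f" shows "smooth (\<lambda>x. c * f x)"
proof -
  obtain R where R: "R 0 = f" "\<And>n x. (R n has_real_derivative R (Suc n) x) (at x)"
    using assms(1) unfolding smooth_def by blast
  show ?thesis unfolding smooth_def
    by (rule exI[of _ "\<lambda>n x. c * R n x"]) (auto simp: R intro!: DERIV_cmult)
qed

lemma smooth_add:
  assumes "smooth f" "smooth g" shows "smooth (\<lambda>x. f x + g x)"
proof -
  obtain R where R: "R 0 = f" "\<And>n x. (R n has_real_derivative R (Suc n) x) (at x)"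
    using assms(1) unfolding smooth_def by blast
  obtain Q where Q: "Q 0 = g" "\<And>n x. (Q n has_real_derivative Q (Suc n) x) (at x)"
    using assms(2) unfolding smooth_def by blast
  show ?thesis unfolding smooth_def
    by (rule exI[of _ "\<lambda>n x. R n x + Q n x"]) (auto simp: R Q intro!: DERIV_add)
qed

text \<open>A family that contains the standard bump (\<open>P = 1\<close>, \<open>k = 0\<close>) and is closed under differentiation.\<close>

definition bump :: "real poly \<Rightarrow> nat \<Rightarrow> real \<Rightarrow> real" where
  "bump P k x = (if \<bar>x\<bar> < 1 then poly P x / (1 - x\<^sup>2) ^ k * exp (- 1 / (1 - x\<^sup>2)) else 0)"

text \<open>The numerator of the derivative of \<open>bump P k\<close> over \<open>(1 - x\<^sup>2) ^ (k + 2)\<close>.\<close>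

definition bump_num :: "real poly \<Rightarrow> nat \<Rightarrow> real poly" where
  "bump_num P k = pderiv P * [:1, 0, -1:]\<^sup>2 + smult (2 * of_nat k) ([:0, 1:] * P * [:1, 0, -1:])
     - smult 2 ([:0, 1:] * P)"

lemma poly_bump_num:
  "poly (bump_num P k) x = poly (pderiv P) x * (1 - x\<^sup>2)\<^sup>2 + 2 * real k * x * poly P x * (1 - x\<^sup>2) - 2 * x * poly P x"
  by (simp add: bump_num_def power2_eq_square algebra_simps)

lemma DERIV_zero_of_quadratic_bound:
  fixes f :: "real \<Rightarrow> real"
  assumes "\<And>y. \<bar>f y\<bar> \<le> K * (y - x)\<^sup>2" and "f x = 0"
  shows "(f has_real_derivative 0) (at x)"
  unfolding has_field_derivative_iff
proof (rule Lim_null_comparison)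
  show "\<forall>\<^sub>F y in at x. norm ((f y - f x) / (y - x)) \<le> K * \<bar>y - x\<bar>"
  proof (intro eventually_at_filter[THEN iffD2] always_eventually allI impI)
    fix y :: real assume "y \<noteq> x"
    then have "0 < \<bar>y - x\<bar>" by simp
    moreover have "\<bar>f y\<bar> \<le> K * (\<bar>y - x\<bar> * \<bar>y - x\<bar>)"
      using assms(1)[of y] by (simp add: power2_eq_square abs_mult_self_eq)
    ultimately show "norm ((f y - f x) / (y - x)) \<le> K * \<bar>y - x\<bar>"
      by (simp add: assms(2) abs_divide pos_divide_le_eq mult.assoc)
  qed
  have "((\<lambda>y. K * \<bar>y - x\<bar>) \<longlongrightarrow> K * \<bar>x - x\<bar>) (at x)"
    by (intro tendsto_intros)
  then show "((\<lambda>y. K * \<bar>y - x\<bar>) \<longlongrightarrow> 0) (at x)" by simp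
qed

text \<open>One term of the exponential series of \<open>1 / s\<close>. At the ends of its support it makes the bump vanish
  faster than any power of the distance, so that the derivative there is zero.\<close>

lemma exp_minus_inverse_le:
  fixes s :: real assumes "s > 0"
  shows "exp (- 1 / s) \<le> fact m * s ^ m"
proof -
  have "(1 / s) ^ m / fact m \<le> exp (1 / s)"
  proof -
    have "sum (\<lambda>n. inverse (fact n) *\<^sub>R (1/s)^n) {m} \<le> (\<Sum>n. inverse (fact n) *\<^sub>R (1/s)^n)"
      using assms by (intro sum_le_suminf summable_exp_generic) auto
    then show ?thesis by (simp add: exp_def field_simps)
  qed
  then show ?thesis using assms
    by (simp add: exp_minus field_simps)
qed

lemma bump_deriv: "(bump P k has_real_derivative bump (bump_num P k) (k + 2) x) (at x)"
proof -
  consider "\<bar>x\<bar> < 1" | "\<bar>x\<bar> > 1" | "\<bar>x\<bar> = 1" by linarith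
  then show ?thesis
  proof cases
    case 1
    define s where "s = 1 - x\<^sup>2"
    have s: "s > 0" using 1 by (simp add: s_def abs_square_less_1)
    have ds: "((\<lambda>x. 1 - x\<^sup>2) has_real_derivative - 2 * x) (at x)"
      by (auto intro!: derivative_eq_intros)
    have A: "((\<lambda>x. poly P x / (1 - x\<^sup>2) ^ k) has_real_derivative
        (poly (pderiv P) x * s ^ k - poly P x * (real k * s ^ (k - 1) * (- 2 * x))) / (s ^ k * s ^ k)) (at x)"
      using s DERIV_divide[OF poly_DERIV[of P x] DERIV_power[OF ds, of k]]
      by (simp add: s_def mult_ac)
    have "((\<lambda>x. - 1 / (1 - x\<^sup>2)) has_real_derivative - 2 * x / s\<^sup>2) (at x)"
      using s DERIV_divide[OF DERIV_const[of "-1"] ds] by (simp add: s_def power2_eq_square)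
    from DERIV_mult[OF A DERIV_fun_exp[OF this]]
    have "((\<lambda>x. poly P x / (1 - x\<^sup>2) ^ k * exp (- 1 / (1 - x\<^sup>2))) has_real_derivative
        poly (pderiv P) x / s ^ k * exp (- 1 / s)
        + poly P x * (real k * s ^ (k - 1) * (2 * x)) / (s ^ k)\<^sup>2 * exp (- 1 / s)
        + poly P x / s ^ k * (exp (- 1 / s) * (- 2 * x / s\<^sup>2))) (at x)"
    proof (rule DERIV_cong, fold s_def)
      have "s ^ k \<noteq> 0" using s by simp
      then have "(poly (pderiv P) x * s ^ k - poly P x * (real k * s ^ (k - 1) * (- 2 * x))) / (s ^ k * s ^ k) =
          poly (pderiv P) x / s ^ k + poly P x * (real k * s ^ (k - 1) * (2 * x)) / (s ^ k)\<^sup>2"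
        by (simp add: power2_eq_square add_divide_distrib del: power_eq_0_iff)
      then show "(poly (pderiv P) x * s ^ k - poly P x * (real k * s ^ (k - 1) * (- 2 * x))) / (s ^ k * s ^ k) *
          exp (- 1 / s) + exp (- 1 / s) * (- 2 * x / s\<^sup>2) * (poly P x / s ^ k) =
        poly (pderiv P) x / s ^ k * exp (- 1 / s)
        + poly P x * (real k * s ^ (k - 1) * (2 * x)) / (s ^ k)\<^sup>2 * exp (- 1 / s)
        + poly P x / s ^ k * (exp (- 1 / s) * (- 2 * x / s\<^sup>2))"
        by (simp only: distrib_right distrib_left mult.commute mult.left_commute)
    qed
    also have "poly (pderiv P) x / s ^ k * exp (- 1 / s)
        + poly P x * (real k * s ^ (k - 1) * (2 * x)) / (s ^ k)\<^sup>2 * exp (- 1 / s)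
        + poly P x / s ^ k * (exp (- 1 / s) * (- 2 * x / s\<^sup>2)) =
        bump (bump_num P k) (k + 2) x"
    proof -
      have "real k * s ^ (k - 1) / (s ^ k)\<^sup>2 = real k / (s ^ k * s)"
        using s by (cases k) (simp_all add: power2_eq_square field_simps)
      moreover have "poly P x * (real k * s ^ (k - 1) * (2 * x)) / (s ^ k)\<^sup>2
          = poly P x * (2 * x) * (real k * s ^ (k - 1) / (s ^ k)\<^sup>2)"
        by (simp add: mult_ac)
      ultimately have "poly P x * (real k * s ^ (k - 1) * (2 * x)) / (s ^ k)\<^sup>2 = poly P x * (2 * x) * (real k / (s ^ k * s))"
        by simp
      moreover have "p' / a * E + p * (2 * x) * (real k / (a * s)) * E + p / a * (E * (- 2 * x / s\<^sup>2)) =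
          (p' * s\<^sup>2 + 2 * real k * x * p * s - 2 * x * p) / (a * s\<^sup>2) * E"
        if "a \<noteq> 0" for a p p' E
        using s that by (simp add: field_simps power2_eq_square)
      moreover have "s ^ k \<noteq> 0" using s by simp
      ultimately show ?thesis
        using 1 by (simp only: bump_def poly_bump_num if_True power_add s_def[symmetric])
    qed
    finally show ?thesis
    proof (rule has_field_derivative_transform_within_open)
      show "open {-1<..<1::real}" by simp
    qed (use 1 in \<open>auto simp: bump_def\<close>)
  next
    case 2
    have "((\<lambda>_. 0) has_real_derivative 0) (at x)" by simp
    then have "(bump P k has_real_derivative 0) (at x)"
    proof (rule has_field_derivative_transform_within_open)
      show "open (- {-1..1::real})" by (intro open_Compl closed_atLeastAtMost)
    qed (use 2 in \<open>auto simp: bump_def\<close>)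
    then show ?thesis using 2 by (simp add: bump_def)
  next
    case 3
    have "compact (poly P ` {-1..1})"
      by (intro compact_continuous_image continuous_intros) simp
    then obtain M where M: "\<And>y. y \<in> {-1..1} \<Longrightarrow> \<bar>poly P y\<bar> \<le> M"
      by (metis (no_types, lifting) bounded_iff compact_imp_bounded imageI real_norm_def)
    have M0: "M \<ge> 0" using M[of 0] by simp
    have "\<bar>bump P k y\<bar> \<le> (M * fact (k + 2) * 4) * (y - x)\<^sup>2" for y
    proof (cases "\<bar>y\<bar> < 1")
      case True
      define s where "s = 1 - y\<^sup>2"
      have s: "s > 0" using True by (simp add: s_def abs_square_less_1)
      have "s \<le> 2 * \<bar>y - x\<bar>"
      proof -
        have eq: "s = (1 - y) * (1 + y)" by (simp add: s_def power2_eq_square algebra_simps)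
        consider "x = 1" | "x = -1" using 3 by linarith
        then show ?thesis
        proof cases
          case 1
          have "(1 - y) * (1 + y) \<le> (1 - y) * 2" using True by (intro mult_left_mono) auto
          then show ?thesis using True 1 by (simp add: eq)
        next
          case 2
          have "(1 - y) * (1 + y) \<le> 2 * (1 + y)" using True by (intro mult_right_mono) auto
          then show ?thesis using True 2 by (simp add: eq)
        qed
      qed
      then have s2: "s\<^sup>2 \<le> 4 * (y - x)\<^sup>2"
        using s power_mono[of s "2 * \<bar>y - x\<bar>" 2] by (simp add: power_mult_distrib)
      have My: "\<bar>poly P y\<bar> \<le> M" using True by (intro M) auto
      have "\<bar>bump P k y\<bar> = \<bar>poly P y\<bar> / s ^ k * exp (- 1 / s)"
        using True s by (simp add: bump_def abs_mult flip: s_def)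
      also have "\<dots> \<le> M / s ^ k * (fact (k + 2) * s ^ (k + 2))"
        using My s exp_minus_inverse_le[OF s, of "k + 2"] M0
        by (intro mult_mono divide_right_mono) auto
      also have "\<dots> = M * fact (k + 2) * s\<^sup>2" using s by (simp add: power_add power2_eq_square)
      also have "\<dots> \<le> M * fact (k + 2) * (4 * (y - x)\<^sup>2)"
        using s2 M0 by (intro mult_left_mono) auto
      finally show ?thesis by (simp add: mult.assoc)
    qed (use M0 in \<open>auto simp: bump_def\<close>)
    moreover have "bump P k x = 0" using 3 by (simp add: bump_def)
    ultimately have "(bump P k has_real_derivative 0) (at x)" by (rule DERIV_zero_of_quadratic_bound)
    then show ?thesis using 3 by (simp add: bump_def[of "bump_num P k"])
  qed
qed

lemma smooth_bump: "smooth (bump P k)"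
proof -
  define S where "S = rec_nat (P, k) (\<lambda>_ (Q, j). (bump_num Q j, j + 2))"
  have S: "S 0 = (P, k)" "S (Suc n) = (bump_num (fst (S n)) (snd (S n)), snd (S n) + 2)" for n
    by (simp_all add: S_def split_beta)
  show ?thesis unfolding smooth_def
    by (rule exI[of _ "\<lambda>n. bump (fst (S n)) (snd (S n))"]) (use S bump_deriv in \<open>simp del: add_2_eq_Suc'\<close>)
qed

lemma antiderivative_on_reals:
  fixes f :: "real \<Rightarrow> real"
  assumes "continuous_on UNIV f"
  obtains F where "\<And>x. (F has_real_derivative f x) (at x)" "F a = 0"
proof -
  define F where "F x = (LBINT y=a..x. f y)" for x :: real
  have "(F has_real_derivative f x) (at x)" for x
  proof -
    define l where "l = min a x - 1"
    define u where "u = max a x + 1"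
    have "(F has_vector_derivative f x) (at x within {l..u})" unfolding F_def
      by (rule interval_integral_FTC2)
         (auto simp: l_def u_def intro: continuous_on_subset[OF assms])
    then show ?thesis
      by (subst (asm) at_within_interior)
         (auto simp: l_def u_def has_real_derivative_iff_has_vector_derivative)
  qed
  moreover have "F a = 0" by (simp add: F_def)
  ultimately show ?thesis by (rule that)
qed

text \<open>A smoothed positive part. Combinations of its translates and dilates that kill affine functions are test
  functions whose second derivatives concentrate at chosen points.\<close>

lemma smooth_positive_part:
  obtains \<Phi> G \<rho> :: "real \<Rightarrow> real" and c e where
    "smooth \<Phi>" "\<And>x. (\<Phi> has_real_derivative G x) (at x)"
    "\<And>x. (G has_real_derivative \<rho> x) (at x)" "continuous_on UNIV \<rho>"
    "\<And>x. 0 \<le> \<rho> x" "\<And>x. \<bar>x\<bar> \<ge> 1 \<Longrightarrow> \<rho> x = 0" "c > 0"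
    "\<And>x. x \<le> -1 \<Longrightarrow> G x = 0" "\<And>x. x \<ge> 1 \<Longrightarrow> G x = c"
    "\<And>x. x \<le> -1 \<Longrightarrow> \<Phi> x = 0" "\<And>x. x \<ge> 1 \<Longrightarrow> \<Phi> x = c * x + e"
proof -
  define \<rho> where "\<rho> = bump 1 0"
  have sm: "smooth \<rho>" unfolding \<rho>_def by (rule smooth_bump)
  have cont: "continuous_on UNIV \<rho>"
    using bump_deriv[of 1 0] unfolding \<rho>_def
    by (meson DERIV_continuous continuous_at_imp_continuous_on)
  have pos: "0 \<le> \<rho> x" and zero: "\<bar>x\<bar> \<ge> 1 \<Longrightarrow> \<rho> x = 0" and pos1: "\<bar>x\<bar> < 1 \<Longrightarrow> \<rho> x > 0" for x
    by (auto simp: \<rho>_def bump_def)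
  obtain G where G: "\<And>x. (G has_real_derivative \<rho> x) (at x)" "G (-1) = 0"
    using antiderivative_on_reals[OF cont, of "-1"] by blast
  have contG: "continuous_on UNIV G"
    using G(1) by (meson DERIV_continuous continuous_at_imp_continuous_on)
  obtain \<Phi> where \<Phi>: "\<And>x. (\<Phi> has_real_derivative G x) (at x)" "\<Phi> (-1) = 0"
    using antiderivative_on_reals[OF contG, of "-1"] by blast
  have smG: "smooth G" and sm\<Phi>: "smooth \<Phi>"
    using smooth_antideriv sm G(1) \<Phi>(1) by blast+
  have const: "F x = F y" if "\<And>z. z \<in> {x..y} \<Longrightarrow> (F has_real_derivative 0) (at z)" "x \<le> y"
    for F :: "real \<Rightarrow> real" and x y
    using has_field_derivative_zero_constant[of "{x..y}" F] that
    by (metis atLeastAtMost_iff convex_real_interval(5) has_field_derivative_at_within order_refl)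
  have G0: "G x = 0" if "x \<le> -1" for x
  proof -
    have "G x = G (-1)"
    proof (rule const[of x "-1" G])
      fix z assume "z \<in> {x..-1}"
      then show "(G has_real_derivative 0) (at z)" using G(1)[of z] zero[of z] by auto
    qed (use that in auto)
    then show ?thesis using G(2) by simp
  qed
  define c where "c = G 1"
  have G1: "G x = c" if "x \<ge> 1" for x
  proof -
    have "G 1 = G x"
    proof (rule const[of 1 x G])
      fix z assume "z \<in> {1..x}"
      then show "(G has_real_derivative 0) (at z)" using G(1)[of z] zero[of z] by auto
    qed (use that in auto)
    then show ?thesis by (simp add: c_def)
  qed
  have "\<Phi> x = 0" if "x \<le> -1" for x
  proof -
    have "\<Phi> x = \<Phi> (-1)"
    proof (rule const[of x "-1" \<Phi>])
      fix z assume "z \<in> {x..-1}"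
      then show "(\<Phi> has_real_derivative 0) (at z)" using \<Phi>(1)[of z] G0[of z] by auto
    qed (use that in auto)
    then show ?thesis using \<Phi>(2) by simp
  qed
  moreover have "\<Phi> x = c * x + (\<Phi> 1 - c)" if "x \<ge> 1" for x
  proof -
    have "\<Phi> 1 - c * 1 = \<Phi> x - c * x"
    proof (rule const[of 1 x "\<lambda>x. \<Phi> x - c * x"])
      fix z assume "z \<in> {1..x}"
      then show "((\<lambda>x. \<Phi> x - c * x) has_real_derivative 0) (at z)"
        using G1[of z] by (auto intro!: derivative_eq_intros \<Phi>(1))
    qed (use that in auto)
    then show ?thesis by (simp add: algebra_simps)
  qed
  moreover have "c > 0"
  proof -
    have "G (-1) < G 1"
    proof (rule DERIV_pos_imp_increasing_open[of "-1" 1 G])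
      show "\<exists>y. (G has_real_derivative y) (at x) \<and> 0 < y" if "-1 < x" "x < 1" for x
        using G(1)[of x] pos1[of x] that by auto
    qed (use contG continuous_on_subset in auto)
    then show ?thesis by (simp add: G(2) c_def)
  qed
  ultimately show thesis
    by (intro that[of \<Phi> G \<rho> c "\<Phi> 1 - c"] sm\<Phi> cont pos zero \<Phi>(1) G(1) G0 G1)
qed

lemma mollifier_tendsto:
  fixes d :: "real \<Rightarrow> complex"
  assumes d: "continuous_on {0..1} d" and x0: "0 < x0" "x0 < 1"
    and G: "\<And>x. (G has_real_derivative \<rho> x) (at x)" and \<rho>: "continuous_on UNIV \<rho>"
    "\<And>x. 0 \<le> \<rho> x" "\<And>x. \<bar>x\<bar> \<ge> 1 \<Longrightarrow> \<rho> x = 0"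
    and Glim: "\<And>x. x \<le> -1 \<Longrightarrow> G x = 0" "\<And>x. x \<ge> 1 \<Longrightarrow> G x = c"
  shows "((\<lambda>\<epsilon>. integral {0..1} (\<lambda>x. d x * complex_of_real (\<rho> ((x - x0) / \<epsilon>) / \<epsilon>)))
            \<longlongrightarrow> complex_of_real c * d x0) (at_right 0)"
proof -
  have c0: "c \<ge> 0"
  proof -
    have "G (-1) \<le> G 1"
      by (rule DERIV_nonneg_imp_nondecreasing[of "-1" 1]) (use G \<rho>(2) in auto)
    then show ?thesis using Glim by simp
  qed
  show ?thesis
  proof (rule tendstoI)
    fix r :: real assume r: "r > 0"
    define \<eta> where "\<eta> = r / (c + 1) / 2"
    have \<eta>: "\<eta> > 0" "\<eta> * c < r"
      using r c0 by (simp_all add: \<eta>_def field_simps add_nonneg_pos)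
    have "\<exists>\<delta>>0. \<forall>x\<in>{0..1}. dist x x0 < \<delta> \<longrightarrow> dist (d x) (d x0) < \<eta>"
      using d x0 \<eta>(1) unfolding continuous_on_iff by auto
    then obtain \<delta> where \<delta>: "\<delta> > 0" "\<And>x. x \<in> {0..1} \<Longrightarrow> \<bar>x - x0\<bar> < \<delta> \<Longrightarrow> cmod (d x - d x0) < \<eta>"
      by (auto simp: dist_norm)
    define b where "b = min \<delta> (min x0 (1 - x0))"
    have b: "b > 0" using \<delta> x0 by (simp add: b_def)
    have "dist (integral {0..1} (\<lambda>x. d x * complex_of_real (\<rho> ((x - x0) / \<epsilon>) / \<epsilon>))) (complex_of_real c * d x0) < r"
      if \<epsilon>: "0 < \<epsilon>" "\<epsilon> < b" for \<epsilon>
    proof -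
      define k where "k x = \<rho> ((x - x0) / \<epsilon>) / \<epsilon>" for x
      have kc: "continuous_on S k" for S
        unfolding k_def
        by (intro continuous_intros continuous_on_compose2[OF \<rho>(1)]) (use \<epsilon> in auto)
      have "((\<lambda>x. G ((x - x0) / \<epsilon>)) has_real_derivative k x) (at x)" for x
      proof -
        have "((\<lambda>x. (x - x0) / \<epsilon>) has_real_derivative 1 / \<epsilon>) (at x)"
          by (rule DERIV_cdivide) (auto intro!: derivative_eq_intros)
        from DERIV_chain2[OF G this] show ?thesis by (simp add: k_def)
      qed
      then have "(k has_integral (G ((1 - x0) / \<epsilon>) - G ((0 - x0) / \<epsilon>))) {0..1}"
        by (intro fundamental_theorem_of_calculus)
           (auto simp: has_real_derivative_iff_has_vector_derivative intro: has_vector_derivative_at_within)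
      moreover have "G ((1 - x0) / \<epsilon>) = c" "G ((0 - x0) / \<epsilon>) = 0"
        using \<epsilon> by (auto intro!: Glim simp: b_def divide_simps)
      ultimately have k: "(k has_integral c) {0..1}" by simp
      have k2: "((\<lambda>x. d x0 * complex_of_real (k x)) has_integral d x0 * complex_of_real c) {0..1}"
        by (intro has_integral_mult_right has_integral_of_real k)
      have ki: "integral {0..1} (\<lambda>x. complex_of_real (k x)) = complex_of_real c"
        by (intro integral_unique has_integral_of_real k)
      have int1: "(\<lambda>x. d x * complex_of_real (k x)) integrable_on {0..1}"
        by (intro integrable_continuous_real continuous_intros d kc)
      have "norm (integral {0..1} (\<lambda>x. d x * complex_of_real (k x) - d x0 * complex_of_real (k x)))
          \<le> integral {0..1} (\<lambda>x. \<eta> * k x)"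
      proof (rule integral_norm_bound_integral)
        show "(\<lambda>x. d x * complex_of_real (k x) - d x0 * complex_of_real (k x)) integrable_on {0..1}"
          using int1 k2 by (intro integrable_diff) auto
        show "(\<lambda>x. \<eta> * k x) integrable_on {0..1}"
          by (intro integrable_continuous_real continuous_intros kc)
        fix x :: real assume x: "x \<in> {0..1}"
        have k0: "k x \<ge> 0" using \<rho>(2) \<epsilon> by (simp add: k_def)
        have "cmod (d x - d x0) * k x \<le> \<eta> * k x"
        proof (cases "\<bar>x - x0\<bar> < \<epsilon>")
          case True
          then show ?thesis using \<delta>(2)[OF x] \<epsilon> k0 by (intro mult_right_mono) (auto simp: b_def)
        next
          case False
          then have "k x = 0" using \<epsilon> \<rho>(3)[of "(x - x0) / \<epsilon>"] by (simp add: k_def abs_divide)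
          then show ?thesis by simp
        qed
        moreover have "d x * complex_of_real (k x) - d x0 * complex_of_real (k x) = (d x - d x0) * complex_of_real (k x)"
          by (simp add: algebra_simps)
        ultimately show "norm (d x * complex_of_real (k x) - d x0 * complex_of_real (k x)) \<le> \<eta> * k x"
          using k0 by (simp add: norm_mult)
      qed
      also have "\<dots> = \<eta> * c" using k by (simp add: integral_unique)
      finally have "norm (integral {0..1} (\<lambda>x. d x * complex_of_real (k x)) - d x0 * complex_of_real c) \<le> \<eta> * c"
        using int1 k2 ki
        by (subst (asm) integral_diff) (auto simp: has_integral_integrable)
      then show ?thesis using \<eta>(2) by (simp add: dist_norm k_def mult.commute)
    qed
    then show "\<forall>\<^sub>F \<epsilon> in at_right 0. dist (integral {0..1} (\<lambda>x. d x * complex_of_real (\<rho> ((x - x0) / \<epsilon>) / \<epsilon>))) (complex_of_real c * d x0) < r"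
      using b by (auto simp: eventually_at_right_field)
  qed
qed

text \<open>It suffices that \<open>c0 * d t + c1 * d a + c2 * d b = 0\<close> for any three interior points and weights for which
  affine functions satisfy this relation. With the smoothed positive part \<open>\<Phi>\<close>, the function
  \<open>c0 * \<Phi> ((x - t) / \<epsilon>) + c1 * \<Phi> ((x - a) / \<epsilon>) + c2 * \<Phi> ((x - b) / \<epsilon>)\<close> has compact support, since its
  affine parts cancel to the right of all three points, and testing \<open>d\<close> against its second derivative
  gives the relation in the limit \<open>\<epsilon> \<rightarrow> 0\<close>.\<close>

lemma du_bois_reymond:
  fixes d :: "real \<Rightarrow> complex"
  assumes d: "continuous_on {0..1} d"
    and zero: "\<And>\<phi>. test_fun \<phi> \<Longrightarrow> (LINT x:{0..1}|lborel. d x * complex_of_real ((deriv ^^ 2) \<phi> x)) = 0"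
  shows "\<exists>A B. \<forall>x\<in>{0..1}. d x = A + complex_of_real x * B"
proof -
  obtain \<Phi> G \<rho> :: "real \<Rightarrow> real" and c e where
    sm: "smooth \<Phi>" and \<Phi>G: "\<And>x. (\<Phi> has_real_derivative G x) (at x)" and
    G\<rho>: "\<And>x. (G has_real_derivative \<rho> x) (at x)" and \<rho>: "continuous_on UNIV \<rho>"
    "\<And>x. 0 \<le> \<rho> x" "\<And>x. \<bar>x\<bar> \<ge> 1 \<Longrightarrow> \<rho> x = 0" and c: "c > 0" and
    Glim: "\<And>x. x \<le> -1 \<Longrightarrow> G x = 0" "\<And>x. x \<ge> 1 \<Longrightarrow> G x = c" and
    \<Phi>lim: "\<And>x. x \<le> -1 \<Longrightarrow> \<Phi> x = 0" "\<And>x. x \<ge> 1 \<Longrightarrow> \<Phi> x = c * x + e"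
    by (rule smooth_positive_part) (rule that)
  have three: "complex_of_real c0 * d t + complex_of_real c1 * d a + complex_of_real c2 * d b = 0"
    if pts: "t \<in> {0<..<1}" "a \<in> {0<..<1}" "b \<in> {0<..<1}" and
      c012: "c0 + c1 + c2 = 0" "c0 * t + c1 * a + c2 * b = 0" for c0 c1 c2 t a b :: real
  proof -
    define m where "m = min t (min a b)"
    define M where "M = max t (max a b)"
    have mM: "0 < m" "M < 1" "m \<le> t" "m \<le> a" "m \<le> b" "t \<le> M" "a \<le> M" "b \<le> M"
      using pts by (auto simp: m_def M_def)
    define I where "I x0 \<epsilon> = integral {0..1} (\<lambda>x. d x * complex_of_real (\<rho> ((x - x0) / \<epsilon>) / \<epsilon>))" for x0 \<epsilon>
    have lim: "(I x0 \<longlongrightarrow> complex_of_real c * d x0) (at_right 0)" if "x0 \<in> {0<..<1}" for x0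
      unfolding I_def using that by (intro mollifier_tendsto[OF d _ _ G\<rho> \<rho> Glim]) auto
    have eq0: "complex_of_real c0 * I t \<epsilon> + complex_of_real c1 * I a \<epsilon> + complex_of_real c2 * I b \<epsilon> = 0"
      if \<epsilon>: "0 < \<epsilon>" "\<epsilon> < min m (1 - M)" for \<epsilon>
    proof -
      define \<phi> where "\<phi> x = c0 * \<Phi> ((x - t) / \<epsilon>) + c1 * \<Phi> ((x - a) / \<epsilon>) + c2 * \<Phi> ((x - b) / \<epsilon>)" for x
      have sm\<phi>: "smooth \<phi>" unfolding \<phi>_def by (intro smooth_add smooth_cmult smooth_affine sm)
      have scaled: "((\<lambda>x. F ((x - x0) / \<epsilon>)) has_real_derivative F' ((x - x0) / \<epsilon>) / \<epsilon>) (at x)"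
        if "\<And>x. (F has_real_derivative F' x) (at x)" for F F' x0 x
      proof -
        have "((\<lambda>x. (x - x0) / \<epsilon>) has_real_derivative 1 / \<epsilon>) (at x)"
          by (rule DERIV_cdivide) (auto intro!: derivative_eq_intros)
        from DERIV_chain2[OF that this] show ?thesis by simp
      qed
      have "deriv \<phi> = (\<lambda>x. c0 * (G ((x - t) / \<epsilon>) / \<epsilon>) + c1 * (G ((x - a) / \<epsilon>) / \<epsilon>) + c2 * (G ((x - b) / \<epsilon>) / \<epsilon>))"
        unfolding \<phi>_def by (intro ext DERIV_imp_deriv DERIV_add DERIV_cmult scaled[OF \<Phi>G])
      moreover have "deriv (\<lambda>x. c0 * (G ((x - t) / \<epsilon>) / \<epsilon>) + c1 * (G ((x - a) / \<epsilon>) / \<epsilon>) + c2 * (G ((x - b) / \<epsilon>) / \<epsilon>))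
        = (\<lambda>x. c0 * (\<rho> ((x - t) / \<epsilon>) / \<epsilon> / \<epsilon>) + c1 * (\<rho> ((x - a) / \<epsilon>) / \<epsilon> / \<epsilon>) + c2 * (\<rho> ((x - b) / \<epsilon>) / \<epsilon> / \<epsilon>))"
        by (intro ext DERIV_imp_deriv DERIV_add DERIV_cmult DERIV_cdivide scaled[OF G\<rho>])
      ultimately have d2: "(deriv ^^ 2) \<phi> = (\<lambda>x. c0 * (\<rho> ((x - t) / \<epsilon>) / \<epsilon> / \<epsilon>) + c1 * (\<rho> ((x - a) / \<epsilon>) / \<epsilon> / \<epsilon>) + c2 * (\<rho> ((x - b) / \<epsilon>) / \<epsilon> / \<epsilon>))"
        by (simp add: numeral_2_eq_2)
      have "\<phi> x = 0" if "x \<notin> {m - \<epsilon>..M + \<epsilon>}" for x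
      proof (cases "x < m - \<epsilon>")
        case True
        then have "(x - x0) / \<epsilon> \<le> -1" if "m \<le> x0" for x0 using \<epsilon> that by (simp add: field_simps)
        then show ?thesis using \<Phi>lim(1) mM by (simp add: \<phi>_def)
      next
        case False
        then have "x > M + \<epsilon>" using that by auto
        then have "(x - x0) / \<epsilon> \<ge> 1" if "x0 \<le> M" for x0 using \<epsilon> that by (simp add: field_simps)
        then have "\<phi> x = c0 * (c * ((x - t) / \<epsilon>) + e) + c1 * (c * ((x - a) / \<epsilon>) + e) + c2 * (c * ((x - b) / \<epsilon>) + e)"
          using \<Phi>lim(2) mM by (simp add: \<phi>_def)
        also have "\<dots> = (c0 + c1 + c2) * (c * x / \<epsilon> + e) - (c0 * t + c1 * a + c2 * b) * c / \<epsilon>"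
          by (simp add: algebra_simps diff_divide_distrib add_divide_distrib)
        finally show ?thesis using c012 by simp
      qed
      then have "{x. \<phi> x \<noteq> 0} \<subseteq> {m - \<epsilon>..M + \<epsilon>}" by blast
      then have "closure {x. \<phi> x \<noteq> 0} \<subseteq> {m - \<epsilon>..M + \<epsilon>}" by (rule closure_minimal) simp
      then have "test_fun \<phi>" unfolding test_fun_def using sm\<phi> \<epsilon> by (auto simp: smooth_iff)
      from zero[OF this] have "(LINT x:{0..1}|lborel. d x * complex_of_real ((deriv ^^ 2) \<phi> x)) = 0" .
      moreover have kc: "continuous_on {0..1} (\<lambda>x. d x * complex_of_real (\<rho> ((x - x0) / \<epsilon>) / \<epsilon>))" for x0
        by (intro continuous_intros d continuous_on_compose2[OF \<rho>(1)]) (use \<epsilon> in auto)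
      have cont2: "continuous_on {0..1} (\<lambda>x. d x * complex_of_real ((deriv ^^ 2) \<phi> x))"
        unfolding d2
        by (intro continuous_intros d continuous_on_compose2[OF \<rho>(1)]) (use \<epsilon> in auto)
      ultimately have "integral {0..1} (\<lambda>x. d x * complex_of_real ((deriv ^^ 2) \<phi> x)) = 0"
        using set_borel_integral_eq_integral(2)[OF borel_integrable_atLeastAtMost', OF cont2] by simp
      moreover have "(\<lambda>x. d x * complex_of_real ((deriv ^^ 2) \<phi> x)) =
         (\<lambda>x. (complex_of_real c0 * (d x * complex_of_real (\<rho> ((x - t) / \<epsilon>) / \<epsilon>)) +
          complex_of_real c1 * (d x * complex_of_real (\<rho> ((x - a) / \<epsilon>) / \<epsilon>)) +
          complex_of_real c2 * (d x * complex_of_real (\<rho> ((x - b) / \<epsilon>) / \<epsilon>))) * complex_of_real (1 / \<epsilon>))"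
        unfolding d2 by (intro ext) (simp add: algebra_simps)
      ultimately have "(complex_of_real c0 * I t \<epsilon> + complex_of_real c1 * I a \<epsilon> + complex_of_real c2 * I b \<epsilon>) * complex_of_real (1 / \<epsilon>) = 0"
        unfolding I_def using kc
        by (simp only: integral_mult_left integral_add integrable_add integral_mult_right
             integrable_continuous_real integrable_on_cmult_left)
      then show ?thesis using \<epsilon> by simp
    qed
    have "((\<lambda>\<epsilon>. complex_of_real c0 * I t \<epsilon> + complex_of_real c1 * I a \<epsilon> + complex_of_real c2 * I b \<epsilon>)
        \<longlongrightarrow> complex_of_real c0 * (complex_of_real c * d t) + complex_of_real c1 * (complex_of_real c * d a) + complex_of_real c2 * (complex_of_real c * d b)) (at_right 0)"
      by (intro tendsto_intros lim pts)
    moreover have "((\<lambda>\<epsilon>. complex_of_real c0 * I t \<epsilon> + complex_of_real c1 * I a \<epsilon> + complex_of_real c2 * I b \<epsilon>)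
        \<longlongrightarrow> 0) (at_right 0)"
    proof (rule tendsto_eventually)
      have "min m (1 - M) > 0" using mM by simp
      then show "\<forall>\<^sub>F \<epsilon> in at_right 0. complex_of_real c0 * I t \<epsilon> + complex_of_real c1 * I a \<epsilon> + complex_of_real c2 * I b \<epsilon> = 0"
        using eq0 by (auto simp only: eventually_at_right_field)
    qed
    ultimately have "complex_of_real c0 * (complex_of_real c * d t) + complex_of_real c1 * (complex_of_real c * d a) + complex_of_real c2 * (complex_of_real c * d b) = 0"
      by (rule tendsto_unique[rotated]) simp
    then have "complex_of_real c * (complex_of_real c0 * d t + complex_of_real c1 * d a + complex_of_real c2 * d b) = 0"
      by (simp add: algebra_simps)
    then show ?thesis using c by simp
  qed
  define a b :: real where "a = 1/3" and "b = 2/3"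
  define B where "B = 3 * (d b - d a)"
  define A where "A = 2 * d a - d b"
  have inner: "d t = A + complex_of_real t * B" if "t \<in> {0<..<1}" for t
  proof -
    have "complex_of_real (b - a) * d t + complex_of_real (t - b) * d a + complex_of_real (a - t) * d b = 0"
      by (rule three) (use that in \<open>auto simp: a_def b_def field_simps\<close>)
    then have "d t / 3 + (complex_of_real t - 2/3) * d a + (1/3 - complex_of_real t) * d b = 0"
      by (simp add: a_def b_def)
    moreover have "d t + (3 * complex_of_real t - 2) * d a + (1 - 3 * complex_of_real t) * d b =
      3 * (d t / 3 + (complex_of_real t - 2/3) * d a + (1/3 - complex_of_real t) * d b)"
      by (simp add: algebra_simps)
    ultimately have "d t + (3 * complex_of_real t - 2) * d a + (1 - 3 * complex_of_real t) * d b = 0"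
      by simp
    then show ?thesis by (simp add: A_def B_def algebra_simps)
  qed
  have "d x - (A + complex_of_real x * B) = 0" if "x \<in> {0..1}" for x
  proof (rule continuous_constant_on_closure[of "{0<..<1}" "\<lambda>x. d x - (A + complex_of_real x * B)"])
    show "continuous_on (closure {0<..<1}) (\<lambda>x. d x - (A + complex_of_real x * B))"
      by (simp, intro continuous_intros d)
  qed (use inner that in auto)
  then show ?thesis by (intro exI[of _ A] exI[of _ B]) auto
qed

section \<open>Indefinite integrals on the unit interval\<close>

text \<open>On the unit interval, \<open>u\<close> is absolutely continuous with derivative \<open>v\<close>.\<close>

definition prim :: "(real \<Rightarrow> complex) \<Rightarrow> (real \<Rightarrow> complex) \<Rightarrow> bool" where
  "prim u v \<longleftrightarrow> set_integrable lborel {0..1} v \<and>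
     (\<forall>x\<in>{0..1}. u x = u 0 + (LINT t:{0..x}|lborel. v t))"

lemma prim_integrable: "prim u v \<Longrightarrow> set_integrable lborel {0..1} v"
  by (simp add: prim_def)

lemma prim_eq: "prim u v \<Longrightarrow> x \<in> {0..1} \<Longrightarrow> u x = u 0 + (LINT t:{0..x}|lborel. v t)"
  unfolding prim_def by blast

lemma primI:
  "set_integrable lborel {0..1} v \<Longrightarrow> (\<And>x. x \<in> {0..1} \<Longrightarrow> u x = u 0 + (LINT t:{0..x}|lborel. v t)) \<Longrightarrow> prim u v"
  unfolding prim_def by blast

lemma set_integrable_sub:
  assumes "set_integrable lborel {0..1} (v :: real \<Rightarrow> complex)" "0 \<le> a" "b \<le> 1"
  shows "set_integrable lborel {a..b} v"
  by (rule set_integrable_subset[OF assms(1)]) (use assms in auto)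

lemma LINT_split:
  fixes v :: "real \<Rightarrow> complex"
  assumes v: "set_integrable lborel {0..1} v" and "0 \<le> a" "a \<le> b" "b \<le> c" "c \<le> 1"
  shows "(LINT t:{a..c}|lborel. v t) = (LINT t:{a..b}|lborel. v t) + (LINT t:{b..c}|lborel. v t)"
proof -
  have i: "set_integrable lborel {a..c} v" "set_integrable lborel {a..b} v" "set_integrable lborel {b..c} v"
    using assms by (auto intro!: set_integrable_sub)
  then show ?thesis
    using assms Henstock_Kurzweil_Integration.integral_combine[of a b c v]
    by (simp add: set_borel_integral_eq_integral)
qed

lemma prim_diff:
  assumes "prim u v" "0 \<le> a" "a \<le> b" "b \<le> 1"
  shows "u b - u a = (LINT t:{a..b}|lborel. v t)"
proof -
  have "u a = u 0 + (LINT t:{0..a}|lborel. v t)" "u b = u 0 + (LINT t:{0..b}|lborel. v t)"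
    by (rule prim_eq[OF assms(1)]; use assms in simp)+
  moreover have "(LINT t:{0..b}|lborel. v t) = (LINT t:{0..a}|lborel. v t) + (LINT t:{a..b}|lborel. v t)"
    by (rule LINT_split[OF prim_integrable[OF assms(1)]]) (use assms in auto)
  ultimately show ?thesis by (simp add: algebra_simps)
qed

lemma prim_continuous: assumes "prim u v" shows "continuous_on {0..1} u"
proof -
  have vi: "v integrable_on {0..1}"
    using prim_integrable[OF assms] by (rule set_borel_integral_eq_integral(1))
  have eq: "u 0 + integral {0..x} v = u x" if "x \<in> {0..1}" for x
  proof -
    have "set_integrable lborel {0..x} v"
      by (rule set_integrable_sub[OF prim_integrable[OF assms]]) (use that in auto)
    from set_borel_integral_eq_integral(2)[OF this] prim_eq[OF assms that] show ?thesis by argo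
  qed
  have "continuous_on {0..1} (\<lambda>x. u 0 + integral {0..x} v)"
    by (intro continuous_intros indefinite_integral_continuous_1 vi)
  then show ?thesis by (rule continuous_on_eq) (rule eq)
qed

lemma prim_C1:
  assumes "\<And>x. x \<in> {0..1} \<Longrightarrow> (u has_vector_derivative v x) (at x within {0..1})"
    and v: "continuous_on {0..1} v"
  shows "prim u v"
proof -
  have vi: "set_integrable lborel {0..1} v" using borel_integrable_atLeastAtMost'[OF v] .
  have "u x = u 0 + (LINT t:{0..x}|lborel. v t)" if x: "x \<in> {0..1}" for x
  proof -
    have "(v has_integral u x - u 0) {0..x}"
      using x by (intro fundamental_theorem_of_calculus)
        (auto intro!: has_vector_derivative_within_subset[OF assms(1)])
    then have "integral {0..x} v = u x - u 0" by (rule integral_unique)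
    then show ?thesis
      using set_borel_integral_eq_integral(2)[OF set_integrable_sub[OF vi], of 0 x] x
      by simp
  qed
  with vi show ?thesis by (rule primI)
qed

lemma prim_cong_left: "prim u v \<Longrightarrow> (\<And>x. x \<in> {0..1} \<Longrightarrow> u x = u' x) \<Longrightarrow> prim u' v"
  unfolding prim_def by (metis atLeastAtMost_iff order_refl zero_le_one)

lemma prim_cong:
  assumes "prim u v" "\<And>x. x \<in> {0..1} \<Longrightarrow> u x = u' x" "\<And>x. x \<in> {0..1} \<Longrightarrow> v x = v' x"
  shows "prim u' v'"
proof -
  have "set_integrable lborel {0..1} v' \<longleftrightarrow> set_integrable lborel {0..1} v"
    unfolding set_integrable_def using assms(3)
    by (intro Bochner_Integration.integrable_cong) (auto simp: indicator_def)
  then have vi: "set_integrable lborel {0..1} v'" using prim_integrable[OF assms(1)] by simp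
  have "u' x = u' 0 + (LINT t:{0..x}|lborel. v' t)" if "x \<in> {0..1}" for x
  proof -
    have "u 0 = u' 0" by (rule assms(2)) simp
    moreover have "u x = u' x" by (rule assms(2)) (rule that)
    moreover have "(LINT t:{0..x}|lborel. v t) = (LINT t:{0..x}|lborel. v' t)"
      using that assms(3) by (intro set_lebesgue_integral_cong) auto
    ultimately show ?thesis using prim_eq[OF assms(1) that] by argo
  qed
  with vi show ?thesis by (rule primI)
qed

lemma prim_add: "prim u v \<Longrightarrow> prim u' v' \<Longrightarrow> prim (\<lambda>x. u x + u' x) (\<lambda>x. v x + v' x)"
proof (rule primI)
  assume p: "prim u v" "prim u' v'"
  note i = p[THEN prim_integrable]
  show "set_integrable lborel {0..1} (\<lambda>x. v x + v' x)" by (intro set_integral_add(1) i)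
  fix x :: real assume x: "x \<in> {0..1}"
  have "(LINT t:{0..x}|lborel. v t + v' t) = (LINT t:{0..x}|lborel. v t) + (LINT t:{0..x}|lborel. v' t)"
    using x by (intro set_integral_add(2) set_integrable_sub[OF i(1)] set_integrable_sub[OF i(2)]) auto
  then show "u x + u' x = u 0 + u' 0 + (LINT t:{0..x}|lborel. v t + v' t)"
    using prim_eq[OF p(1) x] prim_eq[OF p(2) x] by (simp add: algebra_simps)
qed

lemma prim_zero: "prim (\<lambda>x. c) (\<lambda>x. 0)"
  unfolding prim_def by (simp add: set_integrable_def set_lebesgue_integral_def)

lemma prim_sum: "(\<And>i. i \<in> J \<Longrightarrow> prim (u i) (v i)) \<Longrightarrow> prim (\<lambda>x. \<Sum>i\<in>J. u i x) (\<lambda>x. \<Sum>i\<in>J. v i x)"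
  by (induction J rule: infinite_finite_induct) (auto intro: prim_add prim_zero)

lemma prim_cmult: "prim u v \<Longrightarrow> prim (\<lambda>x. c * u x) (\<lambda>x. c * v x)"
proof (rule primI)
  assume p: "prim u v"
  show "set_integrable lborel {0..1} (\<lambda>x. c * v x)" using prim_integrable[OF p] by simp
  fix x :: real assume x: "x \<in> {0..1}"
  show "c * u x = c * u 0 + (LINT t:{0..x}|lborel. c * v t)"
    using prim_eq[OF p x] by (simp add: distrib_left)
qed

lemma prim_integral:
  assumes "set_integrable lborel {0..1} v"
  shows "prim (\<lambda>x. c + (LINT t:{0..x}|lborel. v t)) v"
proof (rule primI[OF assms])
  have "(LINT t:{0..0}|lborel. v t) = 0"
    using set_borel_integral_eq_integral(2)[OF set_integrable_sub[OF assms], of 0 0] by simp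
  then show "c + (LINT t:{0..x}|lborel. v t) = c + (LINT t:{0..0}|lborel. v t) + (LINT t:{0..x}|lborel. v t)" for x
    by simp
qed

lemma integrable_product:
  fixes f g :: "real \<Rightarrow> complex"
  assumes f: "integrable lborel f" and g: "integrable lborel g"
  shows "integrable (lborel \<Otimes>\<^sub>M lborel) (\<lambda>(x, y). f x * g y)"
proof (rule lborel_pair.Fubini_integrable)
  have [measurable]: "f \<in> borel_measurable borel" "g \<in> borel_measurable borel"
    using f g by auto
  show "(\<lambda>(x, y). f x * g y) \<in> borel_measurable (lborel \<Otimes>\<^sub>M lborel)" by measurable
  show "integrable lborel (\<lambda>x. \<integral>y. norm (case (x, y) of (x, y) \<Rightarrow> f x * g y) \<partial>lborel)"
    using f g by (simp add: norm_mult)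
  show "AE x in lborel. integrable lborel (\<lambda>y. case (x, y) of (x, y) \<Rightarrow> f x * g y)"
    using g by simp
qed

text \<open>Fubini over the triangle \<open>s \<le> t\<close>; needed for the product rule.\<close>

lemma LINT_triangle:
  fixes v w :: "real \<Rightarrow> complex"
  assumes v: "set_integrable lborel {0..1} v" and w: "set_integrable lborel {0..1} w" and x: "x \<in> {0..1}"
  shows "(LINT t:{0..x}|lborel. w t * (LINT s:{0..t}|lborel. v s))
       = (LINT s:{0..x}|lborel. v s * (LINT t:{s..x}|lborel. w t))"
proof -
  define V where "V s = indicator {0..x} s *\<^sub>R v s" for s
  define W where "W t = indicator {0..x} t *\<^sub>R w t" for t
  have V: "integrable lborel V" and W: "integrable lborel W"
    using set_integrable_sub[OF v, of 0 x] set_integrable_sub[OF w, of 0 x] x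
    by (auto simp: V_def[abs_def] W_def[abs_def] set_integrable_def)
  have [measurable]: "V \<in> borel_measurable borel" "W \<in> borel_measurable borel" using V W by auto
  define F where "F t s = (if s \<le> t then W t * V s else 0)" for t s
  have "integrable (lborel \<Otimes>\<^sub>M lborel) (case_prod F)"
  proof (rule Bochner_Integration.integrable_bound[OF integrable_product[OF W V]])
    show "case_prod F \<in> borel_measurable (lborel \<Otimes>\<^sub>M lborel)"
      unfolding F_def by measurable
    show "AE z in lborel \<Otimes>\<^sub>M lborel. norm (case_prod F z) \<le> norm (case z of (x, y) \<Rightarrow> W x * V y)"
      by (auto simp: F_def)
  qed
  from lborel_pair.Fubini_integral[OF this]
  have "(LINT s|lborel. LINT t|lborel. F t s) = (LINT t|lborel. LINT s|lborel. F t s)" .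
  moreover have "(LINT s|lborel. F t s) = indicator {0..x} t *\<^sub>R (w t * (LINT s:{0..t}|lborel. v s))" for t
  proof (cases "t \<in> {0..x}")
    case True
    have "(LINT s|lborel. F t s) = (LINT s:{0..t}|lborel. w t * v s)"
      unfolding set_lebesgue_integral_def using True by (intro Bochner_Integration.integral_cong) (auto simp: F_def V_def W_def indicator_def)
    then show ?thesis using True by simp
  next
    case False
    then show ?thesis by (simp add: F_def W_def cong: if_cong)
  qed
  moreover have "(LINT t|lborel. F t s) = indicator {0..x} s *\<^sub>R (v s * (LINT t:{s..x}|lborel. w t))" for s
  proof (cases "s \<in> {0..x}")
    case True
    have "(LINT t|lborel. F t s) = (LINT t:{s..x}|lborel. v s * w t)"
      unfolding set_lebesgue_integral_def using True by (intro Bochner_Integration.integral_cong) (auto simp: F_def V_def W_def indicator_def)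
    then show ?thesis using True by simp
  next
    case False
    then show ?thesis by (simp add: F_def V_def cong: if_cong)
  qed
  ultimately show ?thesis by (simp add: set_lebesgue_integral_def)
qed

lemma set_integrable_continuous_mult:
  fixes v w :: "real \<Rightarrow> complex"
  assumes "continuous_on {0..1} w" "set_integrable lborel {0..1} v"
  shows "set_integrable lborel {0..1} (\<lambda>x. w x * v x)"
proof -
  obtain M where M: "\<And>x. x \<in> {0..1} \<Longrightarrow> norm (w x) \<le> M"
    using compact_imp_bounded[OF compact_continuous_image[OF assms(1) compact_Icc]]
    unfolding bounded_iff by blast
  have M0: "M \<ge> 0" using M[of 0] norm_ge_zero[of "w 0"] by (simp del: norm_ge_zero)
  have vi: "integrable lborel (\<lambda>x. indicator {0..1} x *\<^sub>R v x)" using assms(2) by (simp add: set_integrable_def)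
  have [measurable]: "(\<lambda>x. indicator {0..1} x *\<^sub>R v x) \<in> borel_measurable lborel" using vi by auto
  have [measurable]: "(\<lambda>x. indicator {0..1} x *\<^sub>R w x) \<in> borel_measurable lborel"
    using borel_integrable_atLeastAtMost'[OF assms(1)] by (simp add: set_integrable_def)
  have eq: "(\<lambda>x. indicator {0..1} x *\<^sub>R (w x * v x)) =
     (\<lambda>x. (indicator {0..1} x *\<^sub>R w x) * (indicator {0..1} x *\<^sub>R v x))"
    by (auto simp: indicator_def)
  have "integrable lborel (\<lambda>x. indicator {0..1} x *\<^sub>R (w x * v x))"
  proof (rule Bochner_Integration.integrable_bound)
    show "integrable lborel (\<lambda>x. M *\<^sub>R norm (indicator {0..1} x *\<^sub>R v x))"
      by (intro integrable_scaleR_right integrable_norm vi)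
    show "(\<lambda>x. indicator {0..1} x *\<^sub>R (w x * v x)) \<in> borel_measurable lborel"
      unfolding eq by measurable
    show "AE x in lborel. norm (indicator {0..1} x *\<^sub>R (w x * v x)) \<le> norm (M *\<^sub>R norm (indicator {0..1} x *\<^sub>R v x))"
      using M M0 by (intro AE_I2) (auto simp: indicator_def norm_mult intro!: mult_right_mono)
  qed
  then show ?thesis by (simp add: set_integrable_def)
qed

text \<open>Writing \<open>u\<close> as an integral turns the integral of \<open>w' u\<close> into one over a triangle; in the other order of
  integration the inner integral is a difference of values of \<open>w\<close>.\<close>

lemma prim_mult:
  assumes u: "prim u u'" and w: "prim w w'"
  shows "prim (\<lambda>x. w x * u x) (\<lambda>x. w' x * u x + w x * u' x)"
proof -
  have ui: "set_integrable lborel {0..1} u'" and wi: "set_integrable lborel {0..1} w'"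
    using u w by (auto dest: prim_integrable)
  have i1: "set_integrable lborel {0..1} (\<lambda>x. w' x * u x)"
    using set_integrable_continuous_mult[OF prim_continuous[OF u] wi] by (simp add: mult.commute)
  have i2: "set_integrable lborel {0..1} (\<lambda>x. w x * u' x)"
    by (rule set_integrable_continuous_mult[OF prim_continuous[OF w] ui])
  have "w x * u x = w 0 * u 0 + (LINT t:{0..x}|lborel. w' t * u t + w t * u' t)" if x: "x \<in> {0..1}" for x
  proof -
    define U where "U t = (LINT s:{0..t}|lborel. u' s)" for t
    have sub: "set_integrable lborel {0..x} f" if "set_integrable lborel {0..1} f" for f :: "real \<Rightarrow> complex"
      using set_integrable_sub[OF that] x by simp
    have ueq: "u t = u 0 + U t" if "t \<in> {0..x}" for t
      using prim_eq[OF u, of t] that x by (simp add: U_def)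
    have cU: "continuous_on {0..1} U"
    proof -
      have "continuous_on {0..1} (\<lambda>t. u t - u 0)" by (intro continuous_intros prim_continuous[OF u])
      then show ?thesis
      proof (rule continuous_on_eq)
        show "u t - u 0 = U t" if "t \<in> {0..1}" for t
          using prim_eq[OF u that] by (simp add: U_def)
      qed
    qed
    have iU: "set_integrable lborel {0..1} (\<lambda>t. w' t * U t)"
      using set_integrable_continuous_mult[OF cU wi] by (simp add: mult.commute)
    have "(LINT t:{0..x}|lborel. w' t * u t) = (LINT t:{0..x}|lborel. u 0 * w' t + w' t * U t)"
    proof (intro set_lebesgue_integral_cong allI impI)
      show "w' t * u t = u 0 * w' t + w' t * U t" if "t \<in> {0..x}" for t
        unfolding ueq[OF that] by (simp add: algebra_simps)
    qed simp
    also have "\<dots> = u 0 * (LINT t:{0..x}|lborel. w' t) + (LINT t:{0..x}|lborel. w' t * U t)"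
      by (subst set_integral_add(2)) (auto intro!: sub wi iU)
    also have "(LINT t:{0..x}|lborel. w' t) = w x - w 0" using prim_eq[OF w x] by simp
    also have "(LINT t:{0..x}|lborel. w' t * U t) = (LINT s:{0..x}|lborel. u' s * (LINT t:{s..x}|lborel. w' t))"
      unfolding U_def by (rule LINT_triangle[OF ui wi x])
    also have "\<dots> = (LINT s:{0..x}|lborel. w x * u' s - w s * u' s)"
      using x by (intro set_lebesgue_integral_cong) (auto simp: algebra_simps simp flip: prim_diff[OF w])
    also have "\<dots> = w x * (LINT s:{0..x}|lborel. u' s) - (LINT s:{0..x}|lborel. w s * u' s)"
      by (subst set_integral_diff(2)) (auto intro!: sub ui i2)
    also have "(LINT s:{0..x}|lborel. u' s) = u x - u 0" using prim_eq[OF u x] by simp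
    finally have "(LINT t:{0..x}|lborel. w' t * u t) = u 0 * (w x - w 0) + (w x * (u x - u 0) - (LINT s:{0..x}|lborel. w s * u' s))" .
    moreover have "(LINT t:{0..x}|lborel. w' t * u t + w t * u' t)
        = (LINT t:{0..x}|lborel. w' t * u t) + (LINT t:{0..x}|lborel. w t * u' t)"
      by (rule set_integral_add(2)) (auto intro!: sub i1 i2)
    ultimately show ?thesis by (simp add: algebra_simps)
  qed
  then show ?thesis using i1 i2 by (intro primI set_integral_add(1))
qed

text \<open>Extending the derivative by constants passes from derivatives within the interval to two-sided ones.\<close>

lemma C1_extension:
  fixes g g' :: "real \<Rightarrow> real"
  assumes g: "\<And>x. x \<in> {0..1} \<Longrightarrow> (g has_real_derivative g' x) (at x within {0..1})"
    and g': "continuous_on {0..1} g'"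
  obtains G where "\<And>x. x \<in> {0..1} \<Longrightarrow> (G has_real_derivative g' x) (at x)"
    "\<And>x. x \<in> {0..1} \<Longrightarrow> G x = g x"
proof -
  define e where "e x = g' (max 0 (min 1 x))" for x
  have "continuous_on UNIV e" unfolding e_def
    by (rule continuous_on_compose2[OF g']) (auto intro!: continuous_intros)
  then obtain F where F: "\<And>x. (F has_real_derivative e x) (at x)" using antiderivative_on_reals by blast
  have e: "e x = g' x" if "x \<in> {0..1}" for x using that by (simp add: e_def)
  have "\<exists>c. \<forall>x\<in>{0..1}. g x - F x = c"
  proof (rule has_field_derivative_zero_constant)
    fix x :: real assume x: "x \<in> {0..1}"
    have "((\<lambda>x. g x - F x) has_real_derivative g' x - e x) (at x within {0..1})"
      by (intro DERIV_diff g x has_field_derivative_at_within[OF F])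
    then show "((\<lambda>x. g x - F x) has_real_derivative 0) (at x within {0..1})" using e[OF x] by simp
  qed simp
  then obtain c where c: "\<And>x. x \<in> {0..1} \<Longrightarrow> g x - F x = c" by blast
  show ?thesis
  proof (rule that[of "\<lambda>x. F x + c"])
    fix x :: real assume x: "x \<in> {0..1}"
    show "((\<lambda>x. F x + c) has_real_derivative g' x) (at x)"
      using F[of x] e[OF x] by (auto intro!: derivative_eq_intros)
    show "F x + c = g x" using c[OF x] by simp
  qed
qed

lemma LINT_substitution:
  fixes y y' :: "real \<Rightarrow> real" and v :: "real \<Rightarrow> complex"
  assumes y: "\<And>x. x \<in> {0..1} \<Longrightarrow> (y has_real_derivative y' x) (at x within {0..1})"
    and y': "continuous_on {0..1} y'" "\<And>x. x \<in> {0..1} \<Longrightarrow> y' x \<ge> 0"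
    and ab: "0 \<le> a" "a \<le> b" "b \<le> 1"
    and v: "set_integrable lborel {y a..y b} v"
  shows "set_integrable lborel {a..b} (\<lambda>t. v (y t) * complex_of_real (y' t))"
    and "(LINT s:{y a..y b}|lborel. v s) = (LINT t:{a..b}|lborel. v (y t) * complex_of_real (y' t))"
proof -
  obtain G where G: "\<And>x. x \<in> {0..1} \<Longrightarrow> (G has_real_derivative y' x) (at x)"
    "\<And>x. x \<in> {0..1} \<Longrightarrow> G x = y x"
    by (rule C1_extension[OF y y'(1)]) (auto intro: that)
  have Gab: "G a = y a" "G b = y b" using ab G(2) by auto
  have sub: "{a..b} \<subseteq> {0..1}" using ab by auto
  have real: "set_integrable lborel {a..b} (\<lambda>t. r (y t) * y' t) \<and>
      (LINT s:{y a..y b}|lborel. r s) = (LINT t:{a..b}|lborel. r (y t) * y' t)"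
    if r: "set_integrable lborel {y a..y b} r" for r :: "real \<Rightarrow> real"
  proof -
    have *: "set_integrable lborel {G a..G b} r" using r Gab by simp
    have 1: "set_integrable lborel {a..b} (\<lambda>t. r (G t) * y' t)"
      by (rule integral_substitution(1)[where g = G and a = a and b = b and f = r and g' = y', OF *]) (use G sub y' ab in \<open>auto intro: continuous_on_subset\<close>)
    have 2: "(LBINT s. r s * indicator {G a..G b} s) = (LBINT t. r (G t) * y' t * indicator {a..b} t)"
      by (rule integral_substitution(2)[where g = G and a = a and b = b and f = r and g' = y', OF *]) (use G sub y' ab in \<open>auto intro: continuous_on_subset\<close>)
    have "set_integrable lborel {a..b} (\<lambda>t. r (y t) * y' t)"
      using 1 by (rule set_integrable_cong[THEN iffD1, rotated -1]) (use G(2) sub in auto)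
    moreover have "(LINT t:{a..b}|lborel. r (G t) * y' t) = (LINT t:{a..b}|lborel. r (y t) * y' t)"
      using G(2) sub by (intro set_lebesgue_integral_cong) auto
    ultimately show ?thesis using 2 Gab by (simp add: set_lebesgue_integral_def mult.commute)
  qed
  have ReIm: "set_integrable lborel {y a..y b} (\<lambda>s. Re (v s))" "set_integrable lborel {y a..y b} (\<lambda>s. Im (v s))"
    using v unfolding set_integrable_def by (auto dest: integrable_Re integrable_Im)
  have R: "set_integrable lborel {a..b} (\<lambda>t. complex_of_real (Re (v (y t)) * y' t))"
    using real[OF ReIm(1)] unfolding set_integrable_def
    by (drule_tac conjunct1, drule_tac integrable_of_real[where 'a = complex]) (simp add: scaleR_conv_of_real)
  have I: "set_integrable lborel {a..b} (\<lambda>t. complex_of_real (Im (v (y t)) * y' t))"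
    using real[OF ReIm(2)] unfolding set_integrable_def
    by (drule_tac conjunct1, drule_tac integrable_of_real[where 'a = complex]) (simp add: scaleR_conv_of_real)
  have eq: "v (y t) * complex_of_real (y' t) = complex_of_real (Re (v (y t)) * y' t) + \<i> * complex_of_real (Im (v (y t)) * y' t)" for t
    by (subst complex_eq[of "v (y t)"]) (simp add: algebra_simps)
  show int: "set_integrable lborel {a..b} (\<lambda>t. v (y t) * complex_of_real (y' t))"
    unfolding eq using R I by (intro set_integral_add(1)) auto
  have re_im: "Re (LINT t:A|lborel. f t) = (LINT t:A|lborel. Re (f t))"
    "Im (LINT t:A|lborel. f t) = (LINT t:A|lborel. Im (f t))"
    if "set_integrable lborel A f" for A and f :: "real \<Rightarrow> complex"
    using that unfolding set_integrable_def set_lebesgue_integral_def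
    by (auto simp: integral_Re[symmetric] integral_Im[symmetric])
  show "(LINT s:{y a..y b}|lborel. v s) = (LINT t:{a..b}|lborel. v (y t) * complex_of_real (y' t))"
    using real[OF ReIm(1)] real[OF ReIm(2)] by (intro complex_eqI) (simp_all add: re_im[OF v] re_im[OF int])
qed

lemma prim_comp:
  fixes y y' :: "real \<Rightarrow> real"
  assumes u: "prim u u'"
    and y: "\<And>x. x \<in> {0..1} \<Longrightarrow> (y has_real_derivative y' x) (at x within {0..1})"
    and y': "continuous_on {0..1} y'" "\<And>x. x \<in> {0..1} \<Longrightarrow> y' x \<ge> 0"
    and range: "\<And>x. x \<in> {0..1} \<Longrightarrow> y x \<in> {0..1}"
  shows "prim (\<lambda>x. u (y x)) (\<lambda>x. u' (y x) * complex_of_real (y' x))"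
proof -
  have mono: "y a \<le> y b" if "0 \<le> a" "a \<le> b" "b \<le> 1" for a b
  proof -
    obtain G where G: "\<And>x. x \<in> {0..1} \<Longrightarrow> (G has_real_derivative y' x) (at x)"
      "\<And>x. x \<in> {0..1} \<Longrightarrow> G x = y x"
      by (rule C1_extension[OF y y'(1)]) (auto intro: that)
    have "G a \<le> G b"
    proof (rule DERIV_nonneg_imp_nondecreasing[OF that(2)])
      fix x assume "a \<le> x" "x \<le> b"
      then show "\<exists>d. (G has_real_derivative d) (at x) \<and> 0 \<le> d"
        using G(1)[of x] y'(2)[of x] that by (intro exI[of _ "y' x"]) auto
    qed
    then show ?thesis using G(2) that by simp
  qed
  have sub: "set_integrable lborel {y 0..y x} u'" if "x \<in> {0..1}" for x
    using set_integrable_sub[OF prim_integrable[OF u]] range[OF that] range[of 0] by simp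
  have "u (y x) = u (y 0) + (LINT t:{0..x}|lborel. u' (y t) * complex_of_real (y' t))" if x: "x \<in> {0..1}" for x
    using prim_diff[OF u, of "y 0" "y x"] range[OF x] range[of 0] mono[of 0 x] x
      LINT_substitution(2)[OF y y', of 0 x u'] sub[OF x]
    by (simp add: algebra_simps)
  moreover have "set_integrable lborel {0..1} (\<lambda>x. u' (y x) * complex_of_real (y' x))"
    by (rule LINT_substitution(1)[OF y y', of 0 1 u']) (use sub[of 1] in auto)
  ultimately show ?thesis by (intro primI)
qed

section \<open>The Sobolev space\<close>

text \<open>The rays generate the Borel sets, so the integral vanishes over every Borel set.\<close>

lemma AE_zero_of_zero_integrals:
  fixes w :: "real \<Rightarrow> complex"
  assumes w: "set_integrable lborel {0..1} w"
    and zero: "\<And>x. x \<in> {0..1} \<Longrightarrow> (LINT t:{0..x}|lborel. w t) = 0"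
  shows "AE x in lborel. x \<in> {0..1} \<longrightarrow> w x = 0"
proof -
  define u where "u x = indicator {0..1} x *\<^sub>R w x" for x
  have u: "integrable lborel u" using w by (simp add: u_def[abs_def] set_integrable_def)
  have us: "set_integrable lborel A u" if "A \<in> sets borel" for A
    unfolding set_integrable_def using that u by (intro integrable_mult_indicator) auto
  have "AE x in lborel. u x = 0"
  proof (rule sigma_finite_measure.density_zero[OF sigma_finite_lborel u])
    fix A :: "real set" assume "A \<in> sets lborel"
    then have A: "A \<in> sigma_sets UNIV (range (\<lambda>a. {..a}))"
      by (simp add: borel_eq_atMost)
    have stable: "Int_stable (range (\<lambda>a::real. {..a}))"
    proof (rule Int_stableI)
      show "a \<inter> b \<in> range atMost" if "a \<in> range atMost" "b \<in> range atMost" for a b :: "real set"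
        using that by (auto simp: Int_atMost)
    qed
    show "(LINT x:A|lborel. u x) = 0"
    proof (rule sigma_sets_induct_disjoint[OF stable _ A])
      fix B :: "real set" assume "B \<in> range (\<lambda>a. {..a})"
      then obtain a where B: "B = {..a}" by auto
      have "(LINT x:B|lborel. u x) = (if a < 0 then 0 else (LINT t:{0..min 1 a}|lborel. w t))"
      proof (cases "a < 0")
        case True
        then have "(\<lambda>x. indicator B x *\<^sub>R u x) = (\<lambda>x. 0)" by (auto simp: u_def B indicator_def)
        then show ?thesis using True by (simp add: set_lebesgue_integral_def)
      next
        case False
        then have "(\<lambda>x. indicator B x *\<^sub>R u x) = (\<lambda>x. indicator {0..min 1 a} x *\<^sub>R w x)"
          by (auto simp: u_def B indicator_def)
        then show ?thesis using False by (simp add: set_lebesgue_integral_def)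
      qed
      then show "(LINT x:B|lborel. u x) = 0" using zero[of "min 1 a"] by auto
    next
      show "(LINT x:{}|lborel. u x) = 0" by (simp add: set_lebesgue_integral_def)
    next
      fix B :: "real set" assume B: "B \<in> sigma_sets UNIV (range (\<lambda>a. {..a}))" "(LINT x:B|lborel. u x) = 0"
      have Bb: "B \<in> sets borel" using B(1) by (simp add: borel_eq_atMost)
      have "(LINT x:(B \<union> (UNIV - B))|lborel. u x) = (LINT x:B|lborel. u x) + (LINT x:(UNIV - B)|lborel. u x)"
        using Bb by (intro set_integral_Un us) auto
      moreover have "B \<union> (UNIV - B) = UNIV" by auto
      moreover have "(LINT x:UNIV|lborel. u x) = 0"
        using zero[of 1] by (simp add: set_lebesgue_integral_def u_def)
      ultimately show "(LINT x:(UNIV - B)|lborel. u x) = 0" using B(2) by simp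
    next
      fix F :: "nat \<Rightarrow> real set"
      assume F: "disjoint_family F" "range F \<subseteq> sigma_sets UNIV (range (\<lambda>a. {..a}))"
        "\<And>i. (LINT x:F i|lborel. u x) = 0"
      have Fb: "F i \<in> sets borel" for i using F(2) by (auto simp: borel_eq_atMost)
      have "(LINT x:(\<Union>i. F i)|lborel. u x) = (\<Sum>i. (LINT x:(F i)|lborel. u x))"
        using F(1) Fb
        by (intro lebesgue_integral_countable_add us) (auto simp: disjoint_family_on_def)
      then show "(LINT x:(\<Union>i. F i)|lborel. u x) = 0" using F(3) by simp
    qed simp
  qed
  then show ?thesis by eventually_elim (auto simp: u_def)
qed

lemma prim_unique_AE:
  assumes "prim u v" "prim u' v'" "\<And>x. x \<in> {0..1} \<Longrightarrow> u x = u' x"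
  shows "AE x in lborel. x \<in> {0..1} \<longrightarrow> v x = v' x"
proof -
  have p: "prim (\<lambda>x. u x + (-1) * u' x) (\<lambda>x. v x + (-1) * v' x)"
    using assms by (intro prim_add prim_cmult)
  have "AE x in lborel. x \<in> {0..1} \<longrightarrow> v x + (-1) * v' x = 0"
  proof (rule AE_zero_of_zero_integrals[OF prim_integrable[OF p]])
    fix x :: real assume x: "x \<in> {0..1}"
    then have "u x = u' x" "u 0 = u' 0" using assms(3) by auto
    then show "(LINT t:{0..x}|lborel. v t + (-1) * v' t) = 0"
      using prim_eq[OF p x] by simp
  qed
  then show ?thesis by eventually_elim auto
qed

lemma prim_has_vector_derivative:
  assumes u: "prim u v" and v: "continuous_on {0..1} v" and x: "x \<in> {0..1}"
  shows "(u has_vector_derivative v x) (at x within {0..1})"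
proof -
  have "((\<lambda>t. integral {0..t} v) has_vector_derivative v x) (at x within {0..1})"
    by (rule integral_has_vector_derivative[OF v x])
  then have "((\<lambda>t. u 0 + integral {0..t} v) has_vector_derivative v x) (at x within {0..1})"
    by (auto intro!: derivative_eq_intros)
  then show ?thesis
  proof (rule has_vector_derivative_transform[OF x, rotated])
    fix t :: real assume t: "t \<in> {0..1}"
    have "set_integrable lborel {0..t} v"
      by (rule set_integrable_sub[OF prim_integrable[OF u]]) (use t in auto)
    from set_borel_integral_eq_integral(2)[OF this] prim_eq[OF u t]
    show "u t = u 0 + integral {0..t} v" by argo
  qed
qed

lemma prim_unique:
  assumes "prim u v" "prim u' v'" "continuous_on {0..1} v" "continuous_on {0..1} v'"
    and eq: "\<And>x. x \<in> {0..1} \<Longrightarrow> u x = u' x" and x: "x \<in> {0..1}"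
  shows "v x = v' x"
proof -
  have "(u has_vector_derivative v x) (at x within {0..1})"
    by (rule prim_has_vector_derivative[OF assms(1,3) x])
  moreover have "(u has_vector_derivative v' x) (at x within {0..1})"
    by (rule has_vector_derivative_transform[OF x eq prim_has_vector_derivative[OF assms(2,4) x]])
  ultimately show ?thesis
    using vector_derivative_unique_within_closed_interval[of 0 1 x u] x by simp
qed

lemma test_fun_deriv:
  assumes "test_fun \<phi>"
  shows "(\<phi> has_real_derivative deriv \<phi> x) (at x)" "test_fun (deriv \<phi>)" "\<phi> 0 = 0" "\<phi> 1 = 0"
    "continuous_on UNIV \<phi>"
proof -
  have sm: "(deriv ^^ n) \<phi> field_differentiable at x" for n x using assms by (simp add: test_fun_def)
  have supp: "closure {x. \<phi> x \<noteq> 0} \<subseteq> {0<..<1}" using assms by (simp add: test_fun_def)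
  show d: "(\<phi> has_real_derivative deriv \<phi> x) (at x)" for x
    using sm[of 0 x] by (simp add: DERIV_deriv_iff_field_differentiable)
  show "continuous_on UNIV \<phi>" using d by (meson DERIV_continuous continuous_at_imp_continuous_on)
  show "\<phi> 0 = 0" "\<phi> 1 = 0" using supp closure_subset[of "{x. \<phi> x \<noteq> 0}"] by auto
  have "{x. deriv \<phi> x \<noteq> 0} \<subseteq> closure {x. \<phi> x \<noteq> 0}"
  proof (rule ccontr)
    assume "\<not> ?thesis"
    then obtain x where x: "deriv \<phi> x \<noteq> 0" "x \<notin> closure {x. \<phi> x \<noteq> 0}" by auto
    have "((\<lambda>_. 0) has_real_derivative 0) (at x)" by simp
    then have "(\<phi> has_real_derivative 0) (at x)"
    proof (rule has_field_derivative_transform_within_open)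
      show "open (- closure {x. \<phi> x \<noteq> 0})" by auto
      show "x \<in> - closure {x. \<phi> x \<noteq> 0}" using x by simp
      show "0 = \<phi> y" if "y \<in> - closure {x. \<phi> x \<noteq> 0}" for y
        using that closure_subset[of "{x. \<phi> x \<noteq> 0}"] by auto
    qed
    then show False using x(1) DERIV_imp_deriv by blast
  qed
  then have "closure {x. deriv \<phi> x \<noteq> 0} \<subseteq> {0<..<1}" using supp closure_minimal[of _ "closure {x. \<phi> x \<noteq> 0}"] by blast
  moreover have "(deriv ^^ n) (deriv \<phi>) field_differentiable at x" for n x
    using sm[of "Suc n" x] by (simp add: funpow_swap1)
  ultimately show "test_fun (deriv \<phi>)" by (simp add: test_fun_def)
qed

lemma prim_test_fun:
  assumes "test_fun \<phi>"
  shows "prim (\<lambda>x. complex_of_real (\<phi> x)) (\<lambda>x. complex_of_real (deriv \<phi> x))"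
proof (rule prim_C1)
  note t = test_fun_deriv[OF assms] test_fun_deriv(5)[OF test_fun_deriv(2)[OF assms]]
  show "((\<lambda>x. complex_of_real (\<phi> x)) has_vector_derivative complex_of_real (deriv \<phi> x)) (at x within {0..1})" for x
    by (rule has_vector_derivative_of_real) (rule has_field_derivative_at_within[OF t(1)])
  show "continuous_on {0..1} (\<lambda>x. complex_of_real (deriv \<phi> x))"
    by (intro continuous_on_of_real continuous_on_subset[OF t(6)]) simp
qed

lemma integration_by_parts_test_fun:
  assumes u: "prim u v" and \<phi>: "test_fun \<phi>"
  shows "(LINT x:{0..1}|lborel. u x * complex_of_real (deriv \<phi> x))
       = - (LINT x:{0..1}|lborel. v x * complex_of_real (\<phi> x))"
proof -
  have p: "prim (\<lambda>x. u x * complex_of_real (\<phi> x)) (\<lambda>x. v x * complex_of_real (\<phi> x) + u x * complex_of_real (deriv \<phi> x))"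
    by (rule prim_mult[OF prim_test_fun[OF \<phi>] u])
  have "(LINT x:{0..1}|lborel. v x * complex_of_real (\<phi> x) + u x * complex_of_real (deriv \<phi> x)) = 0"
    using prim_eq[OF p, of 1] test_fun_deriv(3,4)[OF \<phi>] by simp
  moreover have "set_integrable lborel {0..1} (\<lambda>x. v x * complex_of_real (\<phi> x))"
    using set_integrable_continuous_mult[OF prim_continuous[OF prim_test_fun[OF \<phi>]] prim_integrable[OF u]]
    by (simp add: mult.commute)
  moreover have "set_integrable lborel {0..1} (\<lambda>x. u x * complex_of_real (deriv \<phi> x))"
    using set_integrable_continuous_mult[OF prim_continuous[OF u] prim_integrable[OF prim_test_fun[OF \<phi>]]] .
  ultimately show ?thesis by (simp add: set_integral_add(2) eq_neg_iff_add_eq_0 add.commute)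
qed

text \<open>Functions with an absolutely continuous derivative. This is the working form of the Sobolev space: \<open>W21_iff\<close>
  identifies it with the space given by weak derivatives.\<close>

definition W2 :: "(real \<Rightarrow> complex) \<Rightarrow> (real \<Rightarrow> complex) \<Rightarrow> (real \<Rightarrow> complex) \<Rightarrow> bool" where
  "W2 h g v \<longleftrightarrow> prim h g \<and> prim g v"

lemma W2_weak_deriv_2: "W2 h g v \<Longrightarrow> weak_deriv 2 h v"
  unfolding weak_deriv_def W2_def
  using integration_by_parts_test_fun test_fun_deriv(2) prim_integrable
  by (auto simp: numeral_2_eq_2)

lemma W2_weak_deriv_1: "W2 h g v \<Longrightarrow> weak_deriv 1 h g"
  unfolding weak_deriv_def W2_def
  using integration_by_parts_test_fun prim_integrable by auto

lemma W2_weak_deriv_0: "W2 h g v \<Longrightarrow> weak_deriv 0 h h"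
  unfolding weak_deriv_def W2_def
  by (auto intro: borel_integrable_atLeastAtMost' prim_continuous)

text \<open>Integrating \<open>v\<close> twice gives a function with the same second weak derivative as \<open>h\<close>, and the difference of
  the two is affine by \<open>du_bois_reymond\<close>.\<close>

lemma weak_deriv_2_imp_W2:
  assumes h: "continuous_on {0..1} h" and w: "weak_deriv 2 h v"
  shows "\<exists>g. W2 h g v"
proof -
  have v: "set_integrable lborel {0..1} v" using w by (simp add: weak_deriv_def)
  define g0 where "g0 x = 0 + (LINT t:{0..x}|lborel. v t)" for x
  have g0: "prim g0 v" unfolding g0_def by (rule prim_integral[OF v])
  have g0i: "set_integrable lborel {0..1} g0"
    by (intro borel_integrable_atLeastAtMost' prim_continuous[OF g0])
  define h0 where "h0 x = 0 + (LINT t:{0..x}|lborel. g0 t)" for x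
  have h0: "prim h0 g0" unfolding h0_def by (rule prim_integral[OF g0i])
  have ch0: "continuous_on {0..1} h0" by (rule prim_continuous[OF h0])
  have "\<exists>A B. \<forall>x\<in>{0..1}. h x - h0 x = A + complex_of_real x * B"
  proof (rule du_bois_reymond)
    show "continuous_on {0..1} (\<lambda>x. h x - h0 x)" by (intro continuous_intros h ch0)
    fix \<phi> assume \<phi>: "test_fun \<phi>"
    have "continuous_on UNIV ((deriv ^^ 2) \<phi>)"
      using test_fun_deriv(2)[OF test_fun_deriv(2)[OF \<phi>]] test_fun_deriv(5) by (simp add: numeral_2_eq_2)
    then have c2: "continuous_on {0..1} (\<lambda>x. complex_of_real ((deriv ^^ 2) \<phi> x))"
      by (intro continuous_on_of_real) (rule continuous_on_subset, auto)
    have "weak_deriv 2 h0 v" by (rule W2_weak_deriv_2[of _ g0]) (simp add: W2_def h0 g0)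
    then have "(LINT x:{0..1}|lborel. h x * complex_of_real ((deriv ^^ 2) \<phi> x)) =
      (LINT x:{0..1}|lborel. h0 x * complex_of_real ((deriv ^^ 2) \<phi> x))"
      using w \<phi> by (simp add: weak_deriv_def)
    moreover have "(LINT x:{0..1}|lborel. (h x - h0 x) * complex_of_real ((deriv ^^ 2) \<phi> x))
      = (LINT x:{0..1}|lborel. h x * complex_of_real ((deriv ^^ 2) \<phi> x)) -
      (LINT x:{0..1}|lborel. h0 x * complex_of_real ((deriv ^^ 2) \<phi> x))"
      unfolding left_diff_distrib
      by (intro set_integral_diff(2) borel_integrable_atLeastAtMost' continuous_intros h ch0 c2)
    ultimately show "(LINT x:{0..1}|lborel. (h x - h0 x) * complex_of_real ((deriv ^^ 2) \<phi> x)) = 0" by simp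
  qed
  then obtain A B where AB: "\<And>x. x \<in> {0..1} \<Longrightarrow> h x - h0 x = A + complex_of_real x * B" by blast
  have affine: "prim (\<lambda>x. A + complex_of_real x * B) (\<lambda>_. B)"
    by (rule prim_C1) (auto intro!: derivative_eq_intros)
  have "prim (\<lambda>x. h0 x + (A + complex_of_real x * B)) (\<lambda>x. g0 x + B)" by (intro prim_add h0 affine)
  then have "prim h (\<lambda>x. g0 x + B)" by (rule prim_cong_left) (use AB in \<open>auto simp: algebra_simps\<close>)
  moreover have "prim (\<lambda>x. g0 x + B) (\<lambda>x. v x + 0)" by (intro prim_add g0 prim_zero)
  ultimately show ?thesis by (auto simp: W2_def)
qed

text \<open>The second primitive of \<open>w\<close> has second weak derivative \<open>0\<close>, hence is affine.\<close>

lemma AE_zero_of_weak_zero: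
  assumes w: "set_integrable lborel {0..1} w"
    and zero: "\<And>\<phi>. test_fun \<phi> \<Longrightarrow> (LINT x:{0..1}|lborel. w x * complex_of_real (\<phi> x)) = 0"
  shows "AE x in lborel. x \<in> {0..1} \<longrightarrow> w x = 0"
proof -
  define g0 where "g0 x = 0 + (LINT t:{0..x}|lborel. w t)" for x
  have g0: "prim g0 w" unfolding g0_def by (rule prim_integral[OF w])
  have g0i: "set_integrable lborel {0..1} g0"
    by (intro borel_integrable_atLeastAtMost' prim_continuous[OF g0])
  define h0 where "h0 x = 0 + (LINT t:{0..x}|lborel. g0 t)" for x
  have h0: "prim h0 g0" unfolding h0_def by (rule prim_integral[OF g0i])
  have "weak_deriv 2 h0 w" by (rule W2_weak_deriv_2[of _ g0]) (simp add: W2_def h0 g0)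
  then have "weak_deriv 2 h0 (\<lambda>_. 0)"
    using zero by (simp add: weak_deriv_def set_integrable_def set_lebesgue_integral_def)
  then obtain g where g: "prim h0 g" "prim g (\<lambda>_. 0)"
    using weak_deriv_2_imp_W2[OF prim_continuous[OF h0]] by (auto simp: W2_def)
  have "g0 x = g x" if "x \<in> {0..1}" for x
    by (rule prim_unique[OF h0 g(1) prim_continuous[OF g0] prim_continuous[OF g(2)] _ that]) simp
  then show ?thesis by (rule prim_unique_AE[OF g0 g(2)])
qed

lemma W21_iff: "h \<in> W21 \<longleftrightarrow> (\<forall>x. x \<notin> {0..1} \<longrightarrow> h x = 0) \<and> (\<exists>g v. W2 h g v)"
proof
  assume h: "h \<in> W21"
  then obtain v where v: "weak_deriv 2 h v" by (auto simp: W21_def)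
  have "continuous_on {0..1} h" using h by (simp add: W21_def)
  from weak_deriv_2_imp_W2[OF this v] obtain g where "W2 h g v" by blast
  then show "(\<forall>x. x \<notin> {0..1} \<longrightarrow> h x = 0) \<and> (\<exists>g v. W2 h g v)" using h by (auto simp: W21_def)
next
  assume h: "(\<forall>x. x \<notin> {0..1} \<longrightarrow> h x = 0) \<and> (\<exists>g v. W2 h g v)"
  then obtain g v where W: "W2 h g v" by blast
  have "\<exists>v. weak_deriv k h v" if "k \<le> 2" for k
  proof -
    have "k = 0 \<or> k = 1 \<or> k = 2" using that by linarith
    then show ?thesis using W2_weak_deriv_0[OF W] W2_weak_deriv_1[OF W] W2_weak_deriv_2[OF W] by auto
  qed
  then show "h \<in> W21" using h W by (auto simp: W21_def W2_def intro: prim_continuous)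
qed

definition L1 :: "(real \<Rightarrow> complex) \<Rightarrow> real" where
  "L1 v = (LINT x:{0..1}|lborel. cmod (v x))"

lemma L1_cong_AE:
  assumes "set_integrable lborel {0..1} v" "set_integrable lborel {0..1} v'"
    "AE x in lborel. x \<in> {0..1} \<longrightarrow> v x = v' x"
  shows "L1 v = L1 v'"
  unfolding L1_def set_lebesgue_integral_def
proof (rule integral_cong_AE)
  show "AE x in lborel. indicator {0..1} x *\<^sub>R cmod (v x) = indicator {0..1} x *\<^sub>R cmod (v' x)"
    using assms(3) by eventually_elim (auto simp: indicator_def)
  show "(\<lambda>x. indicator {0..1} x *\<^sub>R cmod (v x)) \<in> borel_measurable lborel"
    "(\<lambda>x. indicator {0..1} x *\<^sub>R cmod (v' x)) \<in> borel_measurable lborel"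
    using set_integrable_norm[OF assms(1)] set_integrable_norm[OF assms(2)]
    unfolding set_integrable_def by (auto dest: borel_measurable_integrable)
qed

lemma weak_deriv_integrable: "weak_deriv k h v \<Longrightarrow> set_integrable lborel {0..1} v"
  by (simp add: weak_deriv_def)

lemma weak_deriv_unique:
  assumes "weak_deriv k h v" "weak_deriv k h v'"
  shows "AE x in lborel. x \<in> {0..1} \<longrightarrow> v x = v' x"
proof -
  have i: "set_integrable lborel {0..1} v" "set_integrable lborel {0..1} v'"
    using assms by (auto simp: weak_deriv_def)
  have "AE x in lborel. x \<in> {0..1} \<longrightarrow> v x - v' x = 0"
  proof (rule AE_zero_of_weak_zero)
    show "set_integrable lborel {0..1} (\<lambda>x. v x - v' x)" using i by (rule set_integral_diff(1))
    fix \<phi> assume \<phi>: "test_fun \<phi>"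
    have "(-1) ^ k * (LINT x:{0..1}|lborel. v x * complex_of_real (\<phi> x))
        = (-1) ^ k * (LINT x:{0..1}|lborel. v' x * complex_of_real (\<phi> x))"
      using assms[unfolded weak_deriv_def, THEN conjunct2, rule_format, OF \<phi>] by argo
    then have "(LINT x:{0..1}|lborel. v x * complex_of_real (\<phi> x)) = (LINT x:{0..1}|lborel. v' x * complex_of_real (\<phi> x))"
      by simp
    moreover have mult: "set_integrable lborel {0..1} (\<lambda>x. f x * complex_of_real (\<phi> x))"
      if "set_integrable lborel {0..1} f" for f
      using set_integrable_continuous_mult[OF prim_continuous[OF prim_test_fun[OF \<phi>]] that]
      by (simp add: mult.commute)
    ultimately show "(LINT x:{0..1}|lborel. (v x - v' x) * complex_of_real (\<phi> x)) = 0"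
      unfolding left_diff_distrib by (subst set_integral_diff(2)) (auto intro: mult i)
  qed
  then show ?thesis by eventually_elim auto
qed

text \<open>Weak derivatives are unique almost everywhere, so those at hand compute the norm.\<close>

lemma norm_W21_eq:
  assumes "W2 h g v"
  shows "norm_W21 h = L1 h + L1 g + L1 v"
proof -
  have some: "L1 (SOME v. weak_deriv k h v) = L1 v'" if "weak_deriv k h v'" for k v'
  proof (rule L1_cong_AE)
    have s: "weak_deriv k h (SOME v. weak_deriv k h v)" by (rule someI[where P = "weak_deriv k h", OF that])
    show "set_integrable lborel {0..1} (SOME v. weak_deriv k h v)" "set_integrable lborel {0..1} v'"
      by (rule weak_deriv_integrable[OF s], rule weak_deriv_integrable[OF that])
    show "AE x in lborel. x \<in> {0..1} \<longrightarrow> (SOME v. weak_deriv k h v) x = v' x"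
      by (rule weak_deriv_unique[OF s that])
  qed
  have "norm_W21 h = (\<Sum>k\<le>2. L1 (SOME v. weak_deriv k h v))"
    by (simp add: norm_W21_def L1_def)
  also have "\<dots> = L1 h + L1 g + L1 v"
    using some[OF W2_weak_deriv_0[OF assms]] some[OF W2_weak_deriv_1[OF assms]]
      some[OF W2_weak_deriv_2[OF assms]]
    by (simp add: numeral_2_eq_2)
  finally show ?thesis .
qed

lemma L1_nonneg: "L1 v \<ge> 0"
  unfolding L1_def set_lebesgue_integral_def by (intro integral_nonneg_AE) (auto simp: indicator_def)

lemma L1_triangle:
  assumes "set_integrable lborel {0..1} v" "set_integrable lborel {0..1} w"
  shows "L1 (\<lambda>x. v x + w x) \<le> L1 v + L1 w"
proof -
  have "L1 (\<lambda>x. v x + w x) \<le> (LINT x:{0..1}|lborel. cmod (v x) + cmod (w x))"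
    unfolding L1_def
    by (rule set_integral_mono) (auto intro!: set_integrable_norm set_integral_add(1) assms norm_triangle_ineq)
  also have "\<dots> = L1 v + L1 w"
    unfolding L1_def by (intro set_integral_add(2) set_integrable_norm assms)
  finally show ?thesis .
qed

lemma L1_cmult: "L1 (\<lambda>x. c * v x) = cmod c * L1 v"
  unfolding L1_def by (simp add: norm_mult)

lemma norm_LINT_le_L1:
  assumes "set_integrable lborel {0..1} v" "0 \<le> a" "b \<le> 1"
  shows "norm (LINT t:{a..b}|lborel. v t) \<le> L1 v"
proof -
  have i: "set_integrable lborel {a..b} v" by (rule set_integrable_sub[OF assms])
  have "norm (LINT t:{a..b}|lborel. v t) \<le> (LINT t:{a..b}|lborel. cmod (v t))"
    by (rule set_integral_norm_bound[OF i])
  also have "\<dots> \<le> L1 v" unfolding L1_def set_lebesgue_integral_def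
    using set_integrable_norm[OF i] set_integrable_norm[OF assms(1)] assms(2,3)
    by (intro integral_mono) (auto simp: set_integrable_def indicator_def)
  finally show ?thesis .
qed

lemma prim_bound:
  assumes "prim u v" "x \<in> {0..1}"
  shows "cmod (u x) \<le> cmod (u 0) + L1 v"
  using prim_eq[OF assms] norm_LINT_le_L1[OF prim_integrable[OF assms(1)], of 0 x] assms(2)
  by (metis add_left_mono atLeastAtMost_iff norm_triangle_le order_refl)

lemma L1_le_sup:
  assumes "continuous_on {0..1} u" "\<And>x. x \<in> {0..1} \<Longrightarrow> cmod (u x) \<le> M"
  shows "L1 u \<le> M"
proof -
  have "L1 u \<le> (LINT x:{0..1::real}|lborel. M)"
    unfolding L1_def
    by (rule set_integral_mono) (auto intro!: borel_integrable_atLeastAtMost' continuous_intros assms)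
  also have "\<dots> = M" by (simp add: set_integral_const)
  finally show ?thesis .
qed

lemma prim_bound_L1:
  assumes "prim u v"
  shows "cmod (u 0) \<le> L1 u + L1 v"
proof -
  have c: "continuous_on {0..1} u" by (rule prim_continuous[OF assms])
  have "cmod (u 0) - L1 v = (LINT x:{0..1::real}|lborel. cmod (u 0) - L1 v)"
    by (simp add: set_integral_const)
  also have "\<dots> \<le> L1 u" unfolding L1_def
  proof (rule set_integral_mono)
    fix x :: real assume x: "x \<in> {0..1}"
    have "u 0 = u x - (LINT t:{0..x}|lborel. v t)" using prim_eq[OF assms x] by simp
    then have "cmod (u 0) \<le> cmod (u x) + norm (LINT t:{0..x}|lborel. v t)" by (metis norm_triangle_ineq4)
    then show "cmod (u 0) - (LINT x:{0..1}|lborel. cmod (v x)) \<le> cmod (u x)"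
      using norm_LINT_le_L1[OF prim_integrable[OF assms], of 0 x] x by (simp add: L1_def)
  qed (auto intro!: borel_integrable_atLeastAtMost' continuous_intros c)
  finally show ?thesis by simp
qed

definition dd :: "(real \<Rightarrow> complex) \<Rightarrow> real \<Rightarrow> complex" where
  "dd h x = vector_derivative h (at x within {0..1})"

text \<open>Determined up to a null set.\<close>

definition d2 :: "(real \<Rightarrow> complex) \<Rightarrow> real \<Rightarrow> complex" where
  "d2 h = (SOME v. W2 h (dd h) v)"

lemma W2_dd: assumes "W2 h g v" "x \<in> {0..1}" shows "dd h x = g x"
proof -
  have "(h has_vector_derivative g x) (at x within {0..1})"
    using assms by (intro prim_has_vector_derivative prim_continuous) (auto simp: W2_def)
  then show ?thesis unfolding dd_def using assms(2)
    by (intro vector_derivative_within_closed_interval) auto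
qed

lemma W2_dd_left: assumes "W2 h g v" shows "W2 h (dd h) v"
  using assms W2_dd[OF assms] unfolding W2_def
  by (auto intro: prim_cong[of h g h "dd h"] prim_cong[of g v "dd h" v])

lemma W2_d2: "W2 h g v \<Longrightarrow> W2 h (dd h) (d2 h)"
  unfolding d2_def by (drule W2_dd_left) (rule someI[where P = "W2 h (dd h)"])

text \<open>An equivalent norm (\<open>nrm_equiv\<close>), in which the space is visibly the product of two copies of \<open>\<complex>\<close> and of
  \<open>L\<^sup>1\<close>. It makes completeness simple, and for the transfer operator the part of size \<open>\<mu>\<^sup>2\<close> appears in the
  last summand only.\<close>

definition nrm :: "(real \<Rightarrow> complex) \<Rightarrow> real" where
  "nrm h = cmod (h 0) + cmod (dd h 0) + L1 (d2 h)"

lemma nrm_eq: assumes "W2 h g v" shows "nrm h = cmod (h 0) + cmod (g 0) + L1 v"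
proof -
  note d = W2_d2[OF assms]
  have "AE x in lborel. x \<in> {0..1} \<longrightarrow> d2 h x = v x"
    using prim_unique_AE[of "dd h" "d2 h" g v] d assms W2_dd[OF assms] by (auto simp: W2_def)
  then have "L1 (d2 h) = L1 v" using d assms
    by (intro L1_cong_AE) (auto simp: W2_def dest: prim_integrable)
  then show ?thesis using W2_dd[OF assms, of 0] by (simp add: nrm_def)
qed

lemma nrm_equiv:
  assumes "h \<in> W21"
  shows "norm_W21 h \<le> 3 * nrm h" "nrm h \<le> 3 * norm_W21 h"
proof -
  obtain g v where W: "W2 h g v" using assms by (auto simp: W21_iff)
  have p: "prim h g" "prim g v" using W by (auto simp: W2_def)
  have g: "L1 g \<le> cmod (g 0) + L1 v"
    by (rule L1_le_sup[OF prim_continuous[OF p(2)] prim_bound[OF p(2)]])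
  have h: "L1 h \<le> cmod (h 0) + L1 g"
    by (rule L1_le_sup[OF prim_continuous[OF p(1)] prim_bound[OF p(1)]])
  note e = norm_W21_eq[OF W] nrm_eq[OF W] L1_nonneg[of v] L1_nonneg[of g] L1_nonneg[of h]
  show "norm_W21 h \<le> 3 * nrm h" using g h e norm_ge_zero[of "h 0"] norm_ge_zero[of "g 0"] by argo
  show "nrm h \<le> 3 * norm_W21 h" using prim_bound_L1[OF p(1)] prim_bound_L1[OF p(2)] e by argo
qed

lemma W2_add: "W2 h g v \<Longrightarrow> W2 h' g' v' \<Longrightarrow> W2 (\<lambda>x. h x + h' x) (\<lambda>x. g x + g' x) (\<lambda>x. v x + v' x)"
  by (simp add: W2_def prim_add)

lemma W2_cmult: "W2 h g v \<Longrightarrow> W2 (\<lambda>x. c * h x) (\<lambda>x. c * g x) (\<lambda>x. c * v x)"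
  by (simp add: W2_def prim_cmult)

lemma W2_zero: "W2 (\<lambda>x. 0) (\<lambda>x. 0) (\<lambda>x. 0)"
  by (simp add: W2_def prim_zero)

lemma W21_zero: "(\<lambda>x. 0) \<in> W21"
  using W2_zero by (auto simp: W21_iff)

lemma W21_add: "h \<in> W21 \<Longrightarrow> h' \<in> W21 \<Longrightarrow> (\<lambda>x. h x + h' x) \<in> W21"
  by (force simp: W21_iff dest: W2_add)

lemma W21_cmult: "h \<in> W21 \<Longrightarrow> (\<lambda>x. c * h x) \<in> W21"
  by (force simp: W21_iff dest: W2_cmult)

lemma W21_W2: "h \<in> W21 \<Longrightarrow> W2 h (dd h) (d2 h)"
  using W2_d2 by (auto simp: W21_iff)

lemma nrm_cmult: assumes "h \<in> W21" shows "nrm (\<lambda>x. c * h x) = cmod c * nrm h"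
  using nrm_eq[OF W21_W2[OF assms]] nrm_eq[OF W2_cmult[OF W21_W2[OF assms]], of c]
  by (simp add: L1_cmult norm_mult algebra_simps)

lemma nrm_triangle: assumes "h \<in> W21" "h' \<in> W21" shows "nrm (\<lambda>x. h x + h' x) \<le> nrm h + nrm h'"
proof -
  note W = W21_W2[OF assms(1)] W21_W2[OF assms(2)]
  have "L1 (\<lambda>x. d2 h x + d2 h' x) \<le> L1 (d2 h) + L1 (d2 h')"
    using W by (intro L1_triangle) (auto simp: W2_def dest: prim_integrable)
  then show ?thesis
    using nrm_eq[OF W(1)] nrm_eq[OF W(2)] nrm_eq[OF W2_add[OF W]]
      norm_triangle_ineq[of "h 0" "h' 0"] norm_triangle_ineq[of "dd h 0" "dd h' 0"] by linarith
qed

lemma nrm_eq_0: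
  assumes "h \<in> W21" "nrm h = 0" shows "h = (\<lambda>x. 0)"
proof
  fix x
  note W = W21_W2[OF assms(1)]
  have p: "prim h (dd h)" "prim (dd h) (d2 h)" using W by (auto simp: W2_def)
  have z: "cmod (h 0) = 0" "cmod (dd h 0) = 0" "L1 (d2 h) = 0"
    using nrm_eq[OF W] assms(2) L1_nonneg[of "d2 h"] norm_ge_zero[of "h 0"] norm_ge_zero[of "dd h 0"]
    by linarith+
  have "L1 (dd h) \<le> 0"
    by (rule L1_le_sup[OF prim_continuous[OF p(2)]]) (use prim_bound[OF p(2)] z in auto)
  then show "h x = 0"
  proof (cases "x \<in> {0..1}")
    case True
    then show ?thesis using prim_bound[OF p(1) True] z \<open>L1 (dd h) \<le> 0\<close> norm_ge_zero[of "h x"] norm_le_zero_iff[of "h x"]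
      by linarith
  next
    case False
    then show ?thesis using assms(1) unfolding W21_iff by blast
  qed
qed

subsection \<open>Completeness\<close>

lemma L1_abs_summable:
  assumes v: "\<And>n. set_integrable lborel {0..1} (v n)" and s: "summable (\<lambda>n. L1 (v n))"
  obtains V where "set_integrable lborel {0..1} V"
    "(\<lambda>n. L1 (\<lambda>x. (\<Sum>i<n. v i x) - V x)) \<longlonglongrightarrow> 0"
proof -
  define u where "u n x = indicator {0..1} x *\<^sub>R v n x" for n x
  have u: "integrable lborel (u n)" for n using v[of n] by (simp add: u_def[abs_def] set_integrable_def)
  have [measurable]: "u n \<in> borel_measurable lborel" for n using u by auto
  have nu: "(\<integral>x. norm (u n x) \<partial>lborel) = L1 (v n)" for n
    by (simp add: u_def L1_def set_lebesgue_integral_def)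
  have "(\<integral>\<^sup>+x. (\<Sum>n. ennreal (norm (u n x))) \<partial>lborel) = (\<Sum>n. \<integral>\<^sup>+x. norm (u n x) \<partial>lborel)"
    by (intro nn_integral_suminf) auto
  also have "\<dots> = (\<Sum>n. ennreal (L1 (v n)))"
    by (intro suminf_cong) (simp add: nn_integral_eq_integral u flip: nu)
  also have "\<dots> \<noteq> \<infinity>" using s by (simp add: ennreal_suminf_neq_top L1_nonneg)
  finally have "AE x in lborel. (\<Sum>n. ennreal (norm (u n x))) \<noteq> \<infinity>"
    by (intro nn_integral_PInf_AE) auto
  then have sm: "AE x in lborel. summable (\<lambda>n. norm (u n x))"
    by eventually_elim (auto intro: summable_suminf_not_top)
  have snu: "summable (\<lambda>n. \<integral>x. norm (u n x) \<partial>lborel)" using s by (simp add: nu)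
  define U where "U x = (\<Sum>n. u n x)" for x
  define M where "M x = (\<Sum>n. norm (u n x))" for x
  have U: "integrable lborel U" unfolding U_def by (rule integrable_suminf[OF u sm snu])
  have [measurable]: "U \<in> borel_measurable lborel" using U by auto
  have M: "integrable lborel M" unfolding M_def
    using integrable_suminf[of lborel "\<lambda>n x. norm (u n x)"] u sm snu by simp
  have "(\<lambda>n. \<integral>x. norm ((\<Sum>i<n. u i x) - U x) \<partial>lborel) \<longlonglongrightarrow> (\<integral>x. 0 \<partial>(lborel :: real measure))"
  proof (rule integral_dominated_convergence)
    show "integrable lborel (\<lambda>x. 2 * M x)" using M by simp
    show "AE x in lborel. (\<lambda>n. norm ((\<Sum>i<n. u i x) - U x)) \<longlonglongrightarrow> 0"
      using sm
    proof eventually_elim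
      case (elim x)
      then have "(\<lambda>n. \<Sum>i<n. u i x) \<longlonglongrightarrow> U x"
        unfolding U_def by (intro summable_LIMSEQ) (rule summable_norm_cancel)
      then show ?case by (intro tendsto_norm_zero) (simp add: LIM_zero)
    qed
    show "AE x in lborel. norm (norm ((\<Sum>i<n. u i x) - U x)) \<le> 2 * M x" for n
      using sm
    proof eventually_elim
      case (elim x)
      have "norm (\<Sum>i<n. u i x) \<le> (\<Sum>i<n. norm (u i x))" by (rule norm_sum)
      also have "\<dots> \<le> M x" unfolding M_def by (rule sum_le_suminf[OF elim]) auto
      finally have "norm (\<Sum>i<n. u i x) \<le> M x" .
      moreover have "norm (U x) \<le> M x" unfolding U_def M_def by (rule summable_norm[OF elim])
      ultimately show ?case using norm_triangle_ineq4[of "\<Sum>i<n. u i x" "U x"] by simp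
    qed
  qed auto
  moreover have "(\<integral>x. norm ((\<Sum>i<n. u i x) - U x) \<partial>lborel) = L1 (\<lambda>x. (\<Sum>i<n. v i x) - U x)" for n
  proof -
    have "norm ((\<Sum>i<n. u i x) - U x) = indicator {0..1} x *\<^sub>R norm ((\<Sum>i<n. v i x) - U x)" for x
      by (cases "x \<in> {0..1}") (auto simp: u_def U_def)
    then show ?thesis by (simp add: L1_def set_lebesgue_integral_def)
  qed
  ultimately have "(\<lambda>n. L1 (\<lambda>x. (\<Sum>i<n. v i x) - U x)) \<longlonglongrightarrow> 0" by simp
  moreover have "set_integrable lborel {0..1} U"
    unfolding set_integrable_def by (intro integrable_mult_indicator U) auto
  ultimately show ?thesis using that by blast
qed

subsection \<open>The space as a type\<close>

typedef w21 = W21 using W21_zero by blast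

setup_lifting type_definition_w21

instantiation w21 :: real_normed_vector
begin

lift_definition zero_w21 :: w21 is "\<lambda>_. 0" by (rule W21_zero)
lift_definition plus_w21 :: "w21 \<Rightarrow> w21 \<Rightarrow> w21" is "\<lambda>h k x. h x + k x" by (rule W21_add)
lift_definition uminus_w21 :: "w21 \<Rightarrow> w21" is "\<lambda>h x. - h x" using W21_cmult[of _ "-1"] by simp
lift_definition minus_w21 :: "w21 \<Rightarrow> w21 \<Rightarrow> w21" is "\<lambda>h k x. h x - k x"
  using W21_add[of _ "\<lambda>x. (-1) * k x" for k] W21_cmult[of _ "-1"] by simp
lift_definition scaleR_w21 :: "real \<Rightarrow> w21 \<Rightarrow> w21" is "\<lambda>r h x. complex_of_real r * h x" by (rule W21_cmult)
lift_definition norm_w21 :: "w21 \<Rightarrow> real" is nrm .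

definition "dist_w21 (a :: w21) b = norm (a - b)"
definition "sgn_w21 (a :: w21) = inverse (norm a) *\<^sub>R a"
definition "(uniformity :: (w21 \<times> w21) filter) = (INF e\<in>{0<..}. principal {(x, y). dist x y < e})"
definition "open_w21 (U :: w21 set) \<longleftrightarrow> (\<forall>x\<in>U. \<forall>\<^sub>F (x', y) in uniformity. x' = x \<longrightarrow> y \<in> U)"

instance
proof
  fix a b c :: w21 and r s :: real
  show "a + b + c = a + (b + c)" by transfer (simp add: add.assoc)
  show "a + b = b + a" by transfer (simp add: add.commute)
  show "0 + a = a" by transfer simp
  show "- a + a = 0" by transfer simp
  show "a - b = a + - b" by transfer simp
  show "r *\<^sub>R (a + b) = r *\<^sub>R a + r *\<^sub>R b" by transfer (simp add: distrib_left)
  show "(r + s) *\<^sub>R a = r *\<^sub>R a + s *\<^sub>R a" by transfer (simp add: distrib_right)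
  show "r *\<^sub>R s *\<^sub>R a = (r * s) *\<^sub>R a" by transfer (simp add: mult.assoc)
  show "1 *\<^sub>R a = a" by transfer simp
  show "dist a b = norm (a - b)" by (rule dist_w21_def)
  show "sgn a = inverse (norm a) *\<^sub>R a" by (rule sgn_w21_def)
  show "(uniformity :: (w21 \<times> w21) filter) = (INF e\<in>{0<..}. principal {(x, y). dist x y < e})"
    by (rule uniformity_w21_def)
  show "open U \<longleftrightarrow> (\<forall>x\<in>U. \<forall>\<^sub>F (x', y) in uniformity. x' = x \<longrightarrow> y \<in> U)" for U :: "w21 set"
    by (rule open_w21_def)
  show "norm a = 0 \<longleftrightarrow> a = 0"
    by transfer (use nrm_eq_0 nrm_eq[OF W2_zero] in \<open>auto simp: L1_def\<close>)
  show "norm (a + b) \<le> norm a + norm b" by transfer (rule nrm_triangle)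
  show "norm (r *\<^sub>R a) = \<bar>r\<bar> * norm a" by transfer (simp add: nrm_cmult)
qed

end

lift_definition cscale :: "complex \<Rightarrow> w21 \<Rightarrow> w21" is "\<lambda>c h x. c * h x" by (rule W21_cmult)

lemma Rep_sum: "Rep_w21 (\<Sum>i\<in>J. X i) x = (\<Sum>i\<in>J. Rep_w21 (X i) x)"
  by (induction J rule: infinite_finite_induct) (auto simp: zero_w21.rep_eq plus_w21.rep_eq)

lemma W2_sum:
  "(\<And>i. i \<in> J \<Longrightarrow> W2 (h i) (g i) (v i)) \<Longrightarrow> W2 (\<lambda>x. \<Sum>i\<in>J. h i x) (\<lambda>x. \<Sum>i\<in>J. g i x) (\<lambda>x. \<Sum>i\<in>J. v i x)"
  unfolding W2_def by (auto intro!: prim_sum)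

text \<open>The element of the space with value \<open>a\<close> and slope \<open>c\<close> at \<open>0\<close> and second derivative \<open>v\<close>.\<close>

definition from_d2 :: "complex \<Rightarrow> complex \<Rightarrow> (real \<Rightarrow> complex) \<Rightarrow> real \<Rightarrow> complex" where
  "from_d2 a c v x = (if x \<in> {0..1}
     then a + (LINT t:{0..x}|lborel. c + (LINT s:{0..t}|lborel. v s)) else 0)"

lemma from_d2:
  assumes v: "set_integrable lborel {0..1} v"
  obtains g where "W2 (from_d2 a c v) g v" "from_d2 a c v 0 = a" "g 0 = c" "from_d2 a c v \<in> W21"
proof -
  have z: "(LINT t:{0..0}|lborel. w t) = 0" if "set_integrable lborel {0..1} w" for w :: "real \<Rightarrow> complex"
    using set_borel_integral_eq_integral(2)[OF set_integrable_sub[OF that], of 0 0] by simp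
  define g where "g x = c + (LINT s:{0..x}|lborel. v s)" for x
  have g: "prim g v" unfolding g_def by (rule prim_integral[OF v])
  have gi: "set_integrable lborel {0..1} g" by (intro borel_integrable_atLeastAtMost' prim_continuous[OF g])
  have "prim (from_d2 a c v) g"
    by (rule prim_cong_left[OF prim_integral[OF gi, of a]]) (auto simp: from_d2_def g_def)
  then have W: "W2 (from_d2 a c v) g v" using g by (simp add: W2_def)
  show ?thesis
  proof (rule that[OF W])
    show "from_d2 a c v 0 = a" using z[OF gi] by (simp add: from_d2_def g_def)
    show "g 0 = c" using z[OF v] by (simp add: g_def)
    show "from_d2 a c v \<in> W21" using W by (auto simp: W21_iff from_d2_def)
  qed
qed

interpretation W: complex_scaling cscale
proof
  fix c d :: complex and x y :: w21 and r :: real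
  show "cscale c (x + y) = cscale c x + cscale c y" by transfer (simp add: distrib_left)
  show "cscale (c + d) x = cscale c x + cscale d x" by transfer (simp add: distrib_right)
  show "cscale c (cscale d x) = cscale (c * d) x" by transfer (simp add: mult.assoc)
  show "cscale (complex_of_real r) x = r *\<^sub>R x" by transfer simp
  show "norm (cscale c x) = cmod c * norm x" by transfer (rule nrm_cmult)
  fix X :: "nat \<Rightarrow> w21" assume s: "summable (\<lambda>n. norm (X n))"
  define h where "h n = Rep_w21 (X n)" for n
  have hW: "W2 (h n) (dd (h n)) (d2 (h n))" for n unfolding h_def by (rule W21_W2[OF Rep_w21])
  have nX: "norm (X n) = cmod (h n 0) + cmod (dd (h n) 0) + L1 (d2 (h n))" for n
    by (simp add: norm_w21.rep_eq nrm_def h_def)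
  have s1: "summable (\<lambda>n. h n 0)" "summable (\<lambda>n. dd (h n) 0)" and s3: "summable (\<lambda>n. L1 (d2 (h n)))"
    using nX L1_nonneg
    by (auto intro!: summable_norm_cancel[of "\<lambda>n. h n 0"] summable_norm_cancel[of "\<lambda>n. dd (h n) 0"]
        summable_comparison_test'[OF s, of 0])
  have vi: "set_integrable lborel {0..1} (d2 (h n))" for n using hW by (auto simp: W2_def dest: prim_integrable)
  obtain V where V: "set_integrable lborel {0..1} V"
    "(\<lambda>n. L1 (\<lambda>x. (\<Sum>i<n. d2 (h i) x) - V x)) \<longlonglongrightarrow> 0"
    by (rule L1_abs_summable[OF vi s3]) (rule that)
  define k where "k = from_d2 (\<Sum>n. h n 0) (\<Sum>n. dd (h n) 0) V"
  obtain g where g: "W2 k g V" "k 0 = (\<Sum>n. h n 0)" "g 0 = (\<Sum>n. dd (h n) 0)" "k \<in> W21"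
    unfolding k_def by (rule from_d2[OF V(1), of "\<Sum>n. h n 0" "\<Sum>n. dd (h n) 0"])
  have norm_eq: "norm ((\<Sum>i<n. X i) - Abs_w21 k) = cmod ((\<Sum>i<n. h i 0) - k 0) + cmod ((\<Sum>i<n. dd (h i) 0) - g 0)
      + L1 (\<lambda>x. (\<Sum>i<n. d2 (h i) x) - V x)" for n
  proof -
    have "W2 (\<lambda>x. (\<Sum>i<n. h i x) + (-1) * k x) (\<lambda>x. (\<Sum>i<n. dd (h i) x) + (-1) * g x)
        (\<lambda>x. (\<Sum>i<n. d2 (h i) x) + (-1) * V x)"
      by (intro W2_add W2_sum W2_cmult hW g(1))
    from nrm_eq[OF this] show ?thesis
      by (simp add: norm_w21.rep_eq minus_w21.rep_eq Rep_sum Abs_w21_inverse[OF g(4)] h_def)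
  qed
  have "(\<lambda>n. norm ((\<Sum>i<n. X i) - Abs_w21 k)) \<longlonglongrightarrow> cmod (k 0 - k 0) + cmod (g 0 - g 0) + 0"
    unfolding norm_eq
    by (intro tendsto_intros V(2)) (use summable_LIMSEQ[OF s1(1)] summable_LIMSEQ[OF s1(2)] g(2,3) in auto)
  then have "X sums Abs_w21 k"
    unfolding sums_def by (simp add: tendsto_norm_zero_iff LIM_zero_iff)
  then show "summable X" by (rule sums_summable)
qed

section \<open>Quasi-compact operators on the Sobolev space\<close>

lemma Rep_w21_eq_0: "Rep_w21 w = (\<lambda>_. 0) \<longleftrightarrow> w = 0"
  unfolding zero_w21.rep_eq[symmetric] Rep_w21_inject ..

text \<open>The notions of the spectrum speak of functions and of the Sobolev norm, the abstract theory of a normed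
  type; \<open>rep\<close> links the operator \<open>L\<close> on the type to the operator \<open>T\<close> on functions.\<close>

locale w21_operator = quasi_compact cscale L r for L :: "w21 \<Rightarrow> w21" and r :: real +
  fixes T :: "(real \<Rightarrow> complex) \<Rightarrow> real \<Rightarrow> complex"
  assumes rep: "Rep_w21 (L w) = T (Rep_w21 w)"
begin

lemma T_eq: "h \<in> W21 \<Longrightarrow> T h = Rep_w21 (L (Abs_w21 h))"
  by (simp add: rep Abs_w21_inverse)

lemma Abs_add: "g \<in> W21 \<Longrightarrow> h \<in> W21 \<Longrightarrow> Abs_w21 (\<lambda>x. g x + h x) = Abs_w21 g + Abs_w21 h"
  by (rule injD[OF inj_onI[of UNIV Rep_w21]])
     (simp_all add: Rep_w21_inject plus_w21.rep_eq Abs_w21_inverse W21_add)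

lemma Abs_cmult: "h \<in> W21 \<Longrightarrow> Abs_w21 (\<lambda>x. c * h x) = cscale c (Abs_w21 h)"
  by (rule injD[OF inj_onI[of UNIV Rep_w21]])
     (simp_all add: Rep_w21_inject cscale.rep_eq Abs_w21_inverse W21_cmult)

lemma norm_W21_le_norm: "norm_W21 (Rep_w21 w) \<le> 3 * norm w"
  using nrm_equiv(1)[OF Rep_w21] by (simp add: norm_w21.rep_eq)

lemma norm_le_norm_W21: "norm w \<le> 3 * norm_W21 (Rep_w21 w)"
  using nrm_equiv(2)[OF Rep_w21] by (simp add: norm_w21.rep_eq)

lemma bounded_op_of_clin:
  assumes R: "clinear R"
  shows "bounded_op W21 norm_W21 (\<lambda>h. Rep_w21 (R (Abs_w21 h)))"
proof -
  obtain K where K: "K > 0" "\<And>w. norm (R w) \<le> norm w * K"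
    using bounded_linear.pos_bounded[OF clinear_bl[OF R]] by blast
  have "norm_W21 (Rep_w21 (R (Abs_w21 h))) \<le> 9 * K * norm_W21 h" if "h \<in> W21" for h
  proof -
    have "norm_W21 (Rep_w21 (R (Abs_w21 h))) \<le> 3 * (norm (Abs_w21 h) * K)"
      using norm_W21_le_norm[of "R (Abs_w21 h)"] K(2)[of "Abs_w21 h"] by linarith
    also have "\<dots> \<le> 3 * ((3 * norm_W21 h) * K)"
      using norm_le_norm_W21[of "Abs_w21 h"] K(1) that by (intro mult_left_mono mult_right_mono) (auto simp: Abs_w21_inverse)
    finally show ?thesis by (simp add: mult_ac)
  qed
  then have "\<exists>C. \<forall>h\<in>W21. norm_W21 (Rep_w21 (R (Abs_w21 h))) \<le> C * norm_W21 h" by blast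
  then show ?thesis unfolding bounded_op_def
    by (simp add: Rep_w21 Abs_add Abs_cmult clinear_add[OF R] clinear_cs[OF R] plus_w21.rep_eq cscale.rep_eq)
qed

lemma bounded_op_cong:
  assumes "bounded_op W21 norm_W21 R" "\<And>h. h \<in> W21 \<Longrightarrow> R h = R' h"
  shows "bounded_op W21 norm_W21 R'"
  using assms unfolding bounded_op_def by (simp add: W21_add W21_cmult)

lemma bounded_op_T: "bounded_op W21 norm_W21 T"
  by (rule bounded_op_cong[OF bounded_op_of_clin[OF T]]) (simp add: T_eq)

lemma shift_rep: "Rep_w21 (cscale z w - L w) = shift T z (Rep_w21 w)"
  by (simp add: shift_def minus_w21.rep_eq cscale.rep_eq rep)

text \<open>If \<open>z\<close> is not an eigenvalue, then \<open>z - L\<close> is injective, hence surjective by the Fredholm alternative, and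
  the lifting property bounds its inverse.\<close>

lemma eigenvalue_of_spectrum:
  assumes z: "r < cmod z" and sp: "z \<in> spectrum W21 norm_W21 T"
  shows "\<exists>h\<in>W21. h \<noteq> (\<lambda>_. 0) \<and> T h = (\<lambda>x. z * h x)"
proof (rule ccontr)
  assume no: "\<not> ?thesis"
  define S where "S w = cscale z w - L w" for w
  have fr: "fredholm S" using fredholm_shift[OF z] by (simp add: S_def[abs_def])
  then have cS: "clinear S" by (simp add: fredholm_def)
  have ker: "w = 0" if "S w = 0" for w
  proof (rule ccontr)
    assume "w \<noteq> 0"
    then have "Rep_w21 w \<noteq> (\<lambda>_. 0)" by (simp add: Rep_w21_eq_0)
    moreover have "T (Rep_w21 w) = (\<lambda>x. z * Rep_w21 w x)"
    proof -
      have "L w = cscale z w" using that by (simp add: S_def)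
      then show ?thesis by (simp add: cscale.rep_eq flip: rep)
    qed
    ultimately show False using no Rep_w21 by blast
  qed
  have inj: "inj S"
  proof (rule injI)
    fix x y assume "S x = S y"
    then have "S (x - y) = 0" by (simp add: clinear_diff[OF cS])
    then show "x = y" using ker by fastforce
  qed
  then have surj: "surj S" using fr by (simp add: fredholm_def)
  obtain C where C: "\<And>x. \<exists>y. S y = S x \<and> norm y \<le> C * norm (S x)"
    using fr unfolding fredholm_def lifts_def by blast
  define R where "R = inv S"
  have SR: "S (R w) = w" and RS: "R (S w) = w" for w
    by (simp_all add: R_def surj_f_inv_f[OF surj] inv_f_f[OF inj])
  have "clinear R" unfolding clinear_def
  proof (intro conjI allI)
    show "bounded_linear R"
    proof (rule bounded_linear_intro)
      show "R (x + y) = R x + R y" for x y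
        by (rule injD[OF inj]) (simp add: SR clinear_add[OF cS])
      show "R (a *\<^sub>R x) = a *\<^sub>R R x" for a x
        by (rule injD[OF inj]) (simp add: SR linear_scale[OF bounded_linear.linear[OF clinear_bl[OF cS]]])
      show "norm (R x) \<le> norm x * C" for x
        using C[of "R x"] inj by (metis SR injD mult.commute)
    qed
    show "R (cscale c x) = cscale c (R x)" for c x
      by (rule injD[OF inj]) (simp add: SR clinear_cs[OF cS])
  qed
  then have "bounded_op W21 norm_W21 (\<lambda>h. Rep_w21 (R (Abs_w21 h)))" by (rule bounded_op_of_clin)
  moreover have "Rep_w21 (R (Abs_w21 (shift T z h))) = h" "shift T z (Rep_w21 (R (Abs_w21 h))) = h"
    if "h \<in> W21" for h
  proof -
    have "shift T z h = Rep_w21 (S (Abs_w21 h))"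
      using shift_rep[of z "Abs_w21 h"] that by (simp add: S_def Abs_w21_inverse)
    then show "Rep_w21 (R (Abs_w21 (shift T z h))) = h" using that
      by (simp add: Rep_w21_inverse RS Abs_w21_inverse)
    show "shift T z (Rep_w21 (R (Abs_w21 h))) = h"
      using SR[of "Abs_w21 h"] that unfolding S_def by (metis Abs_w21_inverse shift_rep)
  qed
  ultimately show False using sp unfolding spectrum_def by blast
qed

lemma spectrum_isolated:
  assumes z: "r < cmod z"
  shows "\<not> z islimpt spectrum W21 norm_W21 T"
proof
  assume lim: "z islimpt spectrum W21 norm_W21 T"
  have "z islimpt {w. \<exists>x. x \<noteq> 0 \<and> L x = cscale w x}"
    unfolding islimpt_def
  proof (intro allI impI)
    fix U :: "complex set" assume U: "z \<in> U" "open U"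
    define U' where "U' = U \<inter> {w. r < cmod w}"
    have "open U'" unfolding U'_def using U(2)
      by (intro open_Int open_Collect_less continuous_intros) auto
    moreover have "z \<in> U'" using U(1) z by (simp add: U'_def)
    ultimately obtain w where w: "w \<in> spectrum W21 norm_W21 T" "w \<in> U'" "w \<noteq> z"
      using lim unfolding islimpt_def by blast
    then obtain h where h: "h \<in> W21" "h \<noteq> (\<lambda>_. 0)" "T h = (\<lambda>x. w * h x)"
      using eigenvalue_of_spectrum[of w] by (auto simp: U'_def)
    have "Abs_w21 h \<noteq> 0" using h(1,2) Rep_w21_eq_0[of "Abs_w21 h"] by (simp add: Abs_w21_inverse)
    moreover have "L (Abs_w21 h) = cscale w (Abs_w21 h)"
    proof -
      have "Rep_w21 (L (Abs_w21 h)) = Rep_w21 (cscale w (Abs_w21 h))"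
        using h(1,3) by (simp add: rep cscale.rep_eq Abs_w21_inverse)
      then show ?thesis by (simp add: Rep_w21_inject)
    qed
    ultimately show "\<exists>y\<in>{w. \<exists>x. x \<noteq> 0 \<and> L x = cscale w x}. y \<in> U \<and> y \<noteq> z"
      using w(2,3) by (auto simp: U'_def)
  qed
  then show False using eigenvalues_isolated[OF z] by simp
qed

lemma shift_power_rep: "((\<lambda>w. cscale z w - L w) ^^ n) w = 0 \<longleftrightarrow> (shift T z ^^ n) (Rep_w21 w) = (\<lambda>_. 0)"
proof -
  have "Rep_w21 (((\<lambda>w. cscale z w - L w) ^^ n) w) = (shift T z ^^ n) (Rep_w21 w)"
    by (induction n) (simp_all add: shift_rep)
  then show ?thesis using Rep_w21_eq_0[of "((\<lambda>w. cscale z w - L w) ^^ n) w"] by simp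
qed

text \<open>Each of the three ways to belong to the essential spectrum is excluded: the range is closed by \<open>fredholm_shift\<close>,
  the generalized eigenspace is the kernel of one power by \<open>finite_ascent\<close>, and the point is isolated.\<close>

lemma ess_spectrum_subset: "ess_spectrum W21 norm_W21 T \<subseteq> {z. cmod z \<le> r}"
proof
  fix z assume ess: "z \<in> ess_spectrum W21 norm_W21 T"
  show "z \<in> {z. cmod z \<le> r}"
  proof (rule ccontr)
    assume "z \<notin> {z. cmod z \<le> r}"
    then have z: "r < cmod z" by simp
    define S where "S w = cscale z w - L w" for w
    have fr: "fredholm S" using fredholm_shift[OF z] by (simp add: S_def[abs_def])
    have "closed_in_norm W21 norm_W21 (shift T z ` W21)"
      unfolding closed_in_norm_def
    proof (intro allI impI, elim conjE)
      fix u :: "nat \<Rightarrow> real \<Rightarrow> complex" and h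
      assume u: "\<forall>n. u n \<in> shift T z ` W21" and h: "h \<in> W21"
        and lim: "(\<lambda>n. norm_W21 (\<lambda>x. u n x - h x)) \<longlonglongrightarrow> 0"
      have "\<exists>w. u n = Rep_w21 (S w)" for n
      proof -
        obtain k where k: "k \<in> W21" "u n = shift T z k" using u by blast
        then have "u n = Rep_w21 (S (Abs_w21 k))" by (simp add: S_def shift_rep Abs_w21_inverse)
        then show ?thesis by blast
      qed
      then obtain w where w: "\<And>n. u n = Rep_w21 (S (w n))" by metis
      have "norm (S (w n) - Abs_w21 h) \<le> 3 * norm_W21 (\<lambda>x. u n x - h x)" for n
        using norm_le_norm_W21[of "S (w n) - Abs_w21 h"] h
        by (simp add: minus_w21.rep_eq Abs_w21_inverse w)
      then have "(\<lambda>n. S (w n) - Abs_w21 h) \<longlonglongrightarrow> 0"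
        by (intro Lim_null_comparison[OF always_eventually tendsto_mult_right_zero[OF lim, of 3]] allI)
      then have "(\<lambda>n. S (w n)) \<longlonglongrightarrow> Abs_w21 h" by (simp add: LIM_zero_iff)
      moreover have "closed (range S)" using fr by (simp add: fredholm_def)
      ultimately have "Abs_w21 h \<in> range S" by (rule closed_sequentially[rotated 2]) auto
      then obtain y where "Abs_w21 h = S y" by auto
      then have "h = shift T z (Rep_w21 y)" using h shift_rep unfolding S_def by (metis Abs_w21_inverse)
      then show "h \<in> shift T z ` W21" using Rep_w21 by blast
    qed
    moreover have "finite_dim (gen_eigenspace W21 T z)"
    proof -
      obtain n where n: "\<And>m x. (S ^^ m) x = 0 \<Longrightarrow> (S ^^ n) x = 0"
        using finite_ascent[OF z] unfolding S_def[abs_def] by blast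
      obtain m :: nat and b where mb: "\<And>x. (S ^^ n) x = 0 \<Longrightarrow> \<exists>c. x = (\<Sum>i<m. cscale (c i) (b i))"
        using kernel_power_finite_dim[OF z, of n] unfolding S_def[abs_def] by blast
      define B where "B = (\<lambda>i. Rep_w21 (b i)) ` {..<m}"
      have "\<exists>c. h = (\<lambda>x. \<Sum>\<beta>\<in>B. c \<beta> * \<beta> x)" if h: "h \<in> gen_eigenspace W21 T z" for h
      proof -
        obtain k where k: "h \<in> W21" "(shift T z ^^ k) h = (\<lambda>_. 0)"
          using h by (auto simp: gen_eigenspace_def)
        have "(S ^^ k) (Abs_w21 h) = 0"
          using shift_power_rep[where z = z and n = k and w = "Abs_w21 h"] k unfolding S_def[abs_def] by (simp add: Abs_w21_inverse)
        then obtain c where c: "Abs_w21 h = (\<Sum>i<m. cscale (c i) (b i))" using mb n by blast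
        have hx: "h x = (\<Sum>i<m. c i * Rep_w21 (b i) x)" for x
          using arg_cong[OF c, of "\<lambda>w. Rep_w21 w x"] k(1) by (simp add: Abs_w21_inverse Rep_sum cscale.rep_eq)
        have "h x = (\<Sum>\<beta>\<in>B. (\<Sum>i\<in>{i\<in>{..<m}. Rep_w21 (b i) = \<beta>}. c i) * \<beta> x)" for x
          unfolding hx B_def
          by (subst sum.image_gen[of "{..<m}" _ "\<lambda>i. Rep_w21 (b i)"])
             (auto simp: sum_distrib_right intro!: sum.cong)
        then show ?thesis
          by (intro exI[of _ "\<lambda>\<beta>. \<Sum>i\<in>{i\<in>{..<m}. Rep_w21 (b i) = \<beta>}. c i"] ext)
      qed
      moreover have "finite B" by (simp add: B_def)
      ultimately show ?thesis unfolding finite_dim_def by blast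
    qed
    ultimately show False using ess spectrum_isolated[OF z] unfolding ess_spectrum_def by blast
  qed
qed

end

section \<open>Systems of full inverse branches\<close>

lemma mono_of_deriv:
  fixes F F' :: "real \<Rightarrow> real"
  assumes F: "\<And>x. x \<in> {0..1} \<Longrightarrow> (F has_real_derivative F' x) (at x within {0..1})"
    and pos: "\<And>x. x \<in> {0..1} \<Longrightarrow> 0 \<le> F' x" and ab: "0 \<le> a" "a \<le> b" "b \<le> 1"
  shows "F a \<le> F b"
proof (cases "a = b")
  case False
  have "\<exists>x\<in>{a<..<b}. F b - F a = F' x * (b - a)"
  proof (rule mvt_simple[of a b F "\<lambda>x. (*) (F' x)"])
    show "(F has_derivative (*) (F' x)) (at x within {a..b})" if "a \<le> x" "x \<le> b" for x
      using has_field_derivative_subset[OF F[of x], of "{a..b}"] that ab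
      unfolding has_field_derivative_def by auto
  qed (use False ab in auto)
  then obtain x where x: "x \<in> {a<..<b}" "F b - F a = F' x * (b - a)" by blast
  then have "F' x * (b - a) \<ge> 0" using pos[of x] ab by (intro mult_nonneg_nonneg) auto
  then show ?thesis using x(2) by linarith
qed simp

text \<open>The inverse branches of the map, with their derivatives. The convexity \<open>Y2 \<ge> 0\<close> and the matching at the
  partition points make the derivatives increase along the whole partition; \<open>nonlinear\<close> excludes the
  case in which all of them are the same constant.\<close>

locale branch_system =
  fixes N :: nat and p :: "nat \<Rightarrow> real" and Y Y1 Y2 Y3 :: "nat \<Rightarrow> real \<Rightarrow> real"
  assumes N: "1 \<le> N" and p_first: "p 1 = 0" and p_last: "p (Suc N) = 1"
    and Y_0: "i \<in> {1..N} \<Longrightarrow> Y i 0 = p i" and Y_1: "i \<in> {1..N} \<Longrightarrow> Y i 1 = p (Suc i)"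
    and dY: "i \<in> {1..N} \<Longrightarrow> x \<in> {0..1} \<Longrightarrow> (Y i has_real_derivative Y1 i x) (at x within {0..1})"
    and dY1: "i \<in> {1..N} \<Longrightarrow> x \<in> {0..1} \<Longrightarrow> (Y1 i has_real_derivative Y2 i x) (at x within {0..1})"
    and dY2: "i \<in> {1..N} \<Longrightarrow> x \<in> {0..1} \<Longrightarrow> (Y2 i has_real_derivative Y3 i x) (at x within {0..1})"
    and cY3: "i \<in> {1..N} \<Longrightarrow> continuous_on {0..1} (Y3 i)"
    and Y1_pos: "i \<in> {1..N} \<Longrightarrow> x \<in> {0..1} \<Longrightarrow> 0 < Y1 i x"
    and Y2_nonneg: "i \<in> {1..N} \<Longrightarrow> x \<in> {0..1} \<Longrightarrow> 0 \<le> Y2 i x"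
    and match: "i \<in> {1..<N} \<Longrightarrow> Y1 i 1 = Y1 (Suc i) 0"
    and contracting: "Y1 N 1 < 1" and nonlinear: "Y1 1 0 < Y1 N 1"
begin

definition \<mu> :: real where "\<mu> = Y1 N 1"
definition \<Delta> :: real where "\<Delta> = Y1 N 1 - Y1 1 0"
definition \<Gamma> :: real where "\<Gamma> = 1 - (\<Sum>i=1..N. Y1 i 0)"

definition Op :: "(real \<Rightarrow> complex) \<Rightarrow> real \<Rightarrow> complex" where
  "Op h x = (if x \<in> {0..1} then \<Sum>i=1..N. complex_of_real (Y1 i x) * h (Y i x) else 0)"

lemma cY: "i \<in> {1..N} \<Longrightarrow> continuous_on {0..1} (Y i)"
  using dY DERIV_continuous_on by blast
lemma cY1: "i \<in> {1..N} \<Longrightarrow> continuous_on {0..1} (Y1 i)"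
  using dY1 DERIV_continuous_on by blast
lemma cY2: "i \<in> {1..N} \<Longrightarrow> continuous_on {0..1} (Y2 i)"
  using dY2 DERIV_continuous_on by blast

lemma Y_mono: "i \<in> {1..N} \<Longrightarrow> 0 \<le> a \<Longrightarrow> a \<le> b \<Longrightarrow> b \<le> 1 \<Longrightarrow> Y i a \<le> Y i b"
  by (rule mono_of_deriv[OF dY]) (simp_all add: less_imp_le Y1_pos)

lemma Y1_mono: "i \<in> {1..N} \<Longrightarrow> 0 \<le> a \<Longrightarrow> a \<le> b \<Longrightarrow> b \<le> 1 \<Longrightarrow> Y1 i a \<le> Y1 i b"
  by (rule mono_of_deriv[OF dY1]) (auto intro: Y2_nonneg)

lemma p_step: "i \<in> {1..N} \<Longrightarrow> p i \<le> p (Suc i)"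
  using Y_mono[of i 0 1] Y_0 Y_1 by simp

lemma p_mono: assumes "1 \<le> i" "i \<le> j" "j \<le> Suc N" shows "p i \<le> p j"
  using assms(2,3)
proof (induction j rule: dec_induct)
  case (step n)
  then show ?case using p_step[of n] assms(1) by auto
qed simp

lemma p_range: "i \<in> {1..Suc N} \<Longrightarrow> p i \<in> {0..1}"
  using p_mono[of 1 i] p_mono[of i "Suc N"] p_first p_last by auto

lemma Y_range: "i \<in> {1..N} \<Longrightarrow> x \<in> {0..1} \<Longrightarrow> Y i x \<in> {0..1}"
  using Y_mono[of i 0 x] Y_mono[of i x 1] Y_0[of i] Y_1[of i] p_range[of i] p_range[of "Suc i"] by auto

lemma Y1_le_mu: assumes i: "i \<in> {1..N}" and x: "x \<in> {0..1}" shows "Y1 i x \<le> \<mu>"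
proof -
  have "Y1 i 1 \<le> Y1 j 1" if "i \<le> j" "j \<le> N" for j
    using that
  proof (induction j rule: dec_induct)
    case (step n)
    then have "Y1 n 1 = Y1 (Suc n) 0" "Y1 (Suc n) 0 \<le> Y1 (Suc n) 1"
      using i by (auto intro!: match Y1_mono)
    then show ?case using step by simp
  qed simp
  then show ?thesis using Y1_mono[OF i, of x 1] x i unfolding \<mu>_def by fastforce
qed

lemma mu_pos: "0 < \<mu>" and mu_less_1: "\<mu> < 1" and Delta_pos: "0 < \<Delta>" and Delta_less_mu: "\<Delta> < \<mu>"
  using Y1_pos[of N 1] Y1_pos[of 1 0] N contracting nonlinear by (auto simp: \<mu>_def \<Delta>_def)

text \<open>This is where the matching of the derivatives at the partition points enters: only the two outer ends
  survive in sums of boundary terms.\<close>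

lemma telescope:
  fixes c :: "nat \<Rightarrow> real"
  shows "(\<Sum>i=1..N. Y1 i 1 * c (Suc i) - Y1 i 0 * c i) = \<mu> * c (Suc N) - Y1 1 0 * c 1"
proof -
  have "(\<Sum>i=1..n. Y1 i 1 * c (Suc i) - Y1 i 0 * c i) = Y1 n 1 * c (Suc n) - Y1 1 0 * c 1"
    if "1 \<le> n" "n \<le> N" for n
    using that
  proof (induction n rule: dec_induct)
    case (step n)
    then show ?case using match[of n] by simp
  qed simp
  then show ?thesis using N by (simp add: \<mu>_def)
qed

text \<open>The images of the branches are the intervals of the partition.\<close>

lemma covering:
  assumes x: "x \<in> {0..1}"
  obtains i t where "i \<in> {1..N}" "t \<in> {0..1}" "Y i t = x"
proof -
  have "\<exists>i\<in>{1..n}. p i \<le> x \<and> x \<le> p (Suc i)" if "1 \<le> n" "x \<le> p (Suc n)" for n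
    using that
  proof (induction n rule: dec_induct)
    case base
    then show ?case using x p_first by (intro bexI[of _ 1]) auto
  next
    case (step n)
    then show ?case
    proof (cases "x \<le> p (Suc n)")
      case True
      then obtain i where "i \<in> {1..n}" "p i \<le> x \<and> x \<le> p (Suc i)" using step.IH by blast
      then show ?thesis by (intro bexI[of _ i]) auto
    next
      case False
      then show ?thesis using step.prems by (intro bexI[of _ "Suc n"]) auto
    qed
  qed
  from this[OF N] obtain i where i: "i \<in> {1..N}" "p i \<le> x" "x \<le> p (Suc i)"
    using x p_last by auto
  have "\<exists>t\<ge>0. t \<le> 1 \<and> Y i t = x"
    using IVT'[of "Y i" 0 x 1] i cY Y_0 Y_1 by auto
  then show ?thesis using that i(1) by auto
qed

lemma LINT_sum_split:
  fixes v :: "real \<Rightarrow> complex"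
  assumes v: "set_integrable lborel {0..1} v" and q: "\<And>j. m \<le> j \<Longrightarrow> j < n \<Longrightarrow> q j \<le> q (Suc j)"
    and "m \<le> n" and "0 \<le> q m" "q n \<le> 1"
  shows "(\<Sum>j=m..<n. (LINT s:{q j..q (Suc j)}|lborel. v s)) = (LINT s:{q m..q n}|lborel. v s)"
proof -
  have mono: "q i \<le> q j" if "m \<le> i" "i \<le> j" "j \<le> n" for i j
    using that(2,3)
  proof (induction j rule: dec_induct)
    case (step k)
    then show ?case using q[of k] that(1) by auto
  qed simp
  show ?thesis
    using assms(3,5) q mono
  proof (induction n rule: dec_induct)
    case base
    then show ?case
      using set_borel_integral_eq_integral(2)[OF set_integrable_sub[OF v], of "q m" "q m"] assms(4) by simp
  next
    case (step k)
    have k: "q m \<le> q k" "q k \<le> q (Suc k)" "q (Suc k) \<le> 1"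
      using step.prems step.hyps by auto
    have "(\<Sum>j=m..<k. (LINT s:{q j..q (Suc j)}|lborel. v s)) = (LINT s:{q m..q k}|lborel. v s)"
      using step.prems k by (intro step.IH) auto
    then show ?case
      using LINT_split[OF v assms(4) k] step.hyps by simp
  qed
qed

lemma of_real_L1:
  "(LINT s:{0..1}|lborel. complex_of_real (cmod (v s))) = complex_of_real (L1 v)"
  unfolding L1_def by (rule set_integral_complex_of_real)

text \<open>The substitutions \<open>s = Y i x\<close> turn the integrals into those over the intervals of the partition.\<close>

lemma sum_L1_branches:
  assumes v: "set_integrable lborel {0..1} v"
  shows "(\<Sum>i=1..N. L1 (\<lambda>x. v (Y i x) * complex_of_real (Y1 i x))) = L1 v"
    and "i \<in> {1..N} \<Longrightarrow> set_integrable lborel {0..1} (\<lambda>x. v (Y i x) * complex_of_real (Y1 i x))"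
proof -
  define w where "w s = complex_of_real (cmod (v s))" for s
  have w: "set_integrable lborel {0..1} w"
    using set_integrable_norm[OF v] unfolding w_def[abs_def] set_integrable_def
    by (drule_tac integrable_of_real[where 'a = complex]) (simp add: scaleR_conv_of_real)
  show int: "set_integrable lborel {0..1} (\<lambda>x. v (Y i x) * complex_of_real (Y1 i x))" if i: "i \<in> {1..N}" for i
  proof (rule LINT_substitution(1)[OF dY[OF i] cY1[OF i]])
    show "set_integrable lborel {Y i 0..Y i 1} v"
      using Y_range[OF i, of 0] Y_range[OF i, of 1] by (intro set_integrable_sub[OF v]) auto
  qed (use Y1_pos[OF i] in \<open>auto intro: less_imp_le\<close>)
  have branch: "(LINT s:{p i..p (Suc i)}|lborel. w s) = complex_of_real (L1 (\<lambda>x. v (Y i x) * complex_of_real (Y1 i x)))"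
    if i: "i \<in> {1..N}" for i
  proof -
    have "(LINT s:{Y i 0..Y i 1}|lborel. w s) = (LINT t:{0..1}|lborel. w (Y i t) * complex_of_real (Y1 i t))"
    proof (rule LINT_substitution(2)[OF dY[OF i] cY1[OF i]])
      show "set_integrable lborel {Y i 0..Y i 1} w"
        using Y_range[OF i, of 0] Y_range[OF i, of 1] by (intro set_integrable_sub[OF w]) auto
    qed (use Y1_pos[OF i] in \<open>auto intro: less_imp_le\<close>)
    also have "\<dots> = (LINT t:{0..1}|lborel. complex_of_real (cmod (v (Y i t) * complex_of_real (Y1 i t))))"
    proof (intro set_lebesgue_integral_cong allI impI)
      fix t :: real assume "t \<in> {0..1}"
      then show "w (Y i t) * complex_of_real (Y1 i t) = complex_of_real (cmod (v (Y i t) * complex_of_real (Y1 i t)))"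
        using Y1_pos[OF i, of t] by (simp add: w_def norm_mult)
    qed simp
    also have "\<dots> = complex_of_real (L1 (\<lambda>x. v (Y i x) * complex_of_real (Y1 i x)))"
      by (rule of_real_L1)
    finally show ?thesis using Y_0[OF i] Y_1[OF i] by simp
  qed
  have "complex_of_real (\<Sum>i=1..N. L1 (\<lambda>x. v (Y i x) * complex_of_real (Y1 i x)))
      = (\<Sum>i=1..<Suc N. (LINT s:{p i..p (Suc i)}|lborel. w s))"
    unfolding of_real_sum atLeastLessThanSuc_atLeastAtMost by (intro sum.cong refl branch[symmetric])
  also have "\<dots> = (LINT s:{p 1..p (Suc N)}|lborel. w s)"
    by (rule LINT_sum_split[OF w]) (use p_step p_first p_last N in auto)
  also have "\<dots> = complex_of_real (L1 v)"
    using of_real_L1[of v] by (simp add: p_first p_last w_def[abs_def] del: One_nat_def)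
  finally show "(\<Sum>i=1..N. L1 (\<lambda>x. v (Y i x) * complex_of_real (Y1 i x))) = L1 v"
    by (simp only: of_real_eq_iff)
qed

subsection \<open>Regularity\<close>

text \<open>If \<open>h\<close> has the derivatives \<open>g\<close> and \<open>v\<close>, then \<open>Op1\<close> and \<open>Op2\<close> below are the derivatives of \<open>Op h\<close>.\<close>

definition Op1 :: "(real \<Rightarrow> complex) \<Rightarrow> (real \<Rightarrow> complex) \<Rightarrow> real \<Rightarrow> complex" where
  "Op1 h g x = (\<Sum>i=1..N. complex_of_real (Y2 i x) * h (Y i x) + complex_of_real ((Y1 i x)\<^sup>2) * g (Y i x))"

definition Op2 :: "(real \<Rightarrow> complex) \<Rightarrow> (real \<Rightarrow> complex) \<Rightarrow> (real \<Rightarrow> complex) \<Rightarrow> real \<Rightarrow> complex" where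
  "Op2 h g v x = (\<Sum>i=1..N. complex_of_real (Y3 i x) * h (Y i x)
     + complex_of_real (3 * Y1 i x * Y2 i x) * g (Y i x)
     + complex_of_real ((Y1 i x)\<^sup>2) * (v (Y i x) * complex_of_real (Y1 i x)))"

lemma prim_of_real:
  assumes "\<And>x. x \<in> {0..1} \<Longrightarrow> (F has_real_derivative F' x) (at x within {0..1})" "continuous_on {0..1} F'"
  shows "prim (\<lambda>x. complex_of_real (F x)) (\<lambda>x. complex_of_real (F' x))"
  by (rule prim_C1) (auto intro!: has_vector_derivative_of_real continuous_on_of_real assms)

lemma prim_branch:
  assumes i: "i \<in> {1..N}" and u: "prim u u'"
  shows "prim (\<lambda>x. u (Y i x)) (\<lambda>x. u' (Y i x) * complex_of_real (Y1 i x))"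
  by (rule prim_comp[OF u dY[OF i] cY1[OF i]]) (use i Y_range Y1_pos in \<open>auto intro: less_imp_le\<close>)

lemma W2_Op:
  assumes W: "W2 h g v"
  shows "W2 (Op h) (Op1 h g) (Op2 h g v)"
proof -
  have h: "prim h g" and g: "prim g v" using W by (auto simp: W2_def)
  have P1: "prim (\<lambda>x. complex_of_real (Y1 i x)) (\<lambda>x. complex_of_real (Y2 i x))"
    and P2: "prim (\<lambda>x. complex_of_real (Y2 i x)) (\<lambda>x. complex_of_real (Y3 i x))" if "i \<in> {1..N}" for i
    using that by (auto intro!: prim_of_real dY1 dY2 cY2 cY3)
  have "prim (\<lambda>x. \<Sum>i=1..N. complex_of_real (Y1 i x) * h (Y i x))
     (\<lambda>x. \<Sum>i=1..N. complex_of_real (Y2 i x) * h (Y i x) + complex_of_real (Y1 i x) * (g (Y i x) * complex_of_real (Y1 i x)))"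
    by (intro prim_sum prim_mult P1 prim_branch h)
  then have 1: "prim (Op h) (Op1 h g)"
    by (rule prim_cong) (auto simp: Op_def Op1_def power2_eq_square mult_ac)
  have "prim (\<lambda>x. \<Sum>i=1..N. complex_of_real (Y2 i x) * h (Y i x)
        + (complex_of_real (Y1 i x) * complex_of_real (Y1 i x)) * g (Y i x))
     (\<lambda>x. \<Sum>i=1..N. (complex_of_real (Y3 i x) * h (Y i x) + complex_of_real (Y2 i x) * (g (Y i x) * complex_of_real (Y1 i x)))
        + ((complex_of_real (Y2 i x) * complex_of_real (Y1 i x) + complex_of_real (Y1 i x) * complex_of_real (Y2 i x)) * g (Y i x)
          + (complex_of_real (Y1 i x) * complex_of_real (Y1 i x)) * (v (Y i x) * complex_of_real (Y1 i x))))"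
    by (intro prim_sum prim_add prim_mult P1 P2 prim_branch h g)
  then have "prim (Op1 h g) (Op2 h g v)"
    by (rule prim_cong) (auto simp: Op2_def Op1_def power2_eq_square algebra_simps intro!: sum.cong)
  then show ?thesis using 1 by (simp add: W2_def)
qed

lemma W21_Op: "h \<in> W21 \<Longrightarrow> Op h \<in> W21"
  using W2_Op[OF W21_W2, of h] unfolding W21_iff[of "Op h"] by (auto simp: Op_def)

subsection \<open>Approximation by operators of finite rank\<close>

text \<open>The step function that samples \<open>u\<close> at the left ends of \<open>n\<close> equal intervals.\<close>

definition steps :: "nat \<Rightarrow> (real \<Rightarrow> complex) \<Rightarrow> real \<Rightarrow> complex" where
  "steps n u x = (\<Sum>j<n. indicator {real j / real n..<real (Suc j) / real n} x * u (real j / real n))"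

lemma step_interval:
  assumes n: "0 < n" and x: "0 \<le> x" "x < 1"
  obtains k where "k < n" "x \<in> {real k / real n..<real (Suc k) / real n}"
    "\<And>j. x \<in> {real j / real n..<real (Suc j) / real n} \<longleftrightarrow> j = k"
proof -
  define k where "k = nat \<lfloor>x * real n\<rfloor>"
  have mem: "x \<in> {real j / real n..<real (Suc j) / real n} \<longleftrightarrow> \<lfloor>x * real n\<rfloor> = int j" for j
    using n by (simp add: floor_eq_iff field_simps)
  have "\<lfloor>x * real n\<rfloor> = int k" using x n by (simp add: k_def)
  moreover have "k < n"
  proof -
    have "x * real n < real n" using x n by simp
    then show ?thesis using x n unfolding k_def by (simp add: nat_less_iff floor_less_iff)
  qed
  ultimately show ?thesis using that[of k] mem by auto
qed

text \<open>On each of the intervals the error is at most the integral of \<open>cmod u'\<close> over it.\<close>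

lemma L1_steps:
  assumes u: "prim u u'" and n: "0 < n"
  shows "L1 (\<lambda>x. u x - steps n u x) \<le> L1 u' / real n"
    and "set_integrable lborel {0..1} (\<lambda>x. u x - steps n u x)"
proof -
  define q where "q j = real j / real n" for j
  define w where "w s = complex_of_real (cmod (u' s))" for s
  have u'i: "set_integrable lborel {0..1} u'" by (rule prim_integrable[OF u])
  have w: "set_integrable lborel {0..1} w"
    using set_integrable_norm[OF u'i] unfolding w_def[abs_def] set_integrable_def
    by (drule_tac integrable_of_real[where 'a = complex]) (simp add: scaleR_conv_of_real)
  define m where "m j = (LINT s:{q j..q (Suc j)}|lborel. cmod (u' s))" for j
  have q: "q j \<le> q (Suc j)" "0 \<le> q j" "j < n \<Longrightarrow> q (Suc j) \<le> 1" for j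
    using n by (auto simp: q_def divide_right_mono)
  have wm: "(LINT s:{q j..q (Suc j)}|lborel. w s) = complex_of_real (m j)" for j
    unfolding w_def m_def by (rule set_integral_complex_of_real)
  have "complex_of_real (\<Sum>j<n. m j) = (\<Sum>j=0..<n. (LINT s:{q j..q (Suc j)}|lborel. w s))"
    by (simp add: wm atLeast0LessThan)
  also have "\<dots> = (LINT s:{q 0..q n}|lborel. w s)"
    by (rule LINT_sum_split[OF w]) (use q n in \<open>auto simp: q_def\<close>)
  also have "\<dots> = complex_of_real (L1 u')" using of_real_L1[of u'] n by (simp add: q_def w_def[abs_def])
  finally have sum_m: "(\<Sum>j<n. m j) = L1 u'" by (simp only: of_real_eq_iff)
  have ui: "set_integrable lborel {0..1} u"
    by (intro borel_integrable_atLeastAtMost' prim_continuous[OF u])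
  have si: "set_integrable lborel {0..1} (steps n u)"
    unfolding steps_def[abs_def] set_integrable_def scaleR_sum_right
  proof (intro Bochner_Integration.integrable_sum)
    fix j
    have "integrable lborel (\<lambda>x. indicator ({0..1} \<inter> {real j / real n..<real (Suc j) / real n}) x *\<^sub>R u (real j / real n))"
      by (intro Bochner_Integration.integrable_scaleR_left integrable_real_indicator)
         (auto intro: le_less_trans[OF emeasure_mono[of _ "{0..1}"]])
    moreover have "indicator ({0..1} \<inter> {real j / real n..<real (Suc j) / real n}) x *\<^sub>R u (real j / real n) =
        indicator {0..1} x *\<^sub>R (indicator {real j / real n..<real (Suc j) / real n} x * u (real j / real n))" for x
      by (auto simp: indicator_def)
    ultimately show "integrable lborel (\<lambda>x. indicator {0..1} x *\<^sub>R (indicator {real j / real n..<real (Suc j) / real n} x * u (real j / real n)))"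
      by simp
  qed
  show usi: "set_integrable lborel {0..1} (\<lambda>x. u x - steps n u x)"
    by (rule set_integral_diff(1)[OF ui si])
  have "L1 (\<lambda>x. u x - steps n u x) \<le> (LINT x|lborel. (\<Sum>j<n. indicator {q j..<q (Suc j)} x * m j))"
    unfolding L1_def set_lebesgue_integral_def
  proof (rule integral_mono_AE)
    show "integrable lborel (\<lambda>x. indicator {0..1} x *\<^sub>R cmod (u x - steps n u x))"
      using set_integrable_norm[OF usi] by (simp add: set_integrable_def)
    show "integrable lborel (\<lambda>x. \<Sum>j<n. indicator {q j..<q (Suc j)} x * m j)"
      using q by (intro Bochner_Integration.integrable_sum integrable_mult_left integrable_real_indicator) auto
    show "AE x in lborel. indicator {0..1} x *\<^sub>R cmod (u x - steps n u x) \<le> (\<Sum>j<n. indicator {q j..<q (Suc j)} x * m j)"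
      using AE_lborel_singleton[of 1]
    proof eventually_elim
      case (elim x)
      have m0: "m j \<ge> 0" for j unfolding m_def set_lebesgue_integral_def
        by (intro integral_nonneg_AE) (auto simp: indicator_def)
      show ?case
      proof (cases "x \<in> {0..1}")
        case True
        then have x: "0 \<le> x" "x < 1" using elim by auto
        obtain k where k: "k < n" "x \<in> {q k..<q (Suc k)}" "\<And>j. x \<in> {q j..<q (Suc j)} \<longleftrightarrow> j = k"
          using step_interval[OF n x] unfolding q_def by metis
        have ind: "indicator {q j..<q (Suc j)} x = (if j = k then 1 else 0 :: 'b :: zero_neq_one)" for j
          using k(3)[of j] by (simp add: indicator_def)
        have "steps n u x = u (q k)"
          unfolding steps_def q_def[symmetric] ind using k(1) by (simp add: if_distrib[of "\<lambda>a. a * _"] cong: if_cong)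
        moreover have "(\<Sum>j<n. indicator {q j..<q (Suc j)} x * m j) = m k"
          unfolding ind using k(1) by (simp add: if_distrib[of "\<lambda>a. a * _"] cong: if_cong)
        moreover have "cmod (u x - u (q k)) \<le> m k"
        proof -
          have "u x - u (q k) = (LINT t:{q k..x}|lborel. u' t)"
            using k(2) q x by (intro prim_diff[OF u]) auto
          also have "cmod \<dots> \<le> (LINT t:{q k..x}|lborel. cmod (u' t))"
            by (rule set_integral_norm_bound[OF set_integrable_sub[OF u'i]]) (use q x in auto)
          also have "\<dots> \<le> m k" unfolding m_def set_lebesgue_integral_def
          proof (rule integral_mono)
            show "integrable lborel (\<lambda>t. indicator {q k..x} t *\<^sub>R cmod (u' t))"
              using set_integrable_norm[OF set_integrable_sub[OF u'i], of "q k" x] q x by (simp add: set_integrable_def)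
            show "integrable lborel (\<lambda>t. indicator {q k..q (Suc k)} t *\<^sub>R cmod (u' t))"
              using set_integrable_norm[OF set_integrable_sub[OF u'i], of "q k" "q (Suc k)"] q k(1) by (simp add: set_integrable_def)
          qed (use k(2) in \<open>auto simp: indicator_def\<close>)
          finally show ?thesis .
        qed
        ultimately show ?thesis using True by simp
      qed (auto intro!: sum_nonneg m0)
    qed
  qed
  also have "\<dots> = (\<Sum>j<n. (q (Suc j) - q j) * m j)"
    using q by (subst Bochner_Integration.integral_sum)
      (auto intro!: integrable_mult_left integrable_real_indicator sum.cong)
  also have "\<dots> = (\<Sum>j<n. m j) / real n"
    by (simp add: q_def sum_divide_distrib diff_divide_distrib[symmetric] cong: sum.cong)
  finally show "L1 (\<lambda>x. u x - steps n u x) \<le> L1 u' / real n" by (simp add: sum_m)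
qed

end

lemma L1_sum:
  assumes "\<And>i. i \<in> I \<Longrightarrow> set_integrable lborel {0..1} (f i)"
  shows "L1 (\<lambda>x. \<Sum>i\<in>I. f i x) \<le> (\<Sum>i\<in>I. L1 (f i)) \<and> set_integrable lborel {0..1} (\<lambda>x. \<Sum>i\<in>I. f i x)"
  using assms
proof (induction I rule: infinite_finite_induct)
  case (insert i I)
  then have IH: "L1 (\<lambda>x. \<Sum>i\<in>I. f i x) \<le> (\<Sum>i\<in>I. L1 (f i))" "set_integrable lborel {0..1} (\<lambda>x. \<Sum>i\<in>I. f i x)"
    and fi: "set_integrable lborel {0..1} (f i)" by auto
  from L1_triangle[OF fi IH(2)] IH(1) set_integral_add(1)[OF fi IH(2)] insert(1,2) show ?case
    by simp
qed (auto simp: L1_def set_integrable_def)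

lemma L1_mult_le:
  assumes w: "set_integrable lborel {0..1} w" and c: "continuous_on {0..1} c"
    and M: "\<And>x. x \<in> {0..1} \<Longrightarrow> \<bar>c x\<bar> \<le> M"
  shows "L1 (\<lambda>x. complex_of_real (c x) * w x) \<le> M * L1 w"
    and "set_integrable lborel {0..1} (\<lambda>x. complex_of_real (c x) * w x)"
proof -
  show int: "set_integrable lborel {0..1} (\<lambda>x. complex_of_real (c x) * w x)"
    by (intro set_integrable_continuous_mult w continuous_on_of_real c)
  have "L1 (\<lambda>x. complex_of_real (c x) * w x) \<le> (LINT x:{0..1}|lborel. M * cmod (w x))"
    unfolding L1_def
    by (rule set_integral_mono)
       (use M set_integrable_norm[OF int] set_integrable_norm[OF w] in \<open>auto simp: norm_mult intro!: mult_right_mono\<close>)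
  also have "\<dots> = M * L1 w" by (simp add: L1_def)
  finally show "L1 (\<lambda>x. complex_of_real (c x) * w x) \<le> M * L1 w" .
qed

lemma from_d2_dd:
  assumes v: "set_integrable lborel {0..1} v"
  shows "W2 (from_d2 a c v) (dd (from_d2 a c v)) v" "from_d2 a c v 0 = a" "dd (from_d2 a c v) 0 = c"
    "from_d2 a c v \<in> W21"
proof -
  obtain g where g: "W2 (from_d2 a c v) g v" "from_d2 a c v 0 = a" "g 0 = c" "from_d2 a c v \<in> W21"
    by (rule from_d2[OF v, of a c])
  then show "W2 (from_d2 a c v) (dd (from_d2 a c v)) v" "from_d2 a c v 0 = a" "dd (from_d2 a c v) 0 = c"
    "from_d2 a c v \<in> W21"
    using W2_dd_left[OF g(1)] W2_dd[OF g(1), of 0] by auto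
qed

lemma Rep_bound:
  assumes "x \<in> {0..1}"
  shows "cmod (Rep_w21 w x) \<le> norm w" "cmod (dd (Rep_w21 w) x) \<le> norm w" "L1 (dd (Rep_w21 w)) \<le> norm w"
proof -
  define h where "h = Rep_w21 w"
  have W: "W2 h (dd h) (d2 h)" unfolding h_def by (rule W21_W2[OF Rep_w21])
  then have p: "prim h (dd h)" "prim (dd h) (d2 h)" by (auto simp: W2_def)
  have n: "norm w = cmod (h 0) + cmod (dd h 0) + L1 (d2 h)" by (simp add: norm_w21.rep_eq nrm_def h_def)
  have g: "cmod (dd h x) \<le> cmod (dd h 0) + L1 (d2 h)" if "x \<in> {0..1}" for x
    by (rule prim_bound[OF p(2) that])
  have L1g: "L1 (dd h) \<le> cmod (dd h 0) + L1 (d2 h)"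
    by (rule L1_le_sup[OF prim_continuous[OF p(2)] g])
  show "cmod (dd (Rep_w21 w) x) \<le> norm w" using g[OF assms] n norm_ge_zero[of "h 0"] unfolding h_def by linarith
  show "L1 (dd (Rep_w21 w)) \<le> norm w" using L1g n norm_ge_zero[of "h 0"] unfolding h_def by linarith
  show "cmod (Rep_w21 w x) \<le> norm w" using prim_bound[OF p(1) assms] L1g n unfolding h_def by linarith
qed

lemma cfunctional_eval: "x \<in> {0..1} \<Longrightarrow> W.cfunctional (\<lambda>w. Rep_w21 w x)"
  unfolding W.cfunctional_def
  by (auto intro!: bounded_linear_intro[of _ 1]
      simp: plus_w21.rep_eq scaleR_w21.rep_eq cscale.rep_eq Rep_bound scaleR_conv_of_real)

lemma cfunctional_eval_dd:
  assumes x: "x \<in> {0..1}"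
  shows "W.cfunctional (\<lambda>w. dd (Rep_w21 w) x)"
proof -
  note W = W21_W2[OF Rep_w21]
  have add: "dd (Rep_w21 (a + b)) x = dd (Rep_w21 a) x + dd (Rep_w21 b) x" for a b
    using W2_dd[OF W2_add[OF W W] x, of a b] by (simp add: plus_w21.rep_eq)
  have sc: "dd (Rep_w21 (cscale c a)) x = c * dd (Rep_w21 a) x" for a c
    using W2_dd[OF W2_cmult[OF W] x, of c a] by (simp add: cscale.rep_eq)
  have "dd (Rep_w21 (r *\<^sub>R a)) x = r *\<^sub>R dd (Rep_w21 a) x" for r a
    using sc[of "complex_of_real r" a] by (simp add: W.cs_of_real scaleR_conv_of_real)
  then show ?thesis unfolding W.cfunctional_def
    using Rep_bound(2)[OF x] by (auto intro!: bounded_linear_intro[of _ 1] simp: add sc)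
qed

context branch_system
begin

definition L :: "w21 \<Rightarrow> w21" where "L w = Abs_w21 (Op (Rep_w21 w))"

lemma Rep_L: "Rep_w21 (L w) = Op (Rep_w21 w)"
  by (simp add: L_def Abs_w21_inverse W21_Op Rep_w21)

definition node :: "nat \<Rightarrow> nat \<Rightarrow> real" where "node n j = real j / real n"

text \<open>The approximating operator is \<open>w \<mapsto> \<Sum>t. fun_of n t w \<odot> vec_of n t\<close>, where the index \<open>t = (i, j, b)\<close> stands for
  the branch \<open>i\<close>, the grid point \<open>j\<close> and, according to \<open>b\<close>, the sampling of the function or of its
  derivative.\<close>

definition fun_of :: "nat \<Rightarrow> nat \<times> nat \<times> bool \<Rightarrow> w21 \<Rightarrow> complex" where
  "fun_of n t w = (case t of (i, j, b) \<Rightarrow>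
     if b then Rep_w21 w (Y i (node n j)) else dd (Rep_w21 w) (Y i (node n j)))"

definition vec_d2 :: "nat \<Rightarrow> nat \<times> nat \<times> bool \<Rightarrow> real \<Rightarrow> complex" where
  "vec_d2 n t x = (case t of (i, j, b) \<Rightarrow>
     complex_of_real (if b then Y3 i x else 3 * Y1 i x * Y2 i x) * indicator {node n j..<node n (Suc j)} x)"

text \<open>The initial values are chosen such that the approximating operator reproduces the value and the slope of the
  image at \<open>0\<close> exactly; they are attached to the terms with \<open>j = 0\<close>, which sample at the points \<open>Y i 0\<close>.\<close>

definition vec_of :: "nat \<Rightarrow> nat \<times> nat \<times> bool \<Rightarrow> w21" where
  "vec_of n t = (case t of (i, j, b) \<Rightarrow> Abs_w21 (from_d2
     (complex_of_real (if b \<and> j = 0 then Y1 i 0 else 0))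
     (complex_of_real (if j = 0 then if b then Y2 i 0 else (Y1 i 0)\<^sup>2 else 0))
     (vec_d2 n t)))"

definition grid :: "nat \<Rightarrow> (nat \<times> nat \<times> bool) set" where
  "grid n = {1..N} \<times> {..<n} \<times> UNIV"

lemma finite_grid: "finite (grid n)"
  by (simp add: grid_def)

lemma sum_grid: "(\<Sum>t\<in>grid n. f t) = (\<Sum>i=1..N. \<Sum>j<n. f (i, j, True) + f (i, j, False))"
proof -
  have "(\<Sum>t\<in>grid n. f t) = (\<Sum>i=1..N. \<Sum>jb\<in>{..<n} \<times> UNIV. f (i, jb))"
    unfolding grid_def by (subst sum.cartesian_product) simp
  also have "\<dots> = (\<Sum>i=1..N. \<Sum>j<n. \<Sum>b\<in>UNIV. f (i, j, b))"
    by (subst sum.cartesian_product) simp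
  finally show ?thesis by (simp add: UNIV_bool add.commute)
qed

lemma bounded_weights:
  obtains C where "C \<ge> 1" "\<And>i x. i \<in> {1..N} \<Longrightarrow> x \<in> {0..1} \<Longrightarrow> \<bar>Y3 i x\<bar> \<le> C"
    "\<And>i x. i \<in> {1..N} \<Longrightarrow> x \<in> {0..1} \<Longrightarrow> \<bar>3 * Y1 i x * Y2 i x\<bar> \<le> C"
proof -
  have bd: "\<exists>C. \<forall>x\<in>{0..1}. \<bar>F x\<bar> \<le> C" if "continuous_on {0..1} F" for F :: "real \<Rightarrow> real"
    using compact_imp_bounded[OF compact_continuous_image[OF that compact_Icc]] unfolding bounded_iff by auto
  have "\<exists>C. \<forall>x\<in>{0..1}. \<bar>Y3 i x\<bar> \<le> C" if "i \<in> {1..N}" for i using bd cY3 that by blast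
  then obtain C1 where C1: "\<And>i x. i \<in> {1..N} \<Longrightarrow> x \<in> {0..1} \<Longrightarrow> \<bar>Y3 i x\<bar> \<le> C1 i" by metis
  have "\<exists>C. \<forall>x\<in>{0..1}. \<bar>3 * Y1 i x * Y2 i x\<bar> \<le> C" if "i \<in> {1..N}" for i
    using that by (intro bd continuous_intros cY1 cY2)
  then obtain C2 where C2: "\<And>i x. i \<in> {1..N} \<Longrightarrow> x \<in> {0..1} \<Longrightarrow> \<bar>3 * Y1 i x * Y2 i x\<bar> \<le> C2 i" by metis
  define C where "C = 1 + (\<Sum>i=1..N. \<bar>C1 i\<bar> + \<bar>C2 i\<bar>)"
  have le: "\<bar>C1 i\<bar> + \<bar>C2 i\<bar> \<le> C" if "i \<in> {1..N}" for i
    unfolding C_def using that member_le_sum[of i "{1..N}" "\<lambda>i. \<bar>C1 i\<bar> + \<bar>C2 i\<bar>"] by simp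
  show ?thesis
  proof (rule that[of C])
    show "C \<ge> 1" by (simp add: C_def sum_nonneg)
    show "\<bar>Y3 i x\<bar> \<le> C" if "i \<in> {1..N}" "x \<in> {0..1}" for i x using C1[OF that] le[OF that(1)] by linarith
    show "\<bar>3 * Y1 i x * Y2 i x\<bar> \<le> C" if "i \<in> {1..N}" "x \<in> {0..1}" for i x using C2[OF that] le[OF that(1)] by linarith
  qed
qed

lemma vec_d2_integrable:
  assumes "t \<in> grid n"
  shows "set_integrable lborel {0..1} (vec_d2 n t)"
proof -
  obtain i j b where t: "t = (i, j, b)" "i \<in> {1..N}" using assms by (auto simp: grid_def)
  have ind: "set_integrable lborel {0..1} (\<lambda>x. indicator {node n j..<node n (Suc j)} x :: complex)"
  proof -
    have "integrable lborel (\<lambda>x. indicator ({0..1} \<inter> {node n j..<node n (Suc j)}) x *\<^sub>R (1::complex))"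
      by (intro Bochner_Integration.integrable_scaleR_left integrable_real_indicator)
         (auto intro: le_less_trans[OF emeasure_mono[of _ "{0..1}"]])
    moreover have "indicator ({0..1} \<inter> {node n j..<node n (Suc j)}) x *\<^sub>R (1::complex) =
        indicator {0..1} x *\<^sub>R indicator {node n j..<node n (Suc j)} x" for x
      by (auto simp: indicator_def)
    ultimately show ?thesis by (simp add: set_integrable_def)
  qed
  have "continuous_on {0..1} (\<lambda>x. complex_of_real (if b then Y3 i x else 3 * Y1 i x * Y2 i x))"
    by (cases b) (simp_all, intro continuous_intros cY1[OF t(2)] cY2[OF t(2)] cY3[OF t(2)],
        intro continuous_intros cY1[OF t(2)] cY2[OF t(2)] cY3[OF t(2)])
  from set_integrable_continuous_mult[OF this ind] show ?thesis
    by (simp add: vec_d2_def[abs_def] t)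
qed

lemma vec_of:
  assumes "t \<in> grid n"
  shows "W2 (Rep_w21 (vec_of n t)) (dd (Rep_w21 (vec_of n t))) (vec_d2 n t)"
    "Rep_w21 (vec_of n t) 0 = (case t of (i, j, b) \<Rightarrow> complex_of_real (if b \<and> j = 0 then Y1 i 0 else 0))"
    "dd (Rep_w21 (vec_of n t)) 0 =
      (case t of (i, j, b) \<Rightarrow> complex_of_real (if j = 0 then if b then Y2 i 0 else (Y1 i 0)\<^sup>2 else 0))"
proof -
  obtain i j b where t: "t = (i, j, b)" by (cases t)
  note f = from_d2_dd[OF vec_d2_integrable[OF assms]]
  show "W2 (Rep_w21 (vec_of n t)) (dd (Rep_w21 (vec_of n t))) (vec_d2 n t)"
    "Rep_w21 (vec_of n t) 0 = (case t of (i, j, b) \<Rightarrow> complex_of_real (if b \<and> j = 0 then Y1 i 0 else 0))"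
    "dd (Rep_w21 (vec_of n t)) 0 =
      (case t of (i, j, b) \<Rightarrow> complex_of_real (if j = 0 then if b then Y2 i 0 else (Y1 i 0)\<^sup>2 else 0))"
    using f unfolding vec_of_def t by (simp_all add: Abs_w21_inverse)
qed

text \<open>Value and slope at \<open>0\<close> agree, so the norm of the difference is the \<open>L\<^sup>1\<close> norm of its second derivative. There,
  \<open>h \<circ> Y i\<close> and \<open>h' \<circ> Y i\<close> have been replaced by step functions, at a cost of order \<open>1 / n\<close>, and the term
  with the second derivative of \<open>h\<close> remains: it carries the factor \<open>(Y1 i)\<^sup>2 \<le> \<mu>\<^sup>2\<close>, while the third factor
  \<open>Y1 i\<close> is the Jacobian consumed by \<open>sum_L1_branches\<close>.\<close>

lemma finite_rank_approximation:
  assumes n: "0 < n" and C: "C \<ge> 1"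
    "\<And>i x. i \<in> {1..N} \<Longrightarrow> x \<in> {0..1} \<Longrightarrow> \<bar>Y3 i x\<bar> \<le> C"
    "\<And>i x. i \<in> {1..N} \<Longrightarrow> x \<in> {0..1} \<Longrightarrow> \<bar>3 * Y1 i x * Y2 i x\<bar> \<le> C"
  shows "norm (L w - (\<Sum>t\<in>grid n. cscale (fun_of n t w) (vec_of n t))) \<le> (\<mu>\<^sup>2 + 2 * C / real n) * norm w"
proof -
  define h where "h = Rep_w21 w"
  define g where "g = dd h"
  define v where "v = d2 h"
  have W: "W2 h g v" unfolding h_def g_def v_def by (rule W21_W2[OF Rep_w21])
  then have hg: "prim h g" and gv: "prim g v" by (auto simp: W2_def)
  have gi: "set_integrable lborel {0..1} g" and vi: "set_integrable lborel {0..1} v"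
    using hg gv by (auto dest: prim_integrable)
  define l where "l t = fun_of n t w" for t
  define k where "k = Rep_w21 (L w - (\<Sum>t\<in>grid n. cscale (fun_of n t w) (vec_of n t)))"
  define K2 where "K2 x = Op2 h g v x + (-1) * (\<Sum>t\<in>grid n. l t * vec_d2 n t x)" for x
  have k_eq: "k = (\<lambda>x. Op h x + (-1) * (\<Sum>t\<in>grid n. l t * Rep_w21 (vec_of n t) x))"
    by (simp add: k_def h_def l_def minus_w21.rep_eq Rep_L Rep_sum cscale.rep_eq)
  have Wk: "W2 k (\<lambda>x. Op1 h g x + (-1) * (\<Sum>t\<in>grid n. l t * dd (Rep_w21 (vec_of n t)) x)) K2"
    unfolding k_eq K2_def by (intro W2_add W2_cmult W2_sum W2_Op W vec_of(1))
  have node0: "node n 0 = 0" by (simp add: node_def)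
  have delta: "(\<Sum>j<n. if j = 0 then f j else (0::complex)) = f 0" for f
    using n by (simp add: sum.delta)
  have "(\<Sum>t\<in>grid n. l t * Rep_w21 (vec_of n t) 0)
      = (\<Sum>t\<in>grid n. l t * (case t of (i, j, b) \<Rightarrow> complex_of_real (if b \<and> j = 0 then Y1 i 0 else 0)))"
    by (intro sum.cong refl) (simp add: vec_of(2))
  also have "\<dots> = (\<Sum>i=1..N. \<Sum>j<n. if j = 0 then complex_of_real (Y1 i 0) * h (Y i (node n j)) else 0)"
    unfolding sum_grid by (intro sum.cong refl) (simp add: l_def fun_of_def h_def)
  also have "\<dots> = Op h 0" unfolding delta by (simp add: Op_def node0)
  finally have k0: "k 0 = 0" by (simp add: k_eq)
  have "(\<Sum>t\<in>grid n. l t * dd (Rep_w21 (vec_of n t)) 0)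
      = (\<Sum>t\<in>grid n. l t * (case t of (i, j, b) \<Rightarrow> complex_of_real (if j = 0 then if b then Y2 i 0 else (Y1 i 0)\<^sup>2 else 0)))"
    by (intro sum.cong refl) (simp add: vec_of(3))
  also have "\<dots> = (\<Sum>i=1..N. \<Sum>j<n. if j = 0 then complex_of_real (Y2 i 0) * h (Y i (node n j)) +
      complex_of_real ((Y1 i 0)\<^sup>2) * g (Y i (node n j)) else 0)"
    unfolding sum_grid by (intro sum.cong refl) (simp add: l_def fun_of_def h_def g_def)
  also have "\<dots> = Op1 h g 0" unfolding delta by (simp add: Op1_def node0)
  finally have k1: "Op1 h g 0 + (-1) * (\<Sum>t\<in>grid n. l t * dd (Rep_w21 (vec_of n t)) 0) = 0" by simp
  have norm_eq: "norm (L w - (\<Sum>t\<in>grid n. cscale (fun_of n t w) (vec_of n t))) = L1 K2"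
    using nrm_eq[OF Wk] k0 k1 by (simp add: norm_w21.rep_eq k_def)
  define eh where "eh i x = h (Y i x) - steps n (\<lambda>x. h (Y i x)) x" for i x
  define eg where "eg i x = g (Y i x) - steps n (\<lambda>x. g (Y i x)) x" for i x
  define hY where "hY i x = g (Y i x) * complex_of_real (Y1 i x)" for i x
  define gY where "gY i x = v (Y i x) * complex_of_real (Y1 i x)" for i x
  have K2_eq: "K2 = (\<lambda>x. \<Sum>i=1..N. complex_of_real (Y3 i x) * eh i x
      + (complex_of_real (3 * Y1 i x * Y2 i x) * eg i x + complex_of_real ((Y1 i x)\<^sup>2) * gY i x))"
  proof
    fix x
    have "(\<Sum>t\<in>grid n. l t * vec_d2 n t x) =
      (\<Sum>i=1..N. complex_of_real (Y3 i x) * steps n (\<lambda>x. h (Y i x)) x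
        + complex_of_real (3 * Y1 i x * Y2 i x) * steps n (\<lambda>x. g (Y i x)) x)"
      unfolding sum_grid steps_def sum_distrib_left sum.distrib[symmetric]
      by (intro sum.cong refl) (simp add: l_def fun_of_def vec_d2_def h_def g_def node_def mult_ac del: indicator_simps)
    then show "K2 x = (\<Sum>i=1..N. complex_of_real (Y3 i x) * eh i x
      + (complex_of_real (3 * Y1 i x * Y2 i x) * eg i x + complex_of_real ((Y1 i x)\<^sup>2) * gY i x))"
      by (simp add: K2_def Op2_def eh_def eg_def gY_def sum.distrib sum_subtractf algebra_simps)
  qed
  have ph: "prim (\<lambda>x. h (Y i x)) (hY i)" and pg: "prim (\<lambda>x. g (Y i x)) (gY i)" if "i \<in> {1..N}" for i
    unfolding hY_def gY_def using that by (auto intro!: prim_branch hg gv)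
  have ehi: "L1 (eh i) \<le> L1 (hY i) / real n" "set_integrable lborel {0..1} (eh i)"
    and egi: "L1 (eg i) \<le> L1 (gY i) / real n" "set_integrable lborel {0..1} (eg i)" if "i \<in> {1..N}" for i
    unfolding eh_def eg_def using L1_steps[OF ph[OF that] n] L1_steps[OF pg[OF that] n] by auto
  have gYi: "set_integrable lborel {0..1} (gY i)" if "i \<in> {1..N}" for i
    unfolding gY_def by (rule sum_L1_branches(2)[OF vi that])
  have term1: "L1 (\<lambda>x. complex_of_real (Y3 i x) * eh i x) \<le> C * (L1 (hY i) / real n)"
    "set_integrable lborel {0..1} (\<lambda>x. complex_of_real (Y3 i x) * eh i x)" if i: "i \<in> {1..N}" for i
    using L1_mult_le[OF ehi(2)[OF i] cY3[OF i] C(2)[OF i]] mult_left_mono[OF ehi(1)[OF i], of C] C(1) by auto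
  have c12: "continuous_on {0..1} (\<lambda>x. 3 * Y1 i x * Y2 i x)" "continuous_on {0..1} (\<lambda>x. (Y1 i x)\<^sup>2)"
    if "i \<in> {1..N}" for i
    using that by (auto intro!: continuous_intros cY1 cY2)
  have term2: "L1 (\<lambda>x. complex_of_real (3 * Y1 i x * Y2 i x) * eg i x) \<le> C * (L1 (gY i) / real n)"
    "set_integrable lborel {0..1} (\<lambda>x. complex_of_real (3 * Y1 i x * Y2 i x) * eg i x)" if i: "i \<in> {1..N}" for i
    using L1_mult_le[OF egi(2)[OF i] c12(1)[OF i] C(3)[OF i]] mult_left_mono[OF egi(1)[OF i], of C] C(1) by auto
  have Y1sq: "\<bar>(Y1 i x)\<^sup>2\<bar> \<le> \<mu>\<^sup>2" if "i \<in> {1..N}" "x \<in> {0..1}" for i x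
    using Y1_le_mu[OF that] Y1_pos[OF that] by (simp add: power_mono)
  have term3: "L1 (\<lambda>x. complex_of_real ((Y1 i x)\<^sup>2) * gY i x) \<le> \<mu>\<^sup>2 * L1 (gY i)"
    "set_integrable lborel {0..1} (\<lambda>x. complex_of_real ((Y1 i x)\<^sup>2) * gY i x)" if i: "i \<in> {1..N}" for i
    using L1_mult_le[OF gYi[OF i] c12(2)[OF i] Y1sq[OF i]] by auto
  have each: "L1 (\<lambda>x. complex_of_real (Y3 i x) * eh i x
      + (complex_of_real (3 * Y1 i x * Y2 i x) * eg i x + complex_of_real ((Y1 i x)\<^sup>2) * gY i x))
      \<le> C / real n * L1 (hY i) + (C / real n + \<mu>\<^sup>2) * L1 (gY i)"
    and each_int: "set_integrable lborel {0..1} (\<lambda>x. complex_of_real (Y3 i x) * eh i x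
      + (complex_of_real (3 * Y1 i x * Y2 i x) * eg i x + complex_of_real ((Y1 i x)\<^sup>2) * gY i x))"
    if i: "i \<in> {1..N}" for i
  proof -
    note i23 = set_integral_add(1)[OF term2(2)[OF i] term3(2)[OF i]]
    show "set_integrable lborel {0..1} (\<lambda>x. complex_of_real (Y3 i x) * eh i x
      + (complex_of_real (3 * Y1 i x * Y2 i x) * eg i x + complex_of_real ((Y1 i x)\<^sup>2) * gY i x))"
      by (rule set_integral_add(1)[OF term1(2)[OF i] i23])
    have "C * (L1 (hY i) / real n) + (C * (L1 (gY i) / real n) + \<mu>\<^sup>2 * L1 (gY i))
       = C / real n * L1 (hY i) + (C / real n + \<mu>\<^sup>2) * L1 (gY i)"
      by (simp add: algebra_simps)
    then show "L1 (\<lambda>x. complex_of_real (Y3 i x) * eh i x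
      + (complex_of_real (3 * Y1 i x * Y2 i x) * eg i x + complex_of_real ((Y1 i x)\<^sup>2) * gY i x))
      \<le> C / real n * L1 (hY i) + (C / real n + \<mu>\<^sup>2) * L1 (gY i)"
      using L1_triangle[OF term1(2)[OF i] i23] L1_triangle[OF term2(2)[OF i] term3(2)[OF i]]
        term1(1)[OF i] term2(1)[OF i] term3(1)[OF i] by linarith
  qed
  have "L1 K2 \<le> (\<Sum>i=1..N. C / real n * L1 (hY i) + (C / real n + \<mu>\<^sup>2) * L1 (gY i))"
    unfolding K2_eq by (rule order_trans[OF L1_sum[THEN conjunct1] sum_mono]) (use each each_int in auto)
  also have "\<dots> = C / real n * (\<Sum>i=1..N. L1 (hY i)) + (C / real n + \<mu>\<^sup>2) * (\<Sum>i=1..N. L1 (gY i))"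
    by (simp add: sum.distrib sum_distrib_left)
  also have "\<dots> = C / real n * L1 g + (C / real n + \<mu>\<^sup>2) * L1 v"
    unfolding hY_def gY_def sum_L1_branches(1)[OF gi] sum_L1_branches(1)[OF vi] ..
  also have "\<dots> \<le> C / real n * norm w + (C / real n + \<mu>\<^sup>2) * norm w"
  proof (intro add_mono mult_left_mono)
    show "L1 g \<le> norm w" using Rep_bound(3)[of 0] by (simp add: g_def h_def)
    show "L1 v \<le> norm w" by (simp add: norm_w21.rep_eq nrm_def v_def h_def)
  qed (use C(1) in auto)
  also have "\<dots> = (\<mu>\<^sup>2 + 2 * C / real n) * norm w" by (simp add: algebra_simps)
  finally show ?thesis using norm_eq by simp
qed

lemma fun_of_cfun: "t \<in> grid n \<Longrightarrow> W.cfunctional (fun_of n t)"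
proof -
  assume "t \<in> grid n"
  then obtain i j b where t: "t = (i, j, b)" "i \<in> {1..N}" "j < n" by (auto simp: grid_def)
  then have "node n j \<in> {0..1}" by (simp add: node_def)
  then have "Y i (node n j) \<in> {0..1}" by (rule Y_range[OF t(2)])
  then show ?thesis using cfunctional_eval cfunctional_eval_dd t(1) by (cases b) (auto simp: fun_of_def[abs_def])
qed

lemma L_add: "L (a + b) = L a + L b" and L_cscale: "L (cscale c a) = cscale c (L a)"
  unfolding Rep_w21_inject[symmetric]
  by (auto simp: Rep_L plus_w21.rep_eq cscale.rep_eq Op_def[abs_def] fun_eq_iff sum.distrib distrib_left sum_distrib_left mult_ac)

lemma clinear_L: "W.clinear L"
  unfolding W.clinear_def
proof (intro conjI allI)
  obtain C where C: "C \<ge> 1" "\<And>i x. i \<in> {1..N} \<Longrightarrow> x \<in> {0..1} \<Longrightarrow> \<bar>Y3 i x\<bar> \<le> C"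
    "\<And>i x. i \<in> {1..N} \<Longrightarrow> x \<in> {0..1} \<Longrightarrow> \<bar>3 * Y1 i x * Y2 i x\<bar> \<le> C"
    by (rule bounded_weights) (rule that)
  define F where "F w = (\<Sum>t\<in>grid 1. cscale (fun_of 1 t w) (vec_of 1 t))" for w
  have "bounded_linear F" unfolding F_def
    by (intro bounded_linear_sum W.clinear_bl W.clinear_rank_one fun_of_cfun)
  then obtain K where K: "\<And>w. norm (F w) \<le> norm w * K" using bounded_linear.bounded by blast
  show "bounded_linear L"
  proof (rule bounded_linear_intro)
    show "L (a + b) = L a + L b" for a b by (rule L_add)
    show "L (r *\<^sub>R a) = r *\<^sub>R L a" for r a using L_cscale[of "complex_of_real r" a] by (simp add: W.cs_of_real)
    show "norm (L w) \<le> norm w * (\<mu>\<^sup>2 + 2 * C + K)" for w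
    proof -
      have "norm (L w) \<le> norm (L w - F w) + norm (F w)" by (metis diff_add_cancel norm_triangle_ineq)
      then show ?thesis using finite_rank_approximation[OF _ C, of 1 w] K[of w] by (simp add: F_def algebra_simps)
    qed
  qed
qed (rule L_cscale)

sublocale quasi_compact cscale L "\<mu>\<^sup>2"
proof
  show "W.clinear L" by (rule clinear_L)
  show "0 \<le> \<mu>\<^sup>2" by simp
  fix \<epsilon> :: real assume \<epsilon>: "\<epsilon> > 0"
  obtain C where C: "C \<ge> 1" "\<And>i x. i \<in> {1..N} \<Longrightarrow> x \<in> {0..1} \<Longrightarrow> \<bar>Y3 i x\<bar> \<le> C"
    "\<And>i x. i \<in> {1..N} \<Longrightarrow> x \<in> {0..1} \<Longrightarrow> \<bar>3 * Y1 i x * Y2 i x\<bar> \<le> C"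
    by (rule bounded_weights) (rule that)
  obtain n where n: "2 * C / \<epsilon> < real n" using reals_Archimedean2 by blast
  moreover have "2 * C / \<epsilon> > 0" using C(1) \<epsilon> by simp
  ultimately have n0: "0 < n" using of_nat_0_less_iff by (metis less_trans)
  have nC: "2 * C / real n \<le> \<epsilon>" using n n0 \<epsilon> by (simp add: field_simps)
  obtain \<beta> where \<beta>: "bij_betw \<beta> {0..<card (grid n)} (grid n)"
    using ex_bij_betw_nat_finite[OF finite_grid] by blast
  have "(\<Sum>j<card (grid n). cscale (fun_of n (\<beta> j) w) (vec_of n (\<beta> j))) = (\<Sum>t\<in>grid n. cscale (fun_of n t w) (vec_of n t))" for w
    using sum.reindex_bij_betw[OF \<beta>, of "\<lambda>t. cscale (fun_of n t w) (vec_of n t)"] by (simp add: atLeast0LessThan)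
  moreover have "(\<mu>\<^sup>2 + 2 * C / real n) * norm w \<le> (\<mu>\<^sup>2 + \<epsilon>) * norm w" for w :: w21
    using nC by (intro mult_right_mono) auto
  ultimately have "norm (L w - (\<Sum>j<card (grid n). cscale (fun_of n (\<beta> j) w) (vec_of n (\<beta> j)))) \<le> (\<mu>\<^sup>2 + \<epsilon>) * norm w" for w
    using order_trans[OF finite_rank_approximation[OF n0 C, of w]] by simp
  moreover have "W.cfunctional (fun_of n (\<beta> j))" if "j < card (grid n)" for j
    using fun_of_cfun bij_betwE[OF \<beta>] that by auto
  ultimately show "\<exists>(d::nat) l e. (\<forall>j<d. W.cfunctional (l j)) \<and>
        (\<forall>x. norm (L x - (\<Sum>j<d. cscale (l j x) (e j))) \<le> (\<mu>\<^sup>2 + \<epsilon>) * norm x)"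
    by (intro exI[of _ "card (grid n)"] exI[of _ "\<lambda>j. fun_of n (\<beta> j)"] exI[of _ "\<lambda>j. vec_of n (\<beta> j)"]) auto
qed

sublocale w21_operator L "\<mu>\<^sup>2" Op
  by unfold_locales (rule Rep_L)

end

context branch_system
begin

section \<open>Positive operators on continuous functions\<close>

definition I :: "(real \<Rightarrow> real) \<Rightarrow> real" where "I u = integral {0..1} u"

abbreviation cont :: "(real \<Rightarrow> real) \<Rightarrow> bool" where "cont u \<equiv> continuous_on {0..1} u"

lemma I_lin: "cont u \<Longrightarrow> cont w \<Longrightarrow> I (\<lambda>x. a * u x + b * w x) = a * I u + b * I w"
  unfolding I_def
  by (subst integral_add) (auto intro!: integrable_continuous_real continuous_intros)

lemma I_add: "cont u \<Longrightarrow> cont w \<Longrightarrow> I (\<lambda>x. u x + w x) = I u + I w"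
  using I_lin[of u w 1 1] by simp

lemma I_diff: "cont u \<Longrightarrow> cont w \<Longrightarrow> I (\<lambda>x. u x - w x) = I u - I w"
  using I_lin[of u w 1 "-1"] by simp

lemma I_cmult: "I (\<lambda>x. a * u x) = a * I u"
  unfolding I_def by simp

lemma I_mono: "cont u \<Longrightarrow> cont w \<Longrightarrow> (\<And>x. x \<in> {0..1} \<Longrightarrow> u x \<le> w x) \<Longrightarrow> I u \<le> I w"
  unfolding I_def by (intro integral_le integrable_continuous_real) auto

lemma I_nonneg: "cont u \<Longrightarrow> (\<And>x. x \<in> {0..1} \<Longrightarrow> 0 \<le> u x) \<Longrightarrow> 0 \<le> I u"
  using I_mono[of "\<lambda>x. 0" u] by (simp add: I_def)

lemma I_cong: "(\<And>x. x \<in> {0..1} \<Longrightarrow> u x = w x) \<Longrightarrow> I u = I w"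
  unfolding I_def by (rule integral_cong) auto

lemma I_eq_0:
  assumes "cont u" "\<And>x. x \<in> {0..1} \<Longrightarrow> 0 \<le> u x" "I u = 0" "x \<in> {0..1}"
  shows "u x = 0"
  using assms integral_eq_0_iff[of 0 1 u] unfolding I_def by auto

lemma I_FTC:
  assumes "\<And>x. x \<in> {0..1} \<Longrightarrow> (F has_real_derivative u x) (at x within {0..1})"
  shows "I u = F 1 - F 0"
  unfolding I_def
  by (rule integral_unique, rule fundamental_theorem_of_calculus)
     (use assms in \<open>auto simp: has_real_derivative_iff_has_vector_derivative\<close>)

definition prim0 :: "(real \<Rightarrow> real) \<Rightarrow> real \<Rightarrow> real" where "prim0 u x = integral {0..x} u"

lemma prim0_deriv: "cont u \<Longrightarrow> x \<in> {0..1} \<Longrightarrow> (prim0 u has_real_derivative u x) (at x within {0..1})"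
  unfolding prim0_def has_real_derivative_iff_has_vector_derivative
  by (rule integral_has_vector_derivative)

lemma cont_prim0: "cont u \<Longrightarrow> cont (prim0 u)"
  using prim0_deriv DERIV_continuous_on by blast

lemma cont_sub: "cont u \<Longrightarrow> x \<in> {0..1} \<Longrightarrow> u integrable_on {0..x}"
  by (rule integrable_continuous_real, rule continuous_on_subset[of "{0..1}" u]) auto

lemma prim0_mono:
  assumes "cont u" "cont w" "\<And>x. x \<in> {0..1} \<Longrightarrow> u x \<le> w x" "x \<in> {0..1}"
  shows "prim0 u x \<le> prim0 w x"
  unfolding prim0_def using assms by (intro integral_le cont_sub) auto

lemma prim0_lin:
  assumes "cont u" "cont w" "x \<in> {0..1}"
  shows "prim0 (\<lambda>x. a * u x + b * w x) x = a * prim0 u x + b * prim0 w x"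
  unfolding prim0_def using cont_sub[OF assms(1,3)] cont_sub[OF assms(2,3)]
  by (subst integral_add) (auto intro: integrable_on_mult_right)

lemma prim0_cong: "(\<And>x. x \<in> {0..1} \<Longrightarrow> u x = w x) \<Longrightarrow> x \<in> {0..1} \<Longrightarrow> prim0 u x = prim0 w x"
  unfolding prim0_def by (rule integral_cong) auto

text \<open>The operator that describes the derivative of \<open>Op h\<close> in terms of the derivative \<open>u\<close> of \<open>h\<close>, when
  \<open>h 0 = 0\<close>. For general \<open>h\<close> the function \<open>D\<close> below enters with the factor \<open>h 0\<close>.\<close>

definition Pop :: "(real \<Rightarrow> real) \<Rightarrow> real \<Rightarrow> real" where
  "Pop u x = (\<Sum>i=1..N. (Y1 i x)\<^sup>2 * u (Y i x) + Y2 i x * prim0 u (Y i x))"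

definition D :: "real \<Rightarrow> real" where "D x = (\<Sum>i=1..N. Y2 i x)"

text \<open>The transfer operator on real functions.\<close>

definition Lr :: "(real \<Rightarrow> real) \<Rightarrow> real \<Rightarrow> real" where
  "Lr u x = (\<Sum>i=1..N. Y1 i x * u (Y i x))"

lemma cont_comp_Y: "cont u \<Longrightarrow> i \<in> {1..N} \<Longrightarrow> cont (\<lambda>x. u (Y i x))"
  by (rule continuous_on_compose2[OF _ cY]) (use Y_range in auto)

lemma cont_Pop: "cont u \<Longrightarrow> cont (Pop u)"
  unfolding Pop_def[abs_def]
  by (intro continuous_intros cY1 cY2 cont_comp_Y cont_prim0)

lemma cont_D: "cont D"
  unfolding D_def[abs_def] by (intro continuous_intros cY2)

lemma cont_Lr: "cont u \<Longrightarrow> cont (Lr u)"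
  unfolding Lr_def[abs_def] by (intro continuous_intros cY1 cont_comp_Y)

lemma D_nonneg: "x \<in> {0..1} \<Longrightarrow> 0 \<le> D x"
  unfolding D_def by (intro sum_nonneg Y2_nonneg)

lemma Pop_mono:
  assumes "cont u" "cont w" "\<And>x. x \<in> {0..1} \<Longrightarrow> u x \<le> w x" "x \<in> {0..1}"
  shows "Pop u x \<le> Pop w x"
  unfolding Pop_def
  by (intro sum_mono add_mono mult_left_mono assms prim0_mono Y_range Y2_nonneg) auto

lemma Pop_lin:
  assumes "cont u" "cont w" "x \<in> {0..1}"
  shows "Pop (\<lambda>x. a * u x + b * w x) x = a * Pop u x + b * Pop w x"
  unfolding Pop_def sum_distrib_left sum.distrib[symmetric]
proof (rule sum.cong[OF refl])
  fix i assume "i \<in> {1..N}"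
  from prim0_lin[OF assms(1,2) Y_range[OF this assms(3)]]
  show "(Y1 i x)\<^sup>2 * (a * u (Y i x) + b * w (Y i x)) + Y2 i x * prim0 (\<lambda>x. a * u x + b * w x) (Y i x) =
      a * ((Y1 i x)\<^sup>2 * u (Y i x) + Y2 i x * prim0 u (Y i x)) + b * ((Y1 i x)\<^sup>2 * w (Y i x) + Y2 i x * prim0 w (Y i x))"
    by (simp add: algebra_simps)
qed

lemma Pop_minus: "cont u \<Longrightarrow> x \<in> {0..1} \<Longrightarrow> Pop (\<lambda>x. - u x) x = - Pop u x"
  using Pop_lin[of u u x "-1" 0] by simp

lemma Pop_cong:
  assumes "\<And>x. x \<in> {0..1} \<Longrightarrow> u x = w x" "x \<in> {0..1}"
  shows "Pop u x = Pop w x"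
  unfolding Pop_def by (intro sum.cong refl) (use assms Y_range prim0_cong[of u w] in auto)

lemma Pop_nonneg:
  assumes "cont u" "\<And>x. x \<in> {0..1} \<Longrightarrow> 0 \<le> u x" "x \<in> {0..1}"
  shows "0 \<le> Pop u x"
proof -
  have "Pop (\<lambda>x. 0) x \<le> Pop u x" by (rule Pop_mono) (use assms in auto)
  then show ?thesis by (simp add: Pop_def prim0_def)
qed

lemma abs_Pop_le:
  assumes "cont u" "x \<in> {0..1}"
  shows "\<bar>Pop u x\<bar> \<le> Pop (\<lambda>x. \<bar>u x\<bar>) x"
proof -
  have c: "cont (\<lambda>x. \<bar>u x\<bar>)" "cont (\<lambda>x. - u x)" using assms by (auto intro!: continuous_intros)
  have "Pop u x \<le> Pop (\<lambda>x. \<bar>u x\<bar>) x" "Pop (\<lambda>x. - u x) x \<le> Pop (\<lambda>x. \<bar>u x\<bar>) x"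
    by (rule Pop_mono; use assms c in auto)+
  then show ?thesis using Pop_minus[OF assms] by linarith
qed

lemma Y_chain:
  assumes i: "i \<in> {1..N}" and x: "x \<in> {0..1}"
    and F: "\<And>t. t \<in> {0..1} \<Longrightarrow> (F has_real_derivative f t) (at t within {0..1})"
  shows "((\<lambda>x. F (Y i x)) has_real_derivative f (Y i x) * Y1 i x) (at x within {0..1})"
proof -
  have "(F has_real_derivative f (Y i x)) (at (Y i x) within Y i ` {0..1})"
    by (rule has_field_derivative_subset[OF F[OF Y_range[OF i x]]]) (intro image_subsetI Y_range[OF i])
  from DERIV_image_chain[OF this dY[OF i x]] show ?thesis by (simp add: o_def)
qed

text \<open>\<open>Pop u\<close> is the derivative of \<open>\<Sum>i. Y1 i x * prim0 u (Y i x)\<close>, and the boundary terms telescope.\<close>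

lemma I_Pop: assumes u: "cont u" shows "I (Pop u) = \<mu> * I u"
proof -
  have "I (Pop u) = (\<Sum>i=1..N. Y1 i 1 * prim0 u (Y i 1)) - (\<Sum>i=1..N. Y1 i 0 * prim0 u (Y i 0))"
  proof (rule I_FTC[where F = "\<lambda>x. \<Sum>i=1..N. Y1 i x * prim0 u (Y i x)"])
    fix x :: real assume x: "x \<in> {0..1}"
    have "((\<lambda>x. Y1 i x * prim0 u (Y i x)) has_real_derivative
        ((Y1 i x)\<^sup>2 * u (Y i x) + Y2 i x * prim0 u (Y i x))) (at x within {0..1})" if i: "i \<in> {1..N}" for i
      by (rule DERIV_cong[OF DERIV_mult[OF dY1[OF i x] Y_chain[OF i x prim0_deriv[OF u]]]])
         (auto simp: power2_eq_square algebra_simps)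
    then show "((\<lambda>x. \<Sum>i=1..N. Y1 i x * prim0 u (Y i x)) has_real_derivative Pop u x) (at x within {0..1})"
      unfolding Pop_def by (rule DERIV_sum)
  qed
  also have "\<dots> = (\<Sum>i=1..N. Y1 i 1 * prim0 u (p (Suc i)) - Y1 i 0 * prim0 u (p i))"
    by (simp add: sum_subtractf Y_0 Y_1)
  also have "\<dots> = \<mu> * I u" unfolding telescope[of "\<lambda>i. prim0 u (p i)"] by (simp add: p_first p_last prim0_def I_def del: One_nat_def)
  finally show ?thesis .
qed

lemma I_D: "I D = \<Delta>"
proof -
  have "I D = (\<Sum>i=1..N. Y1 i 1) - (\<Sum>i=1..N. Y1 i 0)"
    by (rule I_FTC[where F = "\<lambda>x. \<Sum>i=1..N. Y1 i x"]) (unfold D_def, intro DERIV_sum dY1)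
  also have "\<dots> = (\<Sum>i=1..N. Y1 i 1 * 1 - Y1 i 0 * 1)" by (simp add: sum_subtractf)
  also have "\<dots> = \<Delta>" unfolding telescope[of "\<lambda>_. 1"] by (simp add: \<Delta>_def \<mu>_def)
  finally show ?thesis .
qed

lemma I_Lr: assumes u: "cont u" shows "I (Lr u) = I u"
proof -
  have "I (Lr u) = (\<Sum>i=1..N. prim0 u (Y i 1)) - (\<Sum>i=1..N. prim0 u (Y i 0))"
  proof (rule I_FTC[where F = "\<lambda>x. \<Sum>i=1..N. prim0 u (Y i x)"])
    fix x :: real assume x: "x \<in> {0..1}"
    have "((\<lambda>x. prim0 u (Y i x)) has_real_derivative Y1 i x * u (Y i x)) (at x within {0..1})" if i: "i \<in> {1..N}" for i
      using Y_chain[OF i x prim0_deriv[OF u]] by (simp add: mult.commute)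
    then show "((\<lambda>x. \<Sum>i=1..N. prim0 u (Y i x)) has_real_derivative Lr u x) (at x within {0..1})"
      unfolding Lr_def by (rule DERIV_sum)
  qed
  also have "\<dots> = (\<Sum>i=1..N. prim0 u (p (Suc i)) - prim0 u (p i))"
    by (simp add: sum_subtractf Y_0 Y_1)
  also have "\<dots> = prim0 u (p (Suc N)) - prim0 u (p 1)" using N by (intro sum_Suc_diff) auto
  finally show ?thesis by (simp add: p_first p_last prim0_def I_def del: One_nat_def)
qed

lemma I_by_parts:
  assumes "\<And>x. x \<in> {0..1} \<Longrightarrow> (F has_real_derivative u x) (at x within {0..1})" "cont u"
  shows "I (\<lambda>x. (1 - x) * u x) = I F - F 0"
proof -
  have cF: "cont F" using assms(1) DERIV_continuous_on by blast
  have "I (\<lambda>x. (1 - x) * u x - F x) = (1 - 1) * F 1 - (1 - 0) * F 0"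
    by (rule I_FTC[where F = "\<lambda>x. (1 - x) * F x"]) (auto intro!: derivative_eq_intros assms(1))
  moreover have "I (\<lambda>x. (1 - x) * u x - F x) = I (\<lambda>x. (1 - x) * u x) - I F"
    by (intro I_diff continuous_intros assms(2) cF)
  ultimately show ?thesis by simp
qed

text \<open>Integration by parts against the derivative \<open>D\<close> of \<open>\<Sum>i. Y1 i\<close>, which is the image of the constant \<open>1\<close> under
  the integral-preserving operator \<open>Lr\<close>.\<close>

lemma I_weight_D: "I (\<lambda>x. (1 - x) * D x) = \<Gamma>"
proof -
  have "I (\<lambda>x. (1 - x) * D x) = I (\<lambda>x. \<Sum>i=1..N. Y1 i x) - (\<Sum>i=1..N. Y1 i 0)"
    by (rule I_by_parts[where F = "\<lambda>x. \<Sum>i=1..N. Y1 i x", OF _ cont_D]) (unfold D_def, intro DERIV_sum dY1)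
  moreover have "I (\<lambda>x. \<Sum>i=1..N. Y1 i x) = 1"
    using I_Lr[of "\<lambda>x. 1"] by (simp add: Lr_def[abs_def] I_def)
  ultimately show ?thesis by (simp add: \<Gamma>_def)
qed

lemma cont_weight: "cont u \<Longrightarrow> cont (\<lambda>x. (1 - x) * u x)"
  by (intro continuous_intros)

lemma Gamma_nonneg: "0 \<le> \<Gamma>"
  unfolding I_weight_D[symmetric] by (rule I_nonneg) (use D_nonneg in \<open>auto intro!: cont_weight cont_D\<close>)

definition pos :: "(real \<Rightarrow> real) \<Rightarrow> real \<Rightarrow> real" where "pos u x = max 0 (u x)"
definition neg :: "(real \<Rightarrow> real) \<Rightarrow> real \<Rightarrow> real" where "neg u x = max 0 (- u x)"

lemma cont_pos: "cont u \<Longrightarrow> cont (pos u)" and cont_neg: "cont u \<Longrightarrow> cont (neg u)"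
  unfolding pos_def[abs_def] neg_def[abs_def] by (auto intro!: continuous_intros)

lemma pos_nonneg [simp]: "0 \<le> pos u x" and neg_nonneg [simp]: "0 \<le> neg u x"
  by (auto simp: pos_def neg_def)

lemma pos_eq_0D: "pos u x = 0 \<Longrightarrow> u x \<le> 0" and pos_gt_0D: "0 < pos u x \<Longrightarrow> 0 < u x"
  by (auto simp: pos_def max_def split: if_splits)

lemma pos_minus_neg: "pos u x - neg u x = u x" by (auto simp: pos_def neg_def)

lemma I_pos_neg: "cont u \<Longrightarrow> I u = I (pos u) - I (neg u)"
  using I_diff[of "pos u" "neg u"] by (simp add: cont_pos cont_neg pos_minus_neg)

lemma I_neg_nonneg: "cont u \<Longrightarrow> 0 \<le> I (neg u)"
  by (auto intro!: I_nonneg cont_neg)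

lemma Pop_le_pos: "cont u \<Longrightarrow> x \<in> {0..1} \<Longrightarrow> Pop u x \<le> Pop (pos u) x"
  by (rule Pop_mono) (simp_all add: cont_pos, simp add: pos_def)

lemma Pop_ge_neg: "cont u \<Longrightarrow> x \<in> {0..1} \<Longrightarrow> - Pop (neg u) x \<le> Pop u x"
proof -
  assume u: "cont u" and x: "x \<in> {0..1}"
  have "Pop (\<lambda>x. - u x) x \<le> Pop (neg u) x"
    by (rule Pop_mono[OF continuous_on_minus[OF u] cont_neg[OF u] _ x]) (simp add: neg_def)
  then show ?thesis using Pop_minus[OF u x] by simp
qed

text \<open>\<open>Pop u \<ge> - Pop (neg u)\<close> and the weight is at most \<open>1\<close>.\<close>

lemma weighted_neg_part:
  assumes u: "cont u" and c: "I (\<lambda>x. (1 - x) * Pop u x) = - c"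
  shows "c \<le> \<mu> * I (neg u)"
proof -
  have "I (\<lambda>x. - Pop (neg u) x) \<le> I (\<lambda>x. (1 - x) * Pop u x)"
  proof (rule I_mono)
    fix x :: real assume x: "x \<in> {0..1}"
    have "0 \<le> Pop (neg u) x" by (rule Pop_nonneg[OF cont_neg[OF u] _ x]) simp
    then have "(1 - x) * Pop (neg u) x \<le> Pop (neg u) x" using x by (intro mult_left_le_one_le) auto
    moreover have "(1 - x) * (- Pop (neg u) x) \<le> (1 - x) * Pop u x"
      using x Pop_ge_neg[OF u x] by (intro mult_left_mono) auto
    ultimately show "- Pop (neg u) x \<le> (1 - x) * Pop u x" by simp
  qed (auto intro!: cont_weight cont_Pop cont_neg u continuous_on_minus)
  then show ?thesis using c I_Pop[OF cont_neg[OF u]] I_cmult[of "-1" "Pop (neg u)"] by simp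
qed

subsection \<open>Closed sets that are invariant under all branches\<close>

lemma Y_contraction:
  assumes "i \<in> {1..N}" "s \<in> {0..1}" "t \<in> {0..1}"
  shows "\<bar>Y i s - Y i t\<bar> \<le> \<mu> * \<bar>s - t\<bar>"
proof -
  have *: "Y i b - Y i a \<le> \<mu> * (b - a)" if "0 \<le> a" "a \<le> b" "b \<le> 1" for a b
  proof -
    have "\<mu> * a - Y i a \<le> \<mu> * b - Y i b"
    proof (rule mono_of_deriv[of "\<lambda>x. \<mu> * x - Y i x" "\<lambda>x. \<mu> - Y1 i x"])
      show "((\<lambda>x. \<mu> * x - Y i x) has_real_derivative \<mu> - Y1 i x) (at x within {0..1})" if "x \<in> {0..1}" for x
        by (auto intro!: derivative_eq_intros dY assms(1) that)
    qed (use that Y1_le_mu[OF assms(1)] in auto)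
    then show ?thesis by (simp add: algebra_simps)
  qed
  show ?thesis
  proof (cases "s \<le> t")
    case True
    then show ?thesis using *[of s t] Y_mono[OF assms(1), of s t] assms by (simp add: abs_if)
  next
    case False
    then show ?thesis using *[of t s] Y_mono[OF assms(1), of t s] assms by (simp add: abs_if)
  qed
qed

text \<open>At a point of maximal distance from \<open>Z\<close>, which is \<open>Y i t\<close> for some \<open>t\<close>, contraction of \<open>Y i\<close> gives a distance
  at most \<open>\<mu>\<close> times that of \<open>t\<close>; hence the maximal distance is zero.\<close>

lemma invariant_closed_set:
  assumes Z: "closed Z" "Z \<subseteq> {0..1}" "Z \<noteq> {}"
    and inv: "\<And>i x. i \<in> {1..N} \<Longrightarrow> x \<in> Z \<Longrightarrow> Y i x \<in> Z"
  shows "Z = {0..1}"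
proof -
  have "continuous_on {0..1} (\<lambda>x. infdist x Z)" by (intro continuous_intros)
  then obtain m where m: "m \<in> {0..1}" "\<And>x. x \<in> {0..1} \<Longrightarrow> infdist x Z \<le> infdist m Z"
    using continuous_attains_sup[of "{0..1::real}" "\<lambda>x. infdist x Z"] by auto
  obtain i t where it: "i \<in> {1..N}" "t \<in> {0..1}" "Y i t = m" using covering[OF m(1)] .
  obtain z where z: "z \<in> Z" "infdist t Z = dist t z" using infdist_attains_inf[OF Z(1,3)] by blast
  have "infdist m Z \<le> dist m (Y i z)" by (rule infdist_le[OF inv[OF it(1) z(1)]])
  also have "\<dots> \<le> \<mu> * dist t z"
    using Y_contraction[OF it(1,2), of z] z(1) Z(2) it(3) by (auto simp: dist_real_def)
  also have "\<dots> \<le> \<mu> * infdist m Z" using m(2)[OF it(2)] z(2) mu_pos by simp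
  finally have "(1 - \<mu>) * infdist m Z \<le> 0" by (simp add: algebra_simps)
  then have "infdist m Z \<le> 0" using mu_less_1 by (simp add: mult_le_0_iff)
  then have "infdist x Z = 0" if "x \<in> {0..1}" for x
    using m(2)[OF that] infdist_nonneg[of x Z] by linarith
  then show ?thesis using in_closed_iff_infdist_zero[OF Z(1,3)] Z(2) by auto
qed

lemma zero_or_positive:
  assumes u: "cont u" "\<And>x. x \<in> {0..1} \<Longrightarrow> 0 \<le> u x"
    and step: "\<And>i x. i \<in> {1..N} \<Longrightarrow> x \<in> {0..1} \<Longrightarrow> u x = 0 \<Longrightarrow> u (Y i x) = 0"
  shows "(\<forall>x\<in>{0..1}. u x = 0) \<or> (\<forall>x\<in>{0..1}. u x > 0)"
proof (cases "\<exists>x\<in>{0..1}. u x = 0")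
  case True
  define Z where "Z = {x\<in>{0..1}. u x = 0}"
  have "Z = {0..1}"
  proof (rule invariant_closed_set)
    show "closed Z" unfolding Z_def by (rule continuous_closed_preimage_constant[OF u(1)]) simp
  qed (use True step Y_range in \<open>auto simp: Z_def\<close>)
  then show ?thesis by (auto simp: Z_def)
next
  case False
  then show ?thesis using u(2) by (metis order_le_less)
qed

lemma Lr_mono:
  assumes "\<And>x. x \<in> {0..1} \<Longrightarrow> u x \<le> w x" "x \<in> {0..1}"
  shows "Lr u x \<le> Lr w x"
  unfolding Lr_def by (intro sum_mono mult_left_mono assms Y_range less_imp_le Y1_pos)

text \<open>The positive part satisfies \<open>pos u \<le> Lr (pos u)\<close>, and both sides have the same integral, so it is fixed too.
  A zero of it is then carried to zeros by all branches, so \<open>u\<close> does not change sign.\<close>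

lemma fixed_mean_zero:
  assumes u: "cont u" and eqn: "\<And>x. x \<in> {0..1} \<Longrightarrow> u x = Lr u x" and mean: "I u = 0"
  shows "\<forall>x\<in>{0..1}. u x = 0"
proof -
  have c: "cont (pos u)" by (rule cont_pos[OF u])
  have le: "pos u x \<le> Lr (pos u) x" if x: "x \<in> {0..1}" for x
  proof -
    have "u x \<le> Lr (pos u) x" using eqn[OF x] Lr_mono[of u "pos u" x] x by (simp add: pos_def)
    moreover have "0 \<le> Lr (pos u) x" unfolding Lr_def
      by (rule sum_nonneg, rule mult_nonneg_nonneg[OF less_imp_le[OF Y1_pos[OF _ x]] pos_nonneg])
    ultimately show ?thesis by (simp add: pos_def)
  qed
  have eq: "pos u x = Lr (pos u) x" if x: "x \<in> {0..1}" for x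
  proof -
    have "Lr (pos u) x - pos u x = 0"
      by (rule I_eq_0[of "\<lambda>x. Lr (pos u) x - pos u x"])
         (use le x I_Lr[OF c] I_diff[OF cont_Lr[OF c] c] in \<open>auto intro!: continuous_intros cont_Lr c\<close>)
    then show ?thesis by simp
  qed
  have "(\<forall>x\<in>{0..1}. pos u x = 0) \<or> (\<forall>x\<in>{0..1}. pos u x > 0)"
  proof (rule zero_or_positive[OF c])
    fix i x assume i: "i \<in> {1..N}" and x: "x \<in> {0..1}" and z: "pos u x = 0"
    have "(\<Sum>i=1..N. Y1 i x * pos u (Y i x)) = 0" using eq[OF x] z by (simp add: Lr_def)
    then have "\<forall>i\<in>{1..N}. Y1 i x * pos u (Y i x) = 0"
    proof (subst (asm) sum_nonneg_eq_0_iff)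
      show "0 \<le> Y1 i x * pos u (Y i x)" if "i \<in> {1..N}" for i
        by (rule mult_nonneg_nonneg[OF less_imp_le[OF Y1_pos[OF that x]] pos_nonneg])
    qed auto
    then have "Y1 i x * pos u (Y i x) = 0" using i by blast
    then show "pos u (Y i x) = 0" using Y1_pos[OF i x] by simp
  qed simp
  then show ?thesis
  proof
    assume "\<forall>x\<in>{0..1}. pos u x = 0"
    then have nonpos: "u x \<le> 0" if "x \<in> {0..1}" for x proof -
      have "pos u x = 0" using \<open>\<forall>x\<in>{0..1}. pos u x = 0\<close> that by blast
      then show ?thesis by (rule pos_eq_0D)
    qed
    have "- u x = 0" if "x \<in> {0..1}" for x
      by (rule I_eq_0[of "\<lambda>x. - u x"]) (use nonpos mean that I_cmult[of "-1" u] in \<open>auto intro!: continuous_intros u\<close>)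
    then show ?thesis by simp
  next
    assume "\<forall>x\<in>{0..1}. pos u x > 0"
    then have nn: "0 \<le> u x" if "x \<in> {0..1}" for x using pos_gt_0D less_imp_le that by blast
    show ?thesis using I_eq_0[OF u nn mean] by blast
  qed
qed

text \<open>The argument of \<open>fixed_mean_zero\<close> with \<open>Pop\<close> in place of \<open>Lr\<close>: here \<open>\<mu> * pos u \<le> Pop (pos u)\<close>, again with
  equal integrals.\<close>

lemma Pop_eigen_mean_zero:
  assumes u: "cont u" and eqn: "\<And>x. x \<in> {0..1} \<Longrightarrow> \<mu> * u x = Pop u x"
    and mean: "I (\<lambda>x. (1 - x) * u x) = 0"
  shows "\<forall>x\<in>{0..1}. u x = 0"
proof -
  have key: "(\<forall>x\<in>{0..1}. pos u x = 0) \<or> (\<forall>x\<in>{0..1}. pos u x > 0)"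
    if u: "cont u" and eqn: "\<And>x. x \<in> {0..1} \<Longrightarrow> \<mu> * u x = Pop u x" for u
  proof -
    have c: "cont (pos u)" by (rule cont_pos[OF u])
    have le: "\<mu> * pos u x \<le> Pop (pos u) x" if x: "x \<in> {0..1}" for x
    proof -
      have "\<mu> * u x \<le> Pop (pos u) x" using eqn[OF x] Pop_le_pos[OF u x] by simp
      moreover have "0 \<le> Pop (pos u) x" by (rule Pop_nonneg[OF c _ x]) simp
      ultimately show ?thesis by (simp add: pos_def max_def)
    qed
    have eq: "\<mu> * pos u x = Pop (pos u) x" if x: "x \<in> {0..1}" for x
    proof -
      have "Pop (pos u) x - \<mu> * pos u x = 0"
        by (rule I_eq_0[of "\<lambda>x. Pop (pos u) x - \<mu> * pos u x"])
           (use le x I_Pop[OF c] I_lin[OF cont_Pop[OF c] c, of 1 "-\<mu>"] in \<open>auto intro!: continuous_intros cont_Pop c\<close>)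
      then show ?thesis by simp
    qed
    show ?thesis
    proof (rule zero_or_positive[OF c])
      fix i x assume i: "i \<in> {1..N}" and x: "x \<in> {0..1}" and z: "pos u x = 0"
      have nn: "0 \<le> Y2 i x * prim0 (pos u) (Y i x)" if "i \<in> {1..N}" for i
        using prim0_mono[of "\<lambda>x. 0" "pos u" "Y i x"] c Y_range[OF that x] Y2_nonneg[OF that x]
        by (intro mult_nonneg_nonneg) (auto simp: prim0_def)
      have "(\<Sum>i=1..N. (Y1 i x)\<^sup>2 * pos u (Y i x) + Y2 i x * prim0 (pos u) (Y i x)) = 0"
        using eq[OF x] z by (simp add: Pop_def)
      then have "\<forall>i\<in>{1..N}. (Y1 i x)\<^sup>2 * pos u (Y i x) + Y2 i x * prim0 (pos u) (Y i x) = 0"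
        by (subst (asm) sum_nonneg_eq_0_iff) (use nn in \<open>auto intro!: add_nonneg_nonneg\<close>)
      then have "(Y1 i x)\<^sup>2 * pos u (Y i x) + Y2 i x * prim0 (pos u) (Y i x) = 0" using i by blast
      then have "(Y1 i x)\<^sup>2 * pos u (Y i x) = 0"
        using nn[OF i] mult_nonneg_nonneg[OF zero_le_power2[of "Y1 i x"] pos_nonneg[of u "Y i x"]] by linarith
      then show "pos u (Y i x) = 0" using Y1_pos[OF i x] by auto
    qed simp
  qed
  have sign: "(\<forall>x\<in>{0..1}. u x \<le> 0) \<or> (\<forall>x\<in>{0..1}. 0 \<le> u x)"
    using key[OF u eqn]
  proof
    assume *: "\<forall>x\<in>{0..1}. pos u x = 0"
    have "u x \<le> 0" if "x \<in> {0..1}" for x using * that pos_eq_0D by blast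
    then show ?thesis by blast
  next
    assume *: "\<forall>x\<in>{0..1}. pos u x > 0"
    have "0 \<le> u x" if "x \<in> {0..1}" for x using * that pos_gt_0D less_imp_le by blast
    then show ?thesis by blast
  qed
  have wz: "(1 - x) * u x = 0" if x: "x \<in> {0..1}" for x
    using sign
  proof
    assume "\<forall>x\<in>{0..1}. 0 \<le> u x"
    then show ?thesis by (intro I_eq_0[OF cont_weight[OF u] _ mean x]) auto
  next
    assume *: "\<forall>x\<in>{0..1}. u x \<le> 0"
    have "(1 - x) * (- u x) = 0"
      by (rule I_eq_0[OF cont_weight[OF continuous_on_minus[OF u]] _ _ x])
         (use * mean I_cmult[of "-1" "\<lambda>x. (1 - x) * u x"] in \<open>auto intro: mult_nonneg_nonpos\<close>)
    then show ?thesis by simp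
  qed
  have "u x = 0" if "x \<in> {0..1}" for x
  proof (rule continuous_constant_on_closure[of "{0..<1}" u])
    show "continuous_on (closure {0..<1}) u" using u by simp
    show "u x = 0" if "x \<in> {0..<1}" for x using wz[of x] that by auto
    show "x \<in> closure {0..<1}" using that by simp
  qed
  then show ?thesis by blast
qed

end

context branch_system
begin

section \<open>The differentiated eigenvalue equation\<close>

text \<open>The equation \<open>z g = Pop g + C D\<close> for \<open>z = a + i b\<close>, \<open>g = r + i q\<close>, \<open>C = A + i B\<close>, together with
  \<open>\<integral> (1 - x) g = - C\<close>. The latter says that the function with derivative \<open>g\<close> and value \<open>C\<close> at \<open>0\<close>
  has mean zero.\<close>

definition eigen_system :: "real \<Rightarrow> real \<Rightarrow> real \<Rightarrow> real \<Rightarrow> (real \<Rightarrow> real) \<Rightarrow> (real \<Rightarrow> real) \<Rightarrow> bool" where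
  "eigen_system a b A B r q \<longleftrightarrow> cont r \<and> cont q \<and>
     (\<forall>x\<in>{0..1}. a * r x - b * q x = Pop r x + A * D x) \<and>
     (\<forall>x\<in>{0..1}. a * q x + b * r x = Pop q x + B * D x) \<and>
     I (\<lambda>x. (1 - x) * r x) = - A \<and> I (\<lambda>x. (1 - x) * q x) = - B"

text \<open>Multiplication of the solution by the complex number \<open>c + i d\<close>.\<close>

lemma eigen_system_rotate:
  assumes s: "eigen_system a b A B r q"
  shows "eigen_system a b (c * A - d * B) (c * B + d * A) (\<lambda>x. c * r x - d * q x) (\<lambda>x. c * q x + d * r x)"
proof -
  have c: "cont r" "cont q" using s by (auto simp: eigen_system_def)
  have P: "Pop (\<lambda>x. c * r x - d * q x) x = c * Pop r x - d * Pop q x"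
    "Pop (\<lambda>x. c * q x + d * r x) x = c * Pop q x + d * Pop r x" if "x \<in> {0..1}" for x
    using Pop_lin[OF c that, of c "- d"] Pop_lin[OF c(2,1) that, of c d] by auto
  have w: "I (\<lambda>x. (1 - x) * (c * r x - d * q x)) = c * I (\<lambda>x. (1 - x) * r x) - d * I (\<lambda>x. (1 - x) * q x)"
    "I (\<lambda>x. (1 - x) * (c * q x + d * r x)) = c * I (\<lambda>x. (1 - x) * q x) + d * I (\<lambda>x. (1 - x) * r x)"
    using I_lin[OF cont_weight[OF c(1)] cont_weight[OF c(2)], of c "- d"]
      I_lin[OF cont_weight[OF c(2)] cont_weight[OF c(1)], of c d]
    by (simp_all add: algebra_simps)
  have e: "a * r x - b * q x = Pop r x + A * D x" "a * q x + b * r x = Pop q x + B * D x" if "x \<in> {0..1}" for x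
    using s that by (auto simp: eigen_system_def)
  show ?thesis unfolding eigen_system_def
  proof (intro conjI ballI)
    show "cont (\<lambda>x. c * r x - d * q x)" "cont (\<lambda>x. c * q x + d * r x)"
      using c by (auto intro!: continuous_intros)
    fix x :: real assume x: "x \<in> {0..1}"
    have "a * (c * r x - d * q x) - b * (c * q x + d * r x) = c * (a * r x - b * q x) - d * (a * q x + b * r x)"
      by (simp add: algebra_simps)
    then show "a * (c * r x - d * q x) - b * (c * q x + d * r x) = Pop (\<lambda>x. c * r x - d * q x) x + (c * A - d * B) * D x"
      unfolding e[OF x] P(1)[OF x] by (simp add: algebra_simps)
    have "a * (c * q x + d * r x) + b * (c * r x - d * q x) = c * (a * q x + b * r x) + d * (a * r x - b * q x)"
      by (simp add: algebra_simps)
    then show "a * (c * q x + d * r x) + b * (c * r x - d * q x) = Pop (\<lambda>x. c * q x + d * r x) x + (c * B + d * A) * D x"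
      unfolding e[OF x] P(2)[OF x] by (simp add: algebra_simps)
  next
    have ia: "I (\<lambda>x. (1 - x) * r x) = - A" "I (\<lambda>x. (1 - x) * q x) = - B"
      using s by (auto simp: eigen_system_def)
    show "I (\<lambda>x. (1 - x) * (c * r x - d * q x)) = - (c * A - d * B)"
      "I (\<lambda>x. (1 - x) * (c * q x + d * r x)) = - (c * B + d * A)"
      unfolding w ia by (simp_all add: algebra_simps)
  qed
qed

lemma eigen_system_conjugate:
  assumes "eigen_system a b A B r q" shows "eigen_system a (- b) A (- B) r (\<lambda>x. - q x)"
  using assms I_cmult[of "-1" "\<lambda>x. (1 - x) * q x"] unfolding eigen_system_def
  by (auto simp: Pop_minus continuous_on_minus algebra_simps)

lemma Cauchy_2: "c * x + s * y \<le> sqrt (x\<^sup>2 + y\<^sup>2)" if "c\<^sup>2 + s\<^sup>2 = (1::real)" for c s x y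
proof -
  have "(c * x + s * y)\<^sup>2 + (c * y - s * x)\<^sup>2 = (c\<^sup>2 + s\<^sup>2) * (x\<^sup>2 + y\<^sup>2)"
    by (simp add: power2_eq_square algebra_simps)
  moreover have "(c\<^sup>2 + s\<^sup>2) * (x\<^sup>2 + y\<^sup>2) = x\<^sup>2 + y\<^sup>2" unfolding that by simp
  ultimately have "(c * x + s * y)\<^sup>2 \<le> x\<^sup>2 + y\<^sup>2" using zero_le_power2[of "c * y - s * x"] by linarith
  then show ?thesis by (rule real_le_rsqrt)
qed

lemma unit_vector:
  fixes x y :: real
  obtains c s where "c\<^sup>2 + s\<^sup>2 = 1" "c * x + s * y = sqrt (x\<^sup>2 + y\<^sup>2)"
proof (cases "x\<^sup>2 + y\<^sup>2 = 0")
  case True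
  then have "x = 0" "y = 0" by (auto simp: sum_power2_eq_zero_iff)
  then show ?thesis using that[of 1 0] by simp
next
  case False
  define m where "m = sqrt (x\<^sup>2 + y\<^sup>2)"
  have "x\<^sup>2 + y\<^sup>2 > 0" using False by (simp add: sum_power2_gt_zero_iff sum_power2_eq_zero_iff)
  then have m: "m > 0" "m\<^sup>2 = x\<^sup>2 + y\<^sup>2" by (simp_all add: m_def)
  show ?thesis
  proof (rule that[of "x / m" "y / m"])
    have "(x / m)\<^sup>2 + (y / m)\<^sup>2 = (x\<^sup>2 + y\<^sup>2) / m\<^sup>2" by (simp add: power_divide add_divide_distrib)
    then show "(x / m)\<^sup>2 + (y / m)\<^sup>2 = 1" using m(2) False by simp
    have "x / m * x + y / m * y = m\<^sup>2 / m" using m(2) by (simp add: power2_eq_square add_divide_distrib)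
    then have "x / m * x + y / m * y = m" using m(1) by (simp add: power2_eq_square)
    then show "x / m * x + y / m * y = sqrt (x\<^sup>2 + y\<^sup>2)" by (simp only: m_def)
  qed
qed

text \<open>With \<open>m = |g|\<close>, positivity gives \<open>|z| m \<le> Pop m + |C| D\<close>; integrated, \<open>(|z| - \<mu>) \<integral> m \<le> |C| \<Delta>\<close>. The
  side condition gives \<open>|C| \<le> \<integral> m\<close>, which yields the bound, and \<open>C = 0\<close> would force \<open>m = 0\<close>.\<close>

lemma eigen_system_bounds:
  assumes s: "eigen_system a b A B r q" and z: "\<mu> < sqrt (a\<^sup>2 + b\<^sup>2)" and nz: "\<exists>x\<in>{0..1}. r x \<noteq> 0 \<or> q x \<noteq> 0"
  shows "sqrt (a\<^sup>2 + b\<^sup>2) \<le> \<mu> + \<Delta>" "A \<noteq> 0 \<or> B \<noteq> 0"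
proof -
  define m where "m x = sqrt ((r x)\<^sup>2 + (q x)\<^sup>2)" for x
  define Z where "Z = sqrt (a\<^sup>2 + b\<^sup>2)"
  define M where "M = sqrt (A\<^sup>2 + B\<^sup>2)"
  have c: "cont r" "cont q" using s by (auto simp: eigen_system_def)
  have cm: "cont m" unfolding m_def[abs_def] by (intro continuous_intros c)
  have m0: "0 \<le> m x" for x by (simp add: m_def)
  have e: "a * r x - b * q x = Pop r x + A * D x" "a * q x + b * r x = Pop q x + B * D x" if "x \<in> {0..1}" for x
    using s that by (auto simp: eigen_system_def)
  have dir: "cont (\<lambda>x. k * r x + l * q x)" for k l by (intro continuous_intros c)
  have le_m: "k * r x + l * q x \<le> m x" if "k\<^sup>2 + l\<^sup>2 = 1" for k l x
    unfolding m_def by (rule Cauchy_2[OF that])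
  have pointwise: "Z * m x \<le> 1 * Pop m x + M * D x" if x: "x \<in> {0..1}" for x
  proof -
    \<comment> \<open>The modulus at \<open>x\<close> is the component in a suitable direction \<open>(k, l)\<close>, in which the real operator
      \<open>Pop\<close> may be applied.\<close>
    obtain k l where kl: "k\<^sup>2 + l\<^sup>2 = 1"
      "k * (a * r x - b * q x) + l * (a * q x + b * r x) = sqrt ((a * r x - b * q x)\<^sup>2 + (a * q x + b * r x)\<^sup>2)"
      by (rule unit_vector)
    have "(a * r x - b * q x)\<^sup>2 + (a * q x + b * r x)\<^sup>2 = (a\<^sup>2 + b\<^sup>2) * ((r x)\<^sup>2 + (q x)\<^sup>2)"
      by (simp add: power2_eq_square algebra_simps)
    then have "Z * m x = k * (a * r x - b * q x) + l * (a * q x + b * r x)"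
      using kl(2) by (simp add: Z_def m_def real_sqrt_mult)
    also have "\<dots> = (k * Pop r x + l * Pop q x) + (k * A + l * B) * D x"
      unfolding e[OF x] by (simp add: algebra_simps)
    also have "k * Pop r x + l * Pop q x = Pop (\<lambda>x. k * r x + l * q x) x"
      using Pop_lin[OF c x] by simp
    also have "\<dots> \<le> Pop m x" by (rule Pop_mono[OF dir cm le_m[OF kl(1)] x])
    also have "(k * A + l * B) * D x \<le> M * D x"
      using Cauchy_2[OF kl(1), of A B] D_nonneg[OF x] by (intro mult_right_mono) (auto simp: M_def)
    finally show ?thesis by simp
  qed
  have "I (\<lambda>x. Z * m x) \<le> I (\<lambda>x. 1 * Pop m x + M * D x)"
    by (rule I_mono) (use pointwise in \<open>auto intro!: continuous_intros cm cont_Pop cont_D\<close>)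
  then have 1: "Z * I m \<le> \<mu> * I m + M * \<Delta>"
    unfolding I_cmult I_lin[OF cont_Pop[OF cm] cont_D] I_Pop[OF cm] I_D by simp
  have 2: "M \<le> I m"
  proof -
    obtain k l where kl: "k\<^sup>2 + l\<^sup>2 = 1" "k * A + l * B = M" unfolding M_def by (rule unit_vector)
    have kl': "(-k)\<^sup>2 + (-l)\<^sup>2 = 1" using kl by simp
    have "M = (- k) * I (\<lambda>x. (1 - x) * r x) + (- l) * I (\<lambda>x. (1 - x) * q x)"
      using s kl(2) by (simp add: eigen_system_def)
    also have "\<dots> = I (\<lambda>x. (- k) * ((1 - x) * r x) + (- l) * ((1 - x) * q x))"
      by (rule I_lin[symmetric]) (intro cont_weight c)+
    also have "\<dots> \<le> I m"
    proof (rule I_mono)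
      fix x :: real assume x: "x \<in> {0..1}"
      have "(- k) * ((1 - x) * r x) + (- l) * ((1 - x) * q x) = (1 - x) * ((- k) * r x + (- l) * q x)"
        by (simp add: algebra_simps)
      also have "\<dots> \<le> (1 - x) * m x" using x le_m[OF kl'] by (intro mult_left_mono) auto
      also have "\<dots> \<le> m x" using x m0 by (intro mult_left_le_one_le) auto
      finally show "(- k) * ((1 - x) * r x) + (- l) * ((1 - x) * q x) \<le> m x" .
    qed (auto intro!: continuous_intros c cm)
    finally show ?thesis .
  qed
  have Im: "I m > 0"
  proof -
    have "I m \<noteq> 0"
    proof
      assume "I m = 0"
      then have "m x = 0" if "x \<in> {0..1}" for x using I_eq_0[OF cm m0 _ that] by simp
      then show False using nz by (auto simp: m_def sum_power2_eq_zero_iff)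
    qed
    then show ?thesis using I_nonneg[OF cm m0] by linarith
  qed
  have Z: "\<mu> < Z" using z by (simp add: Z_def)
  have "(Z - \<mu>) * I m \<le> \<Delta> * I m" using 1 mult_right_mono[OF 2 less_imp_le[OF Delta_pos]] by (simp add: algebra_simps)
  then show "sqrt (a\<^sup>2 + b\<^sup>2) \<le> \<mu> + \<Delta>" using Im unfolding Z_def by (simp add: mult_le_cancel_right)
  have "M \<noteq> 0"
  proof
    assume "M = 0"
    then have "(Z - \<mu>) * I m \<le> 0" using 1 by (simp add: algebra_simps)
    then show False using Im Z by (simp add: mult_le_0_iff)
  qed
  then show "A \<noteq> 0 \<or> B \<noteq> 0" by (auto simp: M_def)
qed

lemma eigen_system_normalize:
  assumes s: "eigen_system a b A B r q" and nz: "A \<noteq> 0 \<or> B \<noteq> 0"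
  obtains r' q' where "eigen_system a b 1 0 r' q'"
proof -
  define n where "n = A\<^sup>2 + B\<^sup>2"
  have n: "n \<noteq> 0" using nz by (simp add: n_def sum_power2_eq_zero_iff)
  have "A / n * A - (- B / n) * B = (A\<^sup>2 + B\<^sup>2) / n" by (simp add: power2_eq_square add_divide_distrib)
  then have "A / n * A - (- B / n) * B = n / n" by (simp only: n_def)
  moreover have "A / n * B + (- B / n) * A = 0" by simp
  ultimately show ?thesis using that eigen_system_rotate[OF s, of "A / n" "- B / n"] n by simp
qed

subsection \<open>Facts on normalized solutions\<close>

lemma eigen_systemD:
  assumes "eigen_system a b 1 0 r q"
  shows "cont r" "cont q" "x \<in> {0..1} \<Longrightarrow> a * r x - b * q x = Pop r x + D x"
    "x \<in> {0..1} \<Longrightarrow> a * q x + b * r x = Pop q x"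
    "I (\<lambda>x. (1 - x) * r x) = - 1" "I (\<lambda>x. (1 - x) * q x) = 0"
  using assms by (auto simp: eigen_system_def)

text \<open>The two integrated equations, solved for the integral of \<open>r\<close>.\<close>

lemma eigen_system_mean:
  assumes s: "eigen_system a b 1 0 r q"
  shows "I r * ((a - \<mu>)\<^sup>2 + b\<^sup>2) = (a - \<mu>) * \<Delta>"
proof -
  note d = eigen_systemD[OF s]
  have "I (\<lambda>x. a * r x + (- b) * q x) = I (\<lambda>x. Pop r x + D x)"
    by (rule I_cong) (use d(3) in simp)
  then have 1: "a * I r - b * I q = \<mu> * I r + \<Delta>"
    unfolding I_lin[OF d(1,2)] I_add[OF cont_Pop[OF d(1)] cont_D] I_Pop[OF d(1)] I_D by simp
  have "I (\<lambda>x. a * q x + b * r x) = I (Pop q)"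
    by (rule I_cong) (use d(4) in simp)
  then have 2: "a * I q + b * I r = \<mu> * I q"
    unfolding I_lin[OF d(2,1)] I_Pop[OF d(2)] .
  have "I r * ((a - \<mu>)\<^sup>2 + b\<^sup>2) = (a - \<mu>) * ((a - \<mu>) * I r - b * I q) + b * ((a - \<mu>) * I q + b * I r)"
    by (simp add: power2_eq_square algebra_simps)
  also have "(a - \<mu>) * I r - b * I q = \<Delta>" using 1 by (simp add: algebra_simps)
  also have "(a - \<mu>) * I q + b * I r = 0" using 2 by (simp add: algebra_simps)
  finally show ?thesis by simp
qed

text \<open>Lower bounds for the negative parts. The first two come from integrating the equations against \<open>1 - x\<close>, where
  the side conditions determine everything but the term with \<open>Pop\<close>; the last one is the side
  condition itself.\<close>

lemma eigen_system_weighted: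
  assumes s: "eigen_system a b 1 0 r q"
  shows "a + \<Gamma> \<le> \<mu> * I (neg r)" "b \<le> \<mu> * I (neg q)" "1 \<le> I (neg r)"
proof -
  note d = eigen_systemD[OF s]
  have "I (\<lambda>x. (1 - x) * Pop r x) = I (\<lambda>x. 1 * (a * ((1 - x) * r x) + (- b) * ((1 - x) * q x)) + (-1) * ((1 - x) * D x))"
  proof (rule I_cong)
    fix x :: real assume x: "x \<in> {0..1}"
    have "Pop r x = a * r x - b * q x - D x" using d(3)[OF x] by simp
    then show "(1 - x) * Pop r x = 1 * (a * ((1 - x) * r x) + (- b) * ((1 - x) * q x)) + (-1) * ((1 - x) * D x)"
      unfolding \<open>Pop r x = _\<close> by (simp add: algebra_simps)
  qed
  also have "\<dots> = 1 * (a * (-1) + (-b) * 0) + (-1) * \<Gamma>"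
    by (subst I_lin, (intro continuous_intros d(1,2) cont_D)+,
        subst I_lin, (intro continuous_intros d(1,2))+) (simp add: d(5,6) I_weight_D)
  finally show "a + \<Gamma> \<le> \<mu> * I (neg r)" by (intro weighted_neg_part d(1)) simp
  have "I (\<lambda>x. (1 - x) * Pop q x) = I (\<lambda>x. a * ((1 - x) * q x) + b * ((1 - x) * r x))"
  proof (rule I_cong)
    fix x :: real assume x: "x \<in> {0..1}"
    show "(1 - x) * Pop q x = a * ((1 - x) * q x) + b * ((1 - x) * r x)"
      using d(4)[OF x, symmetric] by (simp add: algebra_simps)
  qed
  also have "\<dots> = a * 0 + b * (-1)"
    by (subst I_lin, (intro continuous_intros d(1,2))+) (simp add: d(5,6))
  finally show "b \<le> \<mu> * I (neg q)" by (intro weighted_neg_part d(2)) simp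
  have "- I (neg r) \<le> I (\<lambda>x. (1 - x) * r x)"
  proof -
    have "I (\<lambda>x. (-1) * neg r x) \<le> I (\<lambda>x. (1 - x) * r x)"
    proof (rule I_mono)
      fix x :: real assume x: "x \<in> {0..1}"
      have "(1 - x) * (- r x) \<le> (1 - x) * neg r x" using x by (intro mult_left_mono) (auto simp: neg_def)
      also have "\<dots> \<le> neg r x" using x by (intro mult_left_le_one_le) auto
      finally show "(-1) * neg r x \<le> (1 - x) * r x" by simp
    qed (auto intro!: continuous_intros cont_neg d(1))
    then show ?thesis unfolding I_cmult by simp
  qed
  then show "1 \<le> I (neg r)" using d(5) by simp
qed

text \<open>The passage from pointwise inequalities to inequalities between numbers, by which all regions are handled.\<close>

lemma I_ineq:
  assumes u: "cont u" and w: "cont w" and y: "cont y"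
    and le: "\<And>x. x \<in> {0..1} \<Longrightarrow> c * u x \<le> Pop w x + b * y x"
  shows "c * I u \<le> \<mu> * I w + b * I y"
proof -
  have "I (\<lambda>x. c * u x) \<le> I (\<lambda>x. 1 * Pop w x + b * y x)"
    by (rule I_mono) (use le in \<open>auto intro!: continuous_intros cont_Pop u w y\<close>)
  then show ?thesis unfolding I_cmult I_lin[OF cont_Pop[OF w] y] I_Pop[OF w] by simp
qed

text \<open>Where \<open>q < 0\<close>, the equation \<open>a * (- q) = - Pop q + b * r\<close> bounds \<open>neg q\<close> by positive quantities; likewise for
  \<open>r\<close>, where the inhomogeneity \<open>D\<close> has the favourable sign.\<close>

lemma eigen_system_pos_neg_right:
  assumes s: "eigen_system a b 1 0 r q" and a: "\<mu> < a" and b: "0 \<le> b"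
  shows "(a - \<mu>) * I (neg q) \<le> b * I (pos r)" "(a - \<mu>) * I (neg r) \<le> b * I (neg q)"
proof -
  note d = eigen_systemD[OF s]
  have a0: "a > 0" using a mu_pos by linarith
  have "a * I (neg q) \<le> \<mu> * I (neg q) + b * I (pos r)"
  proof (rule I_ineq)
    fix x :: real assume x: "x \<in> {0..1}"
    have "0 \<le> Pop (neg q) x" by (rule Pop_nonneg[OF cont_neg[OF d(2)] _ x]) simp
    moreover have "0 \<le> b * pos r x" using b by simp
    moreover have "a * (- q x) \<le> Pop (neg q) x + b * pos r x"
    proof -
      have "b * r x \<le> b * pos r x" using b by (intro mult_left_mono) (auto simp: pos_def)
      then show ?thesis using d(4)[OF x] Pop_ge_neg[OF d(2) x] by simp
    qed
    ultimately show "a * neg q x \<le> Pop (neg q) x + b * pos r x" by (simp add: neg_def max_def)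
  qed (auto intro: cont_pos cont_neg d)
  then show "(a - \<mu>) * I (neg q) \<le> b * I (pos r)" by (simp add: algebra_simps)
  have "a * I (neg r) \<le> \<mu> * I (neg r) + b * I (neg q)"
  proof (rule I_ineq)
    fix x :: real assume x: "x \<in> {0..1}"
    have "0 \<le> Pop (neg r) x" by (rule Pop_nonneg[OF cont_neg[OF d(1)] _ x]) simp
    moreover have "0 \<le> b * neg q x" using b by simp
    moreover have "a * (- r x) \<le> Pop (neg r) x + b * neg q x"
    proof -
      have "b * (- q x) \<le> b * neg q x" using b by (intro mult_left_mono) (auto simp: neg_def)
      then show ?thesis using d(3)[OF x] Pop_ge_neg[OF d(1) x] D_nonneg[OF x] by simp
    qed
    ultimately show "a * neg r x \<le> Pop (neg r) x + b * neg q x" by (simp add: neg_def max_def)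
  qed (auto intro: cont_pos cont_neg d)
  then show "(a - \<mu>) * I (neg r) \<le> b * I (neg q)" by (simp add: algebra_simps)
qed

lemma no_real_eigenvalue_above_mu:
  assumes "eigen_system a 0 1 0 r q" shows "a \<le> \<mu>"
proof (rule ccontr)
  assume "\<not> a \<le> \<mu>"
  then have "(a - \<mu>) * I (neg r) \<le> 0" using eigen_system_pos_neg_right(2)[OF assms] by simp
  then show False using eigen_system_weighted(3)[OF assms] \<open>\<not> a \<le> \<mu>\<close> by (simp add: mult_le_0_iff)
qed

text \<open>By \<open>eigen_system_conjugate\<close> let \<open>b \<ge> 0\<close>. Put \<open>\<eta> = a - \<mu>\<close> and let \<open>Rp\<close>, \<open>Rn\<close> be the integrals of the positive and negative
  part of \<open>r\<close>. The two estimates of \<open>eigen_system_pos_neg_right\<close> combine to \<open>\<eta>\<^sup>2 * Rn \<le> b\<^sup>2 * Rp\<close>, while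
  \<open>(Rp - Rn) * (\<eta>\<^sup>2 + b\<^sup>2) = \<eta> * \<Delta>\<close> by \<open>eigen_system_mean\<close> and \<open>Rn \<ge> 1 + \<Gamma> / a\<close> by \<open>eigen_system_weighted\<close>. Eliminating
  \<open>Rp\<close> and \<open>Rn\<close> contradicts the assumption on \<open>b\<close>.\<close>

lemma region_1:
  assumes s: "eigen_system a b 1 0 r q" and a: "\<mu> < a"
    and b2: "b\<^sup>2 * ((a - \<mu>) * \<Delta>) < (1 + inverse a * \<Gamma>) * ((a - \<mu>) ^ 4 - (b\<^sup>2)\<^sup>2)"
  shows False
proof -
  have key: False if s: "eigen_system a b 1 0 r q" and b: "0 \<le> b"
    and b2: "b\<^sup>2 * ((a - \<mu>) * \<Delta>) < (1 + inverse a * \<Gamma>) * ((a - \<mu>) ^ 4 - (b\<^sup>2)\<^sup>2)" for b q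
  proof -
    define \<eta> where "\<eta> = a - \<mu>"
    define \<sigma> where "\<sigma> = 1 + inverse a * \<Gamma>"
    define w where "w = \<eta>\<^sup>2 + b\<^sup>2"
    have \<eta>: "\<eta> > 0" using a by (simp add: \<eta>_def)
    have a0: "a > 0" using a mu_pos by linarith
    have \<sigma>: "\<sigma> \<ge> 1" using Gamma_nonneg a0 by (simp add: \<sigma>_def)
    have w: "w > 0" using \<eta> by (simp add: w_def add_pos_nonneg)
    define Rn where "Rn = I (neg r)"
    define Rp where "Rp = I (pos r)"
    have cr: "cont r" using eigen_systemD[OF s] by blast
    have "\<eta> * (\<eta> * Rn) \<le> \<eta> * (b * I (neg q))"
      using eigen_system_pos_neg_right(2)[OF s a b] \<eta> by (intro mult_left_mono) (auto simp: Rn_def \<eta>_def)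
    also have "\<dots> = b * (\<eta> * I (neg q))" by simp
    also have "\<dots> \<le> b * (b * Rp)"
      using eigen_system_pos_neg_right(1)[OF s a b] b by (intro mult_left_mono) (auto simp: Rp_def \<eta>_def)
    finally have 1: "\<eta>\<^sup>2 * Rn \<le> b\<^sup>2 * Rp" by (simp add: power2_eq_square mult.assoc)
    have 2: "(Rp - Rn) * w = \<eta> * \<Delta>"
      using eigen_system_mean[OF s] I_pos_neg[OF cr] by (simp add: Rp_def Rn_def w_def \<eta>_def)
    have c: "b\<^sup>2 * (\<eta> * \<Delta>) < \<sigma> * ((\<eta>\<^sup>2 - b\<^sup>2) * w)"
      using b2 by (simp add: \<eta>_def \<sigma>_def w_def algebra_simps power2_eq_square power4_eq_xxxx)
    have "0 \<le> b\<^sup>2 * (\<eta> * \<Delta>)" using \<eta> Delta_pos by simp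
    then have pos: "\<eta>\<^sup>2 - b\<^sup>2 > 0"
    proof -
      have "0 < (\<eta>\<^sup>2 - b\<^sup>2) * w"
      proof (rule ccontr)
        assume "\<not> 0 < (\<eta>\<^sup>2 - b\<^sup>2) * w"
        then have "\<sigma> * ((\<eta>\<^sup>2 - b\<^sup>2) * w) \<le> 0" using \<sigma> by (intro mult_nonneg_nonpos[of \<sigma> "(\<eta>\<^sup>2 - b\<^sup>2) * w"]) linarith+
        then show False using c \<open>0 \<le> b\<^sup>2 * (\<eta> * \<Delta>)\<close> by linarith
      qed
      then show ?thesis using w by (simp add: zero_less_mult_iff)
    qed
    have "(\<eta>\<^sup>2 - b\<^sup>2) * Rn * w \<le> b\<^sup>2 * (Rp - Rn) * w"
      using 1 w by (intro mult_right_mono) (auto simp: algebra_simps)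
    also have "\<dots> = b\<^sup>2 * (\<eta> * \<Delta>)" using 2 by (simp add: mult.assoc)
    also have "\<dots> < \<sigma> * ((\<eta>\<^sup>2 - b\<^sup>2) * w)" by (rule c)
    finally have "((\<eta>\<^sup>2 - b\<^sup>2) * w) * Rn < ((\<eta>\<^sup>2 - b\<^sup>2) * w) * \<sigma>" by (simp add: mult_ac)
    then have "Rn < \<sigma>" using pos w by simp
    moreover have "\<sigma> \<le> Rn"
    proof -
      have "\<sigma> * a = a + \<Gamma>" using a0 by (simp add: \<sigma>_def field_simps)
      also have "\<dots> \<le> \<mu> * Rn" using eigen_system_weighted(1)[OF s] by (simp add: Rn_def)
      also have "\<dots> \<le> a * Rn" using a I_neg_nonneg[OF cr] by (intro mult_right_mono) (auto simp: Rn_def)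
      finally show ?thesis using a0 by (simp add: mult.commute)
    qed
    ultimately show False by simp
  qed
  show False
  proof (cases "0 \<le> b")
    case True
    then show ?thesis using key[OF s] b2 by blast
  next
    case False
    then show ?thesis using key[of "- b" "\<lambda>x. - q x"] eigen_system_conjugate[OF s] b2 by simp
  qed
qed

text \<open>Let \<open>S\<close>, \<open>U\<close> be the integrals of \<open>|r|\<close>, \<open>|q|\<close>, and \<open>e = \<alpha> - \<mu>\<close>. Taking absolute values in both equations gives
  \<open>e * S \<le> \<Delta> + |b| * U\<close> and \<open>e * U \<le> |b| * S\<close>, hence \<open>S * (e\<^sup>2 - b\<^sup>2) \<le> e * \<Delta>\<close>. On the other hand
  \<open>S = 2 * I (neg r) + I r \<ge> 2 - \<Delta> / (\<alpha> + \<mu>)\<close> by \<open>eigen_system_weighted\<close> and \<open>eigen_system_mean\<close>. For small \<open>b\<close> the two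
  bounds are incompatible.\<close>

lemma region_2:
  assumes s: "eigen_system (- \<alpha>) b 1 0 r q" and \<alpha>: "\<mu> < \<alpha>"
    and b2: "b\<^sup>2 * (\<alpha>\<^sup>2 - \<mu>\<^sup>2 + \<Delta> * \<alpha>) < (\<alpha> - \<mu>)\<^sup>2 * (\<alpha>\<^sup>2 - \<mu>\<^sup>2 - \<Delta> * \<alpha>)"
  shows False
proof -
  note d = eigen_systemD[OF s]
  define e where "e = \<alpha> - \<mu>"
  define f where "f = \<alpha> + \<mu>"
  have ef: "e > 0" "f > 0" "e < f" "2 * \<alpha> = e + f" "\<alpha>\<^sup>2 - \<mu>\<^sup>2 = e * f"
    using \<alpha> mu_pos by (auto simp: e_def f_def power2_eq_square algebra_simps)
  have \<alpha>0: "\<alpha> > 0" using \<alpha> mu_pos by linarith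
  define S where "S = I (\<lambda>x. \<bar>r x\<bar>)"
  define U where "U = I (\<lambda>x. \<bar>q x\<bar>)"
  have ca: "cont (\<lambda>x. \<bar>r x\<bar>)" "cont (\<lambda>x. \<bar>q x\<bar>)" using d by (auto intro!: continuous_intros)
  define \<beta> where "\<beta> = \<bar>b\<bar>"
  have \<beta>: "\<beta> \<ge> 0" "\<beta>\<^sup>2 = b\<^sup>2" by (auto simp: \<beta>_def)
  have "\<alpha> * S \<le> \<mu> * S + 1 * I (\<lambda>x. 1 * D x + \<beta> * \<bar>q x\<bar>)"
    unfolding S_def
  proof (rule I_ineq)
    fix x :: real assume x: "x \<in> {0..1}"
    have "\<alpha> * r x = - Pop r x - D x - b * q x" using d(3)[OF x] by simp
    then have "\<bar>\<alpha> * r x\<bar> \<le> \<bar>Pop r x\<bar> + D x + \<bar>b * q x\<bar>" using D_nonneg[OF x] by linarith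
    then show "\<alpha> * \<bar>r x\<bar> \<le> Pop (\<lambda>x. \<bar>r x\<bar>) x + 1 * (1 * D x + \<beta> * \<bar>q x\<bar>)"
      using abs_Pop_le[OF d(1) x] \<alpha>0 by (simp add: abs_mult \<beta>_def)
  qed (auto intro!: continuous_intros ca cont_D)
  then have 1: "e * S \<le> \<Delta> + \<beta> * U"
    by (subst (asm) I_lin[OF cont_D ca(2)]) (simp add: I_D U_def e_def algebra_simps)
  have "\<alpha> * U \<le> \<mu> * U + \<beta> * S"
    unfolding S_def U_def
  proof (rule I_ineq)
    fix x :: real assume x: "x \<in> {0..1}"
    have "\<alpha> * q x = b * r x - Pop q x" using d(4)[OF x] by simp
    then have "\<bar>\<alpha> * q x\<bar> \<le> \<bar>Pop q x\<bar> + \<bar>b * r x\<bar>" by linarith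
    then show "\<alpha> * \<bar>q x\<bar> \<le> Pop (\<lambda>x. \<bar>q x\<bar>) x + \<beta> * \<bar>r x\<bar>"
      using abs_Pop_le[OF d(2) x] \<alpha>0 by (simp add: abs_mult \<beta>_def)
  qed (auto intro!: ca)
  then have 2: "e * U \<le> \<beta> * S" by (simp add: e_def algebra_simps)
  have "e * (e * S) \<le> e * (\<Delta> + \<beta> * U)" using 1 ef by (intro mult_left_mono) auto
  also have "\<dots> = e * \<Delta> + \<beta> * (e * U)" by (simp add: algebra_simps)
  also have "\<dots> \<le> e * \<Delta> + \<beta> * (\<beta> * S)" using 2 \<beta> by (intro add_left_mono mult_left_mono) auto
  finally have 3: "S * (e\<^sup>2 - b\<^sup>2) \<le> e * \<Delta>" unfolding \<beta>(2)[symmetric] by (simp add: power2_eq_square algebra_simps)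
  have "I (\<lambda>x. \<bar>r x\<bar>) = I (\<lambda>x. 2 * neg r x + 1 * r x)"
    by (rule I_cong) (auto simp: neg_def)
  then have "S = 2 * I (neg r) + I r"
    using I_lin[OF cont_neg[OF d(1)] d(1), of 2 1] by (simp add: S_def)
  then have 4: "2 \<le> S - I r" using eigen_system_weighted(3)[OF s] by simp
  have "I r * (f\<^sup>2 + b\<^sup>2) = - f * \<Delta>" using eigen_system_mean[OF s] by (simp add: f_def power2_eq_square algebra_simps)
  moreover have "f\<^sup>2 + b\<^sup>2 \<noteq> 0" using ef by (simp add: sum_power2_eq_zero_iff)
  ultimately have "I r = - f * \<Delta> / (f\<^sup>2 + b\<^sup>2)" by (intro nonzero_eq_divide_eq[THEN iffD2])
  then have "- I r = f * \<Delta> / (f\<^sup>2 + b\<^sup>2)" by simp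
  also have "\<dots> \<le> f * \<Delta> / f\<^sup>2" using ef Delta_pos by (intro divide_left_mono) (auto simp: add_pos_nonneg)
  also have "\<dots> = \<Delta> / f" using ef by (simp add: power2_eq_square)
  finally have 5: "2 \<le> S + \<Delta> / f" using 4 by linarith
  define k where "k = e\<^sup>2 - b\<^sup>2"
  have cond: "b\<^sup>2 * (e * f + \<Delta> * \<alpha>) < e\<^sup>2 * (e * f - \<Delta> * \<alpha>)"
    using b2 unfolding ef(5) by (simp add: e_def)
  have D\<alpha>: "\<Delta> * \<alpha> > 0" "e * f > 0" "e\<^sup>2 > 0" using Delta_pos \<alpha>0 ef by auto
  have "0 \<le> b\<^sup>2 * (e * f + \<Delta> * \<alpha>)" using D\<alpha> by simp
  then have "0 < e\<^sup>2 * (e * f - \<Delta> * \<alpha>)" using cond by linarith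
  then have small: "\<Delta> * \<alpha> < e * f" using D\<alpha>(3) by (simp add: zero_less_mult_iff)
  have kk: "k * (e * f + \<Delta> * \<alpha>) > 2 * e\<^sup>2 * (\<Delta> * \<alpha>)"
    using cond by (simp add: k_def algebra_simps)
  have "k > 0"
  proof (rule ccontr)
    assume "\<not> k > 0"
    then have "k * (e * f + \<Delta> * \<alpha>) \<le> 0" using D\<alpha> by (simp add: mult_nonpos_nonneg)
    moreover have "0 < 2 * e\<^sup>2 * (\<Delta> * \<alpha>)" using D\<alpha> by simp
    ultimately show False using kk by linarith
  qed
  have \<Delta>f: "\<Delta> < f"
  proof -
    have "\<Delta> * \<alpha> < f * \<alpha>" using small ef \<alpha>0 mu_pos by (smt (verit, best) e_def mult.commute mult_strict_left_mono)
    then show ?thesis using \<alpha>0 by simp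
  qed
  have "2 * f * k \<le> (S + \<Delta> / f) * (f * k)" using 5 ef \<open>k > 0\<close> mult_right_mono[OF 5, of "f * k"] by simp
  also have "\<dots> = f * (S * k) + \<Delta> * k" using ef by (simp add: field_simps)
  also have "\<dots> \<le> f * (e * \<Delta>) + \<Delta> * k" using 3 ef by (intro add_right_mono mult_left_mono) (auto simp: k_def)
  finally have up: "(2 * f - \<Delta>) * k \<le> f * e * \<Delta>" by (simp add: algebra_simps)
  have "(2 * f - \<Delta>) * (2 * e\<^sup>2 * (\<Delta> * \<alpha>)) < (2 * f - \<Delta>) * (k * (e * f + \<Delta> * \<alpha>))"
    using kk \<Delta>f ef by (intro mult_strict_left_mono) auto
  also have "\<dots> = ((2 * f - \<Delta>) * k) * (e * f + \<Delta> * \<alpha>)" by simp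
  also have "\<dots> \<le> (f * e * \<Delta>) * (e * f + \<Delta> * \<alpha>)" using up D\<alpha> by (intro mult_right_mono) auto
  finally have "(e * \<Delta>) * ((2 * f - \<Delta>) * (2 * e * \<alpha>)) < (e * \<Delta>) * (f * (e * f + \<Delta> * \<alpha>))"
    by (simp add: power2_eq_square algebra_simps)
  then have "(2 * f - \<Delta>) * (2 * e * \<alpha>) < f * (e * f + \<Delta> * \<alpha>)"
    using ef Delta_pos by simp
  then have "4 * f * e * \<alpha> < e * f\<^sup>2 + (\<Delta> * \<alpha>) * (f + 2 * e)" by (simp add: power2_eq_square algebra_simps)
  also have "\<dots> \<le> e * f\<^sup>2 + (e * f) * (f + 2 * e)" using small ef by (intro add_left_mono mult_right_mono) auto
  also have "\<dots> = 2 * e * f * (e + f)" by (simp add: power2_eq_square algebra_simps)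
  also have "\<dots> = 4 * f * e * \<alpha>" unfolding ef(4)[symmetric] by simp
  finally show False by simp
qed

text \<open>Multiplying \<open>(z - Pop) g = D\<close> by the conjugate of \<open>z\<close> minus \<open>Pop\<close> and taking imaginary parts leaves a
  relation for \<open>q\<close> alone, in which the inhomogeneity has a sign.\<close>

lemma eigen_system_square:
  assumes s: "eigen_system a b 1 0 r q" and x: "x \<in> {0..1}"
  shows "(a\<^sup>2 + b\<^sup>2) * q x = 2 * a * Pop q x - Pop (Pop q) x - b * D x"
proof -
  note d = eigen_systemD[OF s]
  have "Pop (\<lambda>x. b * r x + 0 * r x) x = Pop (\<lambda>x. 1 * Pop q x + (- a) * q x) x"
    by (rule Pop_cong[OF _ x]) (use d(4) in \<open>simp add: algebra_simps\<close>)
  then have 1: "b * Pop r x = Pop (Pop q) x - a * Pop q x"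
    unfolding Pop_lin[OF d(1,1) x] Pop_lin[OF cont_Pop[OF d(2)] d(2) x] by simp
  have "(a\<^sup>2 + b\<^sup>2) * q x = a * (a * q x + b * r x) - b * (a * r x - b * q x)"
    by (simp add: power2_eq_square algebra_simps)
  also have "\<dots> = a * Pop q x - b * Pop r x - b * D x" unfolding d(3)[OF x] d(4)[OF x] by (simp add: algebra_simps)
  finally show ?thesis using 1 by simp
qed

lemma I_ineq2:
  assumes u: "cont u" and w: "cont w" and y: "cont y"
    and le: "\<And>x. x \<in> {0..1} \<Longrightarrow> c * u x \<le> k * Pop w x + Pop (Pop y) x + b * D x"
  shows "c * I u \<le> k * \<mu> * I w + \<mu>\<^sup>2 * I y + b * \<Delta>"
proof -
  have cc: "cont (\<lambda>x. k * Pop w x + 1 * Pop (Pop y) x)" by (intro continuous_intros cont_Pop w y)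
  have "I (\<lambda>x. c * u x) \<le> I (\<lambda>x. 1 * (k * Pop w x + 1 * Pop (Pop y) x) + b * D x)"
    by (rule I_mono) (use le in \<open>auto intro!: continuous_intros cont_Pop cont_D u w y\<close>)
  then show ?thesis
    unfolding I_cmult I_lin[OF cc cont_D] I_lin[OF cont_Pop[OF w] cont_Pop[OF cont_Pop[OF y]]]
        I_Pop[OF w] I_Pop[OF cont_Pop[OF y]] I_Pop[OF y] I_D by (simp add: power2_eq_square algebra_simps)
qed

lemma PopPop:
  assumes q: "cont q" and x: "x \<in> {0..1}"
  shows "- Pop (Pop (neg q)) x \<le> Pop (Pop q) x" "Pop (Pop q) x \<le> Pop (Pop (pos q)) x"
    "0 \<le> Pop (Pop (neg q)) x" "0 \<le> Pop (Pop (pos q)) x"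
proof -
  have c: "cont (Pop q)" "cont (Pop (neg q))" "cont (Pop (pos q))" by (intro cont_Pop cont_pos cont_neg q)+
  show "Pop (Pop q) x \<le> Pop (Pop (pos q)) x" by (rule Pop_mono[OF c(1,3) Pop_le_pos[OF q] x])
  have "Pop (\<lambda>x. - Pop (neg q) x) x \<le> Pop (Pop q) x"
    by (rule Pop_mono[OF continuous_on_minus[OF c(2)] c(1) Pop_ge_neg[OF q] x])
  then show "- Pop (Pop (neg q)) x \<le> Pop (Pop q) x" using Pop_minus[OF c(2) x] by simp
  show "0 \<le> Pop (Pop (neg q)) x" "0 \<le> Pop (Pop (pos q)) x"
    by (rule Pop_nonneg[OF c(2) Pop_nonneg[OF cont_neg[OF q]] x]; simp)
       (rule Pop_nonneg[OF c(3) Pop_nonneg[OF cont_pos[OF q]] x]; simp)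
qed

text \<open>The positive and negative parts of \<open>eigen_system_square\<close>. For \<open>a \<ge> 0\<close> the term \<open>2 * a * Pop q\<close> respects the sign
  of \<open>q\<close> and moves to the left; for \<open>a < 0\<close> it reverses the sign and stays on the right.\<close>

lemma eigen_system_pos_neg_square:
  assumes s: "eigen_system a b 1 0 r q" and b: "0 \<le> b"
  shows "0 \<le> a \<Longrightarrow> (a\<^sup>2 + b\<^sup>2 - 2 * a * \<mu>) * I (pos q) \<le> \<mu>\<^sup>2 * I (neg q)"
    and "0 \<le> a \<Longrightarrow> (a\<^sup>2 + b\<^sup>2 - 2 * a * \<mu>) * I (neg q) \<le> \<mu>\<^sup>2 * I (pos q) + b * \<Delta>"
    and "a < 0 \<Longrightarrow> (a\<^sup>2 + b\<^sup>2) * I (pos q) \<le> (2 * \<bar>a\<bar> * \<mu> + \<mu>\<^sup>2) * I (neg q)"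
    and "a < 0 \<Longrightarrow> (a\<^sup>2 + b\<^sup>2) * I (neg q) \<le> (2 * \<bar>a\<bar> * \<mu> + \<mu>\<^sup>2) * I (pos q) + b * \<Delta>"
proof -
  define X where "X = a\<^sup>2 + b\<^sup>2"
  have q: "cont q" using eigen_systemD[OF s] by blast
  have cp: "cont (pos q)" and cn: "cont (neg q)" by (rule cont_pos[OF q], rule cont_neg[OF q])
  have nn: "0 \<le> Pop (pos q) x" "0 \<le> Pop (neg q) x" "0 \<le> b * D x" if x: "x \<in> {0..1}" for x
    using D_nonneg[OF x] b by (auto intro!: Pop_nonneg[OF cp _ x] Pop_nonneg[OF cn _ x])
  note sq = eigen_system_square[OF s, folded X_def]
  have up: "X * pos q x \<le> K" if "X * q x \<le> K" "0 \<le> K" for x K using that by (simp add: pos_def max_def)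
  have un: "X * neg q x \<le> K" if "- (X * q x) \<le> K" "0 \<le> K" for x K using that by (simp add: neg_def max_def)
  {
    assume a: "0 \<le> a"
    have ba: "2 * a * Pop q x \<le> 2 * a * Pop (pos q) x" "- (2 * a * Pop (neg q) x) \<le> 2 * a * Pop q x"
      "0 \<le> 2 * a * Pop (pos q) x" "0 \<le> 2 * a * Pop (neg q) x" if x: "x \<in> {0..1}" for x
      using mult_left_mono[OF Pop_le_pos[OF q x], of "2 * a"] mult_left_mono[OF Pop_ge_neg[OF q x], of "2 * a"] a nn[OF x]
      by auto
    have "X * I (pos q) \<le> 2 * a * \<mu> * I (pos q) + \<mu>\<^sup>2 * I (neg q) + 0 * \<Delta>"
    proof (rule I_ineq2[OF cp cp cn])
      fix x :: real assume x: "x \<in> {0..1}"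
      show "X * pos q x \<le> 2 * a * Pop (pos q) x + Pop (Pop (neg q)) x + 0 * D x"
        by (rule up) (use sq[OF x] ba[OF x] PopPop[OF q x] nn[OF x] in linarith)+
    qed
    then show "(a\<^sup>2 + b\<^sup>2 - 2 * a * \<mu>) * I (pos q) \<le> \<mu>\<^sup>2 * I (neg q)" by (simp add: X_def algebra_simps)
    have "X * I (neg q) \<le> 2 * a * \<mu> * I (neg q) + \<mu>\<^sup>2 * I (pos q) + b * \<Delta>"
    proof (rule I_ineq2[OF cn cn cp])
      fix x :: real assume x: "x \<in> {0..1}"
      show "X * neg q x \<le> 2 * a * Pop (neg q) x + Pop (Pop (pos q)) x + b * D x"
        by (rule un) (use sq[OF x] ba[OF x] PopPop[OF q x] nn[OF x] in linarith)+
    qed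
    then show "(a\<^sup>2 + b\<^sup>2 - 2 * a * \<mu>) * I (neg q) \<le> \<mu>\<^sup>2 * I (pos q) + b * \<Delta>" by (simp add: X_def algebra_simps)
  next
    assume a: "a < 0"
    define \<alpha> where "\<alpha> = - a"
    have \<alpha>: "\<bar>a\<bar> = \<alpha>" "a = - \<alpha>" "0 \<le> \<alpha>" using a by (auto simp: \<alpha>_def)
    have ba: "2 * a * Pop q x \<le> 2 * \<alpha> * Pop (neg q) x" "- (2 * \<alpha> * Pop (pos q) x) \<le> 2 * a * Pop q x"
      "0 \<le> 2 * \<alpha> * Pop (pos q) x" "0 \<le> 2 * \<alpha> * Pop (neg q) x" if x: "x \<in> {0..1}" for x
      using mult_left_mono[OF Pop_le_pos[OF q x], of "2 * \<alpha>"] mult_left_mono[OF Pop_ge_neg[OF q x], of "2 * \<alpha>"] \<alpha> nn[OF x]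
      by auto
    have "X * I (pos q) \<le> 2 * \<alpha> * \<mu> * I (neg q) + \<mu>\<^sup>2 * I (neg q) + 0 * \<Delta>"
    proof (rule I_ineq2[OF cp cn cn])
      fix x :: real assume x: "x \<in> {0..1}"
      show "X * pos q x \<le> 2 * \<alpha> * Pop (neg q) x + Pop (Pop (neg q)) x + 0 * D x"
        by (rule up) (use sq[OF x] ba[OF x] PopPop[OF q x] nn[OF x] in linarith)+
    qed
    then show "(a\<^sup>2 + b\<^sup>2) * I (pos q) \<le> (2 * \<bar>a\<bar> * \<mu> + \<mu>\<^sup>2) * I (neg q)" unfolding \<alpha>(1) by (simp add: X_def algebra_simps)
    have "X * I (neg q) \<le> 2 * \<alpha> * \<mu> * I (pos q) + \<mu>\<^sup>2 * I (pos q) + b * \<Delta>"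
    proof (rule I_ineq2[OF cn cp cp])
      fix x :: real assume x: "x \<in> {0..1}"
      show "X * neg q x \<le> 2 * \<alpha> * Pop (pos q) x + Pop (Pop (pos q)) x + b * D x"
        by (rule un) (use sq[OF x] ba[OF x] PopPop[OF q x] nn[OF x] in linarith)+
    qed
    then show "(a\<^sup>2 + b\<^sup>2) * I (neg q) \<le> (2 * \<bar>a\<bar> * \<mu> + \<mu>\<^sup>2) * I (pos q) + b * \<Delta>" unfolding \<alpha>(1) by (simp add: X_def algebra_simps)
  }
qed

text \<open>Elimination of \<open>Qp\<close> between the first two hypotheses bounds \<open>Qn\<close> from above by a multiple of \<open>b\<close>; the third
  bounds it from below.\<close>

lemma coupled_inequalities:
  fixes X k b Qp Qn :: real
  assumes p: "X * Qp \<le> k * Qn" and n: "X * Qn \<le> k * Qp + b * \<Delta>" and w: "b \<le> \<mu> * Qn"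
    and b: "0 < b" and k: "0 \<le> k" and X: "k < X"
  shows "X\<^sup>2 - k\<^sup>2 \<le> \<mu> * \<Delta> * X"
proof -
  have X0: "0 < X" using k X by linarith
  have "X * (X * Qn) \<le> X * (k * Qp + b * \<Delta>)" using n X0 by (intro mult_left_mono) auto
  also have "\<dots> = k * (X * Qp) + X * b * \<Delta>" by (simp add: algebra_simps)
  also have "\<dots> \<le> k * (k * Qn) + X * b * \<Delta>" using p k by (intro add_right_mono mult_left_mono) auto
  finally have 1: "(X\<^sup>2 - k\<^sup>2) * Qn \<le> X * b * \<Delta>" by (simp add: power2_eq_square algebra_simps)
  have pos: "0 \<le> X\<^sup>2 - k\<^sup>2" using k X power_mono[of k X 2] by simp
  have "(X\<^sup>2 - k\<^sup>2) * b \<le> (X\<^sup>2 - k\<^sup>2) * (\<mu> * Qn)" using w pos by (rule mult_left_mono)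
  also have "\<dots> = \<mu> * ((X\<^sup>2 - k\<^sup>2) * Qn)" by simp
  also have "\<dots> \<le> \<mu> * (X * b * \<Delta>)" using 1 mu_pos by (intro mult_left_mono) auto
  finally have "(X\<^sup>2 - k\<^sup>2) * b \<le> (\<mu> * \<Delta> * X) * b" by (simp add: mult_ac)
  then show ?thesis using b by (simp add: mult_le_cancel_right)
qed

text \<open>For \<open>b > 0\<close>, \<open>coupled_inequalities\<close> applies with \<open>X = a\<^sup>2 + b\<^sup>2 - 2 * a * \<mu>\<close> and \<open>k = \<mu>\<^sup>2\<close>, and gives
  \<open>X\<^sup>2 - \<mu> * \<Delta> * X - \<mu>\<^sup>4 \<le> 0\<close>. The assumption says that \<open>X\<close> exceeds the larger root of this quadratic.\<close>

lemma region_3: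
  assumes s: "eigen_system a b 1 0 r q" and a: "0 \<le> a"
    and X: "\<mu> * ((\<Delta> + sqrt (4 * \<mu>\<^sup>2 + \<Delta>\<^sup>2)) / 2) < a\<^sup>2 + b\<^sup>2 - 2 * a * \<mu>"
  shows False
proof -
  define \<kappa> where "\<kappa> = (\<Delta> + sqrt (4 * \<mu>\<^sup>2 + \<Delta>\<^sup>2)) / 2"
  define X where "X = a\<^sup>2 + b\<^sup>2 - 2 * a * \<mu>"
  \<comment> \<open>\<open>\<mu> * \<kappa>\<close> is the larger root of the quadratic, and \<open>\<mu> * (\<Delta> - \<kappa>)\<close> the negative one.\<close>
  have sq: "(sqrt (4 * \<mu>\<^sup>2 + \<Delta>\<^sup>2))\<^sup>2 = 4 * \<mu>\<^sup>2 + \<Delta>\<^sup>2" by simp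
  have \<kappa>2: "\<kappa>\<^sup>2 = \<Delta> * \<kappa> + \<mu>\<^sup>2" unfolding \<kappa>_def using sq by (simp add: power2_eq_square field_simps)
  have "sqrt (4 * \<mu>\<^sup>2 + \<Delta>\<^sup>2) > sqrt (4 * \<mu>\<^sup>2)" using Delta_pos by (intro real_sqrt_less_mono) simp
  moreover have "sqrt (4 * \<mu>\<^sup>2) = 2 * \<mu>" using mu_pos by (simp add: real_sqrt_mult)
  ultimately have \<kappa>: "\<mu> < \<kappa>" using Delta_pos by (simp add: \<kappa>_def)
  have Xk: "\<mu> * \<kappa> < X" using X by (simp add: X_def \<kappa>_def)
  have X2: "\<mu>\<^sup>2 < X" using Xk mult_strict_left_mono[OF \<kappa> mu_pos] unfolding power2_eq_square by linarith
  have key: False if s: "eigen_system a b 1 0 r q" and b: "0 < b" and Xb: "X = a\<^sup>2 + b\<^sup>2 - 2 * a * \<mu>" for b q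
  proof -
    have "X\<^sup>2 - (\<mu>\<^sup>2)\<^sup>2 \<le> \<mu> * \<Delta> * X"
      by (rule coupled_inequalities[OF _ _ eigen_system_weighted(2)[OF s] b])
         (use eigen_system_pos_neg_square(1,2)[OF s less_imp_le[OF b] a] Xb X2 in auto)
    moreover have "(X - \<mu> * \<kappa>) * (X + \<mu> * (\<kappa> - \<Delta>)) = X\<^sup>2 - \<mu> * \<Delta> * X - \<mu>\<^sup>2 * (\<kappa>\<^sup>2 - \<Delta> * \<kappa>)"
      by (simp add: power2_eq_square algebra_simps)
    moreover have "\<mu>\<^sup>2 * (\<kappa>\<^sup>2 - \<Delta> * \<kappa>) = (\<mu>\<^sup>2)\<^sup>2" using \<kappa>2 by (simp add: power2_eq_square)
    ultimately have le: "(X - \<mu> * \<kappa>) * (X + \<mu> * (\<kappa> - \<Delta>)) \<le> 0" by linarith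
    have "\<Delta> < \<kappa>" using \<kappa> Delta_less_mu by linarith
    then have "0 < \<mu> * (\<kappa> - \<Delta>)" using mu_pos by simp
    moreover have "0 < X" using X2 zero_le_power2[of \<mu>] by linarith
    ultimately have "0 < (X - \<mu> * \<kappa>) * (X + \<mu> * (\<kappa> - \<Delta>))" using Xk by (intro mult_pos_pos) auto
    then show False using le by linarith
  qed
  show False
  proof (cases "b = 0")
    case True
    then have "a \<le> \<mu>" using no_real_eigenvalue_above_mu s by blast
    then have "a * a \<le> a * \<mu>" using a by (rule mult_left_mono)
    then have "X \<le> 0" using True mult_nonneg_nonneg[OF a less_imp_le[OF mu_pos]] by (simp add: X_def power2_eq_square)
    then show False using X2 zero_le_power2[of \<mu>] by linarith
  next
    case False
    then show False
      using key[OF s] key[OF eigen_system_conjugate[OF s, simplified]] by (cases "0 < b") (auto simp: X_def)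
  qed
qed

text \<open>For \<open>b > 0\<close>, \<open>coupled_inequalities\<close> applies with \<open>X = a\<^sup>2 + b\<^sup>2\<close> and \<open>k = 2 * |a| * \<mu> + \<mu>\<^sup>2\<close>; the assumption is
  \<open>X - k > \<mu> * \<Delta>\<close>. For \<open>b = 0\<close> it is already incompatible with the bound on the modulus.\<close>

lemma region_4:
  assumes s: "eigen_system a b 1 0 r q" and a: "a < 0" and bound: "sqrt (a\<^sup>2 + b\<^sup>2) \<le> \<mu> + \<Delta>"
    and X: "\<mu> * \<Delta> + \<mu>\<^sup>2 + 2 * \<bar>a\<bar> * \<mu> < a\<^sup>2 + b\<^sup>2"
  shows False
proof -
  define X where "X = a\<^sup>2 + b\<^sup>2"
  define k where "k = 2 * \<bar>a\<bar> * \<mu> + \<mu>\<^sup>2"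
  have k0: "0 \<le> k" using mu_pos by (simp add: k_def)
  have Xk: "k + \<mu> * \<Delta> < X" using X by (simp add: X_def k_def)
  have md: "0 < \<mu> * \<Delta>" using mu_pos Delta_pos by simp
  have key: False if s: "eigen_system a b 1 0 r q" and b: "0 < b" and Xb: "X = a\<^sup>2 + b\<^sup>2" for b q
  proof -
    have "X\<^sup>2 - k\<^sup>2 \<le> \<mu> * \<Delta> * X"
      by (rule coupled_inequalities[OF _ _ eigen_system_weighted(2)[OF s] b k0])
         (use eigen_system_pos_neg_square(3,4)[OF s less_imp_le[OF b] a] Xb Xk md in \<open>auto simp: k_def\<close>)
    moreover have "\<mu> * \<Delta> * X \<le> \<mu> * \<Delta> * (X + k)" using md k0 by (intro mult_left_mono) auto
    moreover have "\<mu> * \<Delta> * (X + k) < (X - k) * (X + k)" using Xk k0 md by (intro mult_strict_right_mono) auto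
    moreover have "(X - k) * (X + k) = X\<^sup>2 - k\<^sup>2" by (simp add: power2_eq_square algebra_simps)
    ultimately show False by linarith
  qed
  show False
  proof (cases "b = 0")
    case True
    then have "\<bar>a\<bar> \<le> \<mu> + \<Delta>" using bound by simp
    then have "\<bar>a\<bar> * \<bar>a\<bar> \<le> \<bar>a\<bar> * (\<mu> + \<Delta>)" by (intro mult_left_mono) auto
    moreover have "\<bar>a\<bar> * \<Delta> \<le> \<bar>a\<bar> * \<mu>" using Delta_less_mu by (intro mult_left_mono) auto
    ultimately have "\<bar>a\<bar> * \<bar>a\<bar> \<le> 2 * \<bar>a\<bar> * \<mu>" by (simp add: distrib_left)
    then have "X \<le> k" using True by (simp add: X_def k_def power2_eq_square add_increasing2)
    then show False using Xk md by linarith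
  next
    case False
    then show False
      using key[OF s] key[OF eigen_system_conjugate[OF s, simplified]] by (cases "0 < b") (auto simp: X_def)
  qed
qed

end

context branch_system
begin

section \<open>The spectrum of the transfer operator\<close>

lemma eigenfunction:
  assumes h: "h \<in> W21" and nz: "h \<noteq> (\<lambda>_. 0)" and eig: "Op h = (\<lambda>x. z * h x)"
  obtains g where "prim h g" "continuous_on {0..1} h" "continuous_on {0..1} g"
    "\<And>x. x \<in> {0..1} \<Longrightarrow> z * g x = Op1 h g x" "\<exists>x\<in>{0..1}. h x \<noteq> 0"
proof -
  define g where "g = dd h"
  have W: "W2 h g (d2 h)" unfolding g_def by (rule W21_W2[OF h])
  then have p: "prim h g" "prim g (d2 h)" by (auto simp: W2_def)
  have c: "continuous_on {0..1} h" "continuous_on {0..1} g" using p prim_continuous by auto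
  have WO: "W2 (Op h) (Op1 h g) (Op2 h g (d2 h))" by (rule W2_Op[OF W])
  have p': "prim (Op h) (\<lambda>x. z * g x)" unfolding eig by (rule prim_cmult[OF p(1)])
  have "z * g x = Op1 h g x" if "x \<in> {0..1}" for x
  proof (rule prim_unique[OF p' _ _ _ refl that])
    show "prim (Op h) (Op1 h g)" "continuous_on {0..1} (Op1 h g)"
      using WO prim_continuous by (auto simp: W2_def)
    show "continuous_on {0..1} (\<lambda>x. z * g x)" by (intro continuous_intros c)
  qed
  moreover have "\<exists>x\<in>{0..1}. h x \<noteq> 0"
  proof -
    obtain x where "h x \<noteq> 0" using nz by blast
    moreover have "\<And>x. x \<notin> {0..1} \<Longrightarrow> h x = 0" using h unfolding W21_iff by blast
    ultimately show ?thesis by blast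
  qed
  ultimately show ?thesis using that p(1) c by blast
qed

lemma Re_Op: "x \<in> {0..1} \<Longrightarrow> Re (Op h x) = Lr (\<lambda>x. Re (h x)) x"
  and Im_Op: "x \<in> {0..1} \<Longrightarrow> Im (Op h x) = Lr (\<lambda>x. Im (h x)) x"
  by (simp_all add: Op_def Lr_def)

lemma eigenvalue_bound:
  assumes h: "h \<in> W21" and nz: "h \<noteq> (\<lambda>_. 0)" and eig: "Op h = (\<lambda>x. z * h x)"
  shows "cmod z \<le> 1"
proof -
  obtain g where g: "continuous_on {0..1} h" "\<exists>x\<in>{0..1}. h x \<noteq> 0"
    by (rule eigenfunction[OF h nz eig])
  define m where "m x = cmod (h x)" for x
  have cm: "cont m" unfolding m_def by (intro continuous_intros g)
  have "cmod z * m x \<le> Lr m x" if x: "x \<in> {0..1}" for x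
  proof -
    have "cmod z * m x = cmod (Op h x)" by (simp add: eig m_def norm_mult)
    also have "\<dots> \<le> (\<Sum>i=1..N. cmod (complex_of_real (Y1 i x) * h (Y i x)))"
      using x by (simp add: Op_def norm_sum del: norm_mult)
    also have "\<dots> = Lr m x" unfolding Lr_def
    proof (rule sum.cong[OF refl])
      fix i assume "i \<in> {1..N}"
      from Y1_pos[OF this x] show "cmod (complex_of_real (Y1 i x) * h (Y i x)) = Y1 i x * m (Y i x)"
        by (simp add: norm_mult m_def)
    qed
    finally show ?thesis .
  qed
  then have "I (\<lambda>x. cmod z * m x) \<le> I (Lr m)"
    by (intro I_mono) (auto intro!: continuous_intros cm cont_Lr)
  then have "cmod z * I m \<le> I m" unfolding I_cmult I_Lr[OF cm] .
  moreover have "I m > 0"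
  proof -
    have "I m \<noteq> 0" using I_eq_0[OF cm, of] g(2) by (auto simp: m_def)
    moreover have "0 \<le> I m" by (rule I_nonneg[OF cm]) (simp add: m_def)
    ultimately show ?thesis by linarith
  qed
  ultimately show ?thesis by (simp add: mult_le_cancel_right1)
qed

lemma eigen_mean:
  assumes c: "continuous_on {0..1} h" and eig: "Op h = (\<lambda>x. Complex a b * h x)" and z: "Complex a b \<noteq> 1"
  shows "I (\<lambda>x. Re (h x)) = 0" "I (\<lambda>x. Im (h x)) = 0"
proof -
  define u where "u x = Re (h x)" for x
  define w where "w x = Im (h x)" for x
  have cu: "cont u" "cont w" unfolding u_def w_def by (auto intro!: continuous_intros c)
  have "I (Lr u) = I (\<lambda>x. a * u x + (- b) * w x)"
    by (rule I_cong) (simp add: Re_Op[symmetric] u_def[abs_def] w_def eig)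
  then have 1: "I u = a * I u - b * I w" unfolding I_Lr[OF cu(1)] I_lin[OF cu] by simp
  have "I (Lr w) = I (\<lambda>x. a * w x + b * u x)"
    by (rule I_cong) (simp add: Im_Op[symmetric] u_def w_def[abs_def] eig)
  then have 2: "I w = a * I w + b * I u" unfolding I_Lr[OF cu(2)] I_lin[OF cu(2,1)] .
  have "((a - 1)\<^sup>2 + b\<^sup>2) * I u = (a - 1) * (a * I u - b * I w - I u) + b * (a * I w + b * I u - I w)"
    by (simp add: power2_eq_square algebra_simps)
  then have u0: "((a - 1)\<^sup>2 + b\<^sup>2) * I u = 0" using 1 2 by simp
  have "((a - 1)\<^sup>2 + b\<^sup>2) * I w = (a - 1) * (a * I w + b * I u - I w) - b * (a * I u - b * I w - I u)"
    by (simp add: power2_eq_square algebra_simps)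
  then have w0: "((a - 1)\<^sup>2 + b\<^sup>2) * I w = 0" using 1 2 by simp
  have "(a - 1)\<^sup>2 + b\<^sup>2 \<noteq> 0" using z by (auto simp: sum_power2_eq_zero_iff complex_eq_iff)
  then show "I (\<lambda>x. Re (h x)) = 0" "I (\<lambda>x. Im (h x)) = 0" using u0 w0 unfolding u_def[abs_def] w_def[abs_def] mult_eq_0_iff by blast+
qed

text \<open>The differentiated eigenvalue equation. The side condition expresses that the mean of the eigenfunction
  vanishes; if the derivative vanished, the eigenfunction would be constant with mean zero.\<close>

lemma eigen_sys:
  assumes h: "h \<in> W21" and nz: "h \<noteq> (\<lambda>_. 0)" and eig: "Op h = (\<lambda>x. Complex a b * h x)" and z: "Complex a b \<noteq> 1"
  obtains A B r q where "eigen_system a b A B r q" "\<exists>x\<in>{0..1}. r x \<noteq> 0 \<or> q x \<noteq> 0"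
proof -
  obtain g where g: "prim h g" "continuous_on {0..1} h" "continuous_on {0..1} g"
    "\<And>x. x \<in> {0..1} \<Longrightarrow> Complex a b * g x = Op1 h g x" "\<exists>x\<in>{0..1}. h x \<noteq> 0"
    by (rule eigenfunction[OF h nz eig]) (rule that)
  define r where "r x = Re (g x)" for x
  define q where "q x = Im (g x)" for x
  define A where "A = Re (h 0)"
  define B where "B = Im (h 0)"
  have c: "cont r" "cont q" unfolding r_def q_def by (auto intro!: continuous_intros g)
  have der: "((\<lambda>x. Re (h x)) has_real_derivative r x) (at x within {0..1})"
    "((\<lambda>x. Im (h x)) has_real_derivative q x) (at x within {0..1})" if x: "x \<in> {0..1}" for x
    using bounded_linear.has_vector_derivative[OF bounded_linear_Re prim_has_vector_derivative[OF g(1,3) x]]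
      bounded_linear.has_vector_derivative[OF bounded_linear_Im prim_has_vector_derivative[OF g(1,3) x]]
    unfolding has_real_derivative_iff_has_vector_derivative r_def q_def .
  have val: "F x = F 0 + prim0 f x"
    if F: "\<And>x. x \<in> {0..1} \<Longrightarrow> (F has_real_derivative f x) (at x within {0..1})" and x: "x \<in> {0..1}" for F f x
  proof -
    have "(f has_integral F x - F 0) {0..x}"
    proof (rule fundamental_theorem_of_calculus)
      show "0 \<le> x" using x by simp
      fix y assume "y \<in> {0..x}"
      then show "(F has_vector_derivative f y) (at y within {0..x})"
        using has_vector_derivative_within_subset[OF F[of y, unfolded has_real_derivative_iff_has_vector_derivative]] x
        by auto
    qed
    then show ?thesis unfolding prim0_def by (simp add: integral_unique)
  qed
  have hr: "Re (h x) = A + prim0 r x" "Im (h x) = B + prim0 q x" if "x \<in> {0..1}" for x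
    using val[OF der(1) that] val[OF der(2) that] by (auto simp: A_def B_def)
  note mean = eigen_mean[OF g(2) eig z]
  have "eigen_system a b A B r q" unfolding eigen_system_def
  proof (intro conjI ballI c)
    fix x :: real assume x: "x \<in> {0..1}"
    have "a * r x - b * q x = Re (Op1 h g x)" using g(4)[OF x, symmetric] by (simp add: r_def q_def)
    also have "\<dots> = (\<Sum>i=1..N. Y2 i x * (A + prim0 r (Y i x)) + (Y1 i x)\<^sup>2 * r (Y i x))"
    proof -
      have "Re (Op1 h g x) = (\<Sum>i=1..N. Y2 i x * Re (h (Y i x)) + (Y1 i x)\<^sup>2 * Re (g (Y i x)))"
        using x by (simp add: Op1_def flip: of_real_power)
      also have "\<dots> = (\<Sum>i=1..N. Y2 i x * (A + prim0 r (Y i x)) + (Y1 i x)\<^sup>2 * r (Y i x))"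
        by (rule sum.cong[OF refl]) (use hr(1)[OF Y_range[OF _ x]] in \<open>simp add: r_def\<close>)
      finally show ?thesis .
    qed
    finally show "a * r x - b * q x = Pop r x + A * D x"
      by (simp add: Pop_def D_def sum.distrib sum_distrib_left algebra_simps)
    have "a * q x + b * r x = Im (Op1 h g x)" using g(4)[OF x, symmetric] by (simp add: r_def q_def)
    also have "\<dots> = (\<Sum>i=1..N. Y2 i x * (B + prim0 q (Y i x)) + (Y1 i x)\<^sup>2 * q (Y i x))"
    proof -
      have "Im (Op1 h g x) = (\<Sum>i=1..N. Y2 i x * Im (h (Y i x)) + (Y1 i x)\<^sup>2 * Im (g (Y i x)))"
        using x by (simp add: Op1_def flip: of_real_power)
      also have "\<dots> = (\<Sum>i=1..N. Y2 i x * (B + prim0 q (Y i x)) + (Y1 i x)\<^sup>2 * q (Y i x))"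
        by (rule sum.cong[OF refl]) (use hr(2)[OF Y_range[OF _ x]] in \<open>simp add: q_def\<close>)
      finally show ?thesis .
    qed
    finally show "a * q x + b * r x = Pop q x + B * D x"
      by (simp add: Pop_def D_def sum.distrib sum_distrib_left algebra_simps)
  next
    show "I (\<lambda>x. (1 - x) * r x) = - A" using I_by_parts[OF der(1) c(1)] mean(1) by (simp add: A_def)
    show "I (\<lambda>x. (1 - x) * q x) = - B" using I_by_parts[OF der(2) c(2)] mean(2) by (simp add: B_def)
  qed
  moreover have "\<exists>x\<in>{0..1}. r x \<noteq> 0 \<or> q x \<noteq> 0"
  proof (rule ccontr)
    assume "\<not> ?thesis"
    then have rq: "r x = 0" "q x = 0" if "x \<in> {0..1}" for x using that by auto
    have "prim0 r x = 0" "prim0 q x = 0" if "x \<in> {0..1}" for x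
      using prim0_cong[of r "\<lambda>_. 0" x] prim0_cong[of q "\<lambda>_. 0" x] rq that by (auto simp: prim0_def)
    then have hc: "Re (h x) = A" "Im (h x) = B" if "x \<in> {0..1}" for x using hr that by auto
    have "I (\<lambda>x. Re (h x)) = I (\<lambda>x. A)" "I (\<lambda>x. Im (h x)) = I (\<lambda>x. B)" by (auto intro!: I_cong simp: hc)
    then have "A = 0" "B = 0" using mean by (auto simp: I_def)
    then show False using g(5) hc by (auto simp: complex_eq_iff)
  qed
  ultimately show ?thesis by (rule that)
qed

lemma eigen_normalized:
  assumes h: "h \<in> W21" and nz: "h \<noteq> (\<lambda>_. 0)" and eig: "Op h = (\<lambda>x. Complex a b * h x)" and z: "Complex a b \<noteq> 1"
    and large: "\<mu> < cmod (Complex a b)"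
  obtains r q where "eigen_system a b 1 0 r q" "sqrt (a\<^sup>2 + b\<^sup>2) \<le> \<mu> + \<Delta>"
proof -
  obtain A B r q where s: "eigen_system a b A B r q" "\<exists>x\<in>{0..1}. r x \<noteq> 0 \<or> q x \<noteq> 0"
    by (rule eigen_sys[OF h nz eig z])
  have l: "\<mu> < sqrt (a\<^sup>2 + b\<^sup>2)" using large by (simp add: cmod_def)
  obtain r' q' where "eigen_system a b 1 0 r' q'" by (rule eigen_system_normalize[OF s(1) eigen_system_bounds(2)[OF s(1) l s(2)]])
  then show ?thesis using that eigen_system_bounds(1)[OF s(1) l s(2)] by blast
qed

text \<open>Integrating \<open>\<mu> * u = Pop u + C * D\<close> gives \<open>C * \<Delta> = 0\<close>, so \<open>u\<close> is an eigenfunction of \<open>Pop\<close> to which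
  \<open>Pop_eigen_mean_zero\<close> applies. Real and imaginary part are treated separately.\<close>

lemma mu_not_eigenvalue:
  assumes h: "h \<in> W21" and nz: "h \<noteq> (\<lambda>_. 0)"
  shows "Op h \<noteq> (\<lambda>x. complex_of_real \<mu> * h x)"
proof
  assume eig: "Op h = (\<lambda>x. complex_of_real \<mu> * h x)"
  have e: "Complex \<mu> 0 \<noteq> 1" "Op h = (\<lambda>x. Complex \<mu> 0 * h x)"
    using mu_less_1 eig by (auto simp: complex_eq_iff complex_of_real_def)
  obtain A B r q where s: "eigen_system \<mu> 0 A B r q" and nzr: "\<exists>x\<in>{0..1}. r x \<noteq> 0 \<or> q x \<noteq> 0"
    by (rule eigen_sys[OF h nz e(2,1)])
  have zero: "\<forall>x\<in>{0..1}. u x = 0"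
    if u: "cont u" and eq: "\<And>x. x \<in> {0..1} \<Longrightarrow> \<mu> * u x = Pop u x + C * D x" and w: "I (\<lambda>x. (1 - x) * u x) = - C" for u C
  proof -
    have "I (\<lambda>x. \<mu> * u x) = I (\<lambda>x. 1 * Pop u x + C * D x)" by (rule I_cong) (simp add: eq)
    then have "\<mu> * I u = 1 * (\<mu> * I u) + C * \<Delta>" unfolding I_cmult I_lin[OF cont_Pop[OF u] cont_D] I_Pop[OF u] I_D .
    then have "C = 0" using Delta_pos by simp
    then show ?thesis using Pop_eigen_mean_zero[OF u] eq w by simp
  qed
  have "\<forall>x\<in>{0..1}. r x = 0" using s by (intro zero[of r A]) (auto simp: eigen_system_def)
  moreover have "\<forall>x\<in>{0..1}. q x = 0" using s by (intro zero[of q B]) (auto simp: eigen_system_def)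
  ultimately show False using nzr by blast
qed

lemma mean_preserved: "h \<in> W21 \<Longrightarrow> integral {0..1} (Op h) = integral {0..1} h"
proof -
  assume h: "h \<in> W21"
  have c: "continuous_on {0..1} k" if "k \<in> W21" for k using that by (simp add: W21_def)
  have ch: "cont (\<lambda>x. Re (h x))" "cont (\<lambda>x. Im (h x))" by (auto intro!: continuous_intros c h)
  have int: "k integrable_on {0..1}" if "k \<in> W21" for k by (rule integrable_continuous_real[OF c[OF that]])
  have ri: "Re (integral {0..1} k) = I (\<lambda>x. Re (k x))" "Im (integral {0..1} k) = I (\<lambda>x. Im (k x))" if "k \<in> W21" for k
    using integral_linear[OF int[OF that] bounded_linear_Re] integral_linear[OF int[OF that] bounded_linear_Im]
    by (simp_all add: I_def o_def)
  have "I (\<lambda>x. Re (Op h x)) = I (Lr (\<lambda>x. Re (h x)))" "I (\<lambda>x. Im (Op h x)) = I (Lr (\<lambda>x. Im (h x)))"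
    by (auto intro!: I_cong simp: Re_Op Im_Op)
  then show ?thesis
    by (intro complex_eqI) (simp_all add: ri[OF h] ri[OF W21_Op[OF h]] I_Lr ch)
qed

lemma fixed_zero:
  assumes h: "h \<in> W21" and fixed: "Op h = h" and mean: "integral {0..1} h = 0"
  shows "h = (\<lambda>_. 0)"
proof -
  have c: "continuous_on {0..1} h" using h by (simp add: W21_def)
  have int: "h integrable_on {0..1}" by (rule integrable_continuous_real[OF c])
  have ri: "I (\<lambda>x. Re (h x)) = 0" "I (\<lambda>x. Im (h x)) = 0"
    using integral_linear[OF int bounded_linear_Re] integral_linear[OF int bounded_linear_Im] mean
    by (simp_all add: I_def o_def)
  have "\<forall>x\<in>{0..1}. Re (h x) = 0"
    by (rule fixed_mean_zero[OF _ _ ri(1)]) (auto intro!: continuous_intros c simp: Re_Op[symmetric] fixed)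
  moreover have "\<forall>x\<in>{0..1}. Im (h x) = 0"
    by (rule fixed_mean_zero[OF _ _ ri(2)]) (auto intro!: continuous_intros c simp: Im_Op[symmetric] fixed)
  moreover have "h x = 0" if "x \<notin> {0..1}" for x using h that unfolding W21_iff by blast
  ultimately show ?thesis by (auto simp: fun_eq_iff complex_eq_iff)
qed

text \<open>The range of \<open>1 - Op\<close> consists of functions of mean zero, so it misses the constant \<open>1\<close>.\<close>

lemma one_in_spectrum: "1 \<in> spectrum W21 norm_W21 Op"
proof (rule ccontr)
  assume "1 \<notin> spectrum W21 norm_W21 Op"
  then obtain R where R: "bounded_op W21 norm_W21 R" "\<And>h. h \<in> W21 \<Longrightarrow> shift Op 1 (R h) = h"
    unfolding spectrum_def by blast
  define e where "e x = (if x \<in> {0..1} then 1 else 0 :: complex)" for x :: real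
  have "prim e (\<lambda>_. 0)" by (rule prim_cong_left[OF prim_zero[of 1]]) (simp add: e_def)
  then have e: "e \<in> W21" using prim_zero[of 0] by (auto simp: W21_iff W2_def e_def)
  have Re: "R e \<in> W21" using R(1) e by (simp add: bounded_op_def)
  have int: "k integrable_on {0..1}" if "k \<in> W21" for k
    using that by (intro integrable_continuous_real) (simp add: W21_def)
  have "integral {0..1} e = integral {0..1} (\<lambda>x. R e x - Op (R e) x)"
    using R(2)[OF e] by (simp add: shift_def)
  also have "\<dots> = 0" by (simp add: integral_diff int Re W21_Op mean_preserved)
  finally have "integral {0..1} e = 0" .
  moreover have "integral {0..1} e = integral {0..1} (\<lambda>x::real. 1 :: complex)"
    by (rule integral_cong) (simp add: e_def)
  ultimately show False by simp
qed

lemma mu2_less: "\<mu>\<^sup>2 < \<mu>" "\<mu>\<^sup>2 < 1"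
  using mu_less_1 mult_strict_left_mono[OF mu_less_1 mu_pos] unfolding power2_eq_square by linarith+

text \<open>A fixed function is determined by its mean, so the eigenspace is a line. In the range of \<open>1 - Op\<close> all
  means vanish, so it contains no fixed function but \<open>0\<close>, and there are no further generalized
  eigenvectors.\<close>

lemma simple_eigenvalue_1: "simple_eigenvalue W21 Op 1"
proof -
  obtain e where e: "e \<in> W21" "e \<noteq> (\<lambda>_. 0)" "Op e = e"
    using eigenvalue_of_spectrum[OF _ one_in_spectrum] mu2_less(2) by auto
  define m where "m = integral {0..1} e"
  have m: "m \<noteq> 0" using fixed_zero[OF e(1,3)] e(2) by (auto simp: m_def)
  have int: "k integrable_on {0..1}" if "k \<in> W21" for k
    using that by (intro integrable_continuous_real) (simp add: W21_def)
  have sh: "shift Op 1 h \<in> W21" "integral {0..1} (shift Op 1 h) = 0" if h: "h \<in> W21" for h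
  proof -
    show "shift Op 1 h \<in> W21"
      using W21_add[OF h W21_cmult[OF W21_Op[OF h], of "-1"]] by (simp add: shift_def)
    show "integral {0..1} (shift Op 1 h) = 0"
      by (simp add: shift_def integral_diff int h W21_Op mean_preserved)
  qed
  have shiftz: "Op h = h" if "shift Op 1 h = (\<lambda>_. 0)" for h
    using that by (auto simp: shift_def fun_eq_iff)
  have reduce: "shift Op 1 h = (\<lambda>_. 0)" if "(shift Op 1 ^^ n) h = (\<lambda>_. 0)" "h \<in> W21" for n h
    using that
  proof (induction n arbitrary: h)
    case 0
    then show ?case using L_add[of 0 0] by (simp add: shift_def Op_def fun_eq_iff)
  next
    case (Suc n)
    have "(shift Op 1 ^^ n) (shift Op 1 h) = (\<lambda>_. 0)" using Suc.prems(1) by (simp add: funpow_swap1)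
    then have "shift Op 1 (shift Op 1 h) = (\<lambda>_. 0)" using Suc.IH sh(1)[OF Suc.prems(2)] by blast
    then show ?case using fixed_zero[OF sh(1)[OF Suc.prems(2)] shiftz sh(2)[OF Suc.prems(2)]] by blast
  qed
  have "gen_eigenspace W21 Op 1 = {\<lambda>x. c * e x | c. True}"
  proof (intro equalityI subsetI)
    fix h assume "h \<in> gen_eigenspace W21 Op 1"
    then obtain n where h: "h \<in> W21" "(shift Op 1 ^^ n) h = (\<lambda>_. 0)" by (auto simp: gen_eigenspace_def)
    have Lh: "Op h = h" by (rule shiftz[OF reduce[OF h(2,1)]])
    define c where "c = integral {0..1} h / m"
    define k where "k x = h x + (- c) * e x" for x
    have kW: "k \<in> W21" unfolding k_def by (intro W21_add W21_cmult h e)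
    have "Op k x = k x" for x
    proof -
      have "Op k x = Op h x + (- c) * Op e x"
        unfolding Op_def k_def
        by (simp add: distrib_left sum.distrib sum_distrib_left sum_subtractf right_diff_distrib mult_ac del: One_nat_def)
      then show ?thesis by (simp add: Lh e(3) k_def)
    qed
    then have "Op k = k" by blast
    moreover have "integral {0..1} k = 0"
    proof -
      have "integral {0..1} k = integral {0..1} h + integral {0..1} (\<lambda>x. (- c) * e x)"
        unfolding k_def by (intro integral_add int h W21_cmult e)
      also have "integral {0..1} (\<lambda>x. (- c) * e x) = (- c) * m" unfolding m_def by (rule integral_mult_right)
      finally show ?thesis using m by (simp add: c_def)
    qed
    ultimately have "k = (\<lambda>_. 0)" by (rule fixed_zero[OF kW])
    then have "h = (\<lambda>x. c * e x)" by (simp add: k_def fun_eq_iff)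
    then show "h \<in> {\<lambda>x. c * e x | c. True}" by blast
  next
    fix h assume "h \<in> {\<lambda>x. c * e x | c. True}"
    then obtain c where h: "h = (\<lambda>x. c * e x)" by blast
    have "Op h = (\<lambda>x. c * Op e x)" unfolding h by (auto simp: Op_def sum_distrib_left mult_ac fun_eq_iff)
    then have "(shift Op 1 ^^ 1) h = (\<lambda>_. 0)" by (simp add: shift_def e(3) h)
    then show "h \<in> gen_eigenspace W21 Op 1" unfolding gen_eigenspace_def using W21_cmult[OF e(1)] h by blast
  qed
  then show ?thesis unfolding simple_eigenvalue_def using e by (intro bexI[of _ e]) auto
qed

lemma spectrum_eigen:
  assumes "z \<in> spectrum W21 norm_W21 Op" "\<mu>\<^sup>2 < cmod z"
  obtains h where "h \<in> W21" "h \<noteq> (\<lambda>_. 0)" "Op h = (\<lambda>x. z * h x)"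
  using eigenvalue_of_spectrum[OF assms(2,1)] by blast

lemma spectrum_sys:
  assumes "z \<in> spectrum W21 norm_W21 Op" "\<mu> < cmod z" "z \<noteq> 1"
  obtains r q where "eigen_system (Re z) (Im z) 1 0 r q" "cmod z \<le> \<mu> + \<Delta>"
proof -
  obtain h where h: "h \<in> W21" "h \<noteq> (\<lambda>_. 0)" "Op h = (\<lambda>x. z * h x)"
    using spectrum_eigen[OF assms(1)] assms(2) mu2_less(1) by (metis less_trans)
  obtain r q where "eigen_system (Re z) (Im z) 1 0 r q" "sqrt ((Re z)\<^sup>2 + (Im z)\<^sup>2) \<le> \<mu> + \<Delta>"
    by (rule eigen_normalized[of h "Re z" "Im z"]) (use h assms in auto)
  then show ?thesis using that by (simp add: cmod_def)
qed

lemma spectrum_bound: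
  "spectrum W21 norm_W21 Op \<subseteq> {z. cmod z \<le> min 1 (\<mu> + \<Delta>)} \<union> {1}"
proof
  fix z assume z: "z \<in> spectrum W21 norm_W21 Op"
  show "z \<in> {z. cmod z \<le> min 1 (\<mu> + \<Delta>)} \<union> {1}"
  proof (cases "z = 1")
    case False
    have "cmod z \<le> 1"
    proof (rule ccontr)
      assume "\<not> cmod z \<le> 1"
      then have "\<mu>\<^sup>2 < cmod z" using mu2_less(2) by linarith
      then obtain h where "h \<in> W21" "h \<noteq> (\<lambda>_. 0)" "Op h = (\<lambda>x. z * h x)" using spectrum_eigen[OF z] by blast
      from eigenvalue_bound[OF this] show False using \<open>\<not> cmod z \<le> 1\<close> by simp
    qed
    moreover have "cmod z \<le> \<mu> + \<Delta>"
    proof (cases "\<mu> < cmod z")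
      case True
      then show ?thesis using spectrum_sys[OF z True False] by blast
    next
      case False
      then show ?thesis using Delta_pos by linarith
    qed
    ultimately show ?thesis by simp
  qed simp
qed

text \<open>The point \<open>\<mu>\<close> exceeds the radius \<open>\<mu>\<^sup>2\<close>, so it is isolated in the spectrum, where it could only be an
  eigenvalue; to the right of it there are no real eigenvalues below \<open>1\<close>.\<close>

lemma gap: obtains \<mu>2 where "\<mu>2 < \<mu>" "A0 \<mu>2 \<inter> (spectrum W21 norm_W21 Op - {1}) = {}"
proof -
  have "\<not> complex_of_real \<mu> islimpt spectrum W21 norm_W21 Op"
    by (rule spectrum_isolated) (use mu2_less mu_pos in auto)
  then obtain U where U: "complex_of_real \<mu> \<in> U" "open U"
    "\<And>y. y \<in> spectrum W21 norm_W21 Op \<Longrightarrow> y \<in> U \<Longrightarrow> y = complex_of_real \<mu>"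
    unfolding islimpt_def by blast
  then obtain \<epsilon> where \<epsilon>: "\<epsilon> > 0" "ball (complex_of_real \<mu>) \<epsilon> \<subseteq> U" by (meson open_contains_ball)
  define \<mu>2 where "\<mu>2 = \<mu> - min \<epsilon> (\<mu> - \<mu>\<^sup>2)"
  have \<mu>2: "\<mu>2 < \<mu>" "\<mu> - \<epsilon> \<le> \<mu>2" "\<mu>\<^sup>2 \<le> \<mu>2" using \<epsilon> mu2_less(1) by (auto simp: \<mu>2_def)
  have "z \<notin> spectrum W21 norm_W21 Op" if "z \<in> A0 \<mu>2" for z
  proof
    assume z: "z \<in> spectrum W21 norm_W21 Op"
    obtain a where a: "z = complex_of_real a" "\<mu>2 < a" "a < 1" using \<open>z \<in> A0 \<mu>2\<close> by (auto simp: A0_def)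
    have a0: "0 < a" using a \<mu>2(3) zero_le_power2[of \<mu>] by linarith
    then have a1: "\<mu>\<^sup>2 < cmod z" using a \<mu>2(3) by simp
    consider "a < \<mu>" | "a = \<mu>" | "\<mu> < a" by linarith
    then show False
    proof cases
      case 1
      then have "dist (complex_of_real \<mu>) z < \<epsilon>"
        using a \<mu>2(2) by (simp add: dist_norm norm_of_real flip: of_real_diff)
      then have "z = complex_of_real \<mu>" using U(3)[OF z] \<epsilon>(2) by auto
      then show ?thesis using 1 a(1) by simp
    next
      case 2
      then show ?thesis using spectrum_eigen[OF z a1] mu_not_eigenvalue a(1) by metis
    next
      case 3
      have "\<mu> < cmod z" "z \<noteq> 1" using 3 a a0 by auto
      then obtain r q where "eigen_system a 0 1 0 r q"
        by (rule spectrum_sys[OF z]) (rule that, simp add: a(1))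
      then show ?thesis using no_real_eigenvalue_above_mu 3 by fastforce
    qed
  qed
  then show ?thesis using that \<mu>2(1) by blast
qed

text \<open>Clearing the square root: with \<open>t = 2 \<sigma> b\<^sup>2 / (\<eta> \<Delta>)\<close> the defining condition is \<open>1 + t < K\<close> for the root \<open>K\<close>, and
  squaring it gives the polynomial condition of \<open>region_1\<close>.\<close>

lemma region_1_free: "A1 \<mu> \<Delta> \<Gamma> \<inter> (spectrum W21 norm_W21 Op - {1}) = {}"
proof -
  have False if z: "z \<in> spectrum W21 norm_W21 Op" "z \<noteq> 1" "z \<in> A1 \<mu> \<Delta> \<Gamma>" for z
  proof -
    obtain a b where ab: "z = Complex a b" "\<mu> < a" and
      b2: "b\<^sup>2 < (a - \<mu>) * \<Delta> / (2 * (1 + inverse a * \<Gamma>)) *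
       (sqrt (1 + 4 * ((1 + inverse a * \<Gamma>)\<^sup>2 * (a - \<mu>)\<^sup>2 / \<Delta>\<^sup>2)) - 1)"
      using z(3) by (auto simp: A1_def)
    have "\<mu> < cmod z" using ab abs_Re_le_cmod[of z] by simp
    then obtain r q where s: "eigen_system a b 1 0 r q"
      by (rule spectrum_sys[OF z(1) _ z(2)]) (rule that, simp add: ab(1))
    define \<sigma> where "\<sigma> = 1 + inverse a * \<Gamma>"
    define \<eta> where "\<eta> = a - \<mu>"
    have pos: "\<eta> > 0" "\<sigma> > 0" "\<Delta> > 0"
      using ab(2) Gamma_nonneg Delta_pos mu_pos by (auto simp: \<eta>_def \<sigma>_def add_pos_nonneg)
    define K where "K = sqrt (1 + 4 * (\<sigma>\<^sup>2 * \<eta>\<^sup>2 / \<Delta>\<^sup>2))"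
    define t where "t = 2 * \<sigma> * b\<^sup>2 / (\<eta> * \<Delta>)"
    have t0: "t \<ge> 0" using pos by (simp add: t_def)
    have "b\<^sup>2 < \<eta> * \<Delta> / (2 * \<sigma>) * (K - 1)" using b2 by (simp add: \<eta>_def \<sigma>_def K_def)
    then have "2 * \<sigma> / (\<eta> * \<Delta>) * b\<^sup>2 < 2 * \<sigma> / (\<eta> * \<Delta>) * (\<eta> * \<Delta> / (2 * \<sigma>) * (K - 1))"
      using pos by (intro mult_strict_left_mono) auto
    also have "\<dots> = K - 1" using pos by simp
    finally have "t + 1 < K" by (simp add: t_def)
    then have "(t + 1)\<^sup>2 < K\<^sup>2" using t0 by (intro power_strict_mono) auto
    also have "K\<^sup>2 = 1 + 4 * (\<sigma>\<^sup>2 * \<eta>\<^sup>2 / \<Delta>\<^sup>2)" unfolding K_def by (rule real_sqrt_pow2) simp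
    finally have "t\<^sup>2 + 2 * t < 4 * (\<sigma>\<^sup>2 * \<eta>\<^sup>2 / \<Delta>\<^sup>2)" by (simp add: power2_eq_square algebra_simps)
    then have "(\<eta>\<^sup>2 * \<Delta>\<^sup>2 / (4 * \<sigma>)) * (t\<^sup>2 + 2 * t) < (\<eta>\<^sup>2 * \<Delta>\<^sup>2 / (4 * \<sigma>)) * (4 * (\<sigma>\<^sup>2 * \<eta>\<^sup>2 / \<Delta>\<^sup>2))"
      using pos by (intro mult_strict_left_mono) auto
    also have "\<dots> = \<sigma> * \<eta> ^ 4" using pos by (simp add: power2_eq_square power4_eq_xxxx field_simps)
    also have "(\<eta>\<^sup>2 * \<Delta>\<^sup>2 / (4 * \<sigma>)) * (t\<^sup>2 + 2 * t) = \<sigma> * (b\<^sup>2)\<^sup>2 + b\<^sup>2 * (\<eta> * \<Delta>)"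
      using pos by (simp add: t_def power2_eq_square field_simps)
    finally have "b\<^sup>2 * ((a - \<mu>) * \<Delta>) < (1 + inverse a * \<Gamma>) * ((a - \<mu>) ^ 4 - (b\<^sup>2)\<^sup>2)"
      unfolding \<eta>_def[symmetric] \<sigma>_def[symmetric] by (simp add: algebra_simps)
    then show False by (rule region_1[OF s ab(2)])
  qed
  then show ?thesis by blast
qed

lemma region_2_free: "A2 \<mu> \<Delta> \<inter> (spectrum W21 norm_W21 Op - {1}) = {}"
proof -
  have False if z: "z \<in> spectrum W21 norm_W21 Op" "z \<noteq> 1" "z \<in> A2 \<mu> \<Delta>" for z
  proof -
    obtain a b where ab: "z = Complex a b" "a < - \<mu>" and
      b2: "b\<^sup>2 < (\<bar>a\<bar> - \<mu>)\<^sup>2 * (a\<^sup>2 - \<mu>\<^sup>2 - \<Delta> * \<bar>a\<bar>) / (a\<^sup>2 - \<mu>\<^sup>2 + \<Delta> * \<bar>a\<bar>)"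
      using z(3) by (auto simp: A2_def)
    define \<alpha> where "\<alpha> = - a"
    have \<alpha>: "\<mu> < \<alpha>" "\<bar>a\<bar> = \<alpha>" "a = - \<alpha>" using ab(2) mu_pos by (auto simp: \<alpha>_def)
    have "\<mu> < cmod z" using ab(1) \<alpha> abs_Re_le_cmod[of z] by simp
    then obtain r q where s: "eigen_system (- \<alpha>) b 1 0 r q"
      by (rule spectrum_sys[OF z(1) _ z(2)]) (rule that, simp add: ab(1) \<alpha>(3))
    have "\<mu>\<^sup>2 < \<alpha>\<^sup>2" using \<alpha>(1) mu_pos by (intro power_strict_mono) auto
    then have "0 < \<alpha>\<^sup>2 - \<mu>\<^sup>2 + \<Delta> * \<alpha>" using \<alpha>(1) mu_pos Delta_pos by (simp add: add_pos_pos)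
    then have "b\<^sup>2 * (\<alpha>\<^sup>2 - \<mu>\<^sup>2 + \<Delta> * \<alpha>) < (\<alpha> - \<mu>)\<^sup>2 * (\<alpha>\<^sup>2 - \<mu>\<^sup>2 - \<Delta> * \<alpha>)"
      using b2 unfolding \<alpha>(2) by (simp add: \<alpha>(3) pos_less_divide_eq)
    then show False by (rule region_2[OF s \<alpha>(1)])
  qed
  then show ?thesis by blast
qed

lemma region_3_free: "A3 \<mu> \<Delta> \<inter> (spectrum W21 norm_W21 Op - {1}) = {}"
proof -
  have False if z: "z \<in> spectrum W21 norm_W21 Op" "z \<noteq> 1" "z \<in> A3 \<mu> \<Delta>" for z
  proof -
    obtain a b where ab: "z = Complex a b" "0 \<le> a" and
      X: "(cmod (Complex a b - complex_of_real \<mu>))\<^sup>2 > \<mu>\<^sup>2 + \<mu> * ((\<Delta> + sqrt (4 * \<mu>\<^sup>2 + \<Delta>\<^sup>2)) / 2)"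
      using z(3) by (auto simp: A3_def)
    have "(cmod (Complex a b - complex_of_real \<mu>))\<^sup>2 = (a - \<mu>)\<^sup>2 + b\<^sup>2"
      by (simp add: cmod_power2)
    then have X': "\<mu> * ((\<Delta> + sqrt (4 * \<mu>\<^sup>2 + \<Delta>\<^sup>2)) / 2) < a\<^sup>2 + b\<^sup>2 - 2 * a * \<mu>"
      using X by (simp add: power2_eq_square algebra_simps)
    have "\<mu> \<le> (\<Delta> + sqrt (4 * \<mu>\<^sup>2 + \<Delta>\<^sup>2)) / 2"
    proof -
      have "sqrt (4 * \<mu>\<^sup>2) \<le> sqrt (4 * \<mu>\<^sup>2 + \<Delta>\<^sup>2)" by (intro real_sqrt_le_mono) simp
      then show ?thesis using mu_pos Delta_pos by (simp add: real_sqrt_mult)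
    qed
    then have "\<mu> * \<mu> \<le> \<mu> * ((\<Delta> + sqrt (4 * \<mu>\<^sup>2 + \<Delta>\<^sup>2)) / 2)" using mu_pos by (intro mult_left_mono) auto
    moreover have "0 \<le> 2 * a * \<mu>" using ab(2) mu_pos by simp
    ultimately have "\<mu>\<^sup>2 < (cmod z)\<^sup>2" using X' unfolding ab(1) cmod_power2 by (simp add: power2_eq_square)
    then have "\<mu> < cmod z" by (rule power2_less_imp_less) simp
    then obtain r q where s: "eigen_system a b 1 0 r q"
      by (rule spectrum_sys[OF z(1) _ z(2)]) (rule that, simp add: ab(1))
    then show False by (rule region_3[OF _ ab(2) X'])
  qed
  then show ?thesis by blast
qed

lemma region_4_free: "A4 \<mu> \<Delta> \<inter> (spectrum W21 norm_W21 Op - {1}) = {}"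
proof -
  have False if z: "z \<in> spectrum W21 norm_W21 Op" "z \<noteq> 1" "z \<in> A4 \<mu> \<Delta>" for z
  proof -
    obtain a b where ab: "z = Complex a b" "a < 0" and
      X: "b\<^sup>2 > \<mu> * \<Delta> + \<mu>\<^sup>2 + 2 * \<bar>a\<bar> * \<mu> - a\<^sup>2"
      using z(3) by (auto simp: A4_def)
    have X': "\<mu> * \<Delta> + \<mu>\<^sup>2 + 2 * \<bar>a\<bar> * \<mu> < a\<^sup>2 + b\<^sup>2" using X by simp
    moreover have "0 \<le> \<mu> * \<Delta>" "0 \<le> 2 * \<bar>a\<bar> * \<mu>" using mu_pos Delta_pos by auto
    ultimately have "\<mu>\<^sup>2 < (cmod z)\<^sup>2" unfolding ab(1) cmod_power2 by simp
    then have "\<mu> < cmod z" by (rule power2_less_imp_less) simp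
    then obtain r q where s: "eigen_system a b 1 0 r q" "cmod z \<le> \<mu> + \<Delta>" using spectrum_sys[OF z(1) _ z(2)] ab(1) by auto
    show False by (rule region_4[OF s(1) ab(2) _ X']) (use s(2) ab(1) in \<open>simp add: cmod_def\<close>)
  qed
  then show ?thesis by blast
qed

end

section \<open>From the map to its inverse branches\<close>

lemma not_bot_within_Ioo:
  assumes "(a::real) < b" "x \<in> {a..b}"
  shows "at x within {a<..<b} \<noteq> bot"
proof -
  consider "x = a" | "x = b" | "x \<in> {a<..<b}" using assms by force
  then show ?thesis
  proof cases
    case 3
    then show ?thesis by (simp add: at_within_open[OF 3])
  qed (use assms(1) in \<open>auto simp: trivial_limit_within islimpt_greaterThanLessThan1 islimpt_greaterThanLessThan2\<close>)
qed

lemma ext_eq: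
  assumes ab: "a < b" and x: "x \<in> {a..b}" and eq: "\<And>y. y \<in> {a<..<b} \<Longrightarrow> g y = G y"
    and G: "continuous_on {a..b} G"
  shows "ext a b g x = G x"
  unfolding ext_def
proof (rule tendsto_Lim[OF not_bot_within_Ioo[OF ab x]])
  have "(G \<longlongrightarrow> G x) (at x within {a<..<b})"
    by (rule tendsto_within_subset[OF G[unfolded continuous_on_def, rule_format, OF x]]) auto
  moreover have "\<forall>\<^sub>F y in at x within {a<..<b}. G y = g y"
    unfolding eventually_at_filter by (rule always_eventually) (simp add: eq)
  ultimately show "(g \<longlongrightarrow> G x) (at x within {a<..<b})" by (rule Lim_transform_eventually)
qed

lemma right_lim_eq_ext: "a < b \<Longrightarrow> right_lim g a = ext a b g a"
  unfolding right_lim_def ext_def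
  by (intro arg_cong2[where f = Lim] at_within_nhd[of a "{..<b}"] refl) auto

lemma left_lim_eq_ext: "a < b \<Longrightarrow> left_lim g b = ext a b g b"
  unfolding left_lim_def ext_def
  by (intro arg_cong2[where f = Lim] at_within_nhd[of b "{a<..}"] refl) auto

text \<open>One branch of the map: \<open>D 0\<close> is its continuous extension to the closed interval, \<open>D j\<close> the \<open>j\<close>-th derivative,
  one-sided at the ends.\<close>

locale full_branch =
  fixes a b :: real and D :: "nat \<Rightarrow> real \<Rightarrow> real"
  assumes ab: "a < b"
    and dD: "j < 3 \<Longrightarrow> x \<in> {a..b} \<Longrightarrow> (D j has_real_derivative D (Suc j) x) (at x within {a..b})"
    and cD3: "continuous_on {a..b} (D 3)"
    and D1_pos: "x \<in> {a..b} \<Longrightarrow> 0 < D 1 x"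
    and onto: "D 0 ` {a..b} = {0..1}"
begin

text \<open>The inverse \<open>Z\<close> and, as functions of the derivatives of the branch, its first three derivatives.\<close>

definition Z :: "real \<Rightarrow> real" where "Z = inv_into {a..b} (D 0)"
definition Z1 :: "real \<Rightarrow> real" where "Z1 x = 1 / D 1 (Z x)"
definition Z2 :: "real \<Rightarrow> real" where "Z2 x = - D 2 (Z x) / (D 1 (Z x)) ^ 3"
definition Z3 :: "real \<Rightarrow> real" where
  "Z3 x = (3 * (D 2 (Z x))\<^sup>2 - D 3 (Z x) * D 1 (Z x)) / (D 1 (Z x)) ^ 5"

lemma cD: "j \<le> 3 \<Longrightarrow> continuous_on {a..b} (D j)"
proof -
  assume "j \<le> 3"
  then consider "j < 3" | "j = 3" by linarith
  then show ?thesis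
  proof cases
    case 1
    then show ?thesis using dD[OF 1] DERIV_continuous_on by blast
  qed (simp add: cD3)
qed

lemma strict: assumes "a \<le> x" "x < y" "y \<le> b" shows "D 0 x < D 0 y"
proof -
  have "\<exists>z\<in>{x<..<y}. D 0 y - D 0 x = D 1 z * (y - x)"
  proof (rule mvt_simple[of x y "D 0" "\<lambda>z. (*) (D 1 z)"])
    show "(D 0 has_derivative (*) (D 1 z)) (at z within {x..y})" if "x \<le> z" "z \<le> y" for z
      using has_field_derivative_subset[OF dD[of 0 z], of "{x..y}"] that assms
      unfolding has_field_derivative_def by auto
  qed (use assms in auto)
  then obtain z where z: "z \<in> {x<..<y}" "D 0 y - D 0 x = D 1 z * (y - x)" by blast
  then have "0 < D 1 z * (y - x)" using D1_pos[of z] assms by (intro mult_pos_pos) auto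
  then show ?thesis using z(2) by linarith
qed

lemma inj: "inj_on (D 0) {a..b}"
proof (rule linorder_inj_onI')
  fix x y assume "x \<in> {a..b}" "y \<in> {a..b}" "x < y"
  then show "D 0 x \<noteq> D 0 y" using strict[of x y] by auto
qed

lemma Z_D: "x \<in> {a..b} \<Longrightarrow> Z (D 0 x) = x"
  unfolding Z_def by (rule inv_into_f_f[OF inj])

lemma Z_range: "x \<in> {0..1} \<Longrightarrow> Z x \<in> {a..b}" and D_Z: "x \<in> {0..1} \<Longrightarrow> D 0 (Z x) = x"
  unfolding Z_def using onto inv_into_into[of x "D 0" "{a..b}"] f_inv_into_f[of x "D 0" "{a..b}"] by auto

lemma D_ends: "D 0 a = 0" "D 0 b = 1"
proof -
  have r: "D 0 a \<in> {0..1}" "D 0 b \<in> {0..1}" using onto ab by auto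
  have "Z 0 \<in> {a..b}" "D 0 (Z 0) = 0" "Z 1 \<in> {a..b}" "D 0 (Z 1) = 1" using Z_range D_Z by auto
  then show "D 0 a = 0" "D 0 b = 1" using strict[of a "Z 0"] strict[of "Z 1" b] r by force+
qed

lemma Z_0: "Z 0 = a" and Z_1: "Z 1 = b"
  using Z_D[of a] Z_D[of b] D_ends ab by auto

lemma cZ: "continuous_on {0..1} Z"
  using continuous_on_inv[OF cD[of 0], of Z] Z_D by (simp add: onto)

lemma dZ: assumes x: "x \<in> {0..1}" shows "(Z has_real_derivative Z1 x) (at x within {0..1})"
proof -
  have "(Z has_derivative (*) (Z1 x)) (at (D 0 (Z x)) within D 0 ` {a..b})"
  proof (rule has_derivative_inverse_within)
    show "(D 0 has_derivative (*) (D 1 (Z x))) (at (Z x) within {a..b})"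
      using dD[of 0 "Z x"] Z_range[OF x] unfolding has_field_derivative_def by simp
    show "continuous (at (D 0 (Z x)) within D 0 ` {a..b}) Z"
      using cZ x by (simp add: onto D_Z continuous_on_eq_continuous_within)
    show "(*) (Z1 x) \<circ> (*) (D 1 (Z x)) = id"
      using D1_pos[OF Z_range[OF x]] by (auto simp: Z1_def fun_eq_iff)
  qed (use Z_range[OF x] Z_D in \<open>auto intro!: linear_times\<close>)
  then show ?thesis unfolding has_field_derivative_def onto D_Z[OF x] .
qed

lemma D_comp:
  assumes j: "j < 3" and x: "x \<in> {0..1}"
  shows "((\<lambda>x. D j (Z x)) has_real_derivative D (Suc j) (Z x) * Z1 x) (at x within {0..1})"
proof -
  have "(D j \<circ> Z has_real_derivative D (Suc j) (Z x) * Z1 x) (at x within {0..1})"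
  proof (rule DERIV_image_chain[OF _ dZ[OF x]])
    have "Z ` {0..1} \<subseteq> {a..b}" using Z_range by auto
    then show "(D j has_real_derivative D (Suc j) (Z x)) (at (Z x) within Z ` {0..1})"
      using has_field_derivative_subset[OF dD[OF j Z_range[OF x]]] by blast
  qed
  then show ?thesis by (simp add: o_def)
qed

lemma dZ1: assumes x: "x \<in> {0..1}" shows "(Z1 has_real_derivative Z2 x) (at x within {0..1})"
proof -
  have p: "D 1 (Z x) \<noteq> 0" using D1_pos[OF Z_range[OF x]] by simp
  have "((\<lambda>x. 1 / D 1 (Z x)) has_real_derivative Z2 x) (at x within {0..1})"
    by (rule derivative_eq_intros D_comp[of 1, OF _ x] p | simp)+
      (use p in \<open>simp add: Z2_def Z1_def numeral_2_eq_2 power3_eq_cube field_simps\<close>)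
  then show ?thesis by (simp add: Z1_def[abs_def])
qed

lemma dZ2: assumes x: "x \<in> {0..1}" shows "(Z2 has_real_derivative Z3 x) (at x within {0..1})"
proof -
  have p: "D 1 (Z x) \<noteq> 0" using D1_pos[OF Z_range[OF x]] by simp
  have "((\<lambda>x. - D 2 (Z x) / (D 1 (Z x)) ^ 3) has_real_derivative
      (- (D 3 (Z x) * Z1 x) * D 1 (Z x) ^ 3 - - D 2 (Z x) * (3 * D 1 (Z x) ^ 2 * (D 2 (Z x) * Z1 x)))
        / (D 1 (Z x) ^ 3 * D 1 (Z x) ^ 3)) (at x within {0..1})"
  proof (rule DERIV_divide)
    show "((\<lambda>x. - D 2 (Z x)) has_real_derivative - (D 3 (Z x) * Z1 x)) (at x within {0..1})"
      using DERIV_minus[OF D_comp[of 2, OF _ x]] by simp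
    show "((\<lambda>x. D 1 (Z x) ^ 3) has_real_derivative 3 * D 1 (Z x) ^ 2 * (D 2 (Z x) * Z1 x)) (at x within {0..1})"
      using DERIV_power[OF D_comp[of 1, OF _ x], of 3] by (simp add: numeral_2_eq_2 mult_ac)
  qed (use p in simp)
  also have "(- (D 3 (Z x) * Z1 x) * D 1 (Z x) ^ 3 - - D 2 (Z x) * (3 * D 1 (Z x) ^ 2 * (D 2 (Z x) * Z1 x)))
        / (D 1 (Z x) ^ 3 * D 1 (Z x) ^ 3) = Z3 x"
    unfolding Z3_def Z1_def using p by (simp add: field_simps power_numeral_reduce)
  finally show ?thesis by (simp add: Z2_def[abs_def])
qed

lemma cZ3: "continuous_on {0..1} Z3"
  unfolding Z3_def
  by (intro continuous_intros continuous_on_compose2[OF cD cZ])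
    (use D1_pos Z_range in \<open>fastforce+\<close>)

lemma ext_D0: "(\<And>x. x \<in> {a<..<b} \<Longrightarrow> f x = D 0 x) \<Longrightarrow> x \<in> {a..b} \<Longrightarrow> ext a b f x = D 0 x"
  by (rule ext_eq[OF ab]) (auto intro: cD)

lemma dD_interior: "j < 3 \<Longrightarrow> x \<in> {a<..<b} \<Longrightarrow> (D j has_real_derivative D (Suc j) x) (at x)"
  using dD[of j x] at_within_Icc_at[of a x b] by auto

context
  fixes f :: "real \<Rightarrow> real"
  assumes f: "\<And>x. x \<in> {a<..<b} \<Longrightarrow> f x = D 0 x"
begin

lemma deriv_f: "x \<in> {a<..<b} \<Longrightarrow> deriv f x = D 1 x"
proof (rule DERIV_imp_deriv)
  assume x: "x \<in> {a<..<b}"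
  have "(D 0 has_real_derivative D 1 x) (at x)" using dD_interior[of 0, OF _ x] by simp
  then show "(f has_real_derivative D 1 x) (at x)"
    by (rule has_field_derivative_transform_within_open[OF _ open_greaterThanLessThan x]) (simp add: f)
qed

lemma ext_deriv_f: "x \<in> {a..b} \<Longrightarrow> ext a b (deriv f) x = D 1 x"
  by (rule ext_eq[OF ab _ deriv_f]) (auto intro: cD)

lemma D_inv_f: "x \<in> {a<..<b} \<Longrightarrow> D_inv f x = - D 2 x / (D 1 x)\<^sup>2"
  unfolding D_inv_def
proof (rule DERIV_imp_deriv)
  assume x: "x \<in> {a<..<b}"
  have p: "D 1 x \<noteq> 0" using D1_pos[of x] x by simp
  have "(D 1 has_real_derivative D 2 x) (at x)"
    using dD_interior[of 1, OF _ x] by (simp add: numeral_2_eq_2)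
  from DERIV_divide[OF DERIV_const this p, of 1]
  have "((\<lambda>y. 1 / D 1 y) has_real_derivative - D 2 x / (D 1 x)\<^sup>2) (at x)"
    by (simp add: power2_eq_square)
  then show "((\<lambda>y. 1 / deriv f y) has_real_derivative - D 2 x / (D 1 x)\<^sup>2) (at x)"
    by (rule has_field_derivative_transform_within_open[OF _ open_greaterThanLessThan x]) (simp add: deriv_f)
qed

lemma inv_into_ext: "inv_into {a..b} (ext a b f) = Z"
proof -
  have "(y \<in> {a..b} \<and> ext a b f y = x) = (y \<in> {a..b} \<and> D 0 y = x)" for x y
    using ext_D0[OF f] by auto
  then show ?thesis unfolding Z_def inv_into_def by simp
qed

lemma Z2_nonneg:
  assumes nn: "\<And>x. x \<in> {a<..<b} \<Longrightarrow> 0 \<le> D_inv f x" and x: "x \<in> {0..1}"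
  shows "0 \<le> Z2 x"
proof -
  have "D 2 y \<le> 0" if "y \<in> {a<..<b}" for y
    using nn[OF that] D1_pos[of y] that unfolding D_inv_f[OF that] by (simp add: divide_le_0_iff zero_le_divide_iff)
  then have "D 2 (Z x) \<le> 0"
    using continuous_le_on_closure[of "{a<..<b}" "D 2" "Z x" 0] cD[of 2] Z_range[OF x] ab by simp
  then show ?thesis
    using D1_pos[OF Z_range[OF x]] unfolding Z2_def by (intro divide_nonneg_pos) auto
qed

text \<open>Otherwise the monotone function \<open>Z1\<close> would be constant and its derivative \<open>Z2\<close> zero.\<close>

lemma Z1_increases:
  assumes nn: "\<And>x. x \<in> {a<..<b} \<Longrightarrow> 0 \<le> D_inv f x" and y: "y \<in> {a<..<b}" "D_inv f y \<noteq> 0"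
  shows "Z1 0 < Z1 1"
proof (rule ccontr)
  assume "\<not> Z1 0 < Z1 1"
  define x where "x = D 0 y"
  have yI: "y \<in> {a..b}" using y by auto
  have x: "x \<in> {0..1}" using onto yI by (auto simp: x_def)
  have const: "Z1 t = Z1 0" if "t \<in> {0..1}" for t
    using mono_of_deriv[OF dZ1 Z2_nonneg[OF nn], of 0 t] mono_of_deriv[OF dZ1 Z2_nonneg[OF nn], of t 1]
      \<open>\<not> Z1 0 < Z1 1\<close> that by force
  have "(Z1 has_real_derivative 0) (at x within {0..1})"
    by (rule has_field_derivative_transform_within[OF DERIV_const[of "Z1 0"] zero_less_one x]) (rule const[symmetric])
  with dZ1[OF x] have "Z2 x = 0"
    unfolding has_real_derivative_iff_has_vector_derivative
    using vector_derivative_unique_within_closed_interval[of 0 1 x Z1] x by auto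
  then have "D 2 y = 0" using D1_pos[OF yI] by (simp add: Z2_def x_def Z_D[OF yI])
  then show False using y D_inv_f[OF y(1)] by simp
qed

end
end

text \<open>The map of the theorem, with the derivatives \<open>D i j\<close> of the extended branches made explicit.\<close>

locale expanding_map =
  fixes N :: nat and p :: "nat \<Rightarrow> real" and f :: "real \<Rightarrow> real" and lam :: real
    and D :: "nat \<Rightarrow> nat \<Rightarrow> real \<Rightarrow> real"
  assumes p_first: "p 1 = 0" and p_last: "p (Suc N) = 1"
    and p_less: "i \<in> {1..N} \<Longrightarrow> p i < p (Suc i)"
    and f_eq: "i \<in> {1..N} \<Longrightarrow> x \<in> {p i<..<p (Suc i)} \<Longrightarrow> f x = D i 0 x"
    and der: "i \<in> {1..N} \<Longrightarrow> j < 3 \<Longrightarrow> x \<in> {p i..p (Suc i)} \<Longrightarrow>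
      (D i j has_real_derivative D i (Suc j) x) (at x within {p i..p (Suc i)})"
    and cont3: "i \<in> {1..N} \<Longrightarrow> continuous_on {p i..p (Suc i)} (D i 3)"
    and onto_unit: "i \<in> {1..N} \<Longrightarrow> D i 0 ` {p i..p (Suc i)} = {0..1}"
    and deriv_match: "i \<in> {2..N} \<Longrightarrow> right_lim (deriv f) (p i) = left_lim (deriv f) (p i)"
    and lam: "lam > 1"
    and expanding: "x \<in> smooth_points N p \<Longrightarrow> deriv f x > lam"
    and D_nonzero: "\<exists>x\<in>smooth_points N p. D_inv f x \<noteq> 0"
    and D_nonneg: "x \<in> smooth_points N p \<Longrightarrow> D_inv f x \<ge> 0"
begin

lemma lam_le: assumes i: "i \<in> {1..N}" and x: "x \<in> {p i..p (Suc i)}" shows "lam \<le> D i 1 x"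
proof -
  have c: "continuous_on {p i..p (Suc i)} (D i 1)" by (rule DERIV_continuous_on[OF der[OF i]]) simp_all
  have "lam \<le> D i 1 y" if y: "y \<in> {p i<..<p (Suc i)}" for y
  proof -
    have "(D i 0 has_real_derivative D i 1 y) (at y)"
      using der[OF i, of 0 y] at_within_Icc_at[of "p i" y "p (Suc i)"] y by auto
    then have "(f has_real_derivative D i 1 y) (at y)"
      by (rule has_field_derivative_transform_within_open[OF _ open_greaterThanLessThan y]) (simp add: f_eq[OF i])
    then have "deriv f y = D i 1 y" by (rule DERIV_imp_deriv)
    moreover have "y \<in> smooth_points N p" using i y by (auto simp: smooth_points_def)
    ultimately show ?thesis using expanding by fastforce
  qed
  then show ?thesis
    using continuous_ge_on_closure[of "{p i<..<p (Suc i)}" "D i 1" x lam] c x p_less[OF i] by simp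
qed

lemma full_branch: assumes i: "i \<in> {1..N}" shows "full_branch (p i) (p (Suc i)) (D i)"
proof
  show "p i < p (Suc i)" by (rule p_less[OF i])
  show "continuous_on {p i..p (Suc i)} (D i 3)" by (rule cont3[OF i])
  show "D i 0 ` {p i..p (Suc i)} = {0..1}" by (rule onto_unit[OF i])
  fix x assume x: "x \<in> {p i..p (Suc i)}"
  show "0 < D i 1 x" using lam_le[OF i x] lam by linarith
  show "(D i j has_real_derivative D i (Suc j) x) (at x within {p i..p (Suc i)})" if "j < 3" for j
    by (rule der[OF i that x])
qed

definition Y :: "nat \<Rightarrow> real \<Rightarrow> real" where "Y i = full_branch.Z (p i) (p (Suc i)) (D i)"
definition Y1 :: "nat \<Rightarrow> real \<Rightarrow> real" where "Y1 i = full_branch.Z1 (p i) (p (Suc i)) (D i)"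
definition Y2 :: "nat \<Rightarrow> real \<Rightarrow> real" where "Y2 i = full_branch.Z2 (p i) (p (Suc i)) (D i)"
definition Y3 :: "nat \<Rightarrow> real \<Rightarrow> real" where "Y3 i = full_branch.Z3 (p i) (p (Suc i)) (D i)"

lemma N_pos: "1 \<le> N"
  using p_first p_last by (cases N) auto

lemma Y1_0: assumes i: "i \<in> {1..N}" shows "Y1 i 0 = 1 / D i 1 (p i)"
  and Y1_1: "i \<in> {1..N} \<Longrightarrow> Y1 i 1 = 1 / D i 1 (p (Suc i))"
proof -
  interpret full_branch "p i" "p (Suc i)" "D i" by (rule full_branch[OF i])
  show "Y1 i 0 = 1 / D i 1 (p i)" "Y1 i 1 = 1 / D i 1 (p (Suc i))"
    by (simp_all add: Y1_def Z1_def Z_0 Z_1)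
qed

lemma right_lim_deriv: assumes i: "i \<in> {1..N}" shows "right_lim (deriv f) (p i) = D i 1 (p i)"
  and left_lim_deriv: "i \<in> {1..N} \<Longrightarrow> left_lim (deriv f) (p (Suc i)) = D i 1 (p (Suc i))"
proof -
  interpret full_branch "p i" "p (Suc i)" "D i" by (rule full_branch[OF i])
  show "right_lim (deriv f) (p i) = D i 1 (p i)"
    using right_lim_eq_ext[OF ab] ext_deriv_f[OF f_eq[OF i]] ab by simp
  show "left_lim (deriv f) (p (Suc i)) = D i 1 (p (Suc i))"
    using left_lim_eq_ext[OF ab] ext_deriv_f[OF f_eq[OF i]] ab by simp
qed

lemma matching: assumes "i \<in> {1..<N}" shows "Y1 i 1 = Y1 (Suc i) 0"
proof -
  have "D (Suc i) 1 (p (Suc i)) = D i 1 (p (Suc i))"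
    using deriv_match[of "Suc i"] right_lim_deriv[of "Suc i"] left_lim_deriv[of i] assms by simp
  then show ?thesis using Y1_0[of "Suc i"] Y1_1[of i] assms by simp
qed

lemma D_inv_nonneg: "i \<in> {1..N} \<Longrightarrow> x \<in> {p i<..<p (Suc i)} \<Longrightarrow> 0 \<le> D_inv f x"
  using D_nonneg[of x] unfolding smooth_points_def by blast

lemma Y1_step: assumes i: "i \<in> {1..N}" shows "Y1 i 0 \<le> Y1 i 1"
proof -
  interpret full_branch "p i" "p (Suc i)" "D i" by (rule full_branch[OF i])
  show ?thesis
    unfolding Y1_def by (rule mono_of_deriv[OF dZ1 Z2_nonneg[OF f_eq[OF i] D_inv_nonneg[OF i]]]) auto
qed

lemma Y1_chain: assumes "1 \<le> i" "i \<le> j" "j \<le> N" shows "Y1 i 0 \<le> Y1 j 0"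
  using assms(2,3)
proof (induction j rule: dec_induct)
  case (step n)
  then show ?case using Y1_step[of n] matching[of n] assms(1) by auto
qed simp

text \<open>Along the partition the values \<open>Y1 i 0\<close>, \<open>Y1 i 1\<close> form a chain that is increasing by the sign of the derivative
  and continues from branch to branch by matching; it increases strictly on a branch where the
  derivative of \<open>1 / f'\<close> does not vanish.\<close>

lemma Y1_increases: "Y1 1 0 < Y1 N 1"
proof -
  obtain i x where i: "i \<in> {1..N}" and x: "x \<in> {p i<..<p (Suc i)}" "D_inv f x \<noteq> 0"
    using D_nonzero by (auto simp: smooth_points_def)
  interpret full_branch "p i" "p (Suc i)" "D i" by (rule full_branch[OF i])
  have "Y1 i 0 < Y1 i 1"
    unfolding Y1_def by (rule Z1_increases[OF f_eq[OF i] D_inv_nonneg[OF i] x])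
  moreover have "Y1 1 0 \<le> Y1 i 0" using Y1_chain[of 1 i] i by simp
  moreover have "Y1 i 1 \<le> Y1 N 1"
  proof (cases "i = N")
    case False
    then have "Y1 i 1 = Y1 (Suc i) 0" "Y1 (Suc i) 0 \<le> Y1 N 0"
      using matching[of i] Y1_chain[of "Suc i" N] i by auto
    then show ?thesis using Y1_step[of N] N_pos by auto
  qed simp
  ultimately show ?thesis by linarith
qed

lemma contraction: "Y1 N 1 < 1"
  using lam_le[of N "p (Suc N)"] lam p_less[of N] N_pos by (simp add: Y1_1)

sublocale branch_system N p Y Y1 Y2 Y3
proof
  fix i :: nat assume i: "i \<in> {1..N}"
  interpret full_branch "p i" "p (Suc i)" "D i" by (rule full_branch[OF i])
  show "Y i 0 = p i" "Y i 1 = p (Suc i)" by (simp_all add: Y_def Z_0 Z_1)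
  show "continuous_on {0..1} (Y3 i)" unfolding Y3_def by (rule cZ3)
  fix x :: real assume x: "x \<in> {0..1}"
  show "(Y i has_real_derivative Y1 i x) (at x within {0..1})" unfolding Y_def Y1_def by (rule dZ[OF x])
  show "(Y1 i has_real_derivative Y2 i x) (at x within {0..1})" unfolding Y1_def Y2_def by (rule dZ1[OF x])
  show "(Y2 i has_real_derivative Y3 i x) (at x within {0..1})" unfolding Y2_def Y3_def by (rule dZ2[OF x])
  show "0 < Y1 i x" unfolding Y1_def Z1_def using D1_pos[OF Z_range[OF x]] by simp
  show "0 \<le> Y2 i x" unfolding Y2_def by (rule Z2_nonneg[OF f_eq[OF i] D_inv_nonneg[OF i] x])
qed (use N_pos p_first p_last matching contraction Y1_increases in auto)

lemma transfer_eq_Op: "transfer N p f = Op"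
proof (intro ext)
  fix h x
  have "h (inv_branch p f i x) / complex_of_real (ext (p i) (p (Suc i)) (deriv f) (inv_branch p f i x))
      = complex_of_real (Y1 i x) * h (Y i x)" if i: "i \<in> {1..N}" and x: "x \<in> {0..1}" for i
  proof -
    interpret full_branch "p i" "p (Suc i)" "D i" by (rule full_branch[OF i])
    have "inv_branch p f i x = Y i x"
    proof -
      have "inv_into {p i..p (Suc i)} (ext (p i) (p (Suc i)) f) = Z"
        by (rule inv_into_ext) (rule f_eq[OF i])
      then show ?thesis unfolding inv_branch_def Y_def by (rule fun_cong)
    qed
    moreover have "ext (p i) (p (Suc i)) (deriv f) (Y i x) = D i 1 (Y i x)"
      unfolding Y_def by (rule ext_deriv_f[OF f_eq[OF i] Z_range[OF x]])
    ultimately show ?thesis by (simp add: Y1_def Y_def Z1_def)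
  qed
  note summand = this
  show "transfer N p f h x = Op h x"
    unfolding transfer_def Op_def by (intro if_cong refl sum.cong summand)
qed

lemma mu_eq: "1 / left_lim (deriv f) 1 = \<mu>"
  using left_lim_deriv[of N] Y1_1[of N] N_pos p_last by (simp add: \<mu>_def)

lemma Delta_eq: "1 / left_lim (deriv f) 1 - 1 / right_lim (deriv f) 0 = \<Delta>"
  using right_lim_deriv[of 1] Y1_0[of 1] N_pos p_first by (simp add: mu_eq \<Delta>_def \<mu>_def)

lemma Gamma_eq: "1 - (\<Sum>i=1..N. 1 / right_lim (deriv f) (p i)) = \<Gamma>"
proof -
  have "(\<Sum>i=1..N. 1 / right_lim (deriv f) (p i)) = (\<Sum>i=1..N. Y1 i 0)"
    by (rule sum.cong[OF refl]) (simp only: right_lim_deriv Y1_0)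
  then show ?thesis unfolding \<Gamma>_def by simp
qed

end

theorem theorem3p9:
  fixes N :: nat and p :: "nat \<Rightarrow> real" and f :: "real \<Rightarrow> real" and lam :: real
  assumes f_maps: "\<And>x. x \<in> {0..1} \<Longrightarrow> f x \<in> {0..1}"
    and p_first: "p 1 = 0" and p_last: "p (Suc N) = 1"
    and p_less: "\<And>i. i \<in> {1..N} \<Longrightarrow> p i < p (Suc i)"
    and branches: "\<And>i. i \<in> {1..N} \<Longrightarrow>
      \<exists>F. (\<forall>x\<in>{p i<..<p (Suc i)}. F x = f x) \<and>
          Ck_on 3 {p i..p (Suc i)} F \<and> F ` {p i..p (Suc i)} = {0..1}"
    and deriv_match: "\<And>i. i \<in> {2..N} \<Longrightarrow> right_lim (deriv f) (p i) = left_lim (deriv f) (p i)"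
    and lam: "lam > 1"
    and expanding: "\<And>x. x \<in> smooth_points N p \<Longrightarrow> deriv f x > lam"
    and D_nonzero: "\<exists>x\<in>smooth_points N p. D_inv f x \<noteq> 0"
    and D_nonneg: "\<And>x. x \<in> smooth_points N p \<Longrightarrow> D_inv f x \<ge> 0"
  shows
    "bounded_op W21 norm_W21 (transfer N p f)
     \<and> spectrum W21 norm_W21 (transfer N p f)
       \<subseteq> {z. cmod z \<le> min 1 (2 / left_lim (deriv f) 1 - 1 / right_lim (deriv f) 0)} \<union> {1}
     \<and> ess_spectrum W21 norm_W21 (transfer N p f)
       \<subseteq> {z. cmod z \<le> 1 / (left_lim (deriv f) 1)\<^sup>2}
     \<and> simple_eigenvalue W21 (transfer N p f) 1
     \<and> (\<exists>\<mu>2. \<mu>2 < 1 / left_lim (deriv f) 1 \<and>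
         (let \<mu> = 1 / left_lim (deriv f) 1;
              \<Delta> = 1 / left_lim (deriv f) 1 - 1 / right_lim (deriv f) 0;
              \<Gamma> = 1 - (\<Sum>i=1..N. 1 / right_lim (deriv f) (p i))
          in (A0 \<mu>2 \<union> A1 \<mu> \<Delta> \<Gamma> \<union> A2 \<mu> \<Delta> \<union> A3 \<mu> \<Delta> \<union> A4 \<mu> \<Delta>)
             \<inter> (spectrum W21 norm_W21 (transfer N p f) - {1}) = {}))"
proof -
  define good where "good i D \<longleftrightarrow> (\<forall>x\<in>{p i<..<p (Suc i)}. f x = D 0 x) \<and>
      (\<forall>j<3. \<forall>x\<in>{p i..p (Suc i)}. (D j has_real_derivative D (Suc j) x) (at x within {p i..p (Suc i)})) \<and>
      continuous_on {p i..p (Suc i)} (D 3) \<and> D 0 ` {p i..p (Suc i)} = {0..1}"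
    for i and D :: "nat \<Rightarrow> real \<Rightarrow> real"
  have "\<forall>i\<in>{1..N}. \<exists>D. good i D"
  proof
    fix i assume "i \<in> {1..N}"
    from branches[OF this] obtain F D where F: "\<forall>x\<in>{p i<..<p (Suc i)}. F x = f x" "F ` {p i..p (Suc i)} = {0..1}"
      and D: "\<forall>x\<in>{p i..p (Suc i)}. D 0 x = F x"
        "\<forall>j<3. \<forall>x\<in>{p i..p (Suc i)}. (D j has_real_derivative D (Suc j) x) (at x within {p i..p (Suc i)})"
        "continuous_on {p i..p (Suc i)} (D 3)"
      unfolding Ck_on_def by blast
    have "D 0 ` {p i..p (Suc i)} = F ` {p i..p (Suc i)}" using D(1) by (intro image_cong) auto
    then have "good i D" unfolding good_def using F D by auto
    then show "\<exists>D. good i D" by blast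
  qed
  then obtain D where D: "\<forall>i\<in>{1..N}. good i (D i)" by metis
  interpret expanding_map N p f lam D
  proof
    fix i assume i: "i \<in> {1..N}"
    then have g: "good i (D i)" using D by blast
    then show "continuous_on {p i..p (Suc i)} (D i 3)" "D i 0 ` {p i..p (Suc i)} = {0..1}"
      by (simp_all add: good_def)
    show "f x = D i 0 x" if "x \<in> {p i<..<p (Suc i)}" for x using g that by (simp add: good_def)
    show "(D i j has_real_derivative D i (Suc j) x) (at x within {p i..p (Suc i)})"
      if "j < 3" "x \<in> {p i..p (Suc i)}" for j x
      using g that unfolding good_def by blast
  qed (fact p_first p_last p_less deriv_match lam expanding D_nonzero D_nonneg)+
  have right: "\<mu> - 1 / right_lim (deriv f) 0 = \<Delta>" using Delta_eq by (simp add: mu_eq)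
  have radius: "2 / left_lim (deriv f) 1 - 1 / right_lim (deriv f) 0 = \<mu> + \<Delta>"
    using mu_eq right by (simp add: divide_inverse)
  have square: "1 / (left_lim (deriv f) 1)\<^sup>2 = \<mu>\<^sup>2" by (simp add: mu_eq[symmetric] power_divide)
  obtain \<mu>2 where "\<mu>2 < \<mu>" "A0 \<mu>2 \<inter> (spectrum W21 norm_W21 Op - {1}) = {}" by (rule gap)
  then show ?thesis
    unfolding transfer_eq_Op radius square Gamma_eq mu_eq right Let_def
    using region_1_free region_2_free region_3_free region_4_free
    by (intro conjI bounded_op_T spectrum_bound ess_spectrum_subset simple_eigenvalue_1 exI[of _ \<mu>2])
      (auto simp: Int_Un_distrib2)
qed

end
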